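(* Let $N \geq n$ be natural numbers and suppose that for some natural $r$ the cohomological product $\prod_{i=1}^r w_{N-n+2i-1}(\xi_n)$ of Stiefel--Whitney classes of the regular bundle $\xi_n$ is not equal to $0$ in the ring $H^*(B(\mathbb{R}^2,n),\mathbb{Z}_2)$. Then for any $N$-dimensional vector subspace $\mathcal{F}^N \subset C^0(\mathbb{R}^1,\mathbb{R}^1)$ there exist independent systems of $n$ conditions $f(a_i)=f(b_i)$, $a_i\neq b_i$, $i=1,\dots,n$, such that the subspaces of $\mathcal{F}^N$ defined by these systems have codimension $\leq n-r$ in $\mathcal{F}^N$.
   Context: $C^0(\mathbb{R}^1,\mathbb{R}^1)$ is the space of continuous functions $\mathbb{R}^1\to\mathbb{R}^1$. A chord is an unordered pair $(a,b)$ of distinct points of $\mathbb{R}^1$; an $n$-chord diagram is an unordered collection of $n$ pairwise distinct chords $\{(a_1,b_1),\dots,(a_n,b_n)\}$. The diagram, or equivalently the system of $n$ conditions $f(a_i)=f(b_i)$, is independent if the subalgebra of $C^0(\mathbb{R}^1,\mathbb{R}^1)$ consisting of all functions satisfying these conditions has codimension exactly $n$. $B(X,n)$ is the configuration space of unordered $n$-point subsets of a topological space $X$, naturally topologized. The regular bundle $\xi_n$ over $B(\mathbb{R}^2,n)$ is the $n$-dimensional real vector bundle whose fiber over an $n$-point configuration is the space of real-valued functions on this set of points; $w_k(\xi_n)\in H^k(B(\mathbb{R}^2,n),\mathbb{Z}_2)$ is its $k$-th Stiefel--Whitney class. *)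

theory Defs
  imports
    "HOL-Analysis.Analysis"
    "HOL-Homology.Homology"
    "HOL-Algebra.QuotRing"
    "HOL-Library.Z2"
    "HOL-Library.Function_Algebras"
begin

section \<open>Singular cohomology ring with coefficients in the field of two elements\<close>

text \<open>
  A cochain assigns to every degree \<open>p\<close> and every singular \<open>p\<close>-simplex an element of the
  two-element field \<^typ>\<open>bit\<close>. The degree is an explicit argument because one and the same
  function may be a singular simplex in several degrees. Cochains vanish on everything that is
  not a singular simplex, and only finitely many degrees are nonzero, so the cochains form the
  direct sum of the cochain groups of \<open>X\<close>.
\<close>

type_synonym 'a cochain = "nat \<Rightarrow> ((nat \<Rightarrow> real) \<Rightarrow> 'a) \<Rightarrow> bit"

definition cochains :: "'a topology \<Rightarrow> 'a cochain set" where
  "cochains X = {c. (\<forall>p s. c p s \<noteq> 0 \<longrightarrow> singular_simplex p X s) \<and> finite {p. c p \<noteq> 0}}"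

definition coboundary :: "'a topology \<Rightarrow> 'a cochain \<Rightarrow> 'a cochain" where
  "coboundary X c = (\<lambda>p s. if 0 < p \<and> singular_simplex p X s
     then \<Sum>k\<le>p. c (p - 1) (singular_face p k s) else 0)"

definition front_face :: "nat \<Rightarrow> ((nat \<Rightarrow> real) \<Rightarrow> 'a) \<Rightarrow> (nat \<Rightarrow> real) \<Rightarrow> 'a" where
  "front_face i s = restrict s (standard_simplex i)"

definition back_face :: "nat \<Rightarrow> nat \<Rightarrow> ((nat \<Rightarrow> real) \<Rightarrow> 'a) \<Rightarrow> (nat \<Rightarrow> real) \<Rightarrow> 'a" where
  "back_face i j s = restrict (\<lambda>x. s (\<lambda>m. if m < i then 0 else x (m - i))) (standard_simplex j)"

definition cup :: "'a topology \<Rightarrow> 'a cochain \<Rightarrow> 'a cochain \<Rightarrow> 'a cochain" where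
  "cup X c d = (\<lambda>p s. if singular_simplex p X s
     then \<Sum>i\<le>p. c i (front_face i s) * d (p - i) (back_face i (p - i) s) else 0)"

definition unit_cochain :: "'a topology \<Rightarrow> 'a cochain" where
  "unit_cochain X = (\<lambda>p s. if p = 0 \<and> singular_simplex 0 X s then 1 else 0)"

definition cocycle_ring :: "'a topology \<Rightarrow> 'a cochain ring" where
  "cocycle_ring X = \<lparr>carrier = {c \<in> cochains X. coboundary X c = 0},
     mult = cup X, one = unit_cochain X, zero = 0, add = (+)\<rparr>"

definition coboundaries :: "'a topology \<Rightarrow> 'a cochain set" where
  "coboundaries X = coboundary X ` cochains X"

definition cohomology_ring :: "'a topology \<Rightarrow> 'a cochain set ring" where
  "cohomology_ring X = cocycle_ring X Quot coboundaries X"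

definition cohomology_group :: "nat \<Rightarrow> 'a topology \<Rightarrow> 'a cochain set set" where
  "cohomology_group k X =
     {A \<in> carrier (cohomology_ring X). \<exists>c\<in>A. \<forall>p. p \<noteq> k \<longrightarrow> c p = 0}"

definition cochain_pullback ::
    "'a topology \<Rightarrow> ('a \<Rightarrow> 'b) \<Rightarrow> 'b cochain \<Rightarrow> 'a cochain" where
  "cochain_pullback X f c =
     (\<lambda>p s. if singular_simplex p X s then c p (simplex_map p f s) else 0)"

definition cohomology_map ::
    "'a topology \<Rightarrow> ('a \<Rightarrow> 'b) \<Rightarrow> 'b cochain set \<Rightarrow> 'a cochain set" where
  "cohomology_map X f A =
     (\<Union>c\<in>A. coboundaries X +>\<^bsub>cocycle_ring X\<^esub> cochain_pullback X f c)"


section \<open>Quotient topology\<close>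

definition quotient_topology :: "'a topology \<Rightarrow> ('a \<Rightarrow> 'b) \<Rightarrow> 'b topology" where
  "quotient_topology X q =
     topology (\<lambda>U. U \<subseteq> q ` topspace X \<and> openin X {x \<in> topspace X. q x \<in> U})"

lemma openin_quotient_topology:
  "openin (quotient_topology X q) U \<longleftrightarrow>
     U \<subseteq> q ` topspace X \<and> openin X {x \<in> topspace X. q x \<in> U}"
proof -
  have "istopology (\<lambda>U. U \<subseteq> q ` topspace X \<and> openin X {x \<in> topspace X. q x \<in> U})"
    unfolding istopology_def
  proof (intro conjI allI impI)
    fix S T
    assume S: "S \<subseteq> q ` topspace X \<and> openin X {x \<in> topspace X. q x \<in> S}"
      and T: "T \<subseteq> q ` topspace X \<and> openin X {x \<in> topspace X. q x \<in> T}"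
    show "S \<inter> T \<subseteq> q ` topspace X" using S by blast
    have "{x \<in> topspace X. q x \<in> S \<inter> T} =
        {x \<in> topspace X. q x \<in> S} \<inter> {x \<in> topspace X. q x \<in> T}" by blast
    then show "openin X {x \<in> topspace X. q x \<in> S \<inter> T}" using S T by auto
  next
    fix K assume K: "\<forall>S\<in>K. S \<subseteq> q ` topspace X \<and> openin X {x \<in> topspace X. q x \<in> S}"
    show "\<Union>K \<subseteq> q ` topspace X" using K by blast
    have "{x \<in> topspace X. q x \<in> \<Union>K} = (\<Union>S\<in>K. {x \<in> topspace X. q x \<in> S})" by blast
    then show "openin X {x \<in> topspace X. q x \<in> \<Union>K}" using K by auto
  qed
  then show ?thesis
    by (simp add: quotient_topology_def topology_inverse')
qed

lemma topspace_quotient_topology [simp]: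
  "topspace (quotient_topology X q) = q ` topspace X"
proof -
  have "openin (quotient_topology X q) (q ` topspace X)"
    by (simp add: openin_quotient_topology cong: conj_cong)
  then show ?thesis
    by (meson openin_quotient_topology openin_subset openin_topspace subset_antisym)
qed

lemma quotient_map_quotient_topology: "quotient_map X (quotient_topology X q) q"
  by (auto simp: quotient_map_def openin_quotient_topology)


section \<open>Real vector bundles and Stiefel--Whitney classes\<close>

record ('b, 'e) real_bundle =
  bundle_base :: "'b topology"
  bundle_total :: "'e topology"
  bundle_proj :: "'e \<Rightarrow> 'b"
  vadd :: "'e \<Rightarrow> 'e \<Rightarrow> 'e"
  vscale :: "real \<Rightarrow> 'e \<Rightarrow> 'e"

definition vector_bundle :: "nat \<Rightarrow> ('b, 'e) real_bundle \<Rightarrow> bool" where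
  "vector_bundle n \<xi> \<longleftrightarrow>
     bundle_proj \<xi> \<in> topspace (bundle_total \<xi>) \<rightarrow> topspace (bundle_base \<xi>) \<and>
     (\<forall>b\<in>topspace (bundle_base \<xi>). \<exists>U h. openin (bundle_base \<xi>) U \<and> b \<in> U \<and>
        homeomorphic_map
          (subtopology (bundle_total \<xi>) {e \<in> topspace (bundle_total \<xi>). bundle_proj \<xi> e \<in> U})
          (prod_topology (subtopology (bundle_base \<xi>) U) (product_topology (\<lambda>_. euclideanreal) {..<n})) h \<and>
        (\<forall>e\<in>topspace (bundle_total \<xi>). bundle_proj \<xi> e \<in> U \<longrightarrow>
           fst (h e) = bundle_proj \<xi> e \<and>
           (\<forall>c. vscale \<xi> c e \<in> topspace (bundle_total \<xi>) \<and>
              h (vscale \<xi> c e) = (bundle_proj \<xi> e, \<lambda>i\<in>{..<n}. c * snd (h e) i)) \<and>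
           (\<forall>e'\<in>topspace (bundle_total \<xi>). bundle_proj \<xi> e' = bundle_proj \<xi> e \<longrightarrow>
              vadd \<xi> e e' \<in> topspace (bundle_total \<xi>) \<and>
              h (vadd \<xi> e e') = (bundle_proj \<xi> e, \<lambda>i\<in>{..<n}. snd (h e) i + snd (h e') i))))"

definition nonzero_vectors :: "('b, 'e) real_bundle \<Rightarrow> 'e set" where
  "nonzero_vectors \<xi> = {e \<in> topspace (bundle_total \<xi>). vscale \<xi> 0 e \<noteq> e}"

definition line_through :: "('b, 'e) real_bundle \<Rightarrow> 'e \<Rightarrow> 'e set" where
  "line_through \<xi> e = range (\<lambda>c. vscale \<xi> c e)"

definition projectivization :: "('b, 'e) real_bundle \<Rightarrow> 'e set topology" where
  "projectivization \<xi> =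
     quotient_topology (subtopology (bundle_total \<xi>) (nonzero_vectors \<xi>)) (line_through \<xi>)"

definition projectivization_proj :: "('b, 'e) real_bundle \<Rightarrow> 'e set \<Rightarrow> 'b" where
  "projectivization_proj \<xi> l = (THE b. bundle_proj \<xi> ` l = {b})"

definition tautological_bundle :: "('b, 'e) real_bundle \<Rightarrow> ('e set, 'e set \<times> 'e) real_bundle" where
  "tautological_bundle \<xi> = \<lparr>
     bundle_base = projectivization \<xi>,
     bundle_total = subtopology (prod_topology (projectivization \<xi>) (bundle_total \<xi>)) {(l, v). v \<in> l},
     bundle_proj = fst,
     vadd = (\<lambda>(l, v) (_, w). (l, vadd \<xi> v w)),
     vscale = (\<lambda>c (l, v). (l, vscale \<xi> c v))\<rparr>"

text \<open>
  The first Stiefel--Whitney class of a line bundle is its orientation character. We choose a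
  nonzero vector in every fibre, with no continuity. A path in the base gets the value \<open>0\<close> if
  parallel continuation of nonzero vectors along it carries the chosen ray over its start to
  the chosen ray over its end, and the value \<open>1\<close> if the two rays are opposite. Another choice
  changes this cocycle by a coboundary.
\<close>

definition chosen_vector :: "('b, 'e) real_bundle \<Rightarrow> 'b \<Rightarrow> 'e" where
  "chosen_vector L b = (SOME e. e \<in> nonzero_vectors L \<and> bundle_proj L e = b)"

definition preserves_rays :: "('b, 'e) real_bundle \<Rightarrow> ((nat \<Rightarrow> real) \<Rightarrow> 'b) \<Rightarrow> bool" where
  "preserves_rays L s \<longleftrightarrow>
     (\<exists>t. singular_simplex 1 (subtopology (bundle_total L) (nonzero_vectors L)) t \<and>
        simplex_map 1 (bundle_proj L) t = s \<and>
        (\<forall>i\<le>1. let v = (\<lambda>j. if j = i then 1 else 0)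
           in \<exists>c>0. t v = vscale L c (chosen_vector L (s v))))"

definition line_bundle_cocycle :: "('b, 'e) real_bundle \<Rightarrow> 'b cochain" where
  "line_bundle_cocycle L = (\<lambda>p s.
     if p = 1 \<and> singular_simplex 1 (bundle_base L) s \<and> \<not> preserves_rays L s then 1 else 0)"

definition line_bundle_class :: "('b, 'e) real_bundle \<Rightarrow> 'b cochain set" where
  "line_bundle_class L =
     coboundaries (bundle_base L) +>\<^bsub>cocycle_ring (bundle_base L)\<^esub> line_bundle_cocycle L"

text \<open>
  The Stiefel--Whitney classes of a bundle \<open>\<xi>\<close> of rank \<open>n\<close> are defined through the projective
  bundle theorem (Grothendieck, Hirzebruch): with \<open>x\<close> the first Stiefel--Whitney class of the
  tautological line bundle over the projectivization, they are the unique classes \<open>w k\<close> of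
  degree \<open>k\<close> with \<open>w 0 = 1\<close>, \<open>w k = 0\<close> for \<open>k > n\<close>, and
  \<open>x^n + w 1 x^(n-1) + \<dots> + w n = 0\<close> in the cohomology of the projectivization.
\<close>

definition sw_classes :: "nat \<Rightarrow> ('b, 'e) real_bundle \<Rightarrow> (nat \<Rightarrow> 'b cochain set) \<Rightarrow> bool" where
  "sw_classes n \<xi> w \<longleftrightarrow>
     (let H = cohomology_ring (bundle_base \<xi>);
          HP = cohomology_ring (projectivization \<xi>);
          x = line_bundle_class (tautological_bundle \<xi>);
          pull = cohomology_map (projectivization \<xi>) (projectivization_proj \<xi>)
      in (\<forall>k. w k \<in> cohomology_group k (bundle_base \<xi>)) \<and>
         w 0 = \<one>\<^bsub>H\<^esub> \<and> (\<forall>k>n. w k = \<zero>\<^bsub>H\<^esub>) \<and>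
         (\<Oplus>\<^bsub>HP\<^esub>k\<in>{..n}. pull (w k) \<otimes>\<^bsub>HP\<^esub> x [^]\<^bsub>HP\<^esub> (n - k)) = \<zero>\<^bsub>HP\<^esub>)"

definition sw_class :: "nat \<Rightarrow> ('b, 'e) real_bundle \<Rightarrow> nat \<Rightarrow> 'b cochain set" where
  "sw_class n \<xi> = (THE w. sw_classes n \<xi> w)"


section \<open>Configuration spaces and their regular bundles\<close>

definition ordered_config :: "'a topology \<Rightarrow> nat \<Rightarrow> (nat \<Rightarrow> 'a) topology" where
  "ordered_config X n = subtopology (product_topology (\<lambda>_. X) {..<n}) {x. inj_on x {..<n}}"

definition config_space :: "'a topology \<Rightarrow> nat \<Rightarrow> 'a set topology" where
  "config_space X n = quotient_topology (ordered_config X n) (\<lambda>x. x ` {..<n})"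

text \<open>
  A point of the total space is a pair of a configuration \<open>S\<close> and a function on \<open>S\<close>, extended
  by \<^const>\<open>undefined\<close> outside \<open>S\<close>. The total space is the quotient of the space of ordered
  configurations with real labels by simultaneous permutations.
\<close>

definition label_config :: "nat \<Rightarrow> (nat \<Rightarrow> 'a) \<times> (nat \<Rightarrow> real) \<Rightarrow> 'a set \<times> ('a \<Rightarrow> real)" where
  "label_config n = (\<lambda>(x, v).
     (x ` {..<n}, \<lambda>p\<in>x ` {..<n}. v (the_inv_into {..<n} x p)))"

definition regular_bundle :: "'a topology \<Rightarrow> nat \<Rightarrow> ('a set, 'a set \<times> ('a \<Rightarrow> real)) real_bundle" where
  "regular_bundle X n = \<lparr>
     bundle_base = config_space X n,
     bundle_total = quotient_topology
       (prod_topology (ordered_config X n) (product_topology (\<lambda>_. euclideanreal) {..<n}))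
       (label_config n),
     bundle_proj = fst,
     vadd = (\<lambda>(S, g) (_, h). (S, \<lambda>p\<in>S. g p + h p)),
     vscale = (\<lambda>c (S, g). (S, \<lambda>p\<in>S. c * g p))\<rparr>"

abbreviation B_plane :: "nat \<Rightarrow> (real^2) set topology" where
  "B_plane n \<equiv> config_space euclidean n"

abbreviation \<xi>_plane :: "nat \<Rightarrow> ((real^2) set, (real^2) set \<times> (real^2 \<Rightarrow> real)) real_bundle" where
  "\<xi>_plane n \<equiv> regular_bundle euclidean n"


section \<open>Chord diagrams\<close>

definition fscale :: "real \<Rightarrow> (real \<Rightarrow> real) \<Rightarrow> real \<Rightarrow> real" where
  "fscale c f = (\<lambda>x. c * f x)"

global_interpretation fun_space: vector_space fscale
  by unfold_locales (auto simp: fscale_def fun_eq_iff algebra_simps)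

definition has_dimension :: "(real \<Rightarrow> real) set \<Rightarrow> nat \<Rightarrow> bool" where
  "has_dimension V k \<longleftrightarrow>
     (\<exists>B. finite B \<and> card B = k \<and> fun_space.independent B \<and> fun_space.span B = V)"

text \<open>
  The codimension of \<open>U\<close> in \<open>V\<close> is the dimension of the quotient space \<open>V / U\<close>; the set \<open>B\<close>
  below consists of representatives of a basis of that quotient.
\<close>

definition has_codimension :: "(real \<Rightarrow> real) set \<Rightarrow> (real \<Rightarrow> real) set \<Rightarrow> nat \<Rightarrow> bool" where
  "has_codimension V U k \<longleftrightarrow>
     fun_space.subspace V \<and> fun_space.subspace U \<and> U \<subseteq> V \<and>
     (\<exists>B\<subseteq>V. finite B \<and> card B = k \<and>
        (\<forall>c. (\<Sum>b\<in>B. fscale (c b) b) \<in> U \<longrightarrow> (\<forall>b\<in>B. c b = 0)) \<and>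
        fun_space.span (U \<union> B) = V)"

definition C0 :: "(real \<Rightarrow> real) set" where
  "C0 = {f. continuous_on UNIV f}"

definition chord_diagram :: "nat \<Rightarrow> real set set \<Rightarrow> bool" where
  "chord_diagram n D \<longleftrightarrow>
     finite D \<and> card D = n \<and> (\<forall>C\<in>D. \<exists>a b. a \<noteq> b \<and> C = {a, b})"

definition chord_conditions :: "real set set \<Rightarrow> (real \<Rightarrow> real) set" where
  "chord_conditions D = {f. \<forall>a b. {a, b} \<in> D \<longrightarrow> f a = f b}"

definition independent_diagram :: "nat \<Rightarrow> real set set \<Rightarrow> bool" where
  "independent_diagram n D \<longleftrightarrow>
     chord_diagram n D \<and> has_codimension C0 (C0 \<inter> chord_conditions D) n"


section \<open>The cohomology ring is a ring\<close>

declare add_bit_eq_xor [simp del] mult_bit_eq_and [simp del] xor_bit_def [simp del]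


lemma back_point_in:
  assumes "x \<in> standard_simplex j"
  shows "(\<lambda>m. if m < i then 0 else x (m - i)) \<in> standard_simplex (i + j)"
proof -
  have "(\<Sum>m\<le>i+j. if m < i then 0 else x (m - i)) = (\<Sum>m\<in>{i..i+j}. x (m - i))"
    by (rule sum.mono_neutral_cong_right) auto
  also have "\<dots> = (\<Sum>m\<le>j. x m)"
    by (rule sum.reindex_bij_witness[where i="\<lambda>m. m + i" and j="\<lambda>m. m - i"]) auto
  finally show ?thesis using assms by (auto simp: standard_simplex_def)
qed

lemma singular_simplex_front_face:
  assumes "singular_simplex p X s" "i \<le> p"
  shows "singular_simplex i X (front_face i s)"
  using assms standard_simplex_mono[OF assms(2)]
  unfolding singular_simplex_def front_face_def
  by (auto intro: continuous_map_eq continuous_map_from_subtopology_mono)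

lemma singular_simplex_back_face:
  assumes "singular_simplex (i + j) X s"
  shows "singular_simplex j X (back_face i j s)"
proof -
  let ?h = "\<lambda>x::nat\<Rightarrow>real. (\<lambda>m. if m < i then 0 else x (m - i))"
  have "continuous_map (subtopology (powertop_real UNIV) (standard_simplex j))
      (subtopology (powertop_real UNIV) (standard_simplex (i+j))) ?h"
    unfolding continuous_map_in_subtopology
  proof
    show "continuous_map (subtopology (powertop_real UNIV) (standard_simplex j)) (powertop_real UNIV) ?h"
      unfolding continuous_map_componentwise
      by (auto intro!: continuous_map_from_subtopology continuous_map_product_projection)
  qed (auto simp: back_point_in)
  moreover have "continuous_map (subtopology (powertop_real UNIV) (standard_simplex (i+j))) X s"
    using assms by (simp add: singular_simplex_def)
  ultimately have "continuous_map (subtopology (powertop_real UNIV) (standard_simplex j)) X (s \<circ> ?h)"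
    by (rule continuous_map_compose)
  then show ?thesis
    unfolding singular_simplex_def back_face_def
    by (auto elim!: continuous_map_eq simp: o_def)
qed

lemma front_front: "i \<le> j \<Longrightarrow> front_face i (front_face j s) = front_face i s"
  using standard_simplex_mono[of i j] by (auto simp: front_face_def fun_eq_iff)

lemma front_back: "front_face i (back_face j k s) = back_face j i (front_face (j + i) s)" if "i \<le> k"
  using standard_simplex_mono[OF that] back_point_in[of _ i j]
  by (auto simp: front_face_def back_face_def fun_eq_iff)

lemma back_back: "back_face i k (back_face j (i + k) s) = back_face (j + i) k s"
proof -
  have e: "(\<lambda>m. if m < j then 0 else if m - j < i then 0 else x (m - j - i)) =
    (\<lambda>m. if m < j + i then 0 else x (m - (j + i)))" for x :: "nat \<Rightarrow> real"
    by (auto simp: fun_eq_iff)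
  show ?thesis
  using back_point_in[of _ k i]
  by (auto simp: back_face_def fun_eq_iff e)
qed

lemma front_0_back: "back_face 0 p s = s" if "singular_simplex p X s"
  using that by (auto simp: back_face_def singular_simplex_def extensional_def fun_eq_iff)
lemma front_full: "front_face p s = s" if "singular_simplex p X s"
  using that by (auto simp: front_face_def singular_simplex_def extensional_def fun_eq_iff)

lemma front_sface1: "k \<le> i \<Longrightarrow> i \<le> p \<Longrightarrow> front_face i (singular_face (Suc p) k s) = singular_face (Suc i) k (front_face (Suc i) s)"
  using simplical_face_in_standard_simplex[of "Suc i" k] standard_simplex_mono[of i p]
  by (auto simp: front_face_def singular_face_def fun_eq_iff)
lemma front_sface2: "i < k \<Longrightarrow> i \<le> p \<Longrightarrow> front_face i (singular_face (Suc p) k s) = front_face i s"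
proof -
  assume a: "i < k" "i \<le> p"
  have "x \<in> standard_simplex i \<Longrightarrow> simplical_face k x = x" for x
    using a by (auto simp: simplical_face_def fun_eq_iff standard_simplex_def)
  then show ?thesis
    using a standard_simplex_mono[of i p]
    by (intro ext) (auto simp: front_face_def singular_face_def)
qed
lemma back_sface1: "k \<le> i \<Longrightarrow> back_face i j (singular_face (Suc (i + j)) k s) = back_face (Suc i) j s"
proof -
  assume a: "k \<le> i"
  have "simplical_face k (\<lambda>m. if m < i then 0 else x (m - i)) =
     (\<lambda>m. if m < Suc i then 0 else x (m - Suc i))" for x :: "nat \<Rightarrow> real"
    using a by (auto simp: simplical_face_def fun_eq_iff)
  then show ?thesis
    using back_point_in[of _ j i]
    by (intro ext) (auto simp: back_face_def singular_face_def)
qed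
lemma back_sface2: "i < k \<Longrightarrow> k \<le> Suc (i + j) \<Longrightarrow> back_face i j (singular_face (Suc (i + j)) k s) =
    singular_face (Suc j) (k - i) (back_face i (Suc j) s)"
proof -
  assume a: "i < k" "k \<le> Suc (i + j)"
  have "simplical_face k (\<lambda>m. if m < i then 0 else x (m - i)) =
     (\<lambda>m. if m < i then 0 else simplical_face (k - i) x (m - i))" for x :: "nat \<Rightarrow> real"
    using a by (auto simp: simplical_face_def fun_eq_iff)
  then show ?thesis
    using back_point_in[of _ j i] simplical_face_in_standard_simplex[of "Suc j" "k - i"] a
    by (intro ext) (auto simp: back_face_def singular_face_def)
qed
lemma sface_0_back: "singular_face (Suc j) 0 (back_face i (Suc j) s) = back_face (Suc i) j s"
proof -
  have "(\<lambda>m. if m < i then 0 else simplical_face 0 x (m - i)) =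
     (\<lambda>m. if m < Suc i then 0 else x (m - Suc i))" for x :: "nat \<Rightarrow> real"
    by (auto simp: simplical_face_def fun_eq_iff)
  then show ?thesis
    using simplical_face_in_standard_simplex[of "Suc j" 0]
    by (intro ext) (auto simp: back_face_def singular_face_def)
qed
lemma sface_last_front: "singular_face (Suc i) (Suc i) (front_face (Suc i) s) = front_face i s"
proof -
  have "x \<in> standard_simplex i \<Longrightarrow> simplical_face (Suc i) x = x" for x
    by (auto simp: simplical_face_def fun_eq_iff standard_simplex_def)
  then show ?thesis
    using standard_simplex_mono[of i "Suc i"]
    by (intro ext) (auto simp: front_face_def singular_face_def)
qed

lemma leibniz: "coboundary X (cup X c d) = cup X (coboundary X c) d + cup X c (coboundary X d)"
proof (intro ext)
  fix q s
  show "coboundary X (cup X c d) q s = (cup X (coboundary X c) d + cup X c (coboundary X d)) q s"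
  proof (cases "0 < q \<and> singular_simplex q X s")
    case False then show ?thesis by (auto simp: coboundary_def cup_def)
  next
    case True
    then obtain p where q: "q = Suc p" and s: "singular_simplex (Suc p) X s" by (cases q) auto
    define A where "A i k = c i (singular_face (Suc i) k (front_face (Suc i) s)) * d (p - i) (back_face (Suc i) (p - i) s)" for i k
    define B where "B i k = c i (front_face i s) * d (p - i) (singular_face (Suc (p - i)) k (back_face i (Suc (p - i)) s))" for i k
    have sf: "singular_simplex p X (singular_face (Suc p) k s)" if "k \<le> Suc p" for k
      using singular_simplex_singular_face[OF s, of k] that by simp
    have L: "coboundary X (cup X c d) q s = (\<Sum>k\<le>Suc p. \<Sum>i\<le>p. if k \<le> i then A i k else B i (k - i))"
      unfolding q using s
      apply (simp add: coboundary_def cup_def sf del: sum.atMost_Suc)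
      apply (intro sum.cong refl)
      subgoal for k i
        using back_sface1[of k i "p - i" s] back_sface2[of i k "p - i" s]
          front_sface1[of k i p s] front_sface2[of i k p s]
        by (auto simp: A_def B_def)
      done
    have L2: "\<dots> = (\<Sum>i\<le>p. (\<Sum>k\<le>i. A i k) + (\<Sum>k\<in>{1..Suc (p - i)}. B i k))"
    proof (subst sum.swap, intro sum.cong refl)
      fix i assume "i \<in> {..p}"
      then have e: "{..Suc p} = {..i} \<union> {Suc i..Suc p}" by auto
      have "(\<Sum>k\<le>Suc p. if k \<le> i then A i k else B i (k - i)) =
        (\<Sum>k\<le>i. if k \<le> i then A i k else B i (k - i)) + (\<Sum>k\<in>{Suc i..Suc p}. if k \<le> i then A i k else B i (k - i))"
        unfolding e by (rule sum.union_disjoint) auto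
      also have "(\<Sum>k\<in>{Suc i..Suc p}. if k \<le> i then A i k else B i (k - i)) = (\<Sum>k\<in>{1..Suc (p - i)}. B i k)"
        by (rule sum.reindex_bij_witness[where i="\<lambda>k. k + i" and j="\<lambda>k. k - i"]) (use \<open>i \<in> {..p}\<close> in auto)
      finally show "(\<Sum>k\<le>Suc p. if k \<le> i then A i k else B i (k - i)) = (\<Sum>k\<le>i. A i k) + (\<Sum>k\<in>{1..Suc (p - i)}. B i k)"
        by simp
    qed
    have ff: "singular_simplex i X (front_face i s)" if "i \<le> Suc p" for i
      using singular_simplex_front_face[OF s that] .
    have bf: "singular_simplex (Suc p - i) X (back_face i (Suc p - i) s)" if "i \<le> Suc p" for i
      using singular_simplex_back_face[of i "Suc p - i" X s] s that by simp
    have c0: "coboundary X c 0 u = 0" "coboundary X d 0 u = 0" for u by (auto simp: coboundary_def)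
    have R1: "cup X (coboundary X c) d q s = (\<Sum>i\<le>p. \<Sum>k\<le>Suc i. A i k)"
      unfolding q using s
      apply (simp add: cup_def sum.atMost_Suc_shift[where n=p] c0 del: sum.atMost_Suc)
      apply (intro sum.cong refl)
      apply (simp add: coboundary_def ff A_def sum_distrib_right del: sum.atMost_Suc)
      done
    have R2: "cup X c (coboundary X d) q s = (\<Sum>i\<le>p. \<Sum>k\<le>Suc (p - i). B i k)"
    proof -
      have "cup X c (coboundary X d) q s = (\<Sum>i\<le>p. c i (front_face i s) * coboundary X d (Suc p - i) (back_face i (Suc p - i) s))"
        unfolding q using s by (simp add: cup_def c0)
      also have "\<dots> = (\<Sum>i\<le>p. \<Sum>k\<le>Suc (p - i). B i k)"
      proof (intro sum.cong refl)
        fix i assume "i \<in> {..p}"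
        then have "Suc p - i = Suc (p - i)" by auto
        then show "c i (front_face i s) * coboundary X d (Suc p - i) (back_face i (Suc p - i) s) = (\<Sum>k\<le>Suc (p - i). B i k)"
          using bf[of i] \<open>i \<in> {..p}\<close>
          by (simp add: coboundary_def B_def sum_distrib_left del: sum.atMost_Suc)
      qed
      finally show ?thesis .
    qed
    have AB: "A i (Suc i) = B i 0" for i
      by (simp add: A_def B_def sface_0_back sface_last_front)
    have "(\<Sum>k\<le>i. A i k) + (\<Sum>k\<in>{1..Suc (p - i)}. B i k) = (\<Sum>k\<le>Suc i. A i k) + (\<Sum>k\<le>Suc (p - i). B i k)" for i
    proof -
      have "(\<Sum>k\<le>Suc (p - i). B i k) = B i 0 + (\<Sum>k\<in>{1..Suc (p - i)}. B i k)"
      proof -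
        have "{..Suc (p - i)} = insert 0 {1..Suc (p - i)}" by auto
        then show ?thesis by simp
      qed
      moreover have "B i 0 + B i 0 = 0" by (cases "B i 0") auto
      ultimately show ?thesis using AB[of i]
        by (simp add: algebra_simps)
    qed
    then show ?thesis
      by (simp add: L L2 R1 R2 sum.distrib del: sum.atMost_Suc)
  qed
qed

lemma cup_assoc: "cup X (cup X a b) c = cup X a (cup X b c)"
proof (intro ext)
  fix p s
  show "cup X (cup X a b) c p s = cup X a (cup X b c) p s"
  proof (cases "singular_simplex p X s")
    case False then show ?thesis by (simp add: cup_def)
  next
    case s: True
    define T where "T i j = a i (front_face i s) * b j (back_face i j (front_face (i + j) s)) * c (p - (i + j)) (back_face (i + j) (p - (i + j)) s)" for i j
    have "cup X (cup X a b) c p s = (\<Sum>l\<le>p. \<Sum>i\<le>l. T i (l - i))"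
      using s apply (simp add: cup_def singular_simplex_front_face)
      apply (intro sum.cong refl)
      apply (simp add: sum_distrib_right)
      apply (intro sum.cong refl)
      apply (simp add: T_def front_front)
      done
    also have "\<dots> = (\<Sum>i\<le>p. \<Sum>j\<le>p - i. T i j)"
      unfolding sum.Sigma[OF finite_atMost ballI[OF finite_atMost]]
      by (rule sum.reindex_bij_witness[where i="\<lambda>(i,j). (i + j, i)" and j="\<lambda>(l,i). (i, l - i)"]) auto
    also have "\<dots> = cup X a (cup X b c) p s"
    proof -
      have "singular_simplex (p - i) X (back_face i (p - i) s)" if "i \<le> p" for i
        using singular_simplex_back_face[of i "p - i"] s that by simp
      moreover have "front_face j (back_face i (p - i) s) = back_face i j (front_face (i + j) s)" if "i + j \<le> p" for i j
        using front_back[of j "p - i" i s] that by simp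
      moreover have "back_face j (p - i - j) (back_face i (p - i) s) = back_face (i + j) (p - (i + j)) s" if "i + j \<le> p" for i j
        using back_back[of j "p - i - j" i s] that by (simp add: add.commute)
      ultimately show ?thesis
        using s
        apply (simp add: cup_def)
        apply (intro sum.cong refl)
        apply (simp add: sum_distrib_left)
        apply (intro sum.cong refl)
        apply (simp add: T_def mult.assoc)
        done
    qed
    finally show ?thesis .
  qed
qed

lemma cup_cochains: assumes "a \<in> cochains X" "b \<in> cochains X" shows "cup X a b \<in> cochains X"
proof -
  have "{p. cup X a b p \<noteq> 0} \<subseteq> (\<lambda>(i,j). i + j) ` ({p. a p \<noteq> 0} \<times> {p. b p \<noteq> 0})"
  proof
    fix p assume "p \<in> {p. cup X a b p \<noteq> 0}"
    then obtain s where "cup X a b p s \<noteq> 0" by (auto simp: fun_eq_iff)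
    then have "(\<Sum>i\<le>p. a i (front_face i s) * b (p - i) (back_face i (p - i) s)) \<noteq> 0"
      by (auto simp: cup_def split: if_splits)
    then obtain i where "i \<le> p" "a i (front_face i s) * b (p - i) (back_face i (p - i) s) \<noteq> 0"
      by (meson atMost_iff sum.not_neutral_contains_not_neutral)
    then have "a i \<noteq> 0" "b (p - i) \<noteq> 0" by (auto simp: fun_eq_iff)
    then show "p \<in> (\<lambda>(i,j). i + j) ` ({p. a p \<noteq> 0} \<times> {p. b p \<noteq> 0})"
      using \<open>i \<le> p\<close> by (intro image_eqI[of _ _ "(i, p - i)"]) auto
  qed
  then have "finite {p. cup X a b p \<noteq> 0}"
    by (rule finite_subset) (use assms in \<open>auto simp: cochains_def\<close>)
  then show ?thesis by (auto simp: cochains_def cup_def)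
qed

lemma coboundary_cochains: assumes "a \<in> cochains X" shows "coboundary X a \<in> cochains X"
proof -
  have "{p. coboundary X a p \<noteq> 0} \<subseteq> Suc ` {p. a p \<noteq> 0}"
  proof
    fix p assume "p \<in> {p. coboundary X a p \<noteq> 0}"
    then obtain s where "coboundary X a p s \<noteq> 0" by (auto simp: fun_eq_iff)
    then have "0 < p" "(\<Sum>k\<le>p. a (p - 1) (singular_face p k s)) \<noteq> 0"
      by (auto simp: coboundary_def split: if_splits)
    then obtain k where "a (p - 1) (singular_face p k s) \<noteq> 0"
      by (meson atMost_iff sum.not_neutral_contains_not_neutral)
    then have "a (p - 1) \<noteq> 0" by (auto simp: fun_eq_iff)
    then show "p \<in> Suc ` {p. a p \<noteq> 0}"
      using \<open>0 < p\<close> by (intro image_eqI[of _ _ "p - 1"]) auto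
  qed
  then have "finite {p. coboundary X a p \<noteq> 0}"
    by (rule finite_subset) (use assms in \<open>auto simp: cochains_def\<close>)
  then show ?thesis by (auto simp: cochains_def coboundary_def)
qed

lemma add_cochains: "a \<in> cochains X \<Longrightarrow> b \<in> cochains X \<Longrightarrow> a + b \<in> cochains X"
proof -
  assume ab: "a \<in> cochains X" "b \<in> cochains X"
  have "{p. (a + b) p \<noteq> 0} \<subseteq> {p. a p \<noteq> 0} \<union> {p. b p \<noteq> 0}" by auto
  then have "finite {p. (a + b) p \<noteq> 0}"
    by (rule finite_subset) (use ab in \<open>auto simp: cochains_def\<close>)
  moreover have "singular_simplex p X s" if "(a + b) p s \<noteq> 0" for p s
  proof -
    have "a p s \<noteq> 0 \<or> b p s \<noteq> 0" using that by (metis add.right_neutral plus_fun_apply)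
    then show ?thesis using ab by (auto simp: cochains_def)
  qed
  ultimately show ?thesis by (auto simp: cochains_def)
qed

lemma coboundary_add: "coboundary X (a + b) = coboundary X a + coboundary X b"
  by (auto simp: coboundary_def fun_eq_iff sum.distrib)
lemma cup_add_left: "cup X (a + b) c = cup X a c + cup X b c"
  by (auto simp: cup_def fun_eq_iff sum.distrib algebra_simps)
lemma cup_add_right: "cup X c (a + b) = cup X c a + cup X c b"
  by (auto simp: cup_def fun_eq_iff sum.distrib algebra_simps)
lemma coboundary_0: "coboundary X 0 = 0" by (auto simp: coboundary_def fun_eq_iff)
lemma cup_0: "cup X 0 c = 0" "cup X c 0 = 0" by (auto simp: cup_def fun_eq_iff)

lemma coboundary_coboundary: "coboundary X (coboundary X c) = 0"
proof (intro ext)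
  fix q s
  show "coboundary X (coboundary X c) q s = 0 q s"
  proof (cases "1 < q \<and> singular_simplex q X s")
    case False then show ?thesis by (auto simp: coboundary_def)
  next
    case True
    then obtain p where q: "q = Suc (Suc p)" and s: "singular_simplex (Suc (Suc p)) X s"
      by (metis less_natE plus_1_eq_Suc add_Suc)
    define T where "T k j = c p (singular_face (Suc p) j (singular_face (Suc (Suc p)) k s))" for k j
    have sf: "singular_simplex (Suc p) X (singular_face (Suc (Suc p)) k s)" if "k \<le> Suc (Suc p)" for k
      using singular_simplex_singular_face[OF s, of k] that by simp
    have T: "T k j = T j (k - 1)" if "j < k" "k \<le> Suc (Suc p)" for j k
    proof -
      have e: "simplical_face k (simplical_face j x) = simplical_face j (simplical_face (k - 1) x)" for x :: "nat \<Rightarrow> real"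
        using that by (auto simp: simplical_face_def fun_eq_iff)
      have 1: "simplical_face j x \<in> standard_simplex (Suc p)" "simplical_face (k - 1) x \<in> standard_simplex (Suc p)"
        if "x \<in> standard_simplex p" for x
        using simplical_face_in_standard_simplex[of "Suc p" j x] simplical_face_in_standard_simplex[of "Suc p" "k-1" x] that \<open>j < k\<close> \<open>k \<le> _\<close> by auto
      show ?thesis unfolding T_def
        by (rule arg_cong[where f="c p"], intro ext) (use e 1 in \<open>auto simp: singular_face_def\<close>)
    qed
    have "coboundary X (coboundary X c) q s = (\<Sum>k\<le>Suc (Suc p). \<Sum>j\<le>Suc p. T k j)"
      unfolding q using s by (simp add: coboundary_def sf T_def del: sum.atMost_Suc)
    also have "\<dots> = (\<Sum>(k,j)\<in>{..Suc (Suc p)} \<times> {..Suc p}. T k j)"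
      by (rule sum.cartesian_product)
    also have "{..Suc (Suc p)} \<times> {..Suc p} = {(k,j). k \<le> Suc (Suc p) \<and> j < k} \<union> {(k,j). k \<le> j \<and> j \<le> Suc p}"
      by auto
    also have "(\<Sum>(k,j)\<in>\<dots>. T k j) = (\<Sum>(k,j)\<in>{(k,j). k \<le> Suc (Suc p) \<and> j < k}. T k j) + (\<Sum>(k,j)\<in>{(k,j). k \<le> j \<and> j \<le> Suc p}. T k j)"
      by (rule sum.union_disjoint)
         (auto intro: finite_subset[of _ "{..Suc (Suc p)} \<times> {..Suc p}"])
    also have "(\<Sum>(k,j)\<in>{(k,j). k \<le> Suc (Suc p) \<and> j < k}. T k j) = (\<Sum>(k,j)\<in>{(k,j). k \<le> j \<and> j \<le> Suc p}. T k j)"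
      by (rule sum.reindex_bij_witness[where i="\<lambda>(k,j). (Suc j, k)" and j="\<lambda>(k,j). (j, k - 1)"])
         (auto simp: T)
    finally have "coboundary X (coboundary X c) q s = (\<Sum>(k,j)\<in>{(k,j). k \<le> j \<and> j \<le> Suc p}. T k j) + (\<Sum>(k,j)\<in>{(k,j). k \<le> j \<and> j \<le> Suc p}. T k j)" .
    moreover have "x + x = 0" for x :: bit by (cases x) auto
    ultimately show ?thesis by simp
  qed
qed

lemma zero_cochains: "0 \<in> cochains X" by (simp add: cochains_def)
lemma unit_cochains: "unit_cochain X \<in> cochains X"
proof -
  have "{p. unit_cochain X p \<noteq> 0} \<subseteq> {0}" by (auto simp: unit_cochain_def fun_eq_iff)
  then show ?thesis by (auto simp: cochains_def unit_cochain_def intro: finite_subset split: if_splits)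
qed

lemma coboundary_unit: "coboundary X (unit_cochain X) = 0"
proof (intro ext)
  fix q s show "coboundary X (unit_cochain X) q s = 0 q s"
  proof (cases "q = 1 \<and> singular_simplex 1 X s")
    case True
    then show ?thesis
      using singular_simplex_singular_face[of 1 X s]
      by (simp add: coboundary_def unit_cochain_def add_bit_eq_xor)
  qed (auto simp: coboundary_def unit_cochain_def le_Suc_eq intro!: sum.neutral)
qed

lemma cup_unit_left: "a \<in> cochains X \<Longrightarrow> cup X (unit_cochain X) a = a"
proof (intro ext)
  fix p s assume a: "a \<in> cochains X"
  show "cup X (unit_cochain X) a p s = a p s"
  proof (cases "singular_simplex p X s")
    case True
    have "(\<Sum>i\<le>p. unit_cochain X i (front_face i s) * a (p - i) (back_face i (p - i) s)) =
      (\<Sum>i\<in>{0}. unit_cochain X i (front_face i s) * a (p - i) (back_face i (p - i) s))"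
      by (rule sum.mono_neutral_right) (auto simp: unit_cochain_def)
    then show ?thesis using True
      by (simp add: cup_def unit_cochain_def singular_simplex_front_face front_0_back)
  next
    case False
    then have "a p s = 0" using a unfolding cochains_def by blast
    then show ?thesis using False by (simp add: cup_def)
  qed
qed

lemma cup_unit_right: "a \<in> cochains X \<Longrightarrow> cup X a (unit_cochain X) = a"
proof (intro ext)
  fix p s assume a: "a \<in> cochains X"
  show "cup X a (unit_cochain X) p s = a p s"
  proof (cases "singular_simplex p X s")
    case True
    have "(\<Sum>i\<le>p. a i (front_face i s) * unit_cochain X (p - i) (back_face i (p - i) s)) =
      (\<Sum>i\<in>{p}. a i (front_face i s) * unit_cochain X (p - i) (back_face i (p - i) s))"
      by (rule sum.mono_neutral_right) (auto simp: unit_cochain_def)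
    then show ?thesis using True singular_simplex_back_face[of p 0 X s]
      by (simp add: cup_def unit_cochain_def front_full)
  next
    case False
    then have "a p s = 0" using a unfolding cochains_def by blast
    then show ?thesis using False by (simp add: cup_def)
  qed
qed

lemma bit_fun_add_self: "a + a = 0" for a :: "'a cochain"
proof (intro ext)
  fix p s show "(a + a) p s = 0 p s" by (cases "a p s") auto
qed

lemma ring_cocycle_ring: "ring (cocycle_ring X)"
proof (rule ringI)
  show "abelian_group (cocycle_ring X)"
    by (rule abelian_groupI)
       (auto simp: cocycle_ring_def add_cochains zero_cochains coboundary_add coboundary_cochains
          add.assoc add.commute intro: exI bit_fun_add_self simp: coboundary_0)
  show "monoid (cocycle_ring X)"
    by (rule monoidI)
       (auto simp: cocycle_ring_def cup_cochains leibniz cup_0 unit_cochains coboundary_unit cup_assoc cup_unit_left cup_unit_right)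
qed (auto simp: cocycle_ring_def cup_add_left cup_add_right)

lemma ideal_coboundaries: "ideal (coboundaries X) (cocycle_ring X)"
proof (rule idealI)
  show "ring (cocycle_ring X)" by (rule ring_cocycle_ring)
  interpret ring "cocycle_ring X" by (rule ring_cocycle_ring)
  have neg: "\<ominus>\<^bsub>cocycle_ring X\<^esub> a = a" if "a \<in> carrier (cocycle_ring X)" for a
    by (rule minus_equality) (use that bit_fun_add_self[of a] in \<open>auto simp: cocycle_ring_def\<close>)
  have sub: "coboundaries X \<subseteq> carrier (cocycle_ring X)"
    by (auto simp: coboundaries_def cocycle_ring_def coboundary_cochains coboundary_coboundary)
  show "subgroup (coboundaries X) (add_monoid (cocycle_ring X))"
  proof (rule add.subgroupI)
    show "coboundaries X \<subseteq> carrier (cocycle_ring X)" by (rule sub)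
    show "coboundaries X \<noteq> {}" using zero_cochains by (auto simp: coboundaries_def)
    show "\<ominus>\<^bsub>cocycle_ring X\<^esub> a \<in> coboundaries X" if "a \<in> coboundaries X" for a
      using neg[of a] sub that by auto
    show "a \<oplus>\<^bsub>cocycle_ring X\<^esub> b \<in> coboundaries X" if "a \<in> coboundaries X" "b \<in> coboundaries X" for a b
      using that by (auto simp: coboundaries_def cocycle_ring_def coboundary_add[symmetric] intro: add_cochains)
  qed
  fix a x assume "a \<in> coboundaries X" and x: "x \<in> carrier (cocycle_ring X)"
  then obtain c where c: "c \<in> cochains X" "a = coboundary X c" by (auto simp: coboundaries_def)
  have xx: "x \<in> cochains X" "coboundary X x = 0" using x by (auto simp: cocycle_ring_def)
  have "cup X x a = coboundary X (cup X x c)" "cup X a x = coboundary X (cup X c x)"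
    by (auto simp: leibniz xx c cup_0)
  then show "x \<otimes>\<^bsub>cocycle_ring X\<^esub> a \<in> coboundaries X" "a \<otimes>\<^bsub>cocycle_ring X\<^esub> x \<in> coboundaries X"
    using c xx by (auto simp: coboundaries_def cocycle_ring_def intro: cup_cochains)
qed

lemma ring_cohomology_ring: "ring (cohomology_ring X)"
  unfolding cohomology_ring_def by (rule ideal.quotient_is_ring[OF ideal_coboundaries])

declare add_bit_eq_xor [simp] mult_bit_eq_and [simp] xor_bit_def [simp]


section \<open>The regular bundle of a Hausdorff space is a vector bundle\<close>

definition perm_act :: "nat \<Rightarrow> (nat \<Rightarrow> nat) \<Rightarrow> (nat \<Rightarrow> 'a) \<Rightarrow> nat \<Rightarrow> 'a" where
  "perm_act n \<pi> x = (\<lambda>i\<in>{..<n}. x (\<pi> i))"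

abbreviation labels :: "nat \<Rightarrow> (nat \<Rightarrow> real) topology" where
  "labels n \<equiv> product_topology (\<lambda>_. euclideanreal) {..<n}"

lemma topspace_ordered_config:
  "topspace (ordered_config X n) = {x \<in> {..<n} \<rightarrow>\<^sub>E topspace X. inj_on x {..<n}}"
  by (auto simp: ordered_config_def)

lemma continuous_perm_act_product:
  assumes "\<pi> \<in> {..<n} \<rightarrow> {..<n}"
  shows "continuous_map (product_topology (\<lambda>_. X) {..<n}) (product_topology (\<lambda>_. X) {..<n}) (perm_act n \<pi>)"
  unfolding continuous_map_componentwise
  using assms by (auto simp: perm_act_def intro!: continuous_map_product_projection)

lemma inj_on_perm_act:
  assumes "inj_on x {..<n}" "bij_betw \<pi> {..<n} {..<n}" shows "inj_on (perm_act n \<pi> x) {..<n}"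
proof -
  have "inj_on (x \<circ> \<pi>) {..<n}" using assms by (auto simp: bij_betw_def intro: comp_inj_on)
  then show ?thesis by (rule inj_on_cong[THEN iffD1, rotated]) (simp add: perm_act_def)
qed

lemma continuous_perm_act:
  assumes "bij_betw \<pi> {..<n} {..<n}"
  shows "continuous_map (ordered_config X n) (ordered_config X n) (perm_act n \<pi>)"
proof -
  have p: "\<pi> \<in> {..<n} \<rightarrow> {..<n}" using assms by (auto simp: bij_betw_def)
  have "inj_on (perm_act n \<pi> x) {..<n}" if "inj_on x {..<n}" for x :: "nat \<Rightarrow> 'a"
    using inj_on_perm_act[OF that assms] .
  then show ?thesis
    unfolding ordered_config_def
    by (auto simp: continuous_map_in_subtopology intro!: continuous_map_from_subtopology continuous_perm_act_product p)
qed

lemma perm_act_image: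
  assumes "bij_betw \<pi> {..<n} {..<n}" shows "perm_act n \<pi> x ` {..<n} = x ` {..<n}"
proof -
  have "perm_act n \<pi> x ` {..<n} = x ` (\<pi> ` {..<n})" by (auto simp: perm_act_def)
  then show ?thesis using assms by (simp add: bij_betw_def)
qed

lemma label_value:
  assumes "inj_on x {..<n}" "i < n"
  shows "snd (label_config n (x, v)) (x i) = v i"
  using assms by (simp add: label_config_def the_inv_into_f_f)

lemma label_eqI:
  assumes "inj_on x {..<n}" "\<And>i. i < n \<Longrightarrow> g (x i) = v i" "g \<in> extensional (x ` {..<n})"
  shows "label_config n (x, v) = (x ` {..<n}, g)"
proof -
  have "(\<lambda>p\<in>x ` {..<n}. v (the_inv_into {..<n} x p)) = g"
  proof
    fix p show "(\<lambda>p\<in>x ` {..<n}. v (the_inv_into {..<n} x p)) p = g p"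
      using assms by (cases "p \<in> x ` {..<n}") (auto simp: the_inv_into_f_f extensional_def)
  qed
  then show ?thesis by (simp add: label_config_def)
qed

lemma same_config:
  assumes "x \<in> topspace (ordered_config X n)" "y \<in> topspace (ordered_config X n)"
    and "x ` {..<n} = y ` {..<n}"
  obtains \<pi> where "bij_betw \<pi> {..<n} {..<n}" "y = perm_act n \<pi> x"
proof
  let ?p = "the_inv_into {..<n} x \<circ> y"
  have i: "inj_on x {..<n}" "inj_on y {..<n}" using assms by (auto simp: topspace_ordered_config)
  show "bij_betw ?p {..<n} {..<n}"
    by (rule bij_betw_trans[of _ _ "x ` {..<n}"])
       (use i assms(3) in \<open>simp_all add: bij_betw_def bij_betw_the_inv_into[unfolded bij_betw_def] inj_on_the_inv_into the_inv_into_onto\<close>)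
  show "y = perm_act n ?p x"
  proof
    fix j show "y j = perm_act n ?p x j"
    proof (cases "j < n")
      case True
      then have "y j \<in> x ` {..<n}" using assms(3) by auto
      then show ?thesis using True i by (simp add: perm_act_def f_the_inv_into_f)
    next
      case False
      then show ?thesis using assms(2) by (auto simp: perm_act_def topspace_ordered_config PiE_def extensional_def)
    qed
  qed
qed

lemma label_perm:
  assumes "inj_on x {..<n}" "bij_betw \<pi> {..<n} {..<n}"
  shows "label_config n (perm_act n \<pi> x, perm_act n \<pi> v) = label_config n (x, v)"
proof -
  have inj: "inj_on (perm_act n \<pi> x) {..<n}"
    using inj_on_perm_act[OF assms] .
  have "label_config n (perm_act n \<pi> x, perm_act n \<pi> v) = (perm_act n \<pi> x ` {..<n}, snd (label_config n (x, v)))"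
  proof (rule label_eqI[OF inj])
    fix i assume "i < n"
    then have "\<pi> i < n" using assms(2) by (auto simp: bij_betw_def)
    then show "snd (label_config n (x, v)) (perm_act n \<pi> x i) = perm_act n \<pi> v i"
      using \<open>i < n\<close> label_value[OF assms(1)] by (simp add: perm_act_def)
  qed (simp add: perm_act_image[OF assms(2)], simp add: label_config_def)
  then show ?thesis using perm_act_image[OF assms(2)] by (simp add: label_config_def)
qed

lemma open_map_config:
  "open_map (ordered_config X n) (config_space X n) (\<lambda>x. x ` {..<n})"
  unfolding open_map_def
proof (intro allI impI)
  fix U assume U: "openin (ordered_config X n) U"
  let ?Y = "ordered_config X n"
  have "{x \<in> topspace ?Y. x ` {..<n} \<in> (\<lambda>x. x ` {..<n}) ` U} =
     (\<Union>\<pi>\<in>{\<pi>. bij_betw \<pi> {..<n} {..<n}}. {x \<in> topspace ?Y. perm_act n \<pi> x \<in> U})" (is "?l = ?r")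
  proof
    show "?l \<subseteq> ?r"
    proof
      fix x assume "x \<in> ?l"
      then obtain y where y: "y \<in> U" "x \<in> topspace ?Y" "x ` {..<n} = y ` {..<n}" by auto
      then obtain \<pi> where "bij_betw \<pi> {..<n} {..<n}" "y = perm_act n \<pi> x"
        using same_config[of x X n y thesis] openin_subset[OF U] by blast
      then show "x \<in> ?r" using y by auto
    qed
    show "?r \<subseteq> ?l"
    proof
      fix x assume "x \<in> ?r"
      then obtain \<pi> where p: "bij_betw \<pi> {..<n} {..<n}" "x \<in> topspace ?Y" "perm_act n \<pi> x \<in> U" by auto
      have "x ` {..<n} \<in> (\<lambda>x. x ` {..<n}) ` U"
        by (rule image_eqI[OF _ p(3)]) (simp add: perm_act_image[OF p(1)])
      with p show "x \<in> ?l" by simp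
    qed
  qed
  moreover have "openin ?Y ?r"
    by (rule openin_Union) (auto intro!: openin_continuous_map_preimage[OF continuous_perm_act U])
  ultimately show "openin (config_space X n) ((\<lambda>x. x ` {..<n}) ` U)"
    using openin_subset[OF U] by (auto simp: config_space_def openin_quotient_topology)
qed

lemma open_map_label:
  "open_map (prod_topology (ordered_config X n) (labels n)) (bundle_total (regular_bundle X n)) (label_config n)"
  unfolding open_map_def
proof (intro allI impI)
  let ?Y = "ordered_config X n"
  let ?P = "prod_topology ?Y (labels n)"
  fix U assume U: "openin ?P U"
  let ?a = "\<lambda>\<pi>. \<lambda>(x, v). (perm_act n \<pi> x, perm_act n \<pi> v)"
  have cont: "continuous_map ?P ?P (?a \<pi>)" if \<pi>: "bij_betw \<pi> {..<n} {..<n}" for \<pi>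
  proof -
    have p: "\<pi> \<in> {..<n} \<rightarrow> {..<n}" using \<pi> by (auto simp: bij_betw_def)
    show ?thesis
      by (rule continuous_map_prod_top[THEN iffD2])
        (simp add: continuous_perm_act[OF \<pi>] continuous_perm_act_product[OF p])
  qed
  have "{z \<in> topspace ?P. label_config n z \<in> label_config n ` U} =
     (\<Union>\<pi>\<in>{\<pi>. bij_betw \<pi> {..<n} {..<n}}. {z \<in> topspace ?P. ?a \<pi> z \<in> U})" (is "?l = ?r")
  proof
    show "?l \<subseteq> ?r"
    proof
      fix z assume "z \<in> ?l"
      then obtain x v y w where z: "z = (x, v)" and y: "(y, w) \<in> U" "(x, v) \<in> topspace ?P"
        "label_config n (x, v) = label_config n (y, w)" by (cases z) fastforce
      have yw: "(y, w) \<in> topspace ?P" using openin_subset[OF U] y by auto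
      have "x ` {..<n} = y ` {..<n}" using y(3) by (simp add: label_config_def)
      then obtain \<pi> where \<pi>: "bij_betw \<pi> {..<n} {..<n}" "y = perm_act n \<pi> x"
        using same_config[of x X n y thesis] y yw by simp
      have inj: "inj_on x {..<n}" "inj_on y {..<n}" using y yw by (auto simp: topspace_ordered_config)
      have "w = perm_act n \<pi> v"
      proof
        fix i show "w i = perm_act n \<pi> v i"
        proof (cases "i < n")
          case True
          then have "\<pi> i < n" using \<pi> by (auto simp: bij_betw_def)
          have "w i = snd (label_config n (x, v)) (y i)" using label_value[OF inj(2) True, of w] y(3) by simp
          also have "y i = x (\<pi> i)" using \<pi> True by (simp add: perm_act_def)
          finally show ?thesis using label_value[OF inj(1) \<open>\<pi> i < n\<close>] True by (simp add: perm_act_def)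
        next
          case False then show ?thesis using yw by (auto simp: perm_act_def PiE_def extensional_def)
        qed
      qed
      then show "z \<in> ?r" using y \<pi> z by auto
    qed
    show "?r \<subseteq> ?l"
    proof
      fix z assume "z \<in> ?r"
      then obtain \<pi> x v where z: "z = (x, v)" "bij_betw \<pi> {..<n} {..<n}" "(x, v) \<in> topspace ?P"
        "(perm_act n \<pi> x, perm_act n \<pi> v) \<in> U" by auto
      then have "label_config n (perm_act n \<pi> x, perm_act n \<pi> v) = label_config n (x, v)"
        by (intro label_perm) (auto simp: topspace_ordered_config)
      then have "label_config n z \<in> label_config n ` U"
        by (intro image_eqI[OF _ z(4)]) (simp add: z(1))
      then show "z \<in> ?l" using z by simp
    qed
  qed
  moreover have "openin ?P ?r"
    by (intro openin_Union ballI) (use openin_continuous_map_preimage[OF cont U] in auto)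
  ultimately show "openin (bundle_total (regular_bundle X n)) (label_config n ` U)"
    using openin_subset[OF U] by (simp add: regular_bundle_def openin_quotient_topology image_mono)
qed

lemma homeo_restrict:
  assumes "continuous_map X Y f" "open_map X Y f" "openin X W" "inj_on f W"
  shows "homeomorphic_map (subtopology X W) (subtopology Y (f ` W)) f"
proof (rule bijective_open_imp_homeomorphic_map)
  have WX: "W \<subseteq> topspace X" using assms(3) by (rule openin_subset)
  have fW: "f ` W \<subseteq> topspace Y" using WX assms(1) by (auto simp: continuous_map_def)
  show "continuous_map (subtopology X W) (subtopology Y (f ` W)) f"
    using assms(1) by (auto simp: continuous_map_in_subtopology continuous_map_from_subtopology)
  show "open_map (subtopology X W) (subtopology Y (f ` W)) f"
    by (rule open_map_into_subtopology[OF open_map_from_subtopology[OF assms(2,3)]]) (use WX in auto)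
  show "f ` topspace (subtopology X W) = topspace (subtopology Y (f ` W))" using WX fW by auto
  show "inj_on f (topspace (subtopology X W))" using assms(4) WX by (simp add: Int_absorb1)
qed


lemma Hausdorff_separate_finite:
  fixes n :: nat
  assumes "Hausdorff_space X" "y \<in> {..<n} \<rightarrow> topspace X" "inj_on y {..<n}"
  obtains V where "\<And>i. i < n \<Longrightarrow> openin X (V i) \<and> y i \<in> V i"
    "\<And>i j. i < n \<Longrightarrow> j < n \<Longrightarrow> i \<noteq> j \<Longrightarrow> V i \<inter> V j = {}"
proof -
  have "\<exists>A B. openin X A \<and> openin X B \<and> y i \<in> A \<and> y j \<in> B \<and> A \<inter> B = {}"
    if "i < n" "j < n" "i \<noteq> j" for i j
  proof -
    have "y i \<in> topspace X" "y j \<in> topspace X" "y i \<noteq> y j"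
      using assms that by (auto simp: inj_on_def)
    then show ?thesis using assms(1) unfolding Hausdorff_space_def disjnt_def by blast
  qed
  then obtain A B where AB: "\<And>i j. i < n \<Longrightarrow> j < n \<Longrightarrow> i \<noteq> j \<Longrightarrow>
     openin X (A i j) \<and> openin X (B i j) \<and> y i \<in> A i j \<and> y j \<in> B i j \<and> A i j \<inter> B i j = {}"
    by metis
  define V where "V i = topspace X \<inter> (\<Inter>j\<in>{..<n} - {i}. A i j \<inter> B j i)" for i
  show thesis
  proof
    fix i assume i: "i < n"
    have "openin X (\<Inter>(insert (topspace X) ((\<lambda>j. A i j \<inter> B j i) ` ({..<n} - {i}))))"
      using AB i by (intro openin_Inter) (auto intro!: finite_imageI)
    then have "openin X (V i)" by (simp add: V_def)
    moreover have "y i \<in> V i" using AB i assms(2) by (auto simp: V_def)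
    ultimately show "openin X (V i) \<and> y i \<in> V i" by blast
  next
    fix i j assume "i < n" "j < n" "i \<noteq> j"
    then have "V i \<subseteq> A i j" "V j \<subseteq> B i j" by (auto simp: V_def)
    then show "V i \<inter> V j = {}" using AB \<open>i < n\<close> \<open>j < n\<close> \<open>i \<noteq> j\<close> by blast
  qed
qed

lemma vector_bundle_regular_bundle:
  fixes X :: "'a topology"
  assumes "Hausdorff_space X"
  shows "vector_bundle n (regular_bundle X n)"
  unfolding vector_bundle_def
proof (intro conjI ballI)
  let ?\<xi> = "regular_bundle X n" and ?Y = "ordered_config X n" and ?q = "\<lambda>x::nat \<Rightarrow> 'a. x ` {..<n}"
  have base: "bundle_base ?\<xi> = config_space X n" and proj: "bundle_proj ?\<xi> = fst"
    by (simp_all add: regular_bundle_def)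
  have totsp: "topspace (bundle_total ?\<xi>) = label_config n ` (topspace ?Y \<times> ({..<n} \<rightarrow>\<^sub>E UNIV))"
    by (simp add: regular_bundle_def)
  have fst_label: "fst (label_config n z) = ?q (fst z)" for z :: "(nat \<Rightarrow> 'a) \<times> (nat \<Rightarrow> real)"
    by (cases z) (simp add: label_config_def)
  show "bundle_proj ?\<xi> \<in> topspace (bundle_total ?\<xi>) \<rightarrow> topspace (bundle_base ?\<xi>)"
    unfolding totsp base proj by (auto simp: fst_label config_space_def)
  fix b assume "b \<in> topspace (bundle_base ?\<xi>)"
  then obtain y where y: "y \<in> topspace ?Y" "b = ?q y" by (auto simp: base config_space_def)
  obtain V where V: "\<And>i. i < n \<Longrightarrow> openin X (V i) \<and> y i \<in> V i"
      and disj: "\<And>i j. i < n \<Longrightarrow> j < n \<Longrightarrow> i \<noteq> j \<Longrightarrow> V i \<inter> V j = {}"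
    using Hausdorff_separate_finite[OF assms, of y n thesis] y(1)
    unfolding topspace_ordered_config PiE_def by blast
  define W where "W = topspace ?Y \<inter> ({..<n} \<rightarrow>\<^sub>E topspace X) \<inter> {x. \<forall>i<n. x i \<in> V i}"
  have W: "openin ?Y W"
  proof -
    have "openin (product_topology (\<lambda>_. X) {..<n}) (Pi\<^sub>E {..<n} V)"
      using V by (subst openin_PiE) auto
    then have "openin ?Y (Pi\<^sub>E {..<n} V \<inter> {x. inj_on x {..<n}})"
      unfolding ordered_config_def openin_subtopology by blast
    moreover have "Pi\<^sub>E {..<n} V \<inter> {x. inj_on x {..<n}} = W"
      using V[THEN conjunct1, THEN openin_subset] unfolding W_def topspace_ordered_config
      by (auto simp: PiE_iff)
    ultimately show ?thesis by simp
  qed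
  have WY: "W \<subseteq> topspace ?Y" using W by (rule openin_subset)
  have inj_q: "inj_on ?q W"
  proof (rule inj_onI, rule ext)
    fix x x' i assume x: "x \<in> W" "x' \<in> W" "?q x = ?q x'"
    show "x i = x' i"
    proof (cases "i < n")
      case True
      then have "x i \<in> ?q x'" using x(3) by blast
      then obtain j where j: "j < n" "x i = x' j" by auto
      then have "x i \<in> V i \<inter> V j" using x True unfolding W_def by auto
      then show ?thesis using disj[OF True j(1)] j by auto
    next
      case False then show ?thesis using x by (auto simp: W_def PiE_def extensional_def)
    qed
  qed
  have injx: "inj_on x {..<n}" if "x \<in> W" for x using that WY by (auto simp: topspace_ordered_config)
  let ?R = "{..<n} \<rightarrow>\<^sub>E (UNIV :: real set)"
  have inj_label: "inj_on (label_config n) (W \<times> ?R)"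
  proof (rule inj_onI)
    fix z z' assume z: "z \<in> W \<times> ?R" "z' \<in> W \<times> ?R" "label_config n z = label_config n z'"
    obtain x v x' v' where e: "z = (x, v)" "z' = (x', v')" by (metis surj_pair)
    have "?q x = ?q x'" using z(3) fst_label[of z] fst_label[of z'] e by simp
    then have xx: "x = x'" using inj_onD[OF inj_q] z e by auto
    have "v i = v' i" for i
    proof (cases "i < n")
      case True then show ?thesis
        using label_value[OF injx True, of x v] label_value[OF injx True, of x' v'] z e xx by simp
    next
      case False then show ?thesis using z e by (auto simp: PiE_def extensional_def)
    qed
    then show "z = z'" using e xx by auto
  qed
  define U where "U = ?q ` W"
  have U: "openin (config_space X n) U"
    using open_map_config W unfolding open_map_def U_def by blast
  have hq: "homeomorphic_map (subtopology ?Y W) (subtopology (config_space X n) U) ?q"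
    unfolding U_def
    by (rule homeo_restrict[OF _ open_map_config W inj_q])
       (simp add: config_space_def quotient_imp_continuous_map quotient_map_quotient_topology)
  let ?P = "prod_topology ?Y (labels n)"
  have hl: "homeomorphic_map (subtopology ?P (W \<times> ?R)) (subtopology (bundle_total ?\<xi>) (label_config n ` (W \<times> ?R))) (label_config n)"
  proof (rule homeo_restrict[OF _ open_map_label _ inj_label])
    show "continuous_map ?P (bundle_total ?\<xi>) (label_config n)"
      by (simp add: regular_bundle_def quotient_imp_continuous_map quotient_map_quotient_topology)
    have "openin (labels n) ?R" using openin_topspace[of "labels n"] by simp
    then show "openin ?P (W \<times> ?R)" using W by (simp add: openin_prod_Times_iff)
  qed
  have PW: "subtopology ?P (W \<times> ?R) = prod_topology (subtopology ?Y W) (labels n)"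
    using subtopology_topspace[of "labels n"] by (simp add: subtopology_Times)
  have U_eq: "{e \<in> topspace (bundle_total ?\<xi>). bundle_proj ?\<xi> e \<in> U} = label_config n ` (W \<times> ?R)" (is "?l = ?r")
  proof
    show "?r \<subseteq> ?l" unfolding totsp proj U_def using WY by (auto simp: fst_label)
    show "?l \<subseteq> ?r"
    proof
      fix e assume "e \<in> ?l"
      then obtain x v where x: "x \<in> topspace ?Y" "v \<in> ?R" "e = label_config n (x, v)" "?q x \<in> U"
        unfolding totsp proj by (auto simp: fst_label)
      then obtain x' where x': "x' \<in> W" "?q x = ?q x'" by (auto simp: U_def)
      then obtain \<pi> where \<pi>: "bij_betw \<pi> {..<n} {..<n}" "x' = perm_act n \<pi> x"
        using same_config[of x X n x' thesis] x(1) WY by blast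
      have "e = label_config n (x', perm_act n \<pi> v)"
        using label_perm[OF _ \<pi>(1), of x v] x \<pi>(2) by (simp add: topspace_ordered_config)
      moreover have "perm_act n \<pi> v \<in> ?R" by (auto simp: perm_act_def)
      ultimately show "e \<in> ?r" using x' by blast
    qed
  qed
  obtain k where k: "homeomorphic_maps (prod_topology (subtopology ?Y W) (labels n)) (subtopology (bundle_total ?\<xi>) (label_config n ` (W \<times> ?R))) (label_config n) k"
    using hl unfolding PW homeomorphic_map_maps by blast
  have hk: "homeomorphic_map (subtopology (bundle_total ?\<xi>) (label_config n ` (W \<times> ?R))) (prod_topology (subtopology ?Y W) (labels n)) k"
    using k by (simp add: homeomorphic_maps_map)
  have kl: "k (label_config n (x, v)) = (x, v)" if "x \<in> W" "v \<in> ?R" for x v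
    using k that WY unfolding homeomorphic_maps_def by auto
  have hqid: "homeomorphic_map (prod_topology (subtopology ?Y W) (labels n)) (prod_topology (subtopology (config_space X n) U) (labels n)) (\<lambda>(x, v). (?q x, id v))"
  proof -
    obtain g where "homeomorphic_maps (subtopology ?Y W) (subtopology (config_space X n) U) ?q g"
      using hq homeomorphic_map_maps by blast
    moreover have "homeomorphic_maps (labels n) (labels n) id id" by (simp add: homeomorphic_maps_def)
    ultimately have "homeomorphic_maps (prod_topology (subtopology ?Y W) (labels n)) (prod_topology (subtopology (config_space X n) U) (labels n)) (\<lambda>(x, v). (?q x, id v)) (\<lambda>(x, v). (g x, id v))"
      by (intro homeomorphic_maps_prod[THEN iffD2] disjI2 conjI)
    then show ?thesis using homeomorphic_map_maps by blast
  qed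
  define h where "h = (\<lambda>(x, v). (?q x, id v)) \<circ> k"
  have h: "homeomorphic_map (subtopology (bundle_total ?\<xi>) (label_config n ` (W \<times> ?R))) (prod_topology (subtopology (config_space X n) U) (labels n)) h"
    unfolding h_def by (rule homeomorphic_map_compose[OF hk hqid])
  have hlabel: "h (label_config n (x, v)) = (?q x, v)" if "x \<in> W" "v \<in> ?R" for x v
    using kl[OF that] by (simp add: h_def)
  have scale: "vscale ?\<xi> c (label_config n (x, v)) = label_config n (x, \<lambda>i\<in>{..<n}. c * v i)" if "x \<in> W" for x v c
    unfolding label_config_def using the_inv_into_into[OF injx[OF that], of _ "{..<n}"]
    by (auto simp: regular_bundle_def fun_eq_iff the_inv_into_f_f[OF injx[OF that]])
  have add: "vadd ?\<xi> (label_config n (x, v)) (label_config n (x, w)) = label_config n (x, \<lambda>i\<in>{..<n}. v i + w i)" if "x \<in> W" for x v w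
    unfolding label_config_def
    by (auto simp: regular_bundle_def fun_eq_iff the_inv_into_f_f[OF injx[OF that]])
  have tot: "label_config n (x, v) \<in> topspace (bundle_total ?\<xi>)" if "x \<in> W" "v \<in> ?R" for x v
    unfolding totsp using that WY by blast
  have "b \<in> U" using y V WY unfolding U_def W_def by (auto simp: topspace_ordered_config)
  moreover have "fst (h e) = bundle_proj ?\<xi> e \<and>
         (\<forall>c. vscale ?\<xi> c e \<in> topspace (bundle_total ?\<xi>) \<and>
            h (vscale ?\<xi> c e) = (bundle_proj ?\<xi> e, \<lambda>i\<in>{..<n}. c * snd (h e) i)) \<and>
         (\<forall>e'\<in>topspace (bundle_total ?\<xi>). bundle_proj ?\<xi> e' = bundle_proj ?\<xi> e \<longrightarrow>
            vadd ?\<xi> e e' \<in> topspace (bundle_total ?\<xi>) \<and>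
            h (vadd ?\<xi> e e') = (bundle_proj ?\<xi> e, \<lambda>i\<in>{..<n}. snd (h e) i + snd (h e') i))"
    if e: "e \<in> topspace (bundle_total ?\<xi>)" "bundle_proj ?\<xi> e \<in> U" for e
  proof -
    obtain x v where x: "x \<in> W" "v \<in> ?R" "e = label_config n (x, v)" using e U_eq by blast
    have pe: "bundle_proj ?\<xi> e = ?q x" by (simp add: proj x(3) fst_label)
    have he: "h e = (?q x, v)" using hlabel x by simp
    have mem: "(\<lambda>i\<in>{..<n}. f i) \<in> ?R" for f by auto
    show ?thesis
    proof (intro conjI allI ballI impI)
      show "fst (h e) = bundle_proj ?\<xi> e" by (simp add: he pe)
      fix c
      show "vscale ?\<xi> c e \<in> topspace (bundle_total ?\<xi>)"
        unfolding x(3) scale[OF x(1)] by (rule tot[OF x(1) mem])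
      show "h (vscale ?\<xi> c e) = (bundle_proj ?\<xi> e, \<lambda>i\<in>{..<n}. c * snd (h e) i)"
        unfolding pe he unfolding x(3) scale[OF x(1)] hlabel[OF x(1) mem] by simp
    next
      fix e' assume e': "e' \<in> topspace (bundle_total ?\<xi>)" "bundle_proj ?\<xi> e' = bundle_proj ?\<xi> e"
      then obtain x' w where x': "x' \<in> W" "w \<in> ?R" "e' = label_config n (x', w)"
        using e(2) U_eq by (metis (mono_tags, lifting) imageE mem_Collect_eq mem_Sigma_iff surj_pair)
      have "?q x' = ?q x" using e'(2) pe by (simp add: proj x'(3) fst_label)
      then have xx: "x' = x" using inj_onD[OF inj_q _ x'(1) x(1)] by simp
      have he': "h e' = (?q x, w)" using hlabel x' xx by simp
      show "vadd ?\<xi> e e' \<in> topspace (bundle_total ?\<xi>)"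
        unfolding x(3) x'(3) xx add[OF x(1)] by (rule tot[OF x(1) mem])
      show "h (vadd ?\<xi> e e') = (bundle_proj ?\<xi> e, \<lambda>i\<in>{..<n}. snd (h e) i + snd (h e') i)"
        unfolding pe he he' unfolding x(3) x'(3) xx add[OF x(1)] hlabel[OF x(1) mem] by simp
    qed
  qed
  ultimately show "\<exists>U h. openin (bundle_base ?\<xi>) U \<and> b \<in> U \<and>
        homeomorphic_map
          (subtopology (bundle_total ?\<xi>) {e \<in> topspace (bundle_total ?\<xi>). bundle_proj ?\<xi> e \<in> U})
          (prod_topology (subtopology (bundle_base ?\<xi>) U) (labels n)) h \<and>
        (\<forall>e\<in>topspace (bundle_total ?\<xi>). bundle_proj ?\<xi> e \<in> U \<longrightarrow>
           fst (h e) = bundle_proj ?\<xi> e \<and>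
           (\<forall>c. vscale ?\<xi> c e \<in> topspace (bundle_total ?\<xi>) \<and>
              h (vscale ?\<xi> c e) = (bundle_proj ?\<xi> e, \<lambda>i\<in>{..<n}. c * snd (h e) i)) \<and>
           (\<forall>e'\<in>topspace (bundle_total ?\<xi>). bundle_proj ?\<xi> e' = bundle_proj ?\<xi> e \<longrightarrow>
              vadd ?\<xi> e e' \<in> topspace (bundle_total ?\<xi>) \<and>
              h (vadd ?\<xi> e e') = (bundle_proj ?\<xi> e, \<lambda>i\<in>{..<n}. snd (h e) i + snd (h e') i)))"
    using h U by (intro exI[of _ U] exI[of _ h]) (simp add: base U_eq)
qed

end

theory Submission imports Defs begin

text \<open>
To a configuration of \<open>n\<close> points we attach chords that depend continuously on it and are always
independent: points with nearby abscissae get chords of very different length. If every such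
diagram had codimension greater than \<open>n - r\<close> in \<open>F\<close>, no \<open>r\<close> orthogonal vectors of a fibre of the
regular bundle could annihilate \<open>F\<close>, so in the \<open>r\<close>-th fibre power of its projectivization
\<open>\<Prod>i. x i ^ N * (\<Prod>j<i. x i + x j)\<close> vanishes. Reading a configuration as points of the complex plane embeds
the bundle into polynomials, and real and imaginary parts give \<open>w k ^ 2 = 0\<close> for \<open>k > 0\<close>. Hence the top
coefficient of \<open>x ^ (n - 1 + k)\<close> is \<open>w k\<close>, and that of the product above times \<open>\<Prod>i. x i ^ i\<close> is a
Hankel determinant whose only surviving term is the product of the \<open>w (N - n + 2 * i - 1)\<close>.
\<close>

text \<open>The chord of a point with abscissa \<open>x\<close> joins \<open>- exp x\<close> to
  \<open>exp (x + h)\<close>, so an even function sees only the interval from \<open>x\<close> to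
  \<open>x + h\<close> on a logarithmic scale. Independence follows once every nonempty subfamily of
  these intervals has a point that lies in just one of them; points may share their abscissa, so
  their ordinates have to set the lengths. The squares vanish because real and imaginary part of
  polynomial evaluation are two bundle maps, without common zero, from the trivial bundle of rank
  \<open>2 * n\<close> to the regular bundle. Where one of them is nonzero on a line, the relation
  defining the \<open>w k\<close> holds for the class \<open>y\<close> of the projectivized trivial
  bundle. Hence the square of that relation is zero, and as \<open>y\<close> satisfies nothing but
  \<open>y ^ (2 * n) = 0\<close>, the coefficients \<open>w k ^ 2\<close> with \<open>k > 0\<close>
  vanish. The total class is then its own inverse, which is why the dual classes in the top
  coefficients are again the \<open>w k\<close>. All freeness statements come from finite covers:
  among \<open>n * n + 1\<close> directions one always separates the points of a
  configuration.\<close>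

abbreviation "cmap == continuous_map"
abbreviation "subt == subtopology"
abbreviation "eur == euclideanreal"
abbreviation "ssx == singular_simplex"
abbreviation "stdx == standard_simplex"
abbreviation "ptop == prod_topology"
abbreviation "dl == coboundary"
abbreviation "smap == simplex_map"
abbreviation "Bp == B_plane"
abbreviation "unc == unit_cochain"
abbreviation "sface == singular_face"
abbreviation "HRg == cohomology_ring"
lemmas cm_comp = continuous_map_compose
lemmas cm_sub = continuous_map_from_subtopology
lemmas cm_into = continuous_map_in_subtopology
lemmas cm_fst = continuous_map_fst
lemmas cm_snd = continuous_map_snd
lemmas cm_eq = continuous_map_eq
lemmas cm_def = continuous_map_def
lemmas cm_mult = continuous_map_real_mult
lemmas cm_pair = continuous_map_pairedI
lemmas cm_sum = continuous_map_sum
lemmas ssx_d = singular_simplex_def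
lemmas sdl = sum_distrib_left
lemmas sdr = sum_distrib_right
lemmas ssx_map = singular_simplex_simplex_map
lemmas p2_eq = power2_eq_square
lemmas pb_d = cochain_pullback_def
lemmas ssx_face = singular_simplex_singular_face
lemmas cm_div = continuous_map_real_divide


declare add_bit_eq_xor [simp del] mult_bit_eq_and [simp del] xor_bit_def [simp del]

section \<open>Singular cochains modulo two\<close>

lemma bit_add_self [simp]: "(a::bit) + a = 0"
 by(cases a) auto

lemma bit_add_eq_0: "(a::bit) + b = 0 \<longleftrightarrow> a = b"
 by(cases a; cases b) auto

lemma cch_add_self [simp]: "(c::'a cochain) + c = 0"
 by(rule bit_fun_add_self)

lemma cch_add_eq_0: "(c::'a cochain) + d = 0 \<longleftrightarrow> c = d"
 by(auto simp: fun_eq_iff bit_add_eq_0 plus_fun_apply zero_fun_apply)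

lemma cch_add_left_cancel: "(c::'a cochain) + (c + d) = d"
 by(simp flip: add.assoc)

declare plus_fun_apply [simp del] zero_fun_apply [simp del]

lemma cch_apply:
 "((c::'a cochain) + d) p s = c p s + d p s" "(0::'a cochain) p s = 0"
 by(simp_all add: plus_fun_apply zero_fun_apply)

lemma sum_additive: "h 0 = 0 ==> (!!x y. h (x + y) = h x + h y) ==> h (\<Sum>i\<in>I. g i) = (\<Sum>i\<in>I. h (g i))"
 using sum_comp_morphism[of h g I] by(simp add: o_def)

text \<open>Cochains are used here without any support or finiteness condition, so one function is a
  cochain of every space on the type at once. \<open>cch_on X\<close> forgets its values off the
  simplices of \<open>X\<close>; coboundary and cup product see only those, and exactness is tested
  after this normalization.\<close>

definition cch_on :: "'a topology => 'a cochain => 'a cochain" where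
 "cch_on X c = (%p s. if ssx p X s then c p s else 0)"

definition cyc :: "'a topology => 'a cochain => bool" where
 "cyc X c \<longleftrightarrow> dl X c = 0"

definition exact :: "'a topology => 'a cochain => bool" where
 "exact X c \<longleftrightarrow> (EX e. cch_on X c = dl X e)"

lemma exactI: "cch_on X c = dl X e ==> exact X c"
 unfolding exact_def by(rule exI[of _ e])

lemma exactE: assumes "exact X c" obtains e where "cch_on X c = dl X e"
 using assms unfolding exact_def by(elim exE)

lemma cch_on_idem [simp]: "cch_on X (cch_on X c) = cch_on X c"
 by(auto simp: cch_on_def fun_eq_iff cch_apply)

lemma cch_on_0 [simp]: "cch_on X 0 = 0"
 by(auto simp: cch_on_def fun_eq_iff cch_apply)

lemma cch_on_add: "cch_on X (c + d) = cch_on X c + cch_on X d"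
 by(auto simp: cch_on_def fun_eq_iff cch_apply)

lemma cch_on_dl [simp]: "cch_on X (dl X c) = dl X c"
 by(auto simp: cch_on_def fun_eq_iff coboundary_def)

lemma cch_on_cup [simp]: "cch_on X (cup X c d) = cup X c d"
 by(auto simp: cch_on_def fun_eq_iff cup_def)

lemma dl_cch_on [simp]: "dl X (cch_on X c) = dl X c"
 by(auto simp: cch_on_def fun_eq_iff coboundary_def ssx_face intro!: sum.cong)

lemma cup_cch_on [simp]:
 "cup X (cch_on X c) d = cup X c d" "cup X c (cch_on X d) = cup X c d"
proof -
 have "ssx (p - i) X (back_face i (p - i) s)" if "ssx p X s" "i <= p" for p s i
  using singular_simplex_back_face[of i "p - i" X s] that by simp
 thus "cup X (cch_on X c) d = cup X c d" "cup X c (cch_on X d) = cup X c d"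
  by(auto simp: cup_def cch_on_def fun_eq_iff singular_simplex_front_face intro!: sum.cong)
qed

lemma cup_unit_cch_left: "cup X (unc X) a = cch_on X a"
proof (intro ext)
 fix p s
 show "cup X (unc X) a p s = cch_on X a p s"
 proof (cases "ssx p X s")
  case True
  have "(\<Sum>i\<le>p. unc X i (front_face i s) * a (p - i) (back_face i (p - i) s)) =
   (\<Sum>i\<in>{0}. unc X i (front_face i s) * a (p - i) (back_face i (p - i) s))"
   by(rule sum.mono_neutral_right) (auto simp: unit_cochain_def)
  thus ?thesis using True
   by(simp add: cup_def unit_cochain_def singular_simplex_front_face front_0_back cch_on_def)
 qed (simp add: cup_def cch_on_def)
qed

lemma cyc_0 [simp]: "cyc X 0"
 by(simp add: cyc_def coboundary_0)

lemma cyc_add: "cyc X c ==> cyc X d ==> cyc X (c + d)"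
 by(simp add: cyc_def coboundary_add)

lemma cyc_sum: "(!!i. i : I ==> cyc X (c i)) ==> cyc X (sum c I)"
 by(induction I rule: infinite_finite_induct) (auto intro: cyc_add)

lemma cyc_cup: "cyc X c ==> cyc X d ==> cyc X (cup X c d)"
 by(simp add: cyc_def leibniz cup_0)

lemma cyc_unit: "cyc X (unc X)"
 by(simp add: cyc_def coboundary_unit)

lemma cyc_dl [simp]: "cyc X (dl X c)"
 by(simp add: cyc_def coboundary_coboundary)

lemma cyc_cch_on [simp]: "cyc X (cch_on X c) \<longleftrightarrow> cyc X c"
 by(simp add: cyc_def)

lemma exact_cch_on [simp]: "exact X (cch_on X c) \<longleftrightarrow> exact X c"
 by(simp add: exact_def)

lemma exact_dl [simp]: "exact X (dl X c)"
 by(auto simp: exact_def)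

lemma exact_0 [simp]: "exact X 0"
 using exact_dl[of X 0] by(simp add: coboundary_0)

lemma exact_add: "exact X c ==> exact X d ==> exact X (c + d)"
 unfolding exact_def by(metis cch_on_add coboundary_add)

lemma exact_trans: "exact X (a + b) ==> exact X (b + c) ==> exact X (a + c)"
 using exact_add[of X "a + b" "b + c"] by(simp add: add.assoc cch_add_left_cancel)

lemma exact_cup_left: "exact X c ==> cyc X d ==> exact X (cup X c d)"
proof -
 assume "exact X c" and d: "cyc X d"
 then obtain e where e: "cch_on X c = dl X e" by(auto simp: exact_def)
 have "cup X c d = cup X (cch_on X c) d" by simp
 also have "... = dl X (cup X e d)"
  using d by(simp add: e leibniz cyc_def cup_0)
 finally show ?thesis by simp
qed

lemma exact_cup_right: "exact X d ==> cyc X c ==> exact X (cup X c d)"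
proof -
 assume "exact X d" and d: "cyc X c"
 then obtain e where e: "cch_on X d = dl X e" by(auto simp: exact_def)
 have "cup X c d = cup X c (cch_on X d)" by simp
 also have "... = dl X (cup X c e)"
  using d by(simp add: e leibniz cyc_def cup_0)
 finally show ?thesis by simp
qed

lemma dl_sum: "dl X (\<Sum>i\<in>I. c i) = (\<Sum>i\<in>I. dl X (c i))"
 by(rule sum_additive[where h = "dl X"]) (rule coboundary_0 coboundary_add)+

subsection \<open>Functoriality\<close>

abbreviation "pb == cochain_pullback"

lemma pb_add: "pb X f (c + d) = pb X f c + pb X f d"
 by(auto simp: pb_d fun_eq_iff cch_apply)

lemma pb_0 [simp]: "pb X f 0 = 0"
 by(auto simp: pb_d fun_eq_iff cch_apply)

lemma cch_on_pb [simp]: "cch_on X (pb X f c) = pb X f c"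
 by(auto simp: pb_d cch_on_def fun_eq_iff)

lemma sx_map_face:
 assumes "ssx p X s" "1 <= p" "k <= p"
 shows "sface p k (smap p f s) = smap (p - 1) f (sface p k s)"
 using assms simplical_face_in_standard_simplex[of p k]
 by(auto simp: singular_face_def simplex_map_def fun_eq_iff)

lemma sx_map_front: "i <= p ==> front_face i (smap p f s) = smap i f (front_face i s)"
 using standard_simplex_mono[of i p] by(auto simp: front_face_def simplex_map_def fun_eq_iff)

lemma sx_map_back: "back_face i j (smap (i + j) f s) = smap j f (back_face i j s)"
 using back_point_in[of _ j i] by(auto simp: back_face_def simplex_map_def fun_eq_iff)

context
 fixes X :: "'a topology" and Y :: "'b topology" and f
 assumes f: "cmap X Y f"
begin

lemma pb_dl: "dl X (pb X f c) = pb X f (dl Y c)"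
 using ssx_map[OF _ f] ssx_face[where X=X]
 by(auto simp: coboundary_def pb_d fun_eq_iff sx_map_face intro!: sum.cong)

lemma pb_cup: "pb X f (cup Y c d) = cup X (pb X f c) (pb X f d)"
proof -
 have "ssx (p - i) X (back_face i (p - i) s)" if "ssx p X s" "i <= p" for p s i
  using singular_simplex_back_face[of i "p - i" X s] that by simp
 moreover have "back_face i (p - i) (smap p f s) = smap (p - i) f (back_face i (p - i) s)"
  if "i <= p" for i p s
  using sx_map_back[of i "p - i" f s] that by simp
 ultimately show ?thesis
  using ssx_map[OF _ f]
  unfolding cup_def pb_d
  by(intro ext if_cong refl sum.cong) (simp_all add: singular_simplex_front_face sx_map_front)
qed

lemma pb_cch_on [simp]: "pb X f (cch_on Y c) = pb X f c"
 using ssx_map[OF _ f] by(auto simp: cch_on_def pb_d fun_eq_iff)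

lemma pb_unit: "pb X f (unc Y) = unc X"
 using ssx_map[OF _ f] by(auto simp: unit_cochain_def pb_d fun_eq_iff)

lemma pb_pb: "pb X f (pb Y g c) = pb X (g o f) c"
 using ssx_map[OF _ f] 
 by(auto simp: pb_d fun_eq_iff simplex_map_compose)

lemma cyc_pb: "cyc Y c ==> cyc X (pb X f c)"
 by(simp add: cyc_def pb_dl)

lemma exact_pb: "exact Y c ==> exact X (pb X f c)"
 unfolding exact_def by(metis pb_dl pb_cch_on cch_on_pb)

end

lemma pb_cong: "(!!x. x : topspace X ==> f x = g x) ==> pb X f c = pb X g c"
 using simplex_map_eq[of _ X _ f g] by(intro ext) (simp add: pb_d)

lemma pb_id: "(!!x. x : topspace X ==> f x = x) ==> pb X f c = cch_on X c"
 using simplex_map_id_gen[of _ X _ f] by(intro ext) (simp add: pb_d cch_on_def)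

section \<open>Restriction of cochains to subspaces\<close>

lemma subtopology_sx: "ssx p (subt X U) s ==> ssx p X s"
 by(simp add: singular_simplex_subtopology)

lemma dl_sub: "cch_on (subt X U) (dl X c) = dl (subt X U) c"
 by(auto simp: coboundary_def cch_on_def fun_eq_iff subtopology_sx)

lemma cup_sub: "cch_on (subt X U) (cup X c d) = cup (subt X U) c d"
 by(auto simp: cup_def cch_on_def fun_eq_iff subtopology_sx)

lemma cch_on_sub: "cch_on (subt X U) (cch_on X c) = cch_on (subt X U) c"
 by(auto simp: cch_on_def fun_eq_iff subtopology_sx)

lemma pb_sub: "cch_on (subt X U) (pb X f c) = pb (subt X U) f c"
 by(auto simp: cch_on_def pb_d fun_eq_iff subtopology_sx)

lemma cyc_sub: "cyc X c ==> cyc (subt X U) c"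
 by(metis cyc_def dl_sub cch_on_0)

lemma exact_sub: "exact X c ==> exact (subt X U) c"
 unfolding exact_def by(metis cch_on_sub dl_sub)

subsection \<open>Evaluation on integral chains and small simplices\<close>

text \<open>Barycentric subdivision acts on integral chains; evaluating a mod 2 cochain on them
  through \<open>of_int\<close> makes its chain homotopy available, and all signs become
  invisible.\<close>

definition cch_eval :: "'a cochain => nat => 'a chain => bit" where
 "cch_eval c p z = (\<Sum>s\<in>Poly_Mapping.keys z. of_int (poly_mapping.lookup z s) * c p s)"

lemma cch_eval_superset:
 assumes "finite A" "Poly_Mapping.keys z <= A"
 shows "cch_eval c p z = (\<Sum>s\<in>A. of_int (poly_mapping.lookup z s) * c p s)"
 unfolding cch_eval_def using assms
 by(intro sum.mono_neutral_left) (auto simp: in_keys_iff)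

lemma cch_eval_0 [simp]: "cch_eval c p 0 = 0"
 by(simp add: cch_eval_def)

lemma cch_eval_of [simp]: "cch_eval c p (frag_of s) = c p s"
 by(simp add: cch_eval_def)

lemma cch_eval_add: "cch_eval c p (z + w) = cch_eval c p z + cch_eval c p w"
proof -
 let ?A = "Poly_Mapping.keys z Un Poly_Mapping.keys w"
 have f: "finite ?A" by simp
 show ?thesis
  using cch_eval_superset[OF f, of "z + w" c p] cch_eval_superset[OF f, of z c p]
   cch_eval_superset[OF f, of w c p] keys_add[of z w]
  by(simp add: lookup_add algebra_simps sum.distrib)
qed

lemma cch_eval_minus: "cch_eval c p (- z) = cch_eval c p z"
 using cch_eval_add[of c p z "-z"] by(simp add: bit_add_eq_0)

lemma cch_eval_diff: "cch_eval c p (z - w) = cch_eval c p z + cch_eval c p w"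
 using cch_eval_add[of c p z "-w"] by(simp add: cch_eval_minus)

lemma cch_eval_sum: "cch_eval c p (\<Sum>i\<in>I. z i) = (\<Sum>i\<in>I. cch_eval c p (z i))"
 by(induction I rule: infinite_finite_induct) (auto simp: cch_eval_add)

lemma cch_eval_sign: "cch_eval c p (frag_cmul ((- 1) ^ k) z) = cch_eval c p z"
 by(cases "even k") (auto simp: cch_eval_minus)

lemma cch_eval_dl:
 assumes "singular_chain (Suc p) X z"
 shows "cch_eval (dl X c) (Suc p) z = cch_eval c p (chain_boundary (Suc p) z)"
 using assms unfolding singular_chain_def
proof (induction rule: frag_induction)
 case (one s)
 thus ?case
  by(simp add: coboundary_def chain_boundary_of cch_eval_sum cch_eval_sign del: sum.atMost_Suc)
qed (auto simp: cch_eval_diff chain_boundary_diff)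

lemma cch_eval_neutral:
 assumes "!!s. s : Poly_Mapping.keys z ==> c p s = 0"
 shows "cch_eval c p z = 0"
 using assms by(simp add: cch_eval_def)

lemma cch_eval_zero [simp]: "cch_eval 0 p z = 0"
 by(simp add: cch_eval_def cch_apply)

definition small_chain :: "'a topology => 'a set set => nat => 'a chain => bool" where
 "small_chain X \<C> p z \<longleftrightarrow> Poly_Mapping.keys z <= {s. EX V:\<C>. ssx p (subt X V) s}"

text \<open>
 Subdivide each simplex until it is small, with the least number of subdivisions; the chain
 homotopy to the identity then yields a primitive that vanishes on small simplices, since
 further subdivisions contribute only small chains.
\<close>

lemma small_cyc_exact:
 fixes X :: "'a topology"
 assumes op: "!!V. V : \<C> ==> openin X V" and cover: "topspace X <= \<Union>\<C>"
  and c: "cyc X c"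
  and small: "!!p s V. V : \<C> ==> ssx p (subt X V) s ==> c p s = 0"
 obtains e where "cch_on X c = dl X e"
  "!!p s V. V : \<C> ==> ssx p (subt X V) s ==> e p s = 0"
proof -
 obtain h where h: "!!p. h p 0 = (0 :: 'a chain)"
    "!!p c1 c2. h p (c1-c2) = h p c1 - h p c2"
    "!!p X c. singular_chain p X c ==> singular_chain (Suc p) X (h p c)"
    "!!p X c. singular_chain p X c
        ==> chain_boundary (Suc p) (h p c) + h (p - Suc 0) (chain_boundary p c) = singular_subdivision p c - c"
  by(blast intro: chain_homotopic_singular_subdivision)
 let ?sm = "small_chain X \<C>"
 let ?Sd = "%p i. singular_subdivision p ^^ i"
 have sm_diff: "?sm p (z - w)" if "?sm p z" "?sm p w" for p z w
  using that keys_diff[of z w] unfolding small_chain_def by blast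
 have sm_ev: "cch_eval c p z = 0" if "?sm p z" for p z
  using that small by(intro cch_eval_neutral) (auto simp: small_chain_def)
 have sm_h: "?sm (Suc p) (h p z)" if "?sm p z" for p z
  using that unfolding small_chain_def[of X \<C> p]
 proof (induction rule: frag_induction)
  case (one s)
  then obtain V where V: "V : \<C>" "singular_chain p (subt X V) (frag_of s)"
   by(auto simp: singular_chain_of)
  thus ?case using h(3)[OF V(2)] unfolding small_chain_def singular_chain_def by blast
 qed (auto simp: h sm_diff, auto simp: small_chain_def)
 have sm_Sd1: "?sm p (singular_subdivision p z)" if "?sm p z" for p z
  using that unfolding small_chain_def[of X \<C> p z]
 proof (induction rule: frag_induction)
  case (one s)
  then obtain V where V: "V : \<C>" "singular_chain p (subt X V) (frag_of s)"
   by(auto simp: singular_chain_of)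
  thus ?case using singular_chain_singular_subdivision[OF V(2)]
   unfolding small_chain_def singular_chain_def by blast
 qed (auto simp: singular_subdivision_diff sm_diff, auto simp: small_chain_def)
 have sm_Sd: "?sm p (?Sd p i z)" if "?sm p z" for p z i
  using that by(induction i) (auto simp: sm_Sd1)
 have ch_Sd: "singular_chain p X (?Sd p i z)" if "singular_chain p X z" for p z i
  using that by(induction i) (auto simp: singular_chain_singular_subdivision)
 have bd_Sd: "chain_boundary p (?Sd p i z) = ?Sd (p - Suc 0) i (chain_boundary p z)"
  if "singular_chain p X z" for p z i
 proof (induction i)
  case (Suc i)
  thus ?case using chain_boundary_singular_subdivision[OF ch_Sd[OF that, of i]] by simp
 qed simp
 \<comment> \<open>Smallness is demanded of all later subdivisions, so that from \<open>N\<close> on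
   the extra terms of the homotopy are annihilated by \<open>c\<close>.\<close>
 define N where "N p s = (LEAST m. ALL i>=m. ?sm p (?Sd p i (frag_of s)))" for p s
 have N: "?sm p (?Sd p i (frag_of s))" if s: "ssx p X s" and "i >= N p s" for p s i
 proof -
  have sc: "singular_chain p X (frag_of s)" using s by(simp add: singular_chain_of)
  obtain m where m: "!!i f. m <= i ==> f : Poly_Mapping.keys (?Sd p i (frag_of s)) ==> EX V:\<C>. f : stdx p \<rightarrow> V"
   using sufficient_iterated_singular_subdivision_exists[OF op cover sc] by blast
  have "ALL i>=m. ?sm p (?Sd p i (frag_of s))"
   unfolding small_chain_def
  proof (intro allI impI subsetI CollectI)
   fix i f assume i: "m <= i" "f : Poly_Mapping.keys (?Sd p i (frag_of s))"
   then obtain V where "V : \<C>" "f : stdx p \<rightarrow> V" using m by blast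
   moreover have "ssx p X f" using ch_Sd[OF sc, of i] i by(auto simp: singular_chain_def)
   ultimately show "EX V:\<C>. ssx p (subt X V) f"
    by(auto simp: singular_simplex_subtopology)
  qed
  hence "ALL i>=N p s. ?sm p (?Sd p i (frag_of s))" unfolding N_def by(rule LeastI)
  thus ?thesis using that by blast
 qed
 have N0: "N p s = 0" if "V : \<C>" "ssx p (subt X V) s" for p s V
 proof -
  have "?sm p (frag_of s)" using that by(auto simp: small_chain_def)
  thus ?thesis unfolding N_def by(intro Least_eq_0) (simp add: sm_Sd)
 qed
 \<comment> \<open>The homotopy between the identity and the \<open>M\<close>-fold subdivision,
   obtained by telescoping \<open>h\<close>.\<close>
 define D where "D M p z = (\<Sum>i<M. h p (?Sd p i z))" for M p z
 have D_chain: "singular_chain (Suc p) X (D M p z)" if "singular_chain p X z" for M p z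
  unfolding D_def using that by(intro singular_chain_sum h ch_Sd)
 have D_bd: "chain_boundary (Suc p) (D M p z) + D M (p - Suc 0) (chain_boundary p z) = ?Sd p M z - z"
  if "singular_chain p X z" for M p z
 proof (induction M)
  case (Suc M)
  have "chain_boundary (Suc p) (h p (?Sd p M z)) + h (p - Suc 0) (?Sd (p - Suc 0) M (chain_boundary p z))
    = ?Sd p (Suc M) z - ?Sd p M z"
   using h(4)[OF ch_Sd[OF that, of M]] bd_Sd[OF that, of M] by simp
  moreover have "(c + a) + (d + b) = s' - z" if "a + b = s' - s" "c + d = s - z" for a b c d s s' z :: "'a chain"
  proof -
   have "(c + a) + (d + b) = (c + d) + (a + b)" by(simp only: ac_simps)
   thus ?thesis using that by simp
  qed
  ultimately show ?case using Suc by(simp add: D_def chain_boundary_add)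
 qed (simp add: D_def)
 have Sd_diff: "?Sd p i (z - w) = ?Sd p i z - ?Sd p i w" for p i z w
  by(rule singular_subdivision_power_diff)
 define G where "G M p z = cch_eval c (Suc p) (D M p z)" for M p z
 have G_diff: "G M p (z - w) = G M p z + G M p w" for M p z w
  by(simp add: G_def D_def h Sd_diff sum_subtractf cch_eval_diff)
 have G_0: "G M p 0 = 0" for M p by(simp add: G_def D_def h)
 have G_minus: "G M p (- z) = G M p z" for M p z using G_diff[of M p 0 z] by(simp add: G_0)
 have G_add: "G M p (z + w) = G M p z + G M p w" for M p z w
  using G_diff[of M p z "- w"] by(simp add: G_minus)
 have G_sign: "G M p (frag_cmul ((- 1) ^ k) z) = G M p z" for M p k z
  by(cases "even k") (auto simp: G_minus)
 have G_stable: "G M p (frag_of s) = G (N p s) p (frag_of s)"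
  if s: "ssx p X s" and M: "M >= N p s" for M p s
  using M
 proof (induction rule: dec_induct)
  case (step M)
  thus ?case using sm_ev[OF sm_h[OF N[OF s, of M]]] by(simp add: G_def D_def cch_eval_add)
 qed simp
 \<comment> \<open>By \<open>G_stable\<close> any larger number of subdivisions gives the same
   value; for a small simplex \<open>N\<close> is 0 and the sum is empty.\<close>
 define e where "e p s = (if ssx p X s then G (N p s) p (frag_of s) else 0)" for p s
 show thesis
 proof
  show "e p s = 0" if "V : \<C>" "ssx p (subt X V) s" for p s V
   using N0[OF that] by(simp add: e_def G_def D_def)
  show "cch_on X c = dl X e"
  proof (intro ext)
   fix p s
   show "cch_on X c p s = dl X e p s"
   proof (cases "ssx p X s")
    case s: True
    show ?thesis
    proof (cases p)
     \<comment> \<open>A 0-simplex is a point of some member of the cover, hence already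
       small.\<close>
     case 0
     let ?b = "(%j. if j = 0 then 1 else 0) :: nat => real"
     have "s ?b : topspace X" using s by(auto simp: 0 ssx_d cm_def Pi_iff standard_simplex_0)
     then obtain V where V: "V : \<C>" "s ?b : V" using cover by blast
     hence "ssx 0 (subt X V) s"
      using s by(auto simp: 0 singular_simplex_subtopology standard_simplex_0)
     thus ?thesis using small[OF V(1)] by(simp add: 0 cch_on_def coboundary_def)
    next
     case (Suc q)
     have sc: "singular_chain p X (frag_of s)" using s by(simp add: singular_chain_of)
     have sf: "ssx q X (sface p k s)" if "k <= p" for k
      using ssx_face[OF s, of k] that Suc by simp
     \<comment> \<open>One number of subdivisions that is large enough for the simplex and all its
       faces.\<close>
     define M where "M = N p s + (\<Sum>k\<le>p. N q (sface p k s))"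
     have M: "N q (sface p k s) <= M" if "k <= p" for k
      using member_le_sum[of k "{..p}" "%k. N q (sface p k s)"] that by(simp add: M_def)
     have eG: "e q (sface p k s) = G M q (frag_of (sface p k s))" if "k <= p" for k
      using sf[OF that] G_stable[OF sf[OF that] M[OF that]] by(simp add: e_def)
     have "dl X e p s = (\<Sum>k\<le>p. e q (sface p k s))"
      using s Suc by(simp add: coboundary_def del: sum.atMost_Suc)
     also have "... = (\<Sum>k\<le>p. G M q (frag_of (sface p k s)))"
      by(intro sum.cong refl eG) simp
     also have "... = G M q (\<Sum>k\<le>p. frag_cmul ((- 1) ^ k) (frag_of (sface p k s)))"
      by(subst sum_additive[where h = "G M q", OF G_0 G_add]) (simp add: G_sign)
     also have "... = G M q (chain_boundary p (frag_of s))"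
      using Suc by(simp add: chain_boundary_of)
     also have "... = cch_eval c p (D M q (chain_boundary p (frag_of s)))"
      by(simp add: G_def Suc)
     also have "D M q (chain_boundary p (frag_of s)) = ?Sd p M (frag_of s) - frag_of s - chain_boundary (Suc p) (D M p (frag_of s))"
      using D_bd[OF sc, of M] Suc by(simp add: algebra_simps)
     also have "cch_eval c p ... = c p s"
     proof -
      have "cch_eval c p (?Sd p M (frag_of s)) = 0"
       by(rule sm_ev[OF N[OF s]]) (simp add: M_def)
      moreover have "cch_eval c p (chain_boundary (Suc p) (D M p (frag_of s))) = 0"
       using cch_eval_dl[OF D_chain[OF sc], of c M] c by(simp add: cyc_def)
      ultimately show ?thesis by(simp add: cch_eval_diff)
     qed
     finally show ?thesis using s by(simp add: cch_on_def)
    qed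
   qed (simp add: cch_on_def coboundary_def)
  qed
 qed
qed

text \<open>On the intersection the two primitives differ by the coboundary of some
  \<open>c\<close>. Extending \<open>c\<close> by zero and adding its coboundary to
  \<open>al\<close> makes them agree, so they glue to \<open>ga\<close>; then
  \<open>y + dl X ga\<close> vanishes on simplices inside \<open>A\<close> or \<open>B\<close> and
  \<open>small_cyc_exact\<close> applies.\<close>

lemma mayer_vietoris_exact:
 fixes X :: "'a topology"
 assumes op: "openin X A" "openin X B" and cover: "topspace X <= A Un B"
  and y: "cyc X y"
  and A: "cch_on (subt X A) y = dl (subt X A) al"
  and B: "cch_on (subt X B) y = dl (subt X B) be"
  and AB: "exact (subt X (A Int B)) (al + be)"
 shows "exact X y"
proof -
 obtain c where c: "cch_on (subt X (A Int B)) (al + be) = dl (subt X (A Int B)) c"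
  using AB by(auto simp: exact_def)
 let ?A = "subt X A" and ?B = "subt X B" and ?AB = "subt X (A Int B)"
 define c' where "c' = cch_on ?AB c"
 define ga where "ga p s = (if ssx p ?A s then (al + dl ?A c') p s else be p s)" for p s
 have AB_iff: "ssx p ?AB s \<longleftrightarrow> ssx p ?A s & ssx p ?B s" for p s
  by(auto simp: singular_simplex_subtopology)
 have gaB: "ga p s = be p s" if s: "ssx p ?B s" for p s
 proof (cases "ssx p ?A s")
  case True
  hence "dl ?A c' p s = dl ?AB c p s"
   using s AB_iff[of p s] ssx_face[of p ?AB s]
   by(auto simp: coboundary_def c'_def cch_on_def intro!: sum.cong)
  also have "... = al p s + be p s"
   using fun_cong[OF fun_cong[OF c], of p s] True s AB_iff[of p s] by(simp add: cch_on_def cch_apply)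
  finally show ?thesis using True by(simp add: ga_def cch_apply flip: add.assoc)
 qed (simp add: ga_def)
 let ?z = "y + dl X ga"
 have z1: "cyc X ?z" using y by(intro cyc_add) auto
 have z2: "?z p s = 0" if V: "V : {A, B}" "ssx p (subt X V) s" for p s V
 proof -
  have X: "ssx p X s" using V(2) subtopology_sx by blast
  have "dl X ga p s = y p s"
  proof (cases "V = A")
   case True
   have "dl X ga p s = dl ?A (al + dl ?A c') p s"
    using X V ssx_face[of p ?A s] True
    by(auto simp: coboundary_def[of X] coboundary_def[of ?A "al + _"] ga_def intro!: sum.cong)
   also have "... = dl ?A al p s" by(simp add: coboundary_add coboundary_coboundary)
   also have "... = y p s" using V True by(simp flip: A add: cch_on_def)
   finally show ?thesis .
  next
   case False
   hence V': "ssx p ?B s" using V by auto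
   have "dl X ga p s = dl ?B be p s"
    using X V' ssx_face[of p ?B s]
    by(auto simp: coboundary_def gaB intro!: sum.cong)
   also have "... = y p s" using V' by(simp flip: B add: cch_on_def)
   finally show ?thesis .
  qed
  thus ?thesis by(simp add: cch_apply)
 qed
 have z3: "openin X V" if "V : {A, B}" for V using that op by auto
 have z4: "topspace X <= \<Union>{A, B}" using cover by auto
 obtain e where "cch_on X ?z = dl X e"
  by(rule small_cyc_exact[OF z3 z4 z1 z2])
 hence "exact X ?z" by(auto simp: exact_def)
 hence "exact X (?z + dl X ga)" by(rule exact_add) simp
 thus ?thesis by(simp add: add.assoc)
qed

section \<open>Products of classes that vanish on the members of a cover\<close>

definition cup_list :: "'a topology => ('i => 'a cochain) => 'i list => 'a cochain" where
 "cup_list X c is = foldr (%i. cup X (c i)) is (unc X)"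

lemma cup_list_Nil: "cup_list X c [] = unc X"
 and cup_list_Cons: "cup_list X c (i # is) = cup X (c i) (cup_list X c is)"
 by(simp_all add: cup_list_def)

lemma cyc_cup_list: "ALL i:set is. cyc X (c i) ==> cyc X (cup_list X c is)"
 by(induction "is") (simp_all add: cup_list_Nil cup_list_Cons cyc_unit cyc_cup)

lemma exact_cup_list:
 assumes "ALL i:set is. cyc X (a i)" "ALL i:set is. cyc X (c i)" "ALL i:set is. exact X (a i + c i)"
 shows "exact X (cup_list X a is + cup_list X c is)"
 using assms
proof (induction "is")
 case Nil
 thus ?case by(simp only: cup_list_Nil cch_add_self exact_0)
next
 case (Cons i "is")
 let ?P = "cup_list X a is" and ?Q = "cup_list X c is"
 have IH: "exact X (?P + ?Q)" using Cons.IH Cons.prems by simp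
 have P: "cyc X ?P" using Cons.prems by(simp add: cyc_cup_list)
 have "exact X (cup X (a i + c i) ?P)" by(rule exact_cup_left) (use Cons.prems P in simp_all)
 moreover have "exact X (cup X (c i) (?P + ?Q))" by(rule exact_cup_right) (use Cons.prems IH in simp_all)
 ultimately have "exact X (cup X (a i) ?P + cup X (c i) ?P)" "exact X (cup X (c i) ?P + cup X (c i) ?Q)"
  by(simp_all only: cup_add_left cup_add_right)
 thus ?case unfolding cup_list_Cons by(rule exact_trans)
qed

text \<open>Front and back faces of a simplex in \<open>U i\<close> stay in \<open>U i\<close>, so
  the factor with index \<open>i\<close> kills every summand.\<close>

lemma cup_list_small:
 assumes "ALL i:set is. ALL p s. ssx p (subt X (U i)) s --> a i p s = 0"
  and "i : set is" "ssx p (subt X (U i)) s"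
 shows "cup_list X a is p s = 0"
 using assms
proof (induction "is" arbitrary: p s)
 case (Cons j "is")
 let ?P = "cup_list X a is"
 have f: "ssx k (subt X (U i)) (front_face k s)"
   "ssx (p - k) (subt X (U i)) (back_face k (p - k) s)" if "k <= p" for k
  using Cons.prems(3) that singular_simplex_front_face singular_simplex_back_face[of k "p - k"] by auto
 have "a j k (front_face k s) * ?P (p - k) (back_face k (p - k) s) = 0" if "k <= p" for k
 proof (cases "i = j")
  case True
  hence "a j k (front_face k s) = 0" using Cons.prems(1) f[OF that] by simp
  thus ?thesis by simp
 next
  case False
  hence "?P (p - k) (back_face k (p - k) s) = 0" using Cons f[OF that] by simp
  thus ?thesis by simp
 qed
 hence "(\<Sum>k\<le>p. a j k (front_face k s) * ?P (p - k) (back_face k (p - k) s)) = 0"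
  by(intro sum.neutral ballI) (simp only: atMost_iff)
 thus ?case by(simp only: cup_list_Cons cup_def if_cancel)
qed simp

text \<open>Adding a coboundary turns each factor into a cocycle that is zero on the simplices of
  \<open>U i\<close>. The product of these cocycles is zero on all small simplices, hence
  exact.\<close>

lemma cup_length:
 fixes X :: "'a topology"
 assumes coc: "!!i. i : set is ==> cyc X (c i)" and op: "!!i. i : set is ==> openin X (U i)"
  and ex: "!!i. i : set is ==> exact (subt X (U i)) (c i)"
  and cover: "topspace X <= (\<Union>i\<in>set is. U i)"
 shows "exact X (cup_list X c is)"
proof -
 obtain e where e: "!!i. i : set is ==> cch_on (subt X (U i)) (c i) = dl (subt X (U i)) (e i)"
  using ex unfolding exact_def by metis
 define a where "a i = c i + dl X (e i)" for i
 have a0: "a i p s = 0" if i: "i : set is" and s: "ssx p (subt X (U i)) s" for i p s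
 proof -
  have "dl X (e i) p s = cch_on (subt X (U i)) (dl X (e i)) p s"
   using s by(simp add: cch_on_def)
  also have "... = cch_on (subt X (U i)) (c i) p s" by(simp only: dl_sub e[OF i])
  finally show ?thesis using s by(simp add: cch_on_def a_def cch_apply)
 qed
 have "a i + c i = dl X (e i)" for i
  using cch_add_left_cancel[of "c i" "dl X (e i)"] unfolding a_def by(simp only: ac_simps)
 hence a1: "exact X (a i + c i)" for i by(simp only: exact_dl)
 have a2: "cyc X (a i)" if "i : set is" for i
  unfolding a_def using coc[OF that] by(intro cyc_add) simp_all
 let ?P = "cup_list X a is" and ?Q = "cup_list X c is"
 have P: "cyc X ?P" "exact X (?P + ?Q)"
  by(simp_all add: cyc_cup_list exact_cup_list coc a1 a2)
 have op': "openin X V" if "V : U ` set is" for V using that op by blast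
 have cov: "topspace X <= \<Union>(U ` set is)" using cover by simp
 have P0: "?P p s = 0" if V: "V : U ` set is" "ssx p (subt X V) s" for p s V
 proof -
  obtain i where i: "i : set is" "V = U i" using V by blast
  show ?thesis by(rule cup_list_small[OF _ i(1)]) (use a0 V i in auto)
 qed
 obtain f where "cch_on X ?P = dl X f"
  by(rule small_cyc_exact[OF op' cov P(1) P0])
 hence "exact X ?P" by(rule exactI)
 hence "exact X (?P + (?P + ?Q))" using P(2) by(rule exact_add)
 thus ?thesis unfolding cch_add_left_cancel .
qed

subsection \<open>Commutativity of the cup product\<close>

text \<open>
 The faces of a simplex spanned by arbitrary sets of vertices. Steenrod's cup-one product is
 \<open>\<Sum>u<v. a (vertices outside the open interval (u, v)) * b (vertices in [u, v])\<close>.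
\<close>

definition vrk :: "nat set => nat => nat" where
 "vrk V m = card {v\<in>V. v < m}"

definition vertex_face :: "((nat => real) => 'a) => nat set => (nat => real) => 'a" where
 "vertex_face s V = restrict (%x. s (%m. if m : V then x (vrk V m) else 0)) (stdx (card V - 1))"

lemma vrk_mono:
 assumes "finite V" "u : V" "u < v" shows "vrk V u < vrk V v"
 unfolding vrk_def using assms by(intro psubset_card_mono) auto

lemma vrk_less_iff:
 assumes "finite V" "u : V" "v : V" shows "vrk V u < vrk V v \<longleftrightarrow> u < v"
 using vrk_mono[OF assms(1)] assms by(metis linorder_neqE_nat less_asym' less_irrefl)

lemma inj_on_vrk: "finite V ==> inj_on (vrk V) V"
 by(rule inj_onI) (metis linorder_neqE_nat less_irrefl vrk_less_iff)

lemma vrk_image: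
 assumes "finite V" shows "vrk V ` V = {..<card V}"
proof (rule card_subset_eq)
 show "vrk V ` V <= {..<card V}"
  using assms by(auto simp: vrk_def intro!: psubset_card_mono)
 show "card (vrk V ` V) = card {..<card V}"
  using card_image[OF inj_on_vrk[OF assms]] by simp
qed simp

lemma vrk_vrk:
 assumes "finite V" "U <= V" "m : V"
 shows "vrk (vrk V ` U) (vrk V m) = vrk U m"
proof -
 have "{w : vrk V ` U. w < vrk V m} = vrk V ` {u\<in>U. u < m}"
  using assms vrk_less_iff[OF assms(1)] by blast
 thus ?thesis
  using card_image[OF inj_on_subset[OF inj_on_vrk[OF assms(1)], of "{u\<in>U. u < m}"]] assms
  unfolding vrk_def[of U] vrk_def[of "vrk V ` U"] by auto
qed

lemma vertex_point_in:
 assumes V: "V <= {..p}" "V ~= {}" and x: "x : stdx (card V - 1)"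
 shows "(%m. if m : V then x (vrk V m) else 0) : stdx p"
proof -
 have f: "finite V" using V finite_subset by blast
 have "(\<Sum>m\<le>p. if m : V then x (vrk V m) else 0) = (\<Sum>m\<in>V. x (vrk V m))"
  using V by(intro sum.mono_neutral_cong_right) auto
 also have "... = sum x (vrk V ` V)"
  by(simp add: sum.reindex[OF inj_on_vrk[OF f]])
 also have "vrk V ` V = {..<card V}" by(rule vrk_image[OF f])
 also have "{..<card V} = {..card V - 1}"
 proof -
  have "card V > 0" using V f by(simp add: card_gt_0_iff)
  thus ?thesis by auto
 qed
 finally have "(\<Sum>m\<le>p. if m : V then x (vrk V m) else 0) = 1"
  using x by(simp add: standard_simplex_def)
 moreover have "m ~: V" if "m > p" for m using V(1) that by auto
 ultimately show ?thesis using x by(simp add: standard_simplex_def)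
qed

lemma vertex_face_vertex_face:
 assumes "finite V" "U <= V" "U ~= {}"
 shows "vertex_face (vertex_face s V) (vrk V ` U) = vertex_face s U"
proof -
 let ?r = "vrk V"
 have cU: "card (?r ` U) = card U"
  using card_image inj_on_subset[OF inj_on_vrk] assms by blast
 have rU: "?r ` U <= {..card V - 1}" "?r ` U ~= {}"
 proof -
  have "?r ` U <= ?r ` V" using assms by(intro image_mono) auto
  thus "?r ` U <= {..card V - 1}" using vrk_image[OF assms(1)] by auto
 qed (use assms in auto)
 show ?thesis
 proof
  fix x
  show "vertex_face (vertex_face s V) (?r ` U) x = vertex_face s U x"
  proof (cases "x : stdx (card U - 1)")
   case True
   let ?y = "%k. if k : ?r ` U then x (vrk (?r ` U) k) else 0"
   have y: "?y : stdx (card V - 1)"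
    using vertex_point_in[OF rU] True cU by simp
   have "(%m. if m : V then ?y (?r m) else 0) = (%m. if m : U then x (vrk U m) else 0)"
   proof
    fix m
    have "?r m : ?r ` U \<longleftrightarrow> m : U" if "m : V"
     using inj_on_image_mem_iff[OF inj_on_vrk[OF assms(1)] that assms(2)] .
    thus "(if m : V then ?y (?r m) else 0) = (if m : U then x (vrk U m) else 0)"
     using vrk_vrk[OF assms(1,2)] assms(2) by auto
   qed
   thus ?thesis using True y cU by(simp add: vertex_face_def)
  qed (simp add: vertex_face_def cU)
 qed
qed

lemma vrk_interval: "m : {i..j} ==> vrk {i..j} m = m - i"
proof -
 assume "m : {i..j}"
 hence "{v\<in>{i..j}. v < m} = {i..<m}" by auto
 thus ?thesis by(simp add: vrk_def)
qed

lemma front_face_vertex: "front_face i s = vertex_face s {0..i}"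
proof -
 have "(%m. if m : {0..i} then x (vrk {0..i} m) else 0) = x" if "x : stdx i" for x
  using that vrk_interval[of _ 0 i] by(auto simp: fun_eq_iff standard_simplex_def)
 thus ?thesis by(auto simp: front_face_def vertex_face_def fun_eq_iff)
qed

lemma back_face_vertex: "i <= p ==> back_face i (p - i) s = vertex_face s {i..p}"
proof -
 assume "i <= p"
 hence "(%m. if m : {i..p} then x (vrk {i..p} m) else 0) = (%m. if m < i then 0 else x (m - i))"
  if "x : stdx (p - i)" for x
  using that vrk_interval[of _ i p] by(auto simp: fun_eq_iff standard_simplex_def)
 thus ?thesis using \<open>i <= p\<close>
  by(auto simp: back_face_def vertex_face_def fun_eq_iff Suc_diff_le)
qed

lemma singular_face_vertex:
 assumes "k <= p" "1 <= p" shows "sface p k s = vertex_face s ({..p} - {k})"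
proof -
 have r: "vrk ({..p} - {k}) m = (if m <= k then m else m - 1)" if "m <= p" for m
 proof (cases "m <= k")
  case True
  hence "{v\<in>{..p} - {k}. v < m} = {..<m}" using that by auto
  thus ?thesis using True by(simp add: vrk_def)
 next
  case False
  hence "{v\<in>{..p} - {k}. v < m} = {..<m} - {k}" using that by auto
  thus ?thesis using False by(simp add: vrk_def)
 qed
 have "(%m. if m : {..p} - {k} then x (vrk ({..p} - {k}) m) else 0) = simplical_face k x"
  if "x : stdx (p - 1)" for x
  using that assms r by(auto simp: fun_eq_iff standard_simplex_def simplical_face_def)
 moreover have "card ({..p} - {k}) - 1 = p - 1" using assms by simp
 ultimately show ?thesis by(auto simp: singular_face_def vertex_face_def fun_eq_iff)
qed

lemma ssx_vertex_face:
 assumes "ssx p X s" "V <= {..p}" "V ~= {}"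
 shows "ssx (card V - 1) X (vertex_face s V)"
proof -
 let ?D = "%q. subt (powertop_real UNIV) (stdx q)"
 let ?h = "%x m. if m : V then x (vrk V m) else 0"
 have "cmap (?D (card V - 1)) (?D p) ?h"
  unfolding cm_into
 proof
  show "cmap (?D (card V - 1)) (powertop_real UNIV) ?h"
   unfolding continuous_map_componentwise
   by(auto intro!: cm_sub continuous_map_product_projection)
 qed (use vertex_point_in[OF assms(2,3)] in auto)
 moreover have "cmap (?D p) X s" using assms by(simp add: ssx_d)
 ultimately have "cmap (?D (card V - 1)) X (s o ?h)" by(rule cm_comp)
 thus ?thesis
  unfolding ssx_d vertex_face_def
  by(auto elim!: cm_eq simp: o_def)
qed

definition cup_one :: "'a topology => 'a cochain => 'a cochain => 'a cochain" where
 "cup_one X a b = (%p s. if ssx p X s then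
  \<Sum>u\<le>p. \<Sum>v\<le>p. if u < v then a (p - (v - u - 1)) (vertex_face s ({..p} - {u<..<v})) *
    b (v - u) (vertex_face s {u..v}) else 0 else 0)"

lemma sum_bit_telescope:
 fixes f h :: "nat => bit"
 assumes "!!i. i < m ==> h (Suc i) = f i"
 shows "(\<Sum>i\<le>m. f i) + (\<Sum>i\<le>m. h i) = f m + h 0"
 using assms
proof (induction m)
 case (Suc m)
 hence "(\<Sum>i\<le>m. f i) + (\<Sum>i\<le>m. h i) = f m + h 0" by simp
 moreover have "h (Suc m) = f m" using Suc by simp
 ultimately show ?case by(cases "f m"; cases "f (Suc m)"; cases "h 0"; cases "\<Sum>i\<le>m. f i"; cases "\<Sum>i\<le>m. h i") auto
qed simp

context
 fixes X :: "'a topology" and s p and a b :: "'a cochain"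
 assumes s: "ssx p X s" and a: "cyc X a" and b: "cyc X b"
begin

text \<open>Values on faces of the fixed simplex \<open>s\<close>, named by their vertices in
  \<open>s\<close>; faces of faces then require no renumbering.\<close>

definition vfv :: "'a cochain => nat set => bit" where
 "vfv c V = c (card V - 1) (vertex_face s V)"

lemma cyc_vfv:
 assumes c: "cyc X c" and V: "V <= {..p}" "1 < card V"
 shows "(\<Sum>v\<in>V. vfv c (V - {v})) = 0"
proof -
 have f: "finite V" and ne: "V ~= {}" using V finite_subset by auto
 let ?q = "card V - 1"
 have ss: "ssx ?q X (vertex_face s V)" by(rule ssx_vertex_face[OF s V(1) ne])
 have q: "0 < ?q" using V by simp
 have img: "vrk V ` V = {..?q}" using vrk_image[OF f] V by auto
 have "(\<Sum>k\<le>?q. c (?q - 1) (sface ?q k (vertex_face s V))) = dl X c ?q (vertex_face s V)"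
  using ss q by(simp add: coboundary_def)
 also have "... = 0" using c by(simp add: cyc_def cch_apply)
 finally have "0 = (\<Sum>k\<in>vrk V ` V. c (?q - 1) (sface ?q k (vertex_face s V)))"
  by(simp add: img)
 also have "... = (\<Sum>v\<in>V. c (?q - 1) (sface ?q (vrk V v) (vertex_face s V)))"
  by(simp add: sum.reindex[OF inj_on_vrk[OF f]])
 also have "... = (\<Sum>v\<in>V. vfv c (V - {v}))"
 proof (intro sum.cong refl)
  fix v assume v: "v : V"
  have "vrk V v <= ?q" using v img by blast
  hence "sface ?q (vrk V v) (vertex_face s V) = vertex_face (vertex_face s V) ({..?q} - {vrk V v})"
   using q by(intro singular_face_vertex) auto
  also have "{..?q} - {vrk V v} = vrk V ` (V - {v})"
   using inj_on_image_set_diff[OF inj_on_vrk[OF f], of V "{v}"] v img by simp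
  also have "vertex_face (vertex_face s V) ... = vertex_face s (V - {v})"
  proof (rule vertex_face_vertex_face[OF f])
   show "V - {v} ~= {}" using V v by(metis card_1_singleton_iff card_gt_0_iff is_singletonI is_singleton_altdef less_irrefl Diff_eq_empty_iff subset_singletonD ne One_nat_def)
  qed auto
  finally show "c (?q - 1) (sface ?q (vrk V v) (vertex_face s V)) = vfv c (V - {v})"
   using v f by(simp add: vfv_def)
 qed
 finally show ?thesis by simp
qed

text \<open>The order isomorphism \<open>vrk\<close> from \<open>{..p} - {k}\<close> onto
  \<open>{..p - 1}\<close> carries intervals to intervals, so the product on the face is the one on
  \<open>s\<close> with \<open>k\<close> deleted from all vertex sets.\<close>

lemma cup_one_face:
 assumes p: "0 < p" and k: "k <= p"
 shows "cup_one X a b (p - 1) (sface p k s) =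
  (\<Sum>u\<le>p. \<Sum>v\<le>p. if u < v & u ~= k & v ~= k
   then vfv a ({..p} - {u<..<v} - {k}) * vfv b ({u..v} - {k}) else 0)"
proof -
 let ?V = "{..p} - {k}"
 let ?r = "vrk ?V"
 let ?t = "sface p k s"
 have f: "finite ?V" by simp
 have c: "card ?V = p" using k by simp
 have img: "?r ` ?V = {..p - 1}" using vrk_image[OF f] c p by auto
 have t: "?t = vertex_face s ?V" using singular_face_vertex[OF k] p by simp
 have tt: "ssx (p - 1) X ?t" using ssx_face[OF s, of k] k p by simp
 have r: "vfv e W = e (card W - 1) (vertex_face ?t (?r ` W))" if "W <= ?V" "W ~= {}" for e W
  unfolding t vertex_face_vertex_face[OF f that] vfv_def ..
 have cr: "card (?r ` W) = card W" if "W <= ?V" for W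
  using card_image inj_on_subset[OF inj_on_vrk[OF f] that] by blast
 have "cup_one X a b (p - 1) ?t = (\<Sum>u\<in>?r ` ?V. \<Sum>v\<in>?r ` ?V. if u < v then a (p - 1 - (v - u - 1)) (vertex_face ?t ({..p-1} - {u<..<v})) *
    b (v - u) (vertex_face ?t {u..v}) else 0)"
  unfolding img cup_one_def by(simp only: tt if_True)
 also have "... = (\<Sum>u\<in>?V. \<Sum>v\<in>?V. if ?r u < ?r v then a (p - 1 - (?r v - ?r u - 1)) (vertex_face ?t ({..p-1} - {?r u<..<?r v})) *
    b (?r v - ?r u) (vertex_face ?t {?r u..?r v}) else 0)"
  by(simp add: sum.reindex[OF inj_on_vrk[OF f]])
 also have "... = (\<Sum>u\<in>?V. \<Sum>v\<in>?V. if u < v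
   then vfv a ({..p} - {u<..<v} - {k}) * vfv b ({u..v} - {k}) else 0)"
 proof (intro sum.cong refl)
  fix u v assume uv: "u : ?V" "v : ?V"
  have lt: "?r u < ?r v \<longleftrightarrow> u < v" using vrk_less_iff[OF f uv] .
  show "(if ?r u < ?r v then a (p - 1 - (?r v - ?r u - 1)) (vertex_face ?t ({..p-1} - {?r u<..<?r v})) *
    b (?r v - ?r u) (vertex_face ?t {?r u..?r v}) else 0) = (if u < v
   then vfv a ({..p} - {u<..<v} - {k}) * vfv b ({u..v} - {k}) else 0)"
  proof (cases "u < v")
   case True
   have le: "?r w <= ?r w' \<longleftrightarrow> w <= w'" if "w : ?V" "w' : ?V" for w w'
    using vrk_less_iff[OF f that(2,1)] by(simp add: not_less[symmetric])
   have im: "{?r u..?r v} = ?r ` ({u..v} - {k})"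
   proof -
    have "{?r u..?r v} <= ?r ` ?V" using uv img by(auto simp: le)
    moreover have "w : {u..v} - {k}" if "?r w : {?r u..?r v}" "w : ?V" for w
     using that uv le by auto
    moreover have "?r w : {?r u..?r v}" if "w : {u..v} - {k}" for w
     using that uv le by auto
    ultimately show ?thesis by blast
   qed
   have im2: "{?r u<..<?r v} = ?r ` ({u<..<v} - {k})"
   proof -
    have "{?r u<..<?r v} <= {?r u..?r v}" by auto
    also have "... <= ?r ` ?V" unfolding im by(intro image_mono) (use uv in auto)
    finally have "{?r u<..<?r v} <= ?r ` ?V" .
    moreover have "w : {u<..<v} - {k}" if "?r w : {?r u<..<?r v}" "w : ?V" for w
     using that uv vrk_less_iff[OF f uv(1) that(2)] vrk_less_iff[OF f that(2) uv(2)] by auto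
    moreover have "?r w : {?r u<..<?r v}" if "w : {u<..<v} - {k}" for w
    proof -
     have w: "w : ?V" using that uv by auto
     thus ?thesis using that vrk_less_iff[OF f uv(1) w] vrk_less_iff[OF f w uv(2)] by auto
    qed
    ultimately show ?thesis by blast
   qed
   have im3: "{..p-1} - {?r u<..<?r v} = ?r ` ({..p} - {u<..<v} - {k})"
   proof -
    have "{..p-1} - {?r u<..<?r v} = ?r ` ?V - ?r ` ({u<..<v} - {k})" using img im2 by simp
    also have "... = ?r ` (?V - ({u<..<v} - {k}))"
     using uv by(intro inj_on_image_set_diff[OF inj_on_vrk[OF f], symmetric]) auto
    also have "?V - ({u<..<v} - {k}) = {..p} - {u<..<v} - {k}" by auto
    finally show ?thesis .
   qed
   have "u : {u..v} - {k}" "u : {..p} - {u<..<v} - {k}" using uv True by auto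
   hence ne: "{u..v} - {k} ~= {}" "{..p} - {u<..<v} - {k} ~= {}" by blast+
   have "{u..v} - {k} <= ?V" "{..p} - {u<..<v} - {k} <= ?V" using uv by auto
   note W1 = this(1) ne(1) and W2 = this(2) ne(2)
   have rv: "?r v <= p - 1" using img uv by blast
   have "card ({u..v} - {k}) = card {?r u..?r v}" by(simp only: im cr[OF W1(1)])
   hence c1: "card ({u..v} - {k}) = Suc (?r v) - ?r u" by(simp only: card_atLeastAtMost)
   have "card ({..p} - {u<..<v} - {k}) = card ({..p-1} - {?r u<..<?r v})" by(simp only: im3 cr[OF W2(1)])
   also have "... = card {..p-1} - card {?r u<..<?r v}"
    using rv by(intro card_Diff_subset) auto
   also have "... = p - (?r v - Suc (?r u))" using p by simp
   finally have c2: "card ({..p} - {u<..<v} - {k}) = p - (?r v - Suc (?r u))" .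
   have "vfv b ({u..v} - {k}) = b (?r v - ?r u) (vertex_face ?t {?r u..?r v})"
   proof -
    have "Suc (?r v) - ?r u - 1 = ?r v - ?r u" by simp
    thus ?thesis by(simp only: r[OF W1] c1 im)
   qed
   moreover have "vfv a ({..p} - {u<..<v} - {k}) = a (p - 1 - (?r v - ?r u - 1)) (vertex_face ?t ({..p-1} - {?r u<..<?r v}))"
   proof -
    have "p - (?r v - Suc (?r u)) - 1 = p - 1 - (?r v - ?r u - 1)" using rv True lt p by simp
    thus ?thesis by(simp only: r[OF W2] c2 im3)
   qed
   ultimately show ?thesis using True lt by(simp only: if_True)
  qed (use lt in simp)
 qed
 also have "... = (\<Sum>u\<in>?V. \<Sum>v\<le>p. if u < v & u ~= k & v ~= k
   then vfv a ({..p} - {u<..<v} - {k}) * vfv b ({u..v} - {k}) else 0)"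
  by(intro sum.cong refl sum.mono_neutral_cong_left) auto
 also have "... = (\<Sum>u\<le>p. \<Sum>v\<le>p. if u < v & u ~= k & v ~= k
   then vfv a ({..p} - {u<..<v} - {k}) * vfv b ({u..v} - {k}) else 0)"
  by(intro sum.mono_neutral_cong_left) (auto intro: sum.neutral)
 finally show ?thesis .
qed

text \<open>A vertex \<open>k\<close> strictly between \<open>u\<close> and \<open>v\<close> is
  deleted from the second factor only, one outside from the first only. In either range the cocycle
  condition replaces the sum by the two terms that delete \<open>u\<close> or
  \<open>v\<close>.\<close>

lemma cup_one_face_sum:
 assumes uv: "u < v" "v <= p"
 shows "(\<Sum>k\<le>p. if u ~= k & v ~= k then vfv a ({..p} - {u<..<v} - {k}) * vfv b ({u..v} - {k}) else 0) =
  vfv a ({..p} - {u<..<v}) * (vfv b {Suc u..v} + vfv b {u..<v}) +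
  (vfv a ({..p} - {u..<v}) + vfv a ({..p} - {u<..v})) * vfv b {u..v}"
proof -
 let ?W = "{..p} - {u<..<v}"
 have "1 < card {u..v}" using uv by simp
 hence "(\<Sum>k\<in>{u..v}. vfv b ({u..v} - {k})) = 0"
  using uv by(intro cyc_vfv[OF b]) auto
 moreover have "{u..v} = insert u (insert v {u<..<v})" using uv by auto
 ultimately have "vfv b ({u..v} - {u}) + (vfv b ({u..v} - {v}) + (\<Sum>k\<in>{u<..<v}. vfv b ({u..v} - {k}))) = 0"
  using uv by simp
 moreover have "{u..v} - {u} = {Suc u..v}" "{u..v} - {v} = {u..<v}" using uv by auto
 ultimately have B: "(\<Sum>k\<in>{u<..<v}. vfv b ({u..v} - {k})) = vfv b {Suc u..v} + vfv b {u..<v}"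
  by(simp add: bit_add_eq_0 flip: add.assoc)
 have W: "?W = insert u (insert v ({..p} - {u..v}))" using uv by auto
 have "card {u, v} <= card ?W" using uv by(intro card_mono) auto
 hence "1 < card ?W" using uv by simp
 hence "(\<Sum>k\<in>?W. vfv a (?W - {k})) = 0"
  by(intro cyc_vfv[OF a]) auto
 hence "vfv a (?W - {u}) + (vfv a (?W - {v}) + (\<Sum>k\<in>{..p} - {u..v}. vfv a (?W - {k}))) = 0"
  using uv by(subst (asm) (1) W) simp
 moreover have "?W - {u} = {..p} - {u..<v}" "?W - {v} = {..p} - {u<..v}" using uv by auto
 ultimately have A: "(\<Sum>k\<in>{..p} - {u..v}. vfv a (?W - {k})) = vfv a ({..p} - {u..<v}) + vfv a ({..p} - {u<..v})"
  by(simp add: bit_add_eq_0 flip: add.assoc)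
 have "(\<Sum>k\<le>p. if u ~= k & v ~= k then vfv a (?W - {k}) * vfv b ({u..v} - {k}) else 0) =
   (\<Sum>k\<in>{u<..<v} Un ({..p} - {u..v}). vfv a (?W - {k}) * vfv b ({u..v} - {k}))"
  using uv by(intro sum.mono_neutral_cong_right) auto
 also have "... = (\<Sum>k\<in>{u<..<v}. vfv a (?W - {k}) * vfv b ({u..v} - {k})) +
   (\<Sum>k\<in>{..p} - {u..v}. vfv a (?W - {k}) * vfv b ({u..v} - {k}))"
  by(rule sum.union_disjoint) auto
 also have "(\<Sum>k\<in>{u<..<v}. vfv a (?W - {k}) * vfv b ({u..v} - {k})) =
   vfv a ?W * (vfv b {Suc u..v} + vfv b {u..<v})"
 proof -
  have "?W - {k} = ?W" if "k : {u<..<v}" for k using that by auto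
  thus ?thesis by(simp add: sdl flip: B)
 qed
 also have "(\<Sum>k\<in>{..p} - {u..v}. vfv a (?W - {k}) * vfv b ({u..v} - {k})) =
   (vfv a ({..p} - {u..<v}) + vfv a ({..p} - {u<..v})) * vfv b {u..v}"
 proof -
  have "{u..v} - {k} = {u..v}" if "k : {..p} - {u..v}" for k using that by auto
  thus ?thesis by(simp add: sdr flip: A)
 qed
 finally show ?thesis .
qed

lemma cup_vfv: "cup X c d p s = (\<Sum>i\<le>p. vfv c {0..i} * vfv d {i..p})"
proof -
 have "cup X c d p s = (\<Sum>i\<le>p. c i (front_face i s) * d (p - i) (back_face i (p - i) s))"
  by(simp only: cup_def s if_True)
 also have "... = (\<Sum>i\<le>p. vfv c {0..i} * vfv d {i..p})"
 proof (intro sum.cong refl)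
  fix i assume "i : {..p}"
  hence "i <= p" "card {0..i} - 1 = i" "card {i..p} - 1 = p - i" by auto
  thus "c i (front_face i s) * d (p - i) (back_face i (p - i) s) = vfv c {0..i} * vfv d {i..p}"
   by(simp only: vfv_def front_face_vertex back_face_vertex)
 qed
 finally show ?thesis .
qed

text \<open>Summed over all faces, the terms \<open>F\<close> and \<open>H\<close> telescope in
  \<open>u\<close> for fixed \<open>v\<close>, and \<open>G\<close> and \<open>K\<close> telescope
  in \<open>v\<close> for fixed \<open>u\<close>. The surviving ends make up the two cup
  products.\<close>

lemma dl_cup_one:
 "dl X (cup_one X a b) p s = cup X a b p s + cup X b a p s"
proof (cases "p = 0")
 case True
 thus ?thesis using s by(simp add: coboundary_def cup_def front_full front_0_back mult.commute)
next
 case False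
 let ?A = "vfv a" and ?B = "vfv b"
 define F where "F u v = ?A ({..p} - {u<..<v}) * ?B {Suc u..v}" for u v
 define G where "G u v = ?A ({..p} - {u<..<v}) * ?B {u..<v}" for u v
 define H where "H u v = ?A ({..p} - {u..<v}) * ?B {u..v}" for u v
 define K where "K u v = ?A ({..p} - {u<..v}) * ?B {u..v}" for u v
 have "dl X (cup_one X a b) p s = (\<Sum>k\<le>p. cup_one X a b (p - 1) (sface p k s))"
  using s False by(simp add: coboundary_def)
 also have "... = (\<Sum>k\<le>p. \<Sum>u\<le>p. \<Sum>v\<le>p. if u < v & u ~= k & v ~= k
   then ?A ({..p} - {u<..<v} - {k}) * ?B ({u..v} - {k}) else 0)"
  by(intro sum.cong refl cup_one_face) (use False in auto)
 also have "... = (\<Sum>u\<le>p. \<Sum>v\<le>p. \<Sum>k\<le>p. if u < v & u ~= k & v ~= k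
   then ?A ({..p} - {u<..<v} - {k}) * ?B ({u..v} - {k}) else 0)"
  by(subst sum.swap) (intro sum.cong refl sum.swap)
 also have "... = (\<Sum>u\<le>p. \<Sum>v\<le>p. if u < v then (F u v + H u v) + (G u v + K u v) else 0)"
 proof (intro sum.cong refl)
  fix u v assume "u : {..p}" "v : {..p}"
  show "(\<Sum>k\<le>p. if u < v & u ~= k & v ~= k then ?A ({..p} - {u<..<v} - {k}) * ?B ({u..v} - {k}) else 0) =
    (if u < v then (F u v + H u v) + (G u v + K u v) else 0)"
  proof (cases "u < v")
   case True
   have "(\<Sum>k\<le>p. if u < v & u ~= k & v ~= k then ?A ({..p} - {u<..<v} - {k}) * ?B ({u..v} - {k}) else 0)
    = (\<Sum>k\<le>p. if u ~= k & v ~= k then ?A ({..p} - {u<..<v} - {k}) * ?B ({u..v} - {k}) else 0)"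
    using True by simp
   also have "... = (F u v + H u v) + (G u v + K u v)"
    unfolding cup_one_face_sum[OF True atMost_iff[THEN iffD1, OF \<open>v : {..p}\<close>]] F_def G_def H_def K_def
    by(simp only: distrib_left distrib_right ac_simps)
   finally show ?thesis using True by simp
  qed simp
 qed
 also have "... = (\<Sum>u\<le>p. \<Sum>v\<le>p. if u < v then F u v + H u v else 0) + (\<Sum>u\<le>p. \<Sum>v\<le>p. if u < v then G u v + K u v else 0)"
  by(simp add: sum.distrib[symmetric] if_distrib cong: if_cong)
 also have "(\<Sum>u\<le>p. \<Sum>v\<le>p. if u < v then F u v + H u v else 0) = (\<Sum>v\<in>{1..p}. ?B {0..v} * ?A {v..p} + ?A {0..p} * ?B {v..v})"
 proof -
  have "(\<Sum>u\<le>p. \<Sum>v\<le>p. if u < v then F u v + H u v else 0) = (\<Sum>v\<le>p. \<Sum>u\<le>p. if u < v then F u v + H u v else 0)"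
   by(rule sum.swap)
  also have "... = (\<Sum>v\<in>{1..p}. \<Sum>u\<le>p. if u < v then F u v + H u v else 0)"
   by(intro sum.mono_neutral_right) (auto intro!: sum.neutral)
  also have "... = (\<Sum>v\<in>{1..p}. ?B {0..v} * ?A {v..p} + ?A {0..p} * ?B {v..v})"
  proof (intro sum.cong refl)
   fix v assume v: "v : {1..p}"
   have "(\<Sum>u\<le>p. if u < v then F u v + H u v else 0) = (\<Sum>u\<le>v - 1. F u v + H u v)"
    using v by(intro sum.mono_neutral_cong_right) auto
   also have "... = F (v - 1) v + H 0 v"
    unfolding sum.distrib
   proof (rule sum_bit_telescope)
    fix i assume "i < v - 1"
    hence "{Suc i..<v} = {i<..<v}" by auto
    thus "H (Suc i) v = F i v" by(simp add: H_def F_def)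
   qed
   also have "F (v - 1) v = ?A {0..p} * ?B {v..v}"
   proof -
    have "{..p} - {v - 1<..<v} = {0..p}" "Suc (v - 1) = v" using v by auto
    thus ?thesis by(simp add: F_def)
   qed
   also have "H 0 v = ?B {0..v} * ?A {v..p}"
   proof -
    have "{..p} - {0..<v} = {v..p}" by auto
    thus ?thesis by(simp add: H_def mult.commute)
   qed
   finally show "(\<Sum>u\<le>p. if u < v then F u v + H u v else 0) = ?B {0..v} * ?A {v..p} + ?A {0..p} * ?B {v..v}"
    by(simp add: add.commute)
  qed
  finally show ?thesis .
 qed
 also have "(\<Sum>u\<le>p. \<Sum>v\<le>p. if u < v then G u v + K u v else 0) = (\<Sum>u<p. ?A {0..u} * ?B {u..p} + ?A {0..p} * ?B {u..u})"
 proof -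
  have "(\<Sum>u\<le>p. \<Sum>v\<le>p. if u < v then G u v + K u v else 0) = (\<Sum>u<p. \<Sum>v\<le>p. if u < v then G u v + K u v else 0)"
   by(intro sum.mono_neutral_right) (auto intro!: sum.neutral)
  also have "... = (\<Sum>u<p. ?A {0..u} * ?B {u..p} + ?A {0..p} * ?B {u..u})"
  proof (intro sum.cong refl)
   fix u assume u: "u : {..<p}"
   have "(\<Sum>v\<le>p. if u < v then G u v + K u v else 0) = (\<Sum>v\<in>{Suc u..p}. G u v + K u v)"
    using u by(intro sum.mono_neutral_cong_right) auto
   also have "... = (\<Sum>j\<le>p - Suc u. G u (Suc u + j) + K u (Suc u + j))"
    using u by(intro sum.reindex_bij_witness[where i="%j. Suc u + j" and j="%v. v - Suc u"]) auto
   also have "... = K u p + G u (Suc u)"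
   proof -
    have "(\<Sum>j\<le>p - Suc u. K u (Suc u + j)) + (\<Sum>j\<le>p - Suc u. G u (Suc u + j)) = K u (Suc u + (p - Suc u)) + G u (Suc u + 0)"
    proof (rule sum_bit_telescope)
     fix i
     have "{u<..<Suc u + Suc i} = {u<..Suc u + i}" "{u..<Suc u + Suc i} = {u..Suc u + i}" by auto
     thus "G u (Suc u + Suc i) = K u (Suc u + i)" by(simp add: G_def K_def)
    qed
    thus ?thesis using u by(simp add: sum.distrib add.commute)
   qed
   also have "G u (Suc u) = ?A {0..p} * ?B {u..u}"
   proof -
    have "{..p} - {u<..<Suc u} = {0..p}" "{u..<Suc u} = {u..u}" by auto
    thus ?thesis by(simp add: G_def)
   qed
   also have "K u p = ?A {0..u} * ?B {u..p}"
   proof -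
    have "{..p} - {u<..p} = {0..u}" using u by auto
    thus ?thesis by(simp add: K_def)
   qed
   finally show "(\<Sum>v\<le>p. if u < v then G u v + K u v else 0) = ?A {0..u} * ?B {u..p} + ?A {0..p} * ?B {u..u}" .
  qed
  finally show ?thesis .
 qed
 also have "(\<Sum>v\<in>{1..p}. ?B {0..v} * ?A {v..p} + ?A {0..p} * ?B {v..v}) + (\<Sum>u<p. ?A {0..u} * ?B {u..p} + ?A {0..p} * ?B {u..u})
  = (\<Sum>i\<le>p. ?B {0..i} * ?A {i..p}) + (\<Sum>i\<le>p. ?A {0..i} * ?B {i..p})"
 proof -
  have 1: "(\<Sum>i\<le>p. f i) = f 0 + (\<Sum>i\<in>{1..p}. f i)" for f :: "nat => bit"
   by(simp add: atMost_atLeast0 sum.atLeast_Suc_atMost)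
  have 2: "(\<Sum>i\<le>p. f i) = (\<Sum>i<p. f i) + f p" for f :: "nat => bit"
   using sum.lessThan_Suc[of f p] by(simp add: lessThan_Suc_atMost)
  \<comment> \<open>The survivors having a single vertex in the second factor cancel except at the
    first and the last vertex, where they supply the summands still missing from the two
    products.\<close>
  have ends: "(\<Sum>i\<in>{1..p}. ?A {0..p} * ?B {i..i}) + (\<Sum>i<p. ?A {0..p} * ?B {i..i}) = ?B {0..0} * ?A {0..p} + ?A {0..p} * ?B {p..p}"
  proof -
   have "s + t = x + y" if "x + s = t + y" for x y s t :: bit
    using that by(cases x; cases y; cases s; cases t) auto
   moreover have "?B {0..0} * ?A {0..p} + (\<Sum>i\<in>{1..p}. ?A {0..p} * ?B {i..i}) = (\<Sum>i<p. ?A {0..p} * ?B {i..i}) + ?A {0..p} * ?B {p..p}"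
    unfolding mult.commute[of "?B {0..0}" "?A {0..p}"]
    by(rule trans[OF 1[of "%i. ?A {0..p} * ?B {i..i}", symmetric] 2[of "%i. ?A {0..p} * ?B {i..i}"]])
   ultimately show ?thesis .
  qed
  have comb: "(w + x) + (y + z) = (x' + w) + (y + z')" if "x + z = x' + z'" for w x y z x' z' :: bit
   using that by(cases x; cases y; cases z; cases w; cases x'; cases z') auto
  show ?thesis unfolding 1[of "%i. ?B {0..i} * ?A {i..p}"] 2[of "%i. ?A {0..i} * ?B {i..p}"] sum.distrib
   by(rule comb[OF ends])
 qed
 also have "(\<Sum>i\<le>p. ?B {0..i} * ?A {i..p}) = cup X b a p s"
  by(rule cup_vfv[symmetric])
 also have "(\<Sum>i\<le>p. ?A {0..i} * ?B {i..p}) = cup X a b p s"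
  by(rule cup_vfv[symmetric])
 finally show ?thesis by(simp add: add.commute)
qed

end

lemma cup_commute:
 assumes "cyc X a" "cyc X b" shows "exact X (cup X a b + cup X b a)"
proof -
 have "cch_on X (cup X a b + cup X b a) = dl X (cup_one X a b)"
 proof (intro ext)
  fix p s
  show "cch_on X (cup X a b + cup X b a) p s = dl X (cup_one X a b) p s"
   using dl_cup_one[OF _ assms, of p s]
   by(cases "ssx p X s") (simp_all add: cch_on_def cch_apply coboundary_def)
 qed
 thus ?thesis by(rule exactI)
qed

subsection \<open>Homotopy invariance\<close>

definition degeneracy :: "nat => (nat => real) => nat => real" where
 "degeneracy i x = (%k. if k < i then x k else if k = i then x i + x (Suc i) else x (Suc k))"

text \<open>The \<open>i\<close>-th simplex of the standard triangulation of the prism: its vertices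
  up to \<open>i\<close> lie at time 0, the later ones at time 1, and \<open>degeneracy i\<close>
  gives vertices \<open>i\<close> and \<open>Suc i\<close> the same foot.\<close>

definition prism_face :: "(real \<times> 'a => 'b) => nat => nat => ((nat => real) => 'a) => (nat => real) => 'b" where
 "prism_face h p i s = restrict (%x. h (1 - (\<Sum>k\<le>i. x k), s (degeneracy i x))) (stdx (Suc p))"

text \<open>The common face of the prism simplices \<open>i - 1\<close> and \<open>i\<close>. For
  \<open>i = 0\<close> it is the end at time 1, for \<open>i = Suc p\<close> the end at time
  0.\<close>

definition prism_slice :: "(real \<times> 'a => 'b) => nat => nat => ((nat => real) => 'a) => (nat => real) => 'b" where
 "prism_slice h p i s = restrict (%x. h (1 - (\<Sum>k<i. x k), s x)) (stdx p)"

lemma degeneracy_in: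
 assumes x: "x : stdx (Suc p)" and i: "i <= p" shows "degeneracy i x : stdx p"
proof -
 have nn: "0 <= x k" for k using x by(simp add: standard_simplex_def)
 have "(\<Sum>k\<le>p. degeneracy i x k) = (\<Sum>k<i. x k) + (x i + x (Suc i)) + (\<Sum>k\<in>{Suc i..p}. x (Suc k))"
 proof -
  have e: "{..p} = {..<i} Un ({i} Un {Suc i..p})" using i by auto
  show ?thesis unfolding e
   by(subst sum.union_disjoint, simp, simp, force)+ (auto simp: degeneracy_def intro!: sum.cong)
 qed
 also have "(\<Sum>k\<in>{Suc i..p}. x (Suc k)) = (\<Sum>k\<in>{Suc (Suc i)..Suc p}. x k)"
  by(rule sum.shift_bounds_cl_Suc_ivl[symmetric])
 also have "(\<Sum>k<i. x k) + (x i + x (Suc i)) + (\<Sum>k\<in>{Suc (Suc i)..Suc p}. x k) = (\<Sum>k\<le>Suc p. x k)"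
 proof -
  have e: "{..Suc p} = {..<i} Un ({i, Suc i} Un {Suc (Suc i)..Suc p})" using i by auto
  show ?thesis unfolding e
   by(subst sum.union_disjoint, simp, simp, force)+ simp
 qed
 finally have 1: "(\<Sum>k\<le>p. degeneracy i x k) = 1" using x by(simp only: standard_simplex_def mem_Collect_eq)
 have n: "0 <= degeneracy i x k" for k using nn by(simp add: degeneracy_def)
 have z: "degeneracy i x k = 0" if "k > p" for k using x that i by(auto simp: degeneracy_def standard_simplex_def)
 have "degeneracy i x k <= 1" for k
 proof (cases "k <= p")
  case True
  thus ?thesis using member_le_sum[of k "{..p}" "degeneracy i x"] n 1 by simp
 next
  case False thus ?thesis using z[of k] by simp
 qed
 thus ?thesis using 1 n z by(simp add: standard_simplex_def)
qed

lemma sx_partial_sum: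
 assumes "x : stdx p" shows "1 - (\<Sum>k<i. x k) : {0..1}"
proof -
 have nn: "0 <= x k" for k using assms by(simp add: standard_simplex_def)
 have "(\<Sum>k<i. x k) = (\<Sum>k\<in>{..<i} Int {..p}. x k)"
 proof (rule sum.mono_neutral_right)
  show "ALL k:{..<i} - {..<i} Int {..p}. x k = 0"
   using assms by(auto simp: standard_simplex_def not_le)
 qed auto
 also have "... <= (\<Sum>k\<le>p. x k)" using nn by(intro sum_mono2) auto
 also have "... = 1" using assms by(simp add: standard_simplex_def)
 finally show ?thesis using nn by(simp add: sum_nonneg)
qed

lemma cmap_sx_coord:
 "cmap (subt (powertop_real UNIV) (stdx p)) eur (%x. x k)"
 by(auto intro!: cm_sub continuous_map_product_projection)

lemma ssx_prism:
 assumes h: "cmap (ptop (top_of_set {0..1}) X) Y h"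
  and s: "ssx p X s"
 shows "i <= p ==> ssx (Suc p) Y (prism_face h p i s)"
  and "ssx p Y (prism_slice h p i s)"
proof -
 let ?D = "%q. subt (powertop_real UNIV) (stdx q)"
 have s': "cmap (?D p) X s" using s by(simp add: ssx_d)
 have sum: "cmap (?D q) (top_of_set {0..1}) (%x. 1 - (\<Sum>k<i. x k))" for q i
  unfolding cm_into
 proof
  show "cmap (?D q) eur (%x. 1 - (\<Sum>k<i. x k))"
   by(intro continuous_map_diff cm_sum cmap_sx_coord) auto
 qed (use sx_partial_sum[of _ q i] in auto)
 { assume i: "i <= p"
  have "cmap (?D (Suc p)) (?D p) (degeneracy i)"
   unfolding cm_into
  proof
   show "cmap (?D (Suc p)) (powertop_real UNIV) (degeneracy i)"
    unfolding continuous_map_componentwise degeneracy_def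
   proof (intro conjI ballI)
    fix k
    show "cmap (?D (Suc p)) eur (%x. if k < i then x k else if k = i then x i + x (Suc i) else x (Suc k))"
     by(cases "k < i"; cases "k = i") (auto intro!: cmap_sx_coord continuous_map_add)
   qed auto
  qed (use degeneracy_in[OF _ i] in auto)
  hence "cmap (?D (Suc p)) X (s o degeneracy i)" using s' by(rule cm_comp)
  hence "cmap (?D (Suc p)) (ptop (top_of_set {0..1}) X) (%x. (1 - (\<Sum>k<Suc i. x k), (s o degeneracy i) x))"
   using sum[of "Suc p" "Suc i"] by(simp only: continuous_map_paired)
  hence "cmap (?D (Suc p)) Y (h o (%x. (1 - (\<Sum>k<Suc i. x k), (s o degeneracy i) x)))"
   using h by(rule cm_comp)
  thus "ssx (Suc p) Y (prism_face h p i s)"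
   unfolding ssx_d prism_face_def lessThan_Suc_atMost
   by(auto elim!: cm_eq simp: o_def) }
 have "cmap (?D p) (ptop (top_of_set {0..1}) X) (%x. (1 - (\<Sum>k<i. x k), s x))"
  using sum[of p i] s' by(simp only: continuous_map_paired)
 hence "cmap (?D p) Y (h o (%x. (1 - (\<Sum>k<i. x k), s x)))"
  using h by(rule cm_comp)
 thus "ssx p Y (prism_slice h p i s)"
  unfolding ssx_d prism_slice_def
  by(auto elim!: cm_eq simp: o_def)
qed

lemma sum_simplical_face:
 fixes x :: "nat => real"
 shows "(\<Sum>j\<le>i. simplical_face k x j) = (if k <= i then \<Sum>j<i. x j else \<Sum>j\<le>i. x j)"
proof (cases "k <= i")
 case True
 have "(\<Sum>j\<le>i. simplical_face k x j) = (\<Sum>j\<in>{..i} - {k}. simplical_face k x j)"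
  by(rule sum.mono_neutral_right) (auto simp: simplical_face_def)
 also have "... = (\<Sum>j<i. x j)"
  using True by(intro sum.reindex_bij_witness[where i="%j. if j < k then j else Suc j" and j="%j. if j < k then j else j - 1"])
   (auto simp: simplical_face_def)
 finally show ?thesis using True by simp
qed (auto simp: simplical_face_def intro!: sum.cong)

lemma prism_faces:
 assumes "i <= p"
 shows "k < i ==> sface (Suc p) k (prism_face h p i s) = prism_face h (p - 1) (i - 1) (sface p k s)"
  and "sface (Suc p) i (prism_face h p i s) = prism_slice h p i s"
  and "sface (Suc p) (Suc i) (prism_face h p i s) = prism_slice h p (Suc i) s"
  and "Suc i < k ==> k <= Suc p ==> sface (Suc p) k (prism_face h p i s) = prism_face h (p - 1) i (sface p (k - 1) s)"
proof -
 have sf: "simplical_face j x : stdx (Suc p)" if "x : stdx p" "j <= Suc p" for x j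
  using simplical_face_in_standard_simplex[of "Suc p" j x] that by simp
 { assume k: "k < i"
  have "degeneracy i (simplical_face k x) = simplical_face k (degeneracy (i - 1) x)" for x :: "nat => real"
   using k by(auto simp: degeneracy_def simplical_face_def fun_eq_iff)
  moreover have "degeneracy (i - 1) x : stdx (p - 1)" if "x : stdx p" for x
   using degeneracy_in[of x "p - 1" "i - 1"] that k assms by simp
  moreover have "{..<i} = {..i - 1}" using k by auto
  moreover have "Suc (p - 1) = p" using k assms by simp
  ultimately show "sface (Suc p) k (prism_face h p i s) = prism_face h (p - 1) (i - 1) (sface p k s)"
   using sf[of _ k] k assms by(intro ext) (auto simp: singular_face_def prism_face_def sum_simplical_face) }
 have "degeneracy i (simplical_face i x) = x" for x :: "nat => real"
  by(auto simp: degeneracy_def simplical_face_def fun_eq_iff)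
 thus "sface (Suc p) i (prism_face h p i s) = prism_slice h p i s"
  using sf[of _ i] assms by(intro ext) (auto simp: singular_face_def prism_face_def prism_slice_def sum_simplical_face)
 have "degeneracy i (simplical_face (Suc i) x) = x" for x :: "nat => real"
  by(auto simp: degeneracy_def simplical_face_def fun_eq_iff)
 thus "sface (Suc p) (Suc i) (prism_face h p i s) = prism_slice h p (Suc i) s"
  using sf[of _ "Suc i"] assms
  by(intro ext) (auto simp: singular_face_def prism_face_def prism_slice_def sum_simplical_face lessThan_Suc_atMost simp del: sum.lessThan_Suc)
 { assume k: "Suc i < k" "k <= Suc p"
  have "degeneracy i (simplical_face k x) = simplical_face (k - 1) (degeneracy i x)" for x :: "nat => real"
   using k by(auto simp: degeneracy_def simplical_face_def fun_eq_iff)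
  moreover have "degeneracy i x : stdx (p - 1)" if "x : stdx p" for x
   using degeneracy_in[of x "p - 1" "i"] that k assms by simp
  moreover have "Suc (p - 1) = p" using k assms by simp
  ultimately show "sface (Suc p) k (prism_face h p i s) = prism_face h (p - 1) i (sface p (k - 1) s)"
   using sf[of _ k] k assms by(intro ext) (auto simp: singular_face_def prism_face_def sum_simplical_face) }
qed

text \<open>Off the two diagonals the faces of the prism over a simplex are the prism simplices over
  its faces and cancel against \<open>g\<close>. On the diagonals stand the slices, each inner one
  twice, so the two ends remain.\<close>

lemma sum_prism_bit:
 fixes f g :: "nat => nat => bit" and c :: "nat => bit"
 assumes "!!i k. k < i ==> i <= p ==> f i k = g (i - 1) k"
  and "!!i k. Suc i < k ==> k <= Suc p ==> i <= p ==> f i k = g i (k - 1)"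
  and "!!i. i <= p ==> f i i = c i" "!!i. i <= p ==> f i (Suc i) = c (Suc i)"
 shows "(\<Sum>i\<le>p. \<Sum>k\<le>Suc p. f i k) + (\<Sum>i<p. \<Sum>k\<le>p. g i k) = c 0 + c (Suc p)"
proof -
 let ?S = "{(i, k). i <= p & k < i}" and ?T = "{(i, k). i <= p & Suc i < k & k <= Suc p}"
 have fin: "finite ?S" "finite ?T"
  by(rule finite_subset[of _ "{..p} \<times> {..Suc p}"]; force)+
 have "(\<Sum>i\<le>p. \<Sum>k\<le>Suc p. f i k) = (\<Sum>(i, k)\<in>{..p} \<times> {..Suc p}. f i k)"
  by(rule sum.cartesian_product)
 also have "{..p} \<times> {..Suc p} = ?S Un (?T Un ((%i. (i, i)) ` {..p} Un (%i. (i, Suc i)) ` {..p}))"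
  by(auto simp: image_iff)
 also have "(\<Sum>(i, k)\<in>.... f i k) = (\<Sum>(i, k)\<in>?S. f i k) + ((\<Sum>(i, k)\<in>?T. f i k) + ((\<Sum>i\<le>p. f i i) + (\<Sum>i\<le>p. f i (Suc i))))"
 proof -
  let ?D = "(%i. (i, i)) ` {..p}" and ?E = "(%i. (i, Suc i)) ` {..p}" and ?F = "%(i, k). f i k"
  have "?S Int (?T Un (?D Un ?E)) = {}" "?T Int (?D Un ?E) = {}" "?D Int ?E = {}" by auto
  hence "sum ?F (?S Un (?T Un (?D Un ?E))) = sum ?F ?S + (sum ?F ?T + (sum ?F ?D + sum ?F ?E))"
   using fin by(simp add: sum.union_disjoint)
  moreover have "sum ?F ?D = (\<Sum>i\<le>p. f i i)" "sum ?F ?E = (\<Sum>i\<le>p. f i (Suc i))"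
   by(simp_all add: sum.reindex inj_on_def)
  ultimately show ?thesis by simp
 qed
 also have "(\<Sum>i\<le>p. f i i) + (\<Sum>i\<le>p. f i (Suc i)) = (\<Sum>i\<le>p. c i) + (\<Sum>i\<le>p. c (Suc i))"
  using assms(3,4) by simp
 also have "... = c 0 + c (Suc p)"
  using sum_bit_telescope[of p c "%i. c (Suc i)"] by(simp only: add.commute)
 also have "(\<Sum>(i, k)\<in>?S. f i k) = (\<Sum>(i, k)\<in>{(i, k). i < p & k <= i}. g i k)"
  by(rule sum.reindex_bij_witness[where i="%(i, k). (Suc i, k)" and j="%(i, k). (i - 1, k)"]) (auto simp: assms(1))
 also have "(\<Sum>(i, k)\<in>?T. f i k) = (\<Sum>(i, k)\<in>{(i, k). i < p & i < k & k <= p}. g i k)"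
  by(rule sum.reindex_bij_witness[where i="%(i, k). (i, Suc k)" and j="%(i, k). (i, k - 1)"]) (auto simp: assms(2))
 finally have "(\<Sum>i\<le>p. \<Sum>k\<le>Suc p. f i k) =
   ((\<Sum>(i, k)\<in>{(i, k). i < p & k <= i}. g i k) + (\<Sum>(i, k)\<in>{(i, k). i < p & i < k & k <= p}. g i k)) + (c 0 + c (Suc p))"
  by(simp only: add.assoc)
 also have "(\<Sum>(i, k)\<in>{(i, k). i < p & k <= i}. g i k) + (\<Sum>(i, k)\<in>{(i, k). i < p & i < k & k <= p}. g i k)
   = (\<Sum>(i, k)\<in>{..<p} \<times> {..p}. g i k)"
  by(subst sum.union_disjoint[symmetric])
   (auto intro!: sum.cong intro: finite_subset[of _ "{..<p} \<times> {..p}"])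
 also have "... = (\<Sum>i<p. \<Sum>k\<le>p. g i k)" by(rule sum.cartesian_product[symmetric])
 finally show ?thesis by(simp add: ac_simps flip: add.assoc)
qed

lemma homotopic_pb_exact:
 assumes fg: "homotopic_with (%_. True) X Y f g" and c: "cyc Y c"
 shows "exact X (pb X f c + pb X g c)"
proof -
 obtain h where h: "cmap (ptop (top_of_set {0..1::real}) X) Y h"
  and h0: "!!x. h (0, x) = f x" and h1: "!!x. h (1, x) = g x"
  using fg by(fastforce simp: homotopic_with_def)
 define D where "D p s = (\<Sum>i\<le>p. c (Suc p) (prism_face h p i s))" for p s
 have "cch_on X (pb X f c + pb X g c) = dl X D"
 proof (intro ext)
  fix p s
  show "cch_on X (pb X f c + pb X g c) p s = dl X D p s"
  proof (cases "ssx p X s")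
   case s: True
   have "(\<Sum>i\<le>p. \<Sum>k\<le>Suc p. c p (sface (Suc p) k (prism_face h p i s))) = (\<Sum>i\<le>p. dl Y c (Suc p) (prism_face h p i s))"
    using ssx_prism(1)[OF h s] by(intro sum.cong refl) (simp add: coboundary_def)
   also have "... = 0" using c by(simp add: cyc_def cch_apply)
   finally have 0: "(\<Sum>i\<le>p. \<Sum>k\<le>Suc p. c p (sface (Suc p) k (prism_face h p i s))) = 0" .
   have "(\<Sum>i\<le>p. \<Sum>k\<le>Suc p. c p (sface (Suc p) k (prism_face h p i s))) +
     (\<Sum>i<p. \<Sum>k\<le>p. c p (prism_face h (p - 1) i (sface p k s))) =
     c p (prism_slice h p 0 s) + c p (prism_slice h p (Suc p) s)"
    by(rule sum_prism_bit) (simp_all add: prism_faces)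
   also have "prism_slice h p 0 s = smap p g s"
    by(auto simp: prism_slice_def simplex_map_def h1 fun_eq_iff)
   also have "prism_slice h p (Suc p) s = smap p f s"
    by(auto simp: prism_slice_def simplex_map_def h0 fun_eq_iff lessThan_Suc_atMost standard_simplex_def simp del: sum.lessThan_Suc)
   also have "(\<Sum>i<p. \<Sum>k\<le>p. c p (prism_face h (p - 1) i (sface p k s))) = dl X D p s"
   proof (cases p)
    case (Suc q)
    have "(\<Sum>i<p. \<Sum>k\<le>p. c p (prism_face h (p - 1) i (sface p k s))) =
      (\<Sum>k\<le>p. \<Sum>i<p. c p (prism_face h (p - 1) i (sface p k s)))"
     by(rule sum.swap)
    thus ?thesis using s Suc by(simp add: coboundary_def D_def lessThan_Suc_atMost del: sum.atMost_Suc sum.lessThan_Suc)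
   qed (simp add: coboundary_def)
   finally have "dl X D p s = c p (smap p g s) + c p (smap p f s)"
    unfolding 0 by simp
   thus ?thesis using s by(simp add: cch_on_def cch_apply pb_d add.commute)
  qed (simp add: cch_on_def coboundary_def)
 qed
 thus ?thesis by(rule exactI)
qed

subsection \<open>Cohomology classes as elements of a commutative ring type\<close>

text \<open>
 There is no type of cohomology classes of a given space, but the product of the cohomology
 rings of all topologies on a type is a type. The class of a cocycle of \<open>X\<close> is the
 family concentrated at \<open>X\<close>, so that the cohomology ring of \<open>X\<close> becomes the ideal
 generated by the idempotent \<open>one_at X\<close>.
\<close>

definition coh_rel :: "('a topology => 'a cochain) => ('a topology => 'a cochain) => bool" where
 "coh_rel al be \<longleftrightarrow> (ALL X. cyc X (al X) & cyc X (be X) & exact X (al X + be X))"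

quotient_type 'a coh = "'a topology => 'a cochain" / partial: coh_rel
proof (rule part_equivpI)
 show "EX al. coh_rel al (al :: 'a topology => 'a cochain)"
  by(rule exI[of _ "%X. 0"]) (simp add: coh_rel_def)
 show "symp (coh_rel :: ('a topology => 'a cochain) => _)"
  by(rule sympI) (simp add: coh_rel_def add.commute)
 show "transp (coh_rel :: ('a topology => 'a cochain) => _)"
 proof (rule transpI)
  fix al be ga :: "'a topology => 'a cochain"
  assume "coh_rel al be" "coh_rel be ga"
  thus "coh_rel al ga" unfolding coh_rel_def by(metis exact_trans)
 qed
qed

lemma exact_cup_cong:
 assumes "cyc X a" "cyc X b'" "exact X (a + a')" "exact X (b + b')" 
 shows "exact X (cup X a b + cup X a' b')"
proof -
 have "exact X (cup X a (b + b'))" "exact X (cup X (a + a') b')"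
  using assms exact_cup_left exact_cup_right by blast+
 thus ?thesis unfolding cup_add_left cup_add_right by(rule exact_trans)
qed

lemma exact_cch_on_add: "exact X (cch_on X c + c)"
proof -
 have "cch_on X (cch_on X c + c) = 0" by(simp only: cch_on_add cch_on_idem cch_add_self)
 hence "exact X (cch_on X (cch_on X c + c))" by(simp only: exact_0)
 thus ?thesis by(simp only: exact_cch_on)
qed

instantiation coh :: (type) comm_ring_1
begin

lift_definition zero_coh :: "'a coh" is "%X. 0"
 by(simp add: coh_rel_def)

lift_definition one_coh :: "'a coh" is "unc"
 by(simp add: coh_rel_def cyc_unit)

lift_definition plus_coh :: "'a coh => 'a coh => 'a coh" is "%al be X. al X + be X"
proof -
 fix al al' be be' :: "'a topology => 'a cochain"
 assume *: "coh_rel al al'" "coh_rel be be'"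
 show "coh_rel (%X. al X + be X) (%X. al' X + be' X)"
  unfolding coh_rel_def
 proof (intro allI conjI)
  fix X
  have "(al X + be X) + (al' X + be' X) = (al X + al' X) + (be X + be' X)" by(simp only: ac_simps)
  moreover have "exact X ((al X + al' X) + (be X + be' X))"
   using * by(simp only: coh_rel_def exact_add)
  ultimately show "exact X ((al X + be X) + (al' X + be' X))" by(simp only:)
 qed (use * in \<open>simp_all only: coh_rel_def cyc_add\<close>)
qed

lift_definition uminus_coh :: "'a coh => 'a coh" is "%al. al" .

definition minus_coh :: "'a coh => 'a coh => 'a coh" where
 "minus_coh a b = a + b"

lift_definition times_coh :: "'a coh => 'a coh => 'a coh" is "%al be X. cup X (al X) (be X)"
proof -
 fix al al' be be' :: "'a topology => 'a cochain"
 assume *: "coh_rel al al'" "coh_rel be be'"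
 show "coh_rel (%X. cup X (al X) (be X)) (%X. cup X (al' X) (be' X))"
  unfolding coh_rel_def
  by(intro allI conjI cyc_cup exact_cup_cong) (use * in \<open>simp_all only: coh_rel_def\<close>)
qed

lemma coh_relI: "(!!X. cyc X (al X)) ==> (!!X. cyc X (be X)) ==> (!!X. exact X (al X + be X)) ==> coh_rel al be"
 by(simp only: coh_rel_def simp_thms)

lemma coh_rel_cyc: "coh_rel al al ==> cyc X (al X)"
 by(simp only: coh_rel_def)

instance
proof
 fix a b c :: "'a coh"
 show "a + b + c = a + (b + c)"
  by transfer (rule coh_relI; simp only: add.assoc cyc_add coh_rel_cyc cch_add_self exact_0)
 show "a + b = b + a"
  by transfer (rule coh_relI; simp only: cyc_add coh_rel_cyc add.commute cch_add_self exact_0)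
 show "0 + a = a"
  by transfer (rule coh_relI; simp only: add_0 coh_rel_cyc cch_add_self exact_0)
 show "- a + a = 0"
  by transfer (rule coh_relI; simp only: add_0_right cch_add_self cyc_0 exact_0)
 have "- b = b" by transfer
 thus "a - b = a + - b" by(simp add: minus_coh_def)
 show "a * b * c = a * (b * c)"
  by transfer (rule coh_relI; simp only: cup_assoc cyc_cup coh_rel_cyc cch_add_self exact_0)
 show "a * b = b * a"
  by transfer (rule coh_relI; simp only: cup_commute cyc_cup coh_rel_cyc)
 show "1 * a = a"
 proof (transfer, rule coh_relI)
  fix al :: "'a topology => 'a cochain" and X
  assume "coh_rel al al"
  show "exact X (cup X (unc X) (al X) + al X)" by(simp only: cup_unit_cch_left exact_cch_on_add)
 qed (simp_all only: cyc_cup coh_rel_cyc cyc_unit)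
 show "(a + b) * c = a * c + b * c"
  by transfer (rule coh_relI; simp only: cup_add_left cyc_add cyc_cup coh_rel_cyc cch_add_self exact_0)
 show "(0::'a coh) ~= 1"
 proof
  assume "(0::'a coh) = 1"
  hence "coh_rel (%X. 0) (unc :: 'a topology => _)" by transfer
  hence "exact (discrete_topology UNIV) (0 + unc (discrete_topology (UNIV::'a set)))"
   by(simp only: coh_rel_def)
  then obtain e where e: "cch_on (discrete_topology UNIV) (unc (discrete_topology (UNIV::'a set))) = dl (discrete_topology UNIV) e"
   unfolding add_0 by(rule exactE)
  \<comment> \<open>Coboundaries are zero in degree 0, while the unit takes the value 1 on a
    constant simplex.\<close>
  let ?s = "\<lambda>x\<in>stdx 0. undefined :: 'a"
  have "ssx 0 (discrete_topology UNIV) ?s"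
   unfolding ssx_d
   by(auto intro!: cm_eq[of _ _ "%x. undefined"])
  hence "cch_on (discrete_topology UNIV) (unc (discrete_topology (UNIV::'a set))) 0 ?s = 1"
   by(simp add: cch_on_def unit_cochain_def)
  moreover have "dl (discrete_topology UNIV) e 0 ?s = 0" by(simp add: coboundary_def)
  ultimately show False unfolding e by simp
 qed
qed

end

lemma coh_add_self [simp]: "(a::'a coh) + a = 0"
proof -
 have "- a = a" by transfer
 thus ?thesis by(metis add.left_inverse)
qed

lemma coh_diff: "(a::'a coh) - b = a + b"
 by(simp add: minus_coh_def)

lemma coh_add_eq_0: "(a::'a coh) + b = 0 \<longleftrightarrow> a = b"
 by(metis coh_diff eq_iff_diff_eq_0)

text \<open>The guard makes every cochain give a legitimate family; the class of a non-cocycle is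
  0.\<close>

definition at_space :: "'a topology => 'a cochain => 'a topology => 'a cochain" where
 "at_space X c = (%Y. if Y = X & cyc X c then c else 0)"

lemma coh_rel_at_space: "coh_rel (at_space X c) (at_space X c)"
 by(simp add: coh_rel_def at_space_def)

lift_definition cls :: "'a topology => 'a cochain => 'a coh" is at_space
 by(rule coh_rel_at_space)

text \<open>For a map that is not continuous the pullback is 0, so additivity and multiplicativity
  hold for all functions. The result lives at \<open>X\<close> alone; for continuous
  \<open>f\<close> the unit is sent to \<open>one_at X\<close>.\<close>

definition pull_family :: "'a topology => ('a => 'b) => 'b topology => ('b topology => 'b cochain) => 'a topology => 'a cochain" where
 "pull_family X f Y al = (%Z. if Z = X & cmap X Y f then pb X f (al Y) else 0)"

lift_definition pull :: "'a topology => ('a => 'b) => 'b topology => 'b coh => 'a coh" is pull_family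
proof (rule coh_relI)
 fix X :: "'a topology" and f :: "'a => 'b" and Y Z and al be :: "'b topology => 'b cochain"
 assume "coh_rel al be"
 hence *: "cyc Y (al Y)" "cyc Y (be Y)" "exact Y (al Y + be Y)" by(simp_all only: coh_rel_def)
 show "cyc Z (pull_family X f Y al Z)" "cyc Z (pull_family X f Y be Z)"
  unfolding pull_family_def using * cyc_pb by auto
 show "exact Z (pull_family X f Y al Z + pull_family X f Y be Z)"
  unfolding pull_family_def using exact_pb[OF _ *(3)] by(auto simp: pb_add)
qed

lemma cls_eq_iff:
 assumes "cyc X c" "cyc X d" shows "cls X c = cls X d \<longleftrightarrow> exact X (c + d)"
proof -
 have "cls X c = cls X d \<longleftrightarrow> coh_rel (at_space X c) (at_space X d)" by transfer (rule refl)
 also have "... \<longleftrightarrow> exact X (c + d)"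
  unfolding coh_rel_def at_space_def using assms by(auto split: if_splits)
 finally show ?thesis .
qed

lemma cls_0 [simp]: "cls X 0 = 0"
 by transfer (simp add: at_space_def coh_rel_def)

lemma cls_eq_0_iff: "cyc X c ==> cls X c = 0 \<longleftrightarrow> exact X c"
 using cls_eq_iff[of X c 0] by simp

lemma cls_add: "cyc X c ==> cyc X d ==> cls X (c + d) = cls X c + cls X d"
 by transfer (auto simp: at_space_def coh_rel_def cyc_add)

lemma cls_cup: "cyc X c ==> cyc X d ==> cls X (cup X c d) = cls X c * cls X d"
 by transfer (auto simp: at_space_def coh_rel_def cyc_cup cup_0)

definition one_at :: "'a topology => 'a coh" where
 "one_at X = cls X (unc X)"

definition cohs :: "'a topology => 'a coh set" where
 "cohs X = {cls X c |c. cyc X c}"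

lemma cls_in_cohs [simp]: "cyc X c ==> cls X c : cohs X"
 by(auto simp: cohs_def)

lemma cohsE: assumes "a : cohs X" obtains c where "cyc X c" "a = cls X c"
 using assms unfolding cohs_def by(elim CollectE exE conjE)

lemma one_at_in [simp]: "one_at X : cohs X"
 by(simp add: one_at_def cyc_unit)

lemma cohs_0 [simp]: "0 : cohs X"
 using cls_in_cohs[of X 0] by simp

lemma cohs_add [simp]: "a : cohs X ==> b : cohs X ==> a + b : cohs X"
 by(elim cohsE) (simp flip: cls_add add: cyc_add)

lemma cohs_mult [simp]: "a : cohs X ==> b : cohs X ==> a * b : cohs X"
 by(elim cohsE) (simp flip: cls_cup add: cyc_cup)

lemma cohs_sum [simp]: "(!!i. i : I ==> a i : cohs X) ==> sum a I : cohs X"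
 by(induction I rule: infinite_finite_induct) simp_all

lemma one_at_mult: assumes "a : cohs X" shows "one_at X * a = a"
proof -
 obtain c where c: "cyc X c" "a = cls X c" using assms by(rule cohsE)
 have "cls X (cup X (unc X) c) = cls X c"
  using cls_eq_iff[OF cyc_cup[OF cyc_unit c(1)] c(1)]
  by(simp only: cup_unit_cch_left exact_cch_on_add)
 thus ?thesis by(simp add: c one_at_def cls_cup cyc_unit)
qed

text \<open>Multiplication by \<open>one_at X\<close> cuts any element down to its component at
  \<open>X\<close>; \<open>cohs X\<close> is therefore an ideal.\<close>

lemma cohs_mult_any: "a : cohs X ==> a * b : cohs X"
proof -
 assume a: "a : cohs X"
 have "EX c. cyc X c & one_at X * b = cls X c"
  unfolding one_at_def
 proof transfer
  fix X :: "'a topology" and be :: "'a topology => 'a cochain"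
  assume be: "coh_rel be be"
  hence "cyc X (be X)" by(rule coh_rel_cyc)
  hence "cyc X (cup X (unc X) (be X))" by(simp add: cyc_cup cyc_unit)
  thus "EX c. cyc X c & coh_rel (%Y. cup Y (at_space X (unc X) Y) (be Y)) (at_space X c)"
   by(intro exI[of _ "cup X (unc X) (be X)"]) (auto simp: at_space_def cyc_unit coh_rel_def cup_0)
 qed
 hence "one_at X * b : cohs X" by(auto simp: cohs_def)
 hence "a * (one_at X * b) : cohs X" using a by simp
 moreover have "a * (one_at X * b) = (one_at X * a) * b" by(simp only: ac_simps)
 ultimately show ?thesis using one_at_mult[OF a] by simp
qed

lemma pull_cls: "cmap X Y f ==> cyc Y c ==> pull X f Y (cls Y c) = cls X (pb X f c)"
 by transfer (auto simp: coh_rel_def pull_family_def at_space_def cyc_pb)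

lemma pull_in [simp]: "cmap X Y f ==> a : cohs Y ==> pull X f Y a : cohs X"
 by(elim cohsE) (simp add: pull_cls cyc_pb)

lemma pull_0 [simp]: "pull X f Y 0 = 0"
 by transfer (simp add: coh_rel_def pull_family_def)

lemma pull_add: "pull X f Y (a + b) = pull X f Y a + pull X f Y b"
proof transfer
 fix X :: "'a topology" and f :: "'a => 'b" and Y and al be :: "'b topology => 'b cochain"
 assume "coh_rel al al" "coh_rel be be"
 thus "coh_rel (pull_family X f Y (%X. al X + be X)) (%Z. pull_family X f Y al Z + pull_family X f Y be Z)"
  by(auto simp: coh_rel_def pull_family_def pb_add cyc_add cyc_pb)
qed

lemma pull_sum: "pull X f Y (\<Sum>i\<in>I. a i) = (\<Sum>i\<in>I. pull X f Y (a i))"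
 by(rule sum_additive) (simp_all add: pull_add)

lemma pull_mult: "pull X f Y (a * b) = pull X f Y a * pull X f Y b"
proof transfer
 fix X :: "'a topology" and f :: "'a => 'b" and Y and al be :: "'b topology => 'b cochain"
 assume "coh_rel al al" "coh_rel be be"
 thus "coh_rel (pull_family X f Y (%X. cup X (al X) (be X))) (%Z. cup Z (pull_family X f Y al Z) (pull_family X f Y be Z))"
  by(auto simp: coh_rel_def pull_family_def pb_cup cyc_cup cyc_pb cup_0)
qed

lemma pull_one_at: "cmap X Y f ==> pull X f Y (one_at Y) = one_at X"
 by(simp add: one_at_def pull_cls cyc_unit pb_unit)

lemma pull_pull:
 assumes "cmap X Y f" "cmap Y Z g" "a : cohs Z"
 shows "pull X f Y (pull Y g Z a) = pull X (g o f) Z a"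
 using assms by(elim cohsE) (simp add: pull_cls cyc_pb pb_pb cm_comp)

lemma pull_cong:
 assumes "cmap X Y f" "!!x. x : topspace X ==> f x = g x" "a : cohs Y"
 shows "pull X f Y a = pull X g Y a"
proof -
 have "cmap X Y g" using assms(1,2) by(rule cm_eq)
 thus ?thesis using assms pb_cong[of X f g] by(elim cohsE) (simp add: pull_cls)
qed

lemma pull_id:
 assumes "!!x. x : topspace X ==> f x = x" "a : cohs X"
 shows "pull X f X a = a"
proof -
 have f: "cmap X X f" by(rule cm_eq[of _ _ id]) (use assms in simp_all)
 obtain c where c: "cyc X c" "a = cls X c" using assms(2) by(rule cohsE)
 have "cls X (cch_on X c) = cls X c" using c by(simp add: cls_eq_iff exact_cch_on_add)
 thus ?thesis using f c pb_id[of X f c] assms(1) by(simp add: pull_cls)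
qed

lemma pull_homotopic:
 assumes "homotopic_with (%_. True) X Y f g" "a : cohs Y"
 shows "pull X f Y a = pull X g Y a"
proof -
 have "cmap X Y f" "cmap X Y g"
  using homotopic_with_imp_continuous_maps[OF assms(1)] by auto
 thus ?thesis using assms homotopic_pb_exact[OF assms(1)]
  by(elim cohsE) (simp add: pull_cls cls_eq_iff cyc_pb)
qed

section \<open>Line fields and their orientation characters\<close>

abbreviation sx_top :: "nat => (nat => real) topology" where
 "sx_top p == subt (powertop_real UNIV) (stdx p)"

abbreviation vertex :: "nat => nat => real" where
 "vertex i == (%j. if j = i then 1 else 0)"

text \<open>
 A line field is given by a unit vector \<open>v x\<close> in \<open>\<real>\<^sup>d\<close> for each \<open>x\<close> which need not depend continuously
 on \<open>x\<close>; the line through it does. A lift over a simplex is a choice of signs that makes it continuous.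
\<close>

definition line_field :: "nat => 'a topology => ('a => nat => real) => bool" where
 "line_field d X v \<longleftrightarrow> (ALL x:topspace X. (ALL a>=d. v x a = 0) & (\<Sum>a<d. (v x a)\<^sup>2) = 1) &
  (ALL a b. cmap X eur (%x. v x a * v x b))"

definition line_lift :: "('a => nat => real) => nat => ((nat => real) => 'a) => ((nat => real) => real) => bool" where
 "line_lift v p s c \<longleftrightarrow> (ALL t:stdx p. c t = 1 \<or> c t = -1) &
  (ALL a. cmap (sx_top p) eur (%t. c t * v (s t) a))"

definition chi :: "'a topology => ('a => nat => real) => 'a cochain" where
 "chi X v = (%p s. if p = 1 & ssx 1 X s &
  (EX c. line_lift v 1 s c & c (vertex 0) ~= c (vertex 1)) then 1 else 0)"

lemma sx_top_euclidean: "sx_top p = top_of_set (stdx p)"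
 by(simp add: euclidean_product_topology)

lemma cmap_sx_top:
 "cmap (sx_top p) eur f \<longleftrightarrow> continuous_on (stdx p) f"
 by(simp add: sx_top_euclidean)

lemma compact_std_sx: "compact (stdx p)"
 using compactin_standard_simplex[of p] by(simp add: euclidean_product_topology)

lemma connected_std_sx: "connected (stdx p)"
 using connectedin_standard_simplex[of p] by(simp add: euclidean_product_topology)

lemma sx_sign_constant:
 assumes f: "cmap (sx_top p) eur f" and nz: "!!t. t : stdx p ==> f t ~= 0"
  and t: "t : stdx p" "t' : stdx p"
 shows "f t < 0 \<longleftrightarrow> f t' < 0"
proof -
 have c: "connected (f ` stdx p)"
  using f by(intro connected_continuous_image connected_std_sx) (simp add: cmap_sx_top)
 have "0 ~: f ` stdx p" using nz by auto
 thus ?thesis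
  using connectedD_interval[OF c, of "f t" "f t'" 0] connectedD_interval[OF c, of "f t'" "f t" 0] t
  by(metis image_eqI linorder_not_less order_less_imp_le)
qed

text \<open>The vector at vertex 0 is carried along the segment to each point \<open>t\<close> by
  finitely many orthogonal projections onto the lines met on the way. A projection only involves the
  products \<open>v x a * v x b\<close>, which are continuous; uniform continuity makes the steps so
  short that no projection is zero. The sign is read off from the transported vector.\<close>

lemma line_lift_exists:
 assumes v: "line_field d X v" and s: "ssx p X s"
 shows "EX c. line_lift v p s c"
proof -
 let ?D = "stdx p"
 define K where "K a b t = v (s t) a * v (s t) b" for a b t
 define R :: "real => (nat => real) => nat => real" where "R u t = (%i. (1 - u) * vertex 0 i + u * t i)" for u t
 have sX: "s t : topspace X" if "t : ?D" for t
  using s that by(auto simp: ssx_d cm_def)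
 have v0: "v (s t) a = 0" if "t : ?D" "a >= d" for t a
  using v sX[OF that(1)] that(2) by(simp add: line_field_def)
 have v1: "(\<Sum>a<d. (v (s t) a)\<^sup>2) = 1" if "t : ?D" for t
  using v sX[OF that] by(simp add: line_field_def)
 have K: "continuous_on ?D (K a b)" for a b
 proof -
  have "cmap (sx_top p) eur ((%x. v x a * v x b) o s)"
   by(rule cm_comp[of _ X]) (use s v in \<open>auto simp: ssx_d line_field_def\<close>)
  thus ?thesis by(simp add: cmap_sx_top K_def o_def)
 qed
 have R_in: "R u t : ?D" if "t : ?D" "u : {0..1}" for u t
  using convex_standard_simplex[of "vertex 0" p t u] that by(simp add: R_def)
 have R0: "R 0 t = vertex 0" and R1: "R 1 t = t" for t by(simp_all add: R_def)
 have R_cont: "continuous_on ({0..1} \<times> ?D) (%z. R (fst z) (snd z))"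
 proof (rule continuous_on_coordinatewise_then_product)
  fix i
  have "continuous_on ({0..1} \<times> ?D) (%z. snd z i)"
   by(rule continuous_on_product_then_coordinatewise[OF continuous_on_snd[OF continuous_on_id]])
  thus "continuous_on ({0..1} \<times> ?D) (%z. R (fst z) (snd z) i)"
   unfolding R_def by(intro continuous_intros)
 qed
 have KR: "continuous_on ({0..1} \<times> ?D) (%z. K a b (R (fst z) (snd z)))" for a b
  by(rule continuous_on_compose2[OF K R_cont]) (auto simp: R_in)
 \<comment> \<open>The squared inner product of the unit vectors at two times of the segment to
   \<open>t\<close>. It is expressed in the continuous products \<open>K\<close>, and it is 1 at
   equal times.\<close>
 define G where "G z = (\<Sum>a<d. \<Sum>b<d. K a b (R (fst z) (snd (snd z))) * K a b (R (fst (snd z)) (snd (snd z))))" for z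
 have G_eq: "G (u, u', t) = (\<Sum>a<d. v (s (R u t)) a * v (s (R u' t)) a)\<^sup>2" for u u' t
  unfolding G_def p2_eq sum_product by(simp add: K_def ac_simps)
 have "continuous_on ({0..1} \<times> {0..1} \<times> ?D) (%z. K a b (R (fst z) (snd (snd z))))" for a b
 proof -
  have "continuous_on ({0..1} \<times> {0..1} \<times> ?D) (%z. (fst z, snd (snd z)))" by(intro continuous_intros)
  thus ?thesis using continuous_on_compose2[OF KR] by fastforce
 qed
 moreover have "continuous_on ({0..1} \<times> {0..1} \<times> ?D) (%z. K a b (R (fst (snd z)) (snd (snd z))))" for a b
 proof -
  have "continuous_on ({0..1} \<times> {0..1} \<times> ?D) (%z. (fst (snd z), snd (snd z)))" by(intro continuous_intros)
  thus ?thesis using continuous_on_compose2[OF KR] by fastforce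
 qed
 ultimately have "continuous_on ({0..1} \<times> {0..1} \<times> ?D) G"
  unfolding G_def by(intro continuous_on_sum continuous_on_mult)
 hence "uniformly_continuous_on ({0..1} \<times> {0..1} \<times> ?D) G"
  by(intro compact_uniformly_continuous compact_Times compact_std_sx) auto
 then obtain de where de: "de > 0" and deG: "!!z z'. z : {0..1} \<times> {0..1} \<times> ?D ==> z' : {0..1} \<times> {0..1} \<times> ?D ==> dist z' z < de ==> dist (G z') (G z) < 1"
  unfolding uniformly_continuous_on_def by(metis zero_less_one)
 obtain N where N: "1 / real (Suc N) < de" using de nat_approx_posE by blast
 define u where "u k = real k / real (Suc N)" for k
 have u_in: "u k : {0..1}" if "k <= Suc N" for k using that by(simp add: u_def)
 have inner: "(\<Sum>a<d. v (s (R (u k) t)) a * v (s (R (u (Suc k)) t)) a) ~= 0" if "k <= N" "t : ?D" for k t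
 proof -
  have "u (Suc k) - u k = 1 / real (Suc N)" unfolding u_def by(simp flip: diff_divide_distrib)
  moreover have "0 < 1 / real (Suc N)" by simp
  ultimately have "dist (u k) (u (Suc k)) < de" using N unfolding dist_real_def by linarith
  hence "dist (G (u k, u (Suc k), t)) (G (u k, u k, t)) < 1"
   using deG[of "(u k, u k, t)" "(u k, u (Suc k), t)"] u_in that by(simp add: dist_Pair_Pair dist_commute)
  moreover have "G (u k, u k, t) = 1"
   using v1[OF R_in[OF that(2) u_in[of k]]] that by(simp add: G_eq p2_eq)
  ultimately have "G (u k, u (Suc k), t) ~= 0" by(auto simp: dist_real_def)
  thus ?thesis by(simp add: G_eq)
 qed
 \<comment> \<open>The transported vector after \<open>k\<close> projections, not
   normalized.\<close>
 define w where "w = rec_nat (%t a. v (s (vertex 0)) a) (%k w t a. \<Sum>b<d. K a b (R (u (Suc k)) t) * w t b)"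
 have w0: "w 0 t a = v (s (vertex 0)) a" and wS: "w (Suc k) t a = (\<Sum>b<d. K a b (R (u (Suc k)) t) * w k t b)" for k t a
  by(simp_all add: w_def)
 have w_cont: "k <= Suc N ==> continuous_on ?D (%t. w k t a)" for k a
 proof (induction k arbitrary: a)
  case (Suc k)
  have "continuous_on ?D (%t. K a b (R (u (Suc k)) t))" for b
  proof -
   have "continuous_on ?D (%t. (u (Suc k), t))" by(intro continuous_intros)
   thus ?thesis using continuous_on_compose2[OF KR, of ?D "%t. (u (Suc k), t)" a b] u_in[OF Suc.prems] by fastforce
  qed
  thus ?case unfolding wS using Suc by(intro continuous_on_sum continuous_on_mult) auto
 qed (simp add: w0)
 have w_eq: "k <= Suc N ==> t : ?D ==> EX l. l ~= 0 & (ALL a. w k t a = l * v (s (R (u k) t)) a)" for k t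
 proof (induction k)
  case 0
  show ?case by(rule exI[of _ 1]) (simp add: w0 u_def R0)
 next
  case (Suc k)
  then obtain l where l: "l ~= 0" "!!a. w k t a = l * v (s (R (u k) t)) a" by auto
  let ?i = "\<Sum>b<d. v (s (R (u k) t)) b * v (s (R (u (Suc k)) t)) b"
  have "w (Suc k) t a = (l * ?i) * v (s (R (u (Suc k)) t)) a" for a
   unfolding wS l(2) K_def by(simp add: sdl sdr ac_simps)
  moreover have "l * ?i ~= 0" using l inner[of k t] Suc.prems by simp
  ultimately show ?case by blast
 qed
 have "u (Suc N) = 1" by(simp add: u_def)
 define c where "c t = (if (\<Sum>a<d. w (Suc N) t a * v (s t) a) > 0 then 1 else -1 :: real)" for t
 have cont: "continuous_on ?D (%t. c t * v (s t) a)" for a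
 proof -
  have *: "c t * v (s t) a = w (Suc N) t a / sqrt (\<Sum>b<d. (w (Suc N) t b)\<^sup>2)" and nz: "(\<Sum>b<d. (w (Suc N) t b)\<^sup>2) ~= 0" if t: "t : ?D" for t
  proof -
   obtain l where l: "l ~= 0" "!!a. w (Suc N) t a = l * v (s t) a"
    using w_eq[OF _ t, of "Suc N"] \<open>u (Suc N) = 1\<close> R1 by auto
   have 1: "(\<Sum>b<d. (w (Suc N) t b)\<^sup>2) = l\<^sup>2"
    using v1[OF t] by(simp add: l(2) power_mult_distrib flip: sdl)
   have "(\<Sum>a<d. w (Suc N) t a * v (s t) a) = l * (\<Sum>a<d. (v (s t) a)\<^sup>2)"
    by(simp add: l(2) sdl p2_eq ac_simps)
   hence "(\<Sum>a<d. w (Suc N) t a * v (s t) a) = l" using v1[OF t] by simp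
   hence ct: "c t = sgn l" using l by(auto simp: c_def sgn_if)
   thus "c t * v (s t) a = w (Suc N) t a / sqrt (\<Sum>b<d. (w (Suc N) t b)\<^sup>2)"
    unfolding 1 ct using l(1) by(simp add: l(2) sgn_if)
   show "(\<Sum>b<d. (w (Suc N) t b)\<^sup>2) ~= 0" unfolding 1 using l by simp
  qed
  have "continuous_on ?D (%t. w (Suc N) t a / sqrt (\<Sum>b<d. (w (Suc N) t b)\<^sup>2))"
   using nz by(intro continuous_intros w_cont) auto
  thus ?thesis using * by(simp cong: continuous_on_cong)
 qed
 have "line_lift v p s c"
  unfolding line_lift_def cmap_sx_top using cont by(auto simp: c_def)
 thus ?thesis by(rule exI[of _ c])
qed

text \<open>The inner product of the two lifted vectors is \<open>c t * c' t\<close>. It is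
  continuous and never zero, so its sign is constant on the connected simplex.\<close>

lemma line_lift_unique:
 assumes v: "line_field d X v" and s: "ssx p X s"
  and c: "line_lift v p s c" "line_lift v p s c'" and t: "t : stdx p" "t' : stdx p"
 shows "c t = c t' \<longleftrightarrow> c' t = c' t'"
proof -
 let ?f = "%t. \<Sum>a<d. (c t * v (s t) a) * (c' t * v (s t) a)"
 have eq: "?f t = c t * c' t" if "t : stdx p" for t
 proof -
  have "s t : topspace X" using s that by(auto simp: ssx_d cm_def)
  hence "(\<Sum>a<d. (v (s t) a)\<^sup>2) = 1" using v by(simp add: line_field_def)
  moreover have "?f t = c t * c' t * (\<Sum>a<d. (v (s t) a)\<^sup>2)"
   by(simp add: sdl p2_eq ac_simps)
  ultimately show ?thesis by simp
 qed
 have pm: "c t = 1 \<or> c t = -1" "c' t = 1 \<or> c' t = -1" if "t : stdx p" for t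
  using c that by(auto simp: line_lift_def)
 have "cmap (sx_top p) eur ?f"
 proof (intro cm_sum)
  fix a
  have "cmap (sx_top p) eur (%t. c t * v (s t) a)"
   "cmap (sx_top p) eur (%t. c' t * v (s t) a)"
   using c unfolding line_lift_def by blast+
  thus "cmap (sx_top p) eur (%t. (c t * v (s t) a) * (c' t * v (s t) a))"
   by(rule cm_mult)
 qed auto
 moreover have "?f t ~= 0" if "t : stdx p" for t using eq[OF that] pm[OF that] by auto
 ultimately have "?f t < 0 \<longleftrightarrow> ?f t' < 0" using t by(intro sx_sign_constant)
 thus ?thesis using eq[OF t(1)] eq[OF t(2)] pm[OF t(1)] pm[OF t(2)] by auto
qed

lemma chi_lift:
 assumes "line_field d X v" "ssx 1 X s" "line_lift v 1 s c"
 shows "chi X v 1 s = (if c (vertex 0) = c (vertex 1) then 0 else 1)"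
proof -
 have "vertex 0 : stdx 1" "vertex 1 : stdx 1" by simp_all
 hence "(EX c'. line_lift v 1 s c' & c' (vertex 0) ~= c' (vertex 1)) \<longleftrightarrow> c (vertex 0) ~= c (vertex 1)"
  using line_lift_unique[OF assms(1,2)] assms(3) by blast
 thus ?thesis using assms(2) by(simp add: chi_def)
qed

lemma chi_other: "p ~= 1 ==> chi X v p s = 0" "~ ssx p X s ==> chi X v p s = 0"
 by(auto simp: chi_def)

lemma cch_on_chi [simp]: "cch_on X (chi X v) = chi X v"
 by(auto simp: cch_on_def fun_eq_iff chi_other)

lemma line_lift_face:
 assumes c: "line_lift v p s c" and p: "1 <= p" "k <= p"
 shows "line_lift v (p - 1) (sface p k s) (c o simplical_face k)"
proof -
 have f: "simplical_face k t : stdx p" if "t : stdx (p - 1)" for t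
  using simplical_face_in_standard_simplex[of p k t] p that by simp
 have cf: "cmap (sx_top (p - 1)) (sx_top p) (simplical_face k)"
  unfolding cm_into continuous_map_componentwise
 proof (intro conjI ballI)
  fix i
  show "cmap (sx_top (p - 1)) eur (%x. simplical_face k x i)"
   unfolding simplical_face_def
   by(cases "i < k"; cases "i = k") (auto intro!: cmap_sx_coord)
 qed (use f in auto)
 show ?thesis unfolding line_lift_def
 proof (intro conjI ballI allI)
  fix t assume "t : stdx (p - 1)"
  thus "(c o simplical_face k) t = 1 \<or> (c o simplical_face k) t = -1"
   using c f by(simp add: line_lift_def)
 next
  fix a
  have "cmap (sx_top (p - 1)) eur ((%t. c t * v (s t) a) o simplical_face k)"
   by(rule cm_comp[OF cf]) (use c in \<open>simp add: line_lift_def\<close>)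
  thus "cmap (sx_top (p - 1)) eur (%t. (c o simplical_face k) t * v (sface p k s t) a)"
   by(rule cm_eq) (simp add: singular_face_def)
 qed
qed

lemma simplical_face_vertex: "simplical_face k (vertex i) = vertex (if i < k then i else Suc i)"
 by(auto simp: simplical_face_def fun_eq_iff)

text \<open>One lift over a 2-simplex computes the values on all three edges, and each vertex sign
  enters two of them.\<close>

lemma cyc_chi:
 assumes v: "line_field d X v" shows "cyc X (chi X v)"
 unfolding cyc_def
proof (intro ext)
 fix p s
 show "dl X (chi X v) p s = 0 p s"
 proof (cases "p = 2 & ssx 2 X s")
  case True
  hence s: "ssx 2 X s" by simp
  obtain c where c: "line_lift v 2 s c" using line_lift_exists[OF v s] by blast
  have chi: "chi X v 1 (sface 2 k s) = (if c (simplical_face k (vertex 0)) = c (simplical_face k (vertex 1)) then 0 else 1)" if "k <= 2" for k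
   using chi_lift[OF v, of "sface 2 k s" "c o simplical_face k"] line_lift_face[OF c _ that] ssx_face[OF s _ that] that by simp
  have "dl X (chi X v) 2 s = (\<Sum>k\<le>2. chi X v 1 (sface 2 k s))"
   using s by(simp add: coboundary_def)
  also have "... = chi X v 1 (sface 2 0 s) + (chi X v 1 (sface 2 1 s) + chi X v 1 (sface 2 2 s))"
   by(simp add: numeral_2_eq_2 add.assoc)
  also have "... = (if c (vertex 1) = c (vertex 2) then 0 else 1) +
    ((if c (vertex 0) = c (vertex 2) then 0 else 1) + (if c (vertex 0) = c (vertex 1) then 0 else 1))"
   by(simp only: chi le0 one_le_numeral order_refl simplical_face_vertex) (simp add: numeral_2_eq_2)
  also have "... = 0"
  proof -
   have "c (vertex i) = 1 \<or> c (vertex i) = -1" if "i <= 2" for i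
    using c that by(simp add: line_lift_def)
   from this[of 0] this[of 1] this[of 2] show ?thesis by auto
  qed
  finally show ?thesis using True by(simp add: cch_apply)
 next
  case False
  have "p - 1 ~= 1" if "0 < p" "ssx p X s"
  proof
   assume "p - 1 = 1"
   hence "p = 2" by simp
   thus False using False that by simp
  qed
  thus ?thesis by(simp add: coboundary_def cch_apply chi_other)
 qed
qed

lemma line_field_compose:
 assumes "line_field d Y v" "cmap X Y f" shows "line_field d X (v o f)"
proof -
 have "f x : topspace Y" if "x : topspace X" for x using assms(2) that by(auto simp: cm_def)
 moreover have "cmap X eur ((%y. v y a * v y b) o f)" for a b
  by(rule cm_comp[OF assms(2)]) (use assms(1) in \<open>simp add: line_field_def\<close>)
 ultimately show ?thesis using assms(1) by(simp add: line_field_def o_def)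
qed

lemma line_field_sub: "line_field d X v ==> line_field d (subt X U) v"
 unfolding line_field_def by(auto intro: cm_sub)

lemma line_lift_cong:
 assumes "!!t. t : stdx p ==> v (s t) = v' (s' t)"
 shows "line_lift v p s c \<longleftrightarrow> line_lift v' p s' c"
 unfolding line_lift_def using assms by(auto elim!: cm_eq)

lemma pb_chi:
 assumes "cmap X Y f" shows "pb X f (chi Y v) = chi X (v o f)"
proof (intro ext)
 fix p s
 have "line_lift v 1 (smap 1 f s) c \<longleftrightarrow> line_lift (v o f) 1 s c" for c
  by(rule line_lift_cong) (simp add: simplex_map_def)
 thus "pb X f (chi Y v) p s = chi X (v o f) p s"
  using ssx_map[OF _ assms, of 1 s] by(auto simp: pb_d chi_def)
qed

lemma cch_on_chi_sub: "cch_on (subt X U) (chi X v) = chi (subt X U) v"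
 by(auto simp: cch_on_def chi_def fun_eq_iff subtopology_sx)

text \<open>A predicate on points as a 0-cochain. It need not be locally constant; its coboundary
  marks the paths whose ends disagree.\<close>

definition pcch :: "('a => bool) => 'a cochain" where
 "pcch P = (%p s. if p = 0 & P (s (vertex 0)) then 1 else 0)"

lemma dl_pcch:
 assumes "ssx 1 X s"
 shows "dl X (pcch P) 1 s = (if P (s (vertex 0)) = P (s (vertex 1)) then 0 else 1)"
proof -
 have 0: "vertex 0 : stdx 0" by simp
 have "sface 1 k s (vertex 0) = s (simplical_face k (vertex 0))" for k
  using 0 by(simp add: singular_face_def)
 thus ?thesis using assms by(auto simp: coboundary_def pcch_def simplical_face_vertex)
qed

text \<open>
 All comparisons of orientation characters below are instances of this lemma: a continuous
 bilinear form without zeros on two line fields identifies their characters.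
\<close>

lemma chi_bilinear:
 assumes v: "line_field d X v" and v': "line_field d' X v'"
  and m: "!!a b. a < d ==> b < d' ==> cmap X eur (m a b)"
  and ph: "!!x. x : topspace X ==> ph x = (\<Sum>a<d. \<Sum>b<d'. m a b x * v x a * v' x b)"
  and nz: "!!x. x : topspace X ==> ph x ~= 0"
 shows "chi X v + chi X v' = dl X (pcch (%x. ph x < 0))"
proof (intro ext)
 fix p s
 show "(chi X v + chi X v') p s = dl X (pcch (%x. ph x < 0)) p s"
 proof (cases "p = 1 & ssx 1 X s")
  case True
  hence s: "ssx 1 X s" by simp
  obtain c where c: "line_lift v 1 s c" using line_lift_exists[OF v s] by blast
  obtain c' where c': "line_lift v' 1 s c'" using line_lift_exists[OF v' s] by blast
  have xor: "((if A then 0 else 1)::bit) + (if B then 0 else 1) = (if C then 0 else 1)" if "A = (B = C)" for A B C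
   using that by(cases A; cases B; cases C) simp_all
  have sX: "s t : topspace X" if "t : stdx 1" for t
   using s that by(auto simp: ssx_d cm_def)
  \<comment> \<open>The form on the two lifted vectors: continuous without zeros, so of the same
    sign at both ends of the path.\<close>
  let ?f = "%t. c t * c' t * ph (s t)"
  have pm: "c t = 1 \<or> c t = -1" "c' t = 1 \<or> c' t = -1" if "t : stdx 1" for t
   using c c' that by(auto simp: line_lift_def)
  have "cmap (sx_top 1) eur (%t. \<Sum>a<d. \<Sum>b<d'. m a b (s t) * (c t * v (s t) a) * (c' t * v' (s t) b))"
  proof (intro cm_sum)
   fix a b assume "a : {..<d}" "b : {..<d'}"
   hence "cmap (sx_top 1) eur (m a b o s)"
    using m[of a b] s by(intro cm_comp[of _ X]) (auto simp: ssx_d)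
   moreover have "cmap (sx_top 1) eur (%t. c t * v (s t) a)"
    "cmap (sx_top 1) eur (%t. c' t * v' (s t) b)"
    using c c' unfolding line_lift_def by blast+
   ultimately show "cmap (sx_top 1) eur (%t. m a b (s t) * (c t * v (s t) a) * (c' t * v' (s t) b))"
    unfolding o_def by(intro cm_mult[OF cm_mult])
  qed auto
  hence "cmap (sx_top 1) eur ?f"
   by(rule cm_eq) (simp add: ph sX sdl ac_simps)
  moreover have "?f t ~= 0" if "t : stdx 1" for t using pm[OF that] nz[OF sX[OF that]] by auto
  ultimately have "?f (vertex 0) < 0 \<longleftrightarrow> ?f (vertex 1) < 0"
   by(rule sx_sign_constant[where p = 1 and t = "vertex 0" and t' = "vertex 1" and f = ?f]) simp_all
  moreover have "ph (s (vertex 0)) ~= 0" "ph (s (vertex 1)) ~= 0" using nz sX by simp_all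
  ultimately have "(c (vertex 0) = c (vertex 1)) = ((c' (vertex 0) = c' (vertex 1)) = ((ph (s (vertex 0)) < 0) = (ph (s (vertex 1)) < 0)))"
   using pm[of "vertex 0"] pm[of "vertex 1"] by auto
  hence "((if c (vertex 0) = c (vertex 1) then 0 else 1)::bit) + (if c' (vertex 0) = c' (vertex 1) then 0 else 1) =
    (if (ph (s (vertex 0)) < 0) = (ph (s (vertex 1)) < 0) then 0 else 1)"
   by(rule xor) 
  moreover have "p = 1" using True by simp
  ultimately show ?thesis
   by(simp only: cch_apply chi_lift[OF v s c] chi_lift[OF v' s c'] dl_pcch[OF s])
 next
  case False
  have "pcch (%x. ph x < 0) (p - 1) s' = 0" if "0 < p" "p ~= 1" for s'
   using that by(simp add: pcch_def)
  thus ?thesis using False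
   by(cases "p = 1") (simp_all add: cch_apply chi_other coboundary_def)
 qed
qed

text \<open>\<open>chi_bilinear\<close> against a constant line, whose character is zero because the
  constant sign 1 lifts it.\<close>

lemma chi_linear:
 assumes v: "line_field d X v"
  and m: "!!a. a < d ==> cmap X eur (m a)"
  and ph: "!!x. x : topspace X ==> ph x = (\<Sum>a<d. m a x * v x a)"
  and nz: "!!x. x : topspace X ==> ph x ~= 0"
 shows "chi X v = dl X (pcch (%x. ph x < 0))"
proof -
 let ?v' = "%x::'a. vertex 0"
 have v': "line_field 1 X ?v'" by(simp add: line_field_def)
 have "chi X ?v' = 0"
 proof (intro ext)
  fix p s
  show "chi X ?v' p s = 0 p s"
  proof (cases "p = 1 & ssx 1 X s")
   case True
   have "line_lift ?v' 1 s (%_. 1)" by(simp add: line_lift_def)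
   thus ?thesis using chi_lift[OF v', of s "%_. 1"] True by(simp add: cch_apply)
  next
   case False
   thus ?thesis by(cases "p = 1") (simp_all add: chi_other cch_apply)
  qed
 qed
 moreover have "chi X v + chi X ?v' = dl X (pcch (%x. ph x < 0))"
  by(rule chi_bilinear[OF v v', where m = "%a b. m a"]) (use m ph nz in auto)
 ultimately show ?thesis by simp
qed

section \<open>Free cohomology modules over a base\<close>

abbreviation restr :: "'a topology => 'a set => 'a coh => 'a coh" where
 "restr X U == pull (subt X U) (%x. x) X"

lemma cmap_sub_id: "cmap (subt X U) X (%x. x)"
 using continuous_map_id_subt[of X U] by(simp add: id_def)

lemma restr_cls: "cyc X c ==> restr X U (cls X c) = cls (subt X U) c"
proof -
 assume c: "cyc X c"
 have "pb (subt X U) (%x. x) c = cch_on (subt X U) c" by(rule pb_id) simp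
 moreover have "cls (subt X U) (cch_on (subt X U) c) = cls (subt X U) c"
  using cyc_sub[OF c] by(simp add: cls_eq_iff exact_cch_on_add)
 ultimately show ?thesis using c by(simp add: pull_cls cmap_sub_id)
qed

lemma restr_in [simp]: "a : cohs X ==> restr X U a : cohs (subt X U)"
 by(simp add: cmap_sub_id)

text \<open>The zeroth power has to be the unit of the cohomology of \<open>X\<close>, not that of
  the product over all topologies.\<close>

definition cpow :: "'a topology => 'a coh => nat => 'a coh" where
 "cpow X a i = one_at X * a ^ i"

lemma cpow_0: "cpow X a 0 = one_at X"
 and class_power_Suc: "cpow X a (Suc i) = cpow X a i * a"
 by(simp_all add: cpow_def ac_simps)

lemma cpow_in [simp]: "cpow X a i : cohs X"
 by(simp add: cpow_def cohs_mult_any)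

lemma pull_cpow: "cmap X Y f ==> pull X f Y (cpow Y a i) = cpow X (pull X f Y a) i"
 by(induction i) (simp_all add: cpow_0 class_power_Suc pull_one_at pull_mult)

primrec cch_power :: "'a topology => 'a cochain => nat => 'a cochain" where
 "cch_power X x 0 = unc X"
| "cch_power X x (Suc i) = cup X (cch_power X x i) x"

lemma cyc_cch_power [simp]: "cyc X x ==> cyc X (cch_power X x i)"
 by(induction i) (simp_all add: cyc_unit cyc_cup)

lemma cls_cch_power: "cyc X x ==> cls X (cch_power X x i) = cpow X (cls X x) i"
 by(induction i) (simp_all add: cpow_0 class_power_Suc one_at_def cls_cup)

lemma pb_cch_power:
 assumes "cmap X Y f" shows "pb X f (cch_power Y x i) = cch_power X (pb X f x) i"
 by(induction i) (simp_all add: pb_unit[OF assms] pb_cup[OF assms])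

lemma cch_on_cch_power: "cch_on (subt X U) (cch_power X x i) = cch_power (subt X U) x i"
proof (induction i)
 case 0
 show ?case by(auto simp: cch_on_def unit_cochain_def fun_eq_iff subtopology_sx)
next
 case (Suc i)
 have "cch_on (subt X U) (cch_power X x (Suc i)) = cup (subt X U) (cch_power X x i) x"
  by(simp add: cup_sub)
 also have "... = cup (subt X U) (cch_on (subt X U) (cch_power X x i)) x" by simp
 finally show ?case by(simp add: Suc)
qed

lemma cls_cup_list:
 "ALL i:set is. cyc X (c i) ==> cls X (cup_list X c is) = one_at X * prod_list (map (%i. cls X (c i)) is)"
 by(induction "is") (simp_all add: cup_list_Nil cup_list_Cons cls_cup cyc_cup_list one_at_def ac_simps)

lemma cup_length_classes:
 assumes a: "!!i. i : set is ==> a i : cohs X" and op: "!!i. i : set is ==> openin X (U i)"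
  and res: "!!i. i : set is ==> restr X (U i) (a i) = 0"
  and cover: "topspace X <= (\<Union>i\<in>set is. U i)"
 shows "one_at X * prod_list (map a is) = 0"
proof -
 have "ALL i:set is. EX c. cyc X c & a i = cls X c"
  using a by(auto simp: cohs_def)
 hence "EX c. ALL i:set is. cyc X (c i) & a i = cls X (c i)" by(rule bchoice)
 then obtain c where c: "!!i. i : set is ==> cyc X (c i)" "!!i. i : set is ==> a i = cls X (c i)" by blast
 have ex: "exact (subt X (U i)) (c i)" if "i : set is" for i
  using res[OF that] c[OF that] by(simp add: restr_cls cls_eq_0_iff cyc_sub)
 have "cls X (cup_list X c is) = 0"
  using cup_length[OF c(1) op ex cover] c(1) by(simp add: cls_eq_0_iff cyc_cup_list)
 moreover have "map (%i. cls X (c i)) is = map a is" using c(2) by simp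
 ultimately show ?thesis using cls_cup_list[of "is" X c] c(1) by simp
qed

definition free_over :: "'a topology => ('a => 'b) => 'b topology => nat => (nat => 'a coh) => bool" where
 "free_over W pj U m g \<longleftrightarrow>
  (ALL y:cohs W. EX u. (ALL i<m. u i : cohs U) & y = (\<Sum>i<m. g i * pull W pj U (u i))) &
  (ALL u. (ALL i<m. u i : cohs U) --> (\<Sum>i<m. g i * pull W pj U (u i)) = 0 --> (ALL i<m. u i = 0))"

lemma free_over_span:
 assumes "free_over W pj U m g" "y : cohs W"
 shows "EX u. (ALL i<m. u i : cohs U) & y = (\<Sum>i<m. g i * pull W pj U (u i))"
 using assms unfolding free_over_def by blast

lemma free_over_indep:
 assumes "free_over W pj U m g" "!!i. i < m ==> u i : cohs U"
  "(\<Sum>i<m. g i * pull W pj U (u i)) = 0" "i < m"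
 shows "u i = 0"
 using assms unfolding free_over_def by blast

text \<open>The homotopy says that pulling back along \<open>f\<close> and then along
  \<open>r\<close> is the identity on the cohomology of \<open>W\<close>. So the coefficients of the
  pullback of \<open>y\<close> to \<open>W'\<close> serve for \<open>y\<close>, and a relation over
  \<open>W\<close> is tested on \<open>W'\<close>.\<close>

lemma free_over_transfer:
 assumes f: "cmap W' W f" and r: "cmap W W' r"
  and pj: "cmap W U pj" and pj': "cmap W' U pj'"
  and pjf: "!!x. x : topspace W' ==> pj (f x) = pj' x" and pjr: "!!x. x : topspace W ==> pj' (r x) = pj x"
  and h: "homotopic_with (%_. True) W W (f o r) id"
  and g: "!!i. i < m ==> g i : cohs W"
  and free: "free_over W' pj' U m (%i. pull W' f W (g i))"
 shows "free_over W pj U m g"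
 unfolding free_over_def
proof (intro conjI ballI allI impI)
 have fr: "pull W r W' (pull W' f W a) = a" if "a : cohs W" for a
  using pull_pull[OF r f that] pull_homotopic[OF h that] pull_id[of W id a] that by simp
 have pf: "pull W' f W (pull W pj U u) = pull W' pj' U u" if "u : cohs U" for u
  using pull_pull[OF f pj that] pull_cong[OF pj', of "pj o f" u] that pjf by simp
 have pr: "pull W r W' (pull W' pj' U u) = pull W pj U u" if "u : cohs U" for u
  using pull_pull[OF r pj' that] pull_cong[OF pj, of "pj' o r" u] that pjr by simp
 fix y assume y: "y : cohs W"
 have fy: "pull W' f W y : cohs W'" using f y by simp
 obtain u where u_in: "ALL i<m. u i : cohs U" and u_eq: "pull W' f W y = (\<Sum>i<m. pull W' f W (g i) * pull W' pj' U (u i))"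
  using free_over_span[OF free fy] by(elim exE conjE) (rule that)
 hence u: "!!i. i < m ==> u i : cohs U" "pull W' f W y = (\<Sum>i<m. pull W' f W (g i) * pull W' pj' U (u i))" by blast+
 have "y = pull W r W' (\<Sum>i<m. pull W' f W (g i) * pull W' pj' U (u i))" using fr[OF y] u(2) by simp
 also have "... = (\<Sum>i<m. g i * pull W pj U (u i))"
  unfolding pull_sum pull_mult by(intro sum.cong refl) (simp add: fr g pr u)
 finally show "EX u. (ALL i<m. u i : cohs U) & y = (\<Sum>i<m. g i * pull W pj U (u i))" using u by blast
next
 fix u i assume u: "ALL i<m. u i : cohs U" "(\<Sum>i<m. g i * pull W pj U (u i)) = 0" and i: "i < m"
 have pf: "pull W' f W (pull W pj U u) = pull W' pj' U u" if "u : cohs U" for u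
  using pull_pull[OF f pj that] pull_cong[OF pj', of "pj o f" u] that pjf by simp
 have "(\<Sum>i<m. pull W' f W (g i) * pull W' pj' U (u i)) = pull W' f W (\<Sum>i<m. g i * pull W pj U (u i))"
  unfolding pull_sum pull_mult by(intro sum.cong refl) (simp add: pf u)
 also have "... = 0" using u by simp
 finally show "u i = 0" using free_over_indep[OF free, of u i] u(1) i by blast
qed

lemma free_over_cong:
 assumes "free_over W pj U m g" "!!i. i < m ==> g i = g' i" shows "free_over W pj U m g'"
proof -
 have "(\<Sum>i<m. g i * pull W pj U (u i)) = (\<Sum>i<m. g' i * pull W pj U (u i))" for u
  using assms(2) by(intro sum.cong) auto
 thus ?thesis using assms(1) by(simp add: free_over_def)
qed

lemma pull_restr:
 assumes "cmap X U pj" "u : cohs U"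
 shows "restr X A (pull X pj U u) = pull (subt X A) pj U u"
 using pull_pull[OF cmap_sub_id assms, of A] by(simp add: o_def)

lemma restr_restr:
 assumes "a : cohs X" "B <= A"
 shows "pull (subt X B) (%x. x) (subt X A) (restr X A a) = restr X B a"
proof -
 have "cmap (subt X B) (subt X A) (%x. x)"
  using assms(2) by(auto simp: cm_into cmap_sub_id)
 thus ?thesis using pull_pull[OF _ cmap_sub_id assms(1)] by(simp add: o_def)
qed

text \<open>The Mayer--Vietoris step: an open set on which the powers of \<open>x\<close> up to \<open>k - 1\<close> form a basis is joined with one on which the cohomology is that of the base.\<close>

lemma free_over_join:
 fixes X :: "'a topology" and U :: "'b topology"
 assumes op: "openin X A" "openin X B" and cover: "topspace X <= A Un B"
  and pj: "cmap X U pj" and x: "cyc X x" and k: "0 < k"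
  and al: "cch_power (subt X A) x k = dl (subt X A) al"
  and be: "cch_power (subt X B) x k = dl (subt X B) be"
  and xB: "exact (subt X B) x"
  and freeA: "free_over (subt X A) pj U k (cpow (subt X A) (cls (subt X A) x))"
  and freeB: "free_over (subt X B) pj U 1 (%i. one_at (subt X B))"
  and freeAB: "free_over (subt X (A Int B)) pj U 2
   (%i. if i = 0 then one_at (subt X (A Int B)) else cls (subt X (A Int B)) (al + be))"
 shows "free_over X pj U (Suc k) (cpow X (cls X x))"
proof -
 let ?A = "subt X A" and ?B = "subt X B" and ?AB = "subt X (A Int B)"
 let ?x = "cls X x" and ?g = "cls ?AB (al + be)"
 have pjA: "cmap ?A U pj" and pjB: "cmap ?B U pj" and pjAB: "cmap ?AB U pj"
  using pj by(simp_all add: cm_sub)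
 have xA: "restr X A (cpow X ?x i) = cpow ?A (cls ?A x) i" for i
  by(simp add: pull_cpow cmap_sub_id restr_cls x)
 have xAk: "cpow ?A (cls ?A x) k = 0"
 proof -
  have "exact ?A (cch_power ?A x k)" unfolding al by simp
  thus ?thesis using x by(simp flip: cls_cch_power add: cyc_sub cls_eq_0_iff)
 qed
 have xB0: "cls ?B x = 0" using xB cyc_sub[OF x] by(simp add: cls_eq_0_iff)
 have xAB0: "cls ?AB x = 0"
 proof -
  have "restr X (A Int B) ?x = pull ?AB (%x. x) ?B (restr X B ?x)"
   by(rule restr_restr[symmetric]) (use x in auto)
  thus ?thesis using xB0 x by(simp add: restr_cls)
 qed
 have sub1: "cch_on ?AB (dl ?A c) = dl ?AB c" "cch_on ?AB (dl ?B c) = dl ?AB c" for c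
  using dl_sub[of ?A B c] dl_sub[of ?B A c] by(simp_all add: subtopology_subtopology Int_commute)
 have subA: "cch_on ?AB (cch_on ?A c) = cch_on ?AB c" "cch_on ?AB (cch_on ?B c) = cch_on ?AB c" for c
  using cch_on_sub[of ?A B c] cch_on_sub[of ?B A c] by(simp_all add: subtopology_subtopology Int_commute)
 have albe: "cyc ?AB (al + be)"
 proof -
  have "dl ?AB (al + be) = cch_on ?AB (cch_power ?A x k) + cch_on ?AB (cch_power ?B x k)"
   by(simp only: coboundary_add al be sub1)
  also have "... = 0" by(simp only: subA flip: cch_on_cch_power) simp
  finally show ?thesis by(simp add: cyc_def)
 qed
 have AB_indep: "s = 0 & t = 0"
  if "s : cohs U" "t : cohs U" "pull ?AB pj U s + ?g * pull ?AB pj U t = 0" for s t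
 proof -
  let ?u = "%i::nat. if i = 0 then s else t"
  have "(\<Sum>i<2. (if i = 0 then one_at ?AB else ?g) * pull ?AB pj U (?u i)) = 0"
   using that pjAB by(simp add: numeral_2_eq_2 one_at_mult)
  hence "?u i = 0" if "i < 2" for i
   using free_over_indep[OF freeAB, of ?u i] that \<open>s : _\<close> \<open>t : _\<close> by simp
  from this[of 0] this[of 1] show ?thesis by simp
 qed
 have spanB: "EX u:cohs U. z = pull ?B pj U u" if z: "z : cohs ?B" for z
 proof -
  obtain u :: "nat => 'b coh" where u_in: "ALL i<1. u i : cohs U" and u_eq: "z = (\<Sum>i<1. one_at ?B * pull ?B pj U (u i))"
   using free_over_span[OF freeB z] by(elim exE conjE) (rule that)
  hence span: "!!i. i < 1 ==> u i : cohs U" "z = (\<Sum>i<1. one_at ?B * pull ?B pj U (u i))" by blast+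
  thus ?thesis using pjB by(intro bexI[of _ "u 0"]) (simp_all add: one_at_mult)
 qed
 have cupA: "cup ?A (cch_power X x k) d = dl ?A (cup ?A al d)" if "cyc X d" for d
 proof -
  have "cup ?A (cch_power X x k) d = cup ?A (cch_on ?A (cch_power X x k)) d" by simp
  also have "... = cup ?A (dl ?A al) d" by(simp only: cch_on_cch_power al)
  also have "... = dl ?A (cup ?A al d)"
   using cyc_sub[OF that, of A] by(simp add: leibniz cyc_def cup_0)
  finally show ?thesis .
 qed
 have cupB: "cup ?B (cch_power X x k) d = dl ?B (cup ?B be d)" if "cyc X d" for d
 proof -
  have "cup ?B (cch_power X x k) d = cup ?B (cch_on ?B (cch_power X x k)) d" by simp
  also have "... = cup ?B (dl ?B be) d" by(simp only: cch_on_cch_power be)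
  also have "... = dl ?B (cup ?B be d)"
   using cyc_sub[OF that, of B] by(simp add: leibniz cyc_def cup_0)
  finally show ?thesis .
 qed
 have cup_AB: "cch_on ?AB (cup ?A c d) = cup ?AB c d" "cch_on ?AB (cup ?B c d) = cup ?AB c d" for c d
  using cup_sub[of ?A B c d] cup_sub[of ?B A c d] by(simp_all add: subtopology_subtopology Int_commute)
 show ?thesis
  unfolding free_over_def
 proof (intro conjI ballI allI impI)
  fix y assume y: "y : cohs X"
  obtain u where u_in: "ALL i<k. u i : cohs U" and u_eq: "restr X A y = (\<Sum>i<k. cpow ?A (cls ?A x) i * pull ?A pj U (u i))"
   using free_over_span[OF freeA restr_in[OF y]] by(elim exE conjE) (rule that)
  hence u: "!!i. i < k ==> u i : cohs U" "restr X A y = (\<Sum>i<k. cpow ?A (cls ?A x) i * pull ?A pj U (u i))" by blast+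
  \<comment> \<open>Subtracting the expansion over \<open>A\<close> leaves a class that vanishes on
    \<open>A\<close>. On \<open>B\<close> it comes from a class \<open>w\<close> of the base, which
    dies on the intersection and is therefore 0.\<close>
  define y1 where "y1 = y + (\<Sum>i<k. cpow X ?x i * pull X pj U (u i))"
  have y1: "y1 : cohs X" unfolding y1_def using y u pj by(intro cohs_add cohs_sum cohs_mult) auto
  have "restr X A (\<Sum>i<k. cpow X ?x i * pull X pj U (u i)) = restr X A y"
   unfolding u(2) pull_sum pull_mult xA by(intro sum.cong refl) (simp add: pull_restr[OF pj] u)
  hence y1A: "restr X A y1 = 0" by(simp add: y1_def pull_add)
  obtain w where w: "w : cohs U" "restr X B y1 = pull ?B pj U w" using spanB[OF restr_in[OF y1]] by blast
  have "pull ?AB pj U w = pull ?AB (%x. x) ?B (restr X B y1)"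
  proof -
   have c: "cmap ?AB ?B (%x. x)" by(auto simp: cm_into cmap_sub_id)
   show ?thesis unfolding w(2) using pull_pull[OF c pjB w(1)] by(simp add: o_def)
  qed
  also have "... = restr X (A Int B) y1" using y1 by(intro restr_restr) auto
  also have "... = pull ?AB (%x. x) ?A (restr X A y1)" using y1 by(intro restr_restr[symmetric]) auto
  also have "... = 0" by(simp add: y1A)
  finally have "w = 0" using AB_indep[of w 0] w by simp
  hence y1B: "restr X B y1 = 0" using w by simp
  obtain c where c: "cyc X c" "y1 = cls X c" using y1 by(rule cohsE)
  have "exact ?A c" "exact ?B c"
   using y1A y1B c by(simp_all add: restr_cls cls_eq_0_iff cyc_sub)
  then obtain a b where a: "cch_on ?A c = dl ?A a" and b: "cch_on ?B c = dl ?B b"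
   by(elim exactE)
  have "dl ?AB (a + b) = cch_on ?AB (cch_on ?A c) + cch_on ?AB (cch_on ?B c)"
   by(simp only: coboundary_add a b sub1)
  also have "... = 0" by(simp only: subA cch_add_self)
  finally have ab: "cyc ?AB (a + b)" by(simp add: cyc_def)
  obtain st :: "nat => 'b coh" where st_in: "ALL i<2. st i : cohs U" and st_eq: "cls ?AB (a + b) = (\<Sum>i<2. (if i = 0 then one_at ?AB else ?g) * pull ?AB pj U (st i))"
   using free_over_span[OF freeAB cls_in_cohs[OF ab]] by(elim exE conjE) (rule that)
  hence st: "!!i. i < 2 ==> st i : cohs U" "cls ?AB (a + b) = (\<Sum>i<2. (if i = 0 then one_at ?AB else ?g) * pull ?AB pj U (st i))" by blast+
  obtain s where s: "cyc U s" "st 0 = cls U s" using st(1)[of 0] by(auto elim: cohsE)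
  obtain t where t: "cyc U t" "st 1 = cls U t" using st(1)[of 1] by(auto elim: cohsE)
  define ps where "ps = pb X pj s"
  define pt where "pt = pb X pj t"
  have ps: "cyc X ps" and pt: "cyc X pt" using s t pj by(simp_all add: ps_def pt_def cyc_pb)
  have clsAB: "pull ?AB pj U (cls U s) = cls ?AB ps" "pull ?AB pj U (cls U t) = cls ?AB pt"
  proof -
   have "pull ?AB pj U (cls U s) = restr X (A Int B) (pull X pj U (cls U s))" "pull ?AB pj U (cls U t) = restr X (A Int B) (pull X pj U (cls U t))"
    using s t pull_restr[OF pj] by simp_all
   thus "pull ?AB pj U (cls U s) = cls ?AB ps" "pull ?AB pj U (cls U t) = cls ?AB pt"
    using s t ps pt by(simp_all add: pull_cls[OF pj] restr_cls ps_def pt_def)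
  qed
  have ps': "cyc ?AB ps" and pt': "cyc ?AB pt" using ps pt by(simp_all add: cyc_sub)
  have "cls ?AB (a + b) = cls ?AB ps + ?g * cls ?AB pt"
   using st(2) s t by(simp add: numeral_2_eq_2 clsAB one_at_mult ps')
  also have "... = cls ?AB (ps + cup ?AB (al + be) pt)"
   using albe ps' pt' by(simp add: cls_add cls_cup cyc_cup)
  finally have ex: "exact ?AB ((a + b) + (ps + cup ?AB (al + be) pt))"
   using cls_eq_iff[OF ab] albe ps' pt' by(simp add: cyc_add cyc_cup)
  \<comment> \<open>Primitives are \<open>a + ps\<close> plus the product of \<open>al\<close> and
    \<open>pt\<close> on \<open>A\<close>, and \<open>b\<close> plus the product of
    \<open>be\<close> and \<open>pt\<close> on \<open>B\<close>; \<open>s\<close> and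
    \<open>t\<close> were chosen so that their sum is exact on the intersection. Hence
    \<open>y1\<close> is \<open>x ^ k\<close> times the pullback of \<open>t\<close>.\<close>
  let ?y2 = "c + cup X (cch_power X x k) pt"
  have "exact X ?y2"
  proof (rule mayer_vietoris_exact[OF op cover])
   show "cyc X ?y2" using c x pt by(intro cyc_add cyc_cup) simp_all
   show "cch_on ?A ?y2 = dl ?A (a + ps + cup ?A al pt)"
    using cyc_sub[OF ps, of A] by(simp add: cch_on_add a cup_sub cupA[OF pt] coboundary_add cyc_def)
   show "cch_on ?B ?y2 = dl ?B (b + cup ?B be pt)"
    by(simp add: cch_on_add b cup_sub cupB[OF pt] coboundary_add)
   have "cch_on ?AB ((a + ps + cup ?A al pt) + (b + cup ?B be pt)) = cch_on ?AB ((a + b) + (ps + cup ?AB (al + be) pt))"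
    by(simp add: cch_on_add cup_AB cup_add_left ac_simps)
   thus "exact ?AB ((a + ps + cup ?A al pt) + (b + cup ?B be pt))"
    using ex by(metis exact_cch_on)
  qed
  hence "cls X ?y2 = 0" using c x pt by(simp add: cls_eq_0_iff cyc_add cyc_cup)
  hence "y1 + cpow X ?x k * pull X pj U (cls U t) = 0"
   using c x pt t pj by(simp add: cls_add cls_cup cyc_cup cls_cch_power pull_cls pt_def)
  hence y1_eq: "y1 = cpow X ?x k * pull X pj U (cls U t)" by(simp add: coh_add_eq_0)
  show "EX u. (ALL i<Suc k. u i : cohs U) & y = (\<Sum>i<Suc k. cpow X ?x i * pull X pj U (u i))"
  proof (intro exI conjI allI impI)
   let ?u = "%i. if i < k then u i else cls U t"
   show "?u i : cohs U" for i using u t by simp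
   have "y = (\<Sum>i<k. cpow X ?x i * pull X pj U (u i)) + y1"
    by(simp add: y1_def add.commute add.left_commute)
   thus "y = (\<Sum>i<Suc k. cpow X ?x i * pull X pj U (?u i))"
    by(simp add: y1_eq)
  qed
 next
  fix u i assume u: "ALL i<Suc k. u i : cohs U" and 0: "(\<Sum>i<Suc k. cpow X ?x i * pull X pj U (u i)) = 0"
   and i: "i < Suc k"
  have "restr X A (\<Sum>i<Suc k. cpow X ?x i * pull X pj U (u i)) = (\<Sum>i<Suc k. cpow ?A (cls ?A x) i * pull ?A pj U (u i))"
   unfolding pull_sum pull_mult xA using u by(intro sum.cong refl) (simp add: pull_restr[OF pj])
  hence "(\<Sum>i<k. cpow ?A (cls ?A x) i * pull ?A pj U (u i)) = 0"
   using 0 by(simp add: xAk)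
  hence u0: "u i = 0" if "i < k" for i using free_over_indep[OF freeA, of u i] u that by simp
  have "(\<Sum>i<k. cpow X ?x i * pull X pj U (u i)) = 0" using u0 by(intro sum.neutral) simp
  hence k0: "cpow X ?x k * pull X pj U (u k) = 0" using 0 by simp
  obtain t where t: "cyc U t" "u k = cls U t" using u by(auto elim: cohsE)
  define pt where "pt = pb X pj t"
  have pt: "cyc X pt" using t pj by(simp add: pt_def cyc_pb)
  have "cls X (cup X (cch_power X x k) pt) = 0"
   using k0 x pt t pj by(simp add: cls_cup cls_cch_power pull_cls pt_def)
  \<comment> \<open>Adding \<open>v\<close> to the products of \<open>al\<close> and of
    \<open>be\<close> with \<open>pt\<close> gives cocycles on \<open>A\<close> and on
    \<open>B\<close>. On the intersection both come from the base, as \<open>x\<close> dies on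
    \<open>B\<close>; their sum is the second basis element times \<open>u k\<close>, so
    \<open>u k = 0\<close>.\<close>
  then obtain v where v: "cch_on X (cup X (cch_power X x k) pt) = dl X v"
   using x pt by(auto simp: cls_eq_0_iff cyc_cup elim: exactE)
  have vA: "cyc ?A (cup ?A al pt + v)"
  proof -
   have "dl ?A v = cch_on ?A (cup X (cch_power X x k) pt)"
    using v by(simp flip: dl_sub)
   thus ?thesis by(simp add: cyc_def coboundary_add cup_sub cupA[OF pt])
  qed
  have vB: "cyc ?B (cup ?B be pt + v)"
  proof -
   have "dl ?B v = cch_on ?B (cup X (cch_power X x k) pt)"
    using v by(simp flip: dl_sub)
   thus ?thesis by(simp add: cyc_def coboundary_add cup_sub cupB[OF pt])
  qed
  have cA: "cmap ?AB ?A (%x. x)" and cB: "cmap ?AB ?B (%x. x)"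
   by(auto simp: cm_into cmap_sub_id)
  obtain a where a_in: "ALL i<k. a i : cohs U" and a_eq: "cls ?A (cup ?A al pt + v) = (\<Sum>i<k. cpow ?A (cls ?A x) i * pull ?A pj U (a i))"
   using free_over_span[OF freeA cls_in_cohs[OF vA]] by(elim exE conjE) (rule that)
  hence a: "!!i. i < k ==> a i : cohs U" "cls ?A (cup ?A al pt + v) = (\<Sum>i<k. cpow ?A (cls ?A x) i * pull ?A pj U (a i))" by blast+
  have toA: "pull ?AB (%x. x) ?A (cls ?A c) = cls ?AB c" if "cyc ?A c" for c
   using restr_cls[OF that, of "B"] by(simp add: subtopology_subtopology)
  have toB: "pull ?AB (%x. x) ?B (cls ?B c) = cls ?AB c" if "cyc ?B c" for c
   using restr_cls[OF that, of "A"] by(simp add: subtopology_subtopology Int_commute)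
  have "cls ?AB (cup ?A al pt + v) = (\<Sum>i<k. cpow ?AB 0 i * pull ?AB pj U (a i))"
   unfolding toA[OF vA, symmetric] a(2) pull_sum pull_mult pull_cpow[OF cA]
   using a(1) pull_pull[OF cA pjA] by(intro sum.cong refl) (simp add: toA cyc_sub x xAB0 o_def)
  also have "... = (\<Sum>i\<in>{0}. cpow ?AB 0 i * pull ?AB pj U (a i))"
   using k by(intro sum.mono_neutral_right) (auto simp: cpow_def power_0_left split: if_splits)
  also have "... = pull ?AB pj U (a 0)" using k a pjAB by(simp add: cpow_0 one_at_mult)
  finally have A0: "cls ?AB (cup ?A al pt + v) = pull ?AB pj U (a 0)" .
  obtain b where b: "b : cohs U" "cls ?B (cup ?B be pt + v) = pull ?B pj U b"
   using spanB[OF cls_in_cohs[OF vB]] by blast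
  have B0: "cls ?AB (cup ?B be pt + v) = pull ?AB pj U b"
   unfolding toB[OF vB, symmetric] b(2) using pull_pull[OF cB pjB b(1)] by(simp add: o_def)
  have cAB: "cyc ?AB (cup ?A al pt + v)" "cyc ?AB (cup ?B be pt + v)"
   using cyc_sub[OF vA, of B] cyc_sub[OF vB, of A] by(simp_all add: subtopology_subtopology Int_commute)
  have "cls ?AB (cup ?AB (al + be) pt) = cls ?AB ((cup ?A al pt + v) + (cup ?B be pt + v))"
  proof -
   have "cch_on ?AB ((cup ?A al pt + v) + (cup ?B be pt + v)) = cup ?AB (al + be) pt + (cch_on ?AB v + cch_on ?AB v)"
    by(simp only: cch_on_add cup_AB cup_add_left ac_simps)
   also have "... = cup ?AB (al + be) pt" by(simp only: cch_add_self add_0_right)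
   finally have "cch_on ?AB (cup ?AB (al + be) pt + ((cup ?A al pt + v) + (cup ?B be pt + v))) = 0"
    by(simp only: cch_on_add cch_on_cup cch_add_self)
   hence "exact ?AB (cup ?AB (al + be) pt + ((cup ?A al pt + v) + (cup ?B be pt + v)))"
    by(metis exact_0 exact_cch_on)
   thus ?thesis
    using cls_eq_iff[OF cyc_cup[OF albe cyc_sub[OF pt]] cyc_add[OF cAB]] by(rule iffD2[rotated])
  qed
  also have "... = pull ?AB pj U (a 0) + pull ?AB pj U b"
   unfolding cls_add[OF cAB] A0 B0 ..
  also have "cls ?AB (cup ?AB (al + be) pt) = ?g * pull ?AB pj U (u k)"
  proof -
   have "pull ?AB pj U (u k) = restr X (A Int B) (pull X pj U (u k))" using u pull_restr[OF pj] by simp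
   also have "... = cls ?AB pt" using t pt by(simp add: pull_cls[OF pj] restr_cls pt_def)
   finally show ?thesis using albe pt by(simp add: cls_cup cyc_sub)
  qed
  finally have "pull ?AB pj U (a 0 + b) + ?g * pull ?AB pj U (u k) = 0" by(simp add: pull_add)
  hence "u k = 0" using AB_indep[of "a 0 + b" "u k"] a(1)[OF k] b u by simp
  thus "u i = 0" using u0 i less_Suc_eq by blast
 qed
qed

section \<open>Double covers and the transfer\<close>

lemma cup_unit_cch_right: "cup X a (unc X) = cch_on X a"
proof (intro ext)
 fix p s
 show "cup X a (unc X) p s = cch_on X a p s"
 proof (cases "ssx p X s")
  case True
  have "(\<Sum>i\<le>p. a i (front_face i s) * unc X (p - i) (back_face i (p - i) s)) =
   (\<Sum>i\<in>{p}. a i (front_face i s) * unc X (p - i) (back_face i (p - i) s))"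
   by(rule sum.mono_neutral_right) (auto simp: unit_cochain_def)
  thus ?thesis using True singular_simplex_back_face[of p 0 X s]
   by(simp add: cup_def unit_cochain_def front_full cch_on_def)
 qed (simp add: cup_def cch_on_def)
qed

text \<open>Covering theory is reduced to what cochains see: simplices of \<open>P\<close> lift, and
  two lifts of the same simplex agree up to the involution \<open>T\<close>.\<close>

locale double_cover =
 fixes S :: "'s topology" and P :: "'p topology" and q :: "'s => 'p" and T :: "'s => 's"
 assumes q: "cmap S P q" and T: "cmap S S T"
  and qT: "!!z. z : topspace S ==> q (T z) = q z" and TT: "!!z. z : topspace S ==> T (T z) = z"
  and ex_lift: "!!p s. ssx p P s ==> EX t. ssx p S t & smap p q t = s"
  and lift_unique: "!!p t t'. ssx p S t ==> ssx p S t' ==>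
   smap p q t = smap p q t' ==> t' = t \<or> t' = smap p T t"
begin

definition some_lift :: "nat => ((nat => real) => 'p) => (nat => real) => 's" where
 "some_lift p s = (SOME t. ssx p S t & smap p q t = s)"

lemma some_lift:
 assumes "ssx p P s"
 shows "ssx p S (some_lift p s)" "smap p q (some_lift p s) = s"
 using someI_ex[OF ex_lift[OF assms]] by(simp_all add: some_lift_def)

definition transfer :: "'s cochain => 'p cochain" where
 "transfer c = (%p s. if ssx p P s
  then c p (some_lift p s) + c p (smap p T (some_lift p s)) else 0)"

lemma sx_map_T:
 assumes "ssx p S t"
 shows "ssx p S (smap p T t)" "smap p q (smap p T t) = smap p q t"
  "smap p T (smap p T t) = t"
proof -
 show "ssx p S (smap p T t)" using assms T by(rule ssx_map)
 have tS: "t x : topspace S" if "x : stdx p" for x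
  using assms that by(auto simp: ssx_d cm_def)
 show "smap p q (smap p T t) = smap p q t"
  using tS by(auto simp: simplex_map_def fun_eq_iff qT)
 show "smap p T (smap p T t) = t"
  using tS assms by(auto simp: simplex_map_def fun_eq_iff TT ssx_d extensional_def)
qed

text \<open>The sum is symmetric in the two lifts, so the choice made by \<open>some_lift\<close>
  does not matter.\<close>

lemma transfer_lift:
 assumes t: "ssx p S t"
 shows "transfer c p (smap p q t) = c p t + c p (smap p T t)"
proof -
 let ?s = "smap p q t" and ?l = "some_lift p (smap p q t)"
 have s: "ssx p P ?s" using t q by(rule ssx_map)
 have "t = ?l \<or> t = smap p T ?l"
  using lift_unique[OF some_lift(1)[OF s] t] some_lift(2)[OF s] by simp
 hence "c p ?l + c p (smap p T ?l) = c p t + c p (smap p T t)"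
  using sx_map_T(3)[OF some_lift(1)[OF s]] by(auto simp: add.commute)
 thus ?thesis using s by(simp add: transfer_def)
qed

lemma liftE:
 assumes "ssx p P s"
 obtains t where "ssx p S t" "s = smap p q t"
 using some_lift[OF assms] by metis

lemma cch_on_transfer [simp]: "cch_on P (transfer c) = transfer c"
 by(auto simp: cch_on_def transfer_def fun_eq_iff)

lemma transfer_add: "transfer (c + d) = transfer c + transfer d"
 by(auto simp: transfer_def fun_eq_iff cch_apply ac_simps)

lemma cch_eqI:
 assumes "!!p t. ssx p S t ==> c p (smap p q t) = d p (smap p q t)"
 shows "cch_on P c = cch_on P d"
proof (intro ext)
 fix p s
 show "cch_on P c p s = cch_on P d p s"
 proof (cases "ssx p P s")
  case True
  then obtain t where "ssx p S t" "s = smap p q t" by(rule liftE)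
  thus ?thesis using assms True by(simp add: cch_on_def)
 qed (simp add: cch_on_def)
qed

lemma transfer_dl: "transfer (dl S c) = dl P (transfer c)"
proof -
 have "cch_on P (transfer (dl S c)) = cch_on P (dl P (transfer c))"
 proof (rule cch_eqI)
  fix p t assume t: "ssx p S t"
  show "transfer (dl S c) p (smap p q t) = dl P (transfer c) p (smap p q t)"
  proof (cases "p = 0")
   case True
   thus ?thesis unfolding transfer_lift[OF t] by(simp add: coboundary_def)
  next
   case False
   have s: "ssx p P (smap p q t)" using t q by(rule ssx_map)
   have f: "ssx (p - 1) S (sface p k t)" if "k <= p" for k
    using ssx_face[OF t, of k] False that by simp
   have "dl P (transfer c) p (smap p q t) = (\<Sum>k\<le>p. transfer c (p - 1) (sface p k (smap p q t)))"
    using s False by(simp add: coboundary_def)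
   also have "... = (\<Sum>k\<le>p. c (p - 1) (sface p k t) + c (p - 1) (sface p k (smap p T t)))"
   proof (intro sum.cong refl)
    fix k assume k: "k : {..p}"
    thus "transfer c (p - 1) (sface p k (smap p q t)) = c (p - 1) (sface p k t) + c (p - 1) (sface p k (smap p T t))"
     using False sx_map_face[OF t, of k q] sx_map_face[OF t, of k T] transfer_lift[OF f, of k c] by simp
   qed
   also have "... = dl S c p t + dl S c p (smap p T t)"
    using t sx_map_T(1)[OF t] False by(simp add: coboundary_def sum.distrib)
   finally show ?thesis by(simp add: transfer_lift[OF t])
  qed
 qed
 thus ?thesis by simp
qed

lemma transfer_cup:
 "transfer (cup S (pb S q a) c) = cup P a (transfer c)" "transfer (cup S c (pb S q a)) = cup P (transfer c) a"
proof -
 have *: "ssx i S (front_face i t)" "ssx (p - i) S (back_face i (p - i) t)"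
  "front_face i (smap p f t) = smap i f (front_face i t)"
  "back_face i (p - i) (smap p f t) = smap (p - i) f (back_face i (p - i) t)"
  if "ssx p S t" "i <= p" for p t i and f :: "'s => 'x"
  using that singular_simplex_front_face singular_simplex_back_face[of i "p - i" S t] sx_map_front[of i p f t]
   sx_map_back[of i "p - i" f t] by auto
 have "cch_on P (transfer (cup S (pb S q a) c)) = cch_on P (cup P a (transfer c))"
 proof (rule cch_eqI)
  fix p t assume t: "ssx p S t"
  have s: "ssx p P (smap p q t)" using t q by(rule ssx_map)
  have "cup P a (transfer c) p (smap p q t) =
   (\<Sum>i\<le>p. a i (smap i q (front_face i t)) * transfer c (p - i) (smap (p - i) q (back_face i (p - i) t)))"
   using s by(simp add: cup_def *[OF t])
  also have "... = (\<Sum>i\<le>p. a i (smap i q (front_face i t)) * c (p - i) (back_face i (p - i) t)) +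
    (\<Sum>i\<le>p. a i (smap i q (front_face i (smap p T t))) * c (p - i) (back_face i (p - i) (smap p T t)))"
   by(simp add: transfer_lift *[OF t] sx_map_T sum.distrib distrib_left)
  also have "... = cup S (pb S q a) c p t + cup S (pb S q a) c p (smap p T t)"
   using t sx_map_T(1)[OF t] by(simp add: cup_def pb_d * cong: if_cong)
  finally show "transfer (cup S (pb S q a) c) p (smap p q t) = cup P a (transfer c) p (smap p q t)"
   by(simp add: transfer_lift[OF t])
 qed
 thus "transfer (cup S (pb S q a) c) = cup P a (transfer c)" by simp
 have "cch_on P (transfer (cup S c (pb S q a))) = cch_on P (cup P (transfer c) a)"
 proof (rule cch_eqI)
  fix p t assume t: "ssx p S t"
  have s: "ssx p P (smap p q t)" using t q by(rule ssx_map)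
  have "cup P (transfer c) a p (smap p q t) =
   (\<Sum>i\<le>p. transfer c i (smap i q (front_face i t)) * a (p - i) (smap (p - i) q (back_face i (p - i) t)))"
   using s by(simp add: cup_def *[OF t])
  also have "... = (\<Sum>i\<le>p. c i (front_face i t) * a (p - i) (smap (p - i) q (back_face i (p - i) t))) +
    (\<Sum>i\<le>p. c i (front_face i (smap p T t)) * a (p - i) (smap (p - i) q (back_face i (p - i) (smap p T t))))"
   by(simp add: transfer_lift *[OF t] sx_map_T sum.distrib distrib_right)
  also have "... = cup S c (pb S q a) p t + cup S c (pb S q a) p (smap p T t)"
   using t sx_map_T(1)[OF t] by(simp add: cup_def pb_d * cong: if_cong)
  finally show "transfer (cup S c (pb S q a)) p (smap p q t) = cup P (transfer c) a p (smap p q t)"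
   by(simp add: transfer_lift[OF t])
 qed
 thus "transfer (cup S c (pb S q a)) = cup P (transfer c) a" by simp
qed

lemma transfer_pb: "transfer (pb S q a) = 0"
proof -
 have "cch_on P (transfer (pb S q a)) = cch_on P 0"
  by(rule cch_eqI) (simp add: transfer_lift pb_d sx_map_T cch_apply)
 thus ?thesis by simp
qed

lemma transfer_cch_on: "transfer (cch_on S c) = transfer c"
proof -
 have "cch_on P (transfer (cch_on S c)) = cch_on P (transfer c)"
  by(rule cch_eqI) (simp add: transfer_lift cch_on_def sx_map_T)
 thus ?thesis by simp
qed

text \<open>A cochain with transfer 0 takes equal values on the two lifts of a simplex and so
  descends. Together with \<open>pb_inj\<close> this is the exactness of the cochain sequence behind
  the Gysin sequence.\<close>

lemma transfer_eq_0:
 assumes "transfer c = 0" shows "EX z. cch_on S c = pb S q z"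
proof -
 let ?z = "%p s. c p (some_lift p s)"
 have "cch_on S c p t = pb S q ?z p t" for p t
 proof (cases "ssx p S t")
  case t: True
  let ?s = "smap p q t" and ?l = "some_lift p (smap p q t)"
  have s: "ssx p P ?s" using t q by(rule ssx_map)
  have "c p t + c p (smap p T t) = 0" using transfer_lift[OF t, of c] assms by(simp add: cch_apply)
  hence "c p (smap p T t) = c p t" by(simp add: bit_add_eq_0)
  moreover have "?l = t \<or> ?l = smap p T t"
   using lift_unique[OF t some_lift(1)[OF s]] some_lift(2)[OF s] by simp
  ultimately show ?thesis using t by(auto simp: cch_on_def pb_d)
 qed (simp add: cch_on_def pb_d)
 hence "cch_on S c = pb S q ?z" by(intro ext)
 thus ?thesis by(rule exI[of _ ?z])
qed

lemma pb_inj: "pb S q a = pb S q b ==> cch_on P a = cch_on P b"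
proof (rule cch_eqI)
 fix p t assume *: "pb S q a = pb S q b" "ssx p S t"
 from *(1) have "pb S q a p t = pb S q b p t" by simp
 thus "a p (smap p q t) = b p (smap p q t)" using *(2) by(simp add: pb_d)
qed

text \<open>\<open>E\<close> selects one of the two lifts of every point, without continuity. The
  cup product of \<open>pcch E\<close> with a pulled back cochain is then a preimage of that cochain
  under the transfer.\<close>

lemma transfer_pcch:
 assumes "!!z. z : topspace S ==> E (T z) \<longleftrightarrow> ~ E z"
 shows "transfer (pcch E) = unc P"
proof -
 have "cch_on P (transfer (pcch E)) = cch_on P (unc P)"
 proof (rule cch_eqI)
  fix p t assume t: "ssx p S t"
  have s: "ssx p P (smap p q t)" using t q by(rule ssx_map)
  have "t (vertex 0) : topspace S" using t by(auto simp: ssx_d cm_def Pi_iff)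
  moreover have "smap p T t (vertex 0) = T (t (vertex 0))" by(simp add: simplex_map_def)
  ultimately show "transfer (pcch E) p (smap p q t) = unc P p (smap p q t)"
   using s by(auto simp: transfer_lift[OF t] pcch_def unit_cochain_def assms)
 qed
 moreover have "cch_on P (unc P) = unc P"
  by(auto simp: cch_on_def unit_cochain_def fun_eq_iff)
 ultimately show ?thesis by simp
qed

lemma cyc_transfer: "cyc S c ==> cyc P (transfer c)"
proof -
 assume "cyc S c"
 hence "dl P (transfer c) = transfer 0" by(simp add: cyc_def flip: transfer_dl)
 also have "... = 0" using transfer_pb[of 0] by simp
 finally show ?thesis by(simp add: cyc_def)
qed

text \<open>The Gysin argument: the class \<open>g\<close> with transfer \<open>x ^ (k - 1)\<close> completes the unit to a basis.\<close>

lemma free_over_sphere: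
 fixes U :: "'u topology"
 assumes pj: "cmap P U pj" and sec: "cmap U S si" "!!u. u : topspace U ==> pj (q (si u)) = u"
  and x: "cyc P x" and E: "!!z. z : topspace S ==> E (T z) \<longleftrightarrow> ~ E z"
  and qx: "pb S q x = dl S (pcch E)"
  and free: "free_over P pj U (Suc k) (cpow P (cls P x))"
  and al: "cch_power P x (Suc k) = dl P al"
 defines "g == pb S q al + cup S (pb S q (cch_power P x k)) (pcch E)"
 shows "cyc S g" and "free_over S (pj o q) U 2 (%i. if i = 0 then one_at S else cls S g)"
proof -
 let ?e = "pcch E" and ?xk = "cch_power P x k" and ?x = "cls P x"
 have xk: "cyc P ?xk" using x by simp
 have qpj: "cmap S U (pj o q)" using q pj by(rule cm_comp)
 have "dl S g = pb S q (dl P al) + (cup S (dl S (pb S q ?xk)) ?e + cup S (pb S q ?xk) (dl S ?e))"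
  by(simp only: g_def coboundary_add leibniz pb_dl[OF q])
 also have "... = pb S q (cup P ?xk x) + cup S (pb S q ?xk) (pb S q x)"
  using xk by(simp add: al[symmetric] qx pb_dl[OF q] cyc_def cup_0)
 also have "... = 0" by(simp add: pb_cup[OF q])
 finally show g: "cyc S g" by(simp add: cyc_def)
 have trE: "transfer ?e = unc P" by(rule transfer_pcch) (rule E)
 have trg: "transfer g = cch_on P ?xk"
  by(simp add: g_def transfer_add transfer_pb transfer_cup trE cup_unit_cch_right)
 have xpow0: "cpow P ?x (Suc k) = 0"
 proof -
  have "exact P (cch_power P x (Suc k))" unfolding al by simp
  thus ?thesis using x by(simp add: cls_eq_0_iff cyc_cup flip: cls_cch_power)
 qed
 have qx0: "pull S q P ?x = 0" using x by(simp add: pull_cls[OF q] qx cls_eq_0_iff)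
 show "free_over S (pj o q) U 2 (%i. if i = 0 then one_at S else cls S g)"
  unfolding free_over_def
 proof (intro conjI ballI allI impI)
  fix Y assume "Y : cohs S"
  then obtain y where y: "cyc S y" "Y = cls S y" by(rule cohsE)
  have ty: "cyc P (transfer y)" using y by(simp add: cyc_transfer)
  obtain u where u: "ALL i<Suc k. u i : cohs U" "cls P (transfer y) = (\<Sum>i<Suc k. cpow P ?x i * pull P pj U (u i))"
   using free_over_span[OF free cls_in_cohs[OF ty]] by(elim exE conjE) (rule that)
  \<comment> \<open>\<open>x\<close> becomes \<open>dl S ?e\<close> on \<open>S\<close>, so
    \<open>x\<close> annihilates every transfer. Multiplying the expansion by \<open>x\<close>
    shifts the coefficients and leaves only the one of \<open>x ^ k\<close> free to be
    nonzero.\<close>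
  have "cup P x (transfer y) = dl P (transfer (cup S ?e y))"
  proof -
   have "cup P x (transfer y) = transfer (cup S (dl S ?e) y)" by(simp add: transfer_cup flip: qx)
   also have "cup S (dl S ?e) y = dl S (cup S ?e y)" using y by(simp add: leibniz cyc_def cup_0)
   finally show ?thesis by(simp add: transfer_dl)
  qed
  hence "exact P (cup P x (transfer y))" by simp
  hence "?x * cls P (transfer y) = 0" using x ty by(simp add: cls_eq_0_iff cyc_cup flip: cls_cup)
  hence "(\<Sum>i<Suc k. cpow P ?x (Suc i) * pull P pj U (u i)) = 0"
   by(simp add: u(2) sdl class_power_Suc ac_simps del: sum.lessThan_Suc)
  hence "(\<Sum>i<k. cpow P ?x (Suc i) * pull P pj U (u i)) = 0" by(simp add: xpow0)
  hence "(\<Sum>i<Suc k. cpow P ?x i * pull P pj U (case i of 0 => 0 | Suc j => u j)) = 0"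
   by(simp add: sum.lessThan_Suc_shift del: sum.lessThan_Suc)
  hence u0: "u j = 0" if "j < k" for j
   using free_over_indep[OF free, of "%i. case i of 0 => 0 | Suc j => u j" "Suc j"] u(1) that by(simp split: nat.splits)
  have tyk: "cls P (transfer y) = cpow P ?x k * pull P pj U (u k)"
   unfolding u(2) by(simp add: u0)
  obtain c where c: "cyc U c" "u k = cls U c" using u(1) by(auto elim: cohsE)
  let ?pc = "pb S (pj o q) c"
  have pc: "?pc = pb S q (pb P pj c)" by(simp add: pb_pb[OF q])
  have cpc: "cyc S ?pc" using c qpj by(simp add: cyc_pb)
  define y1 where "y1 = y + cup S g ?pc"
  have y1: "cyc S y1" unfolding y1_def using y g cpc by(intro cyc_add cyc_cup)
  have "transfer y1 = transfer y + cup P ?xk (pb P pj c)"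
   by(simp add: y1_def transfer_add pc transfer_cup trg)
  moreover have "cls P (transfer y + cup P ?xk (pb P pj c)) = 0"
   using ty xk c pj tyk x by(simp add: cls_add cls_cup cyc_cup cyc_pb pull_cls cls_cch_power)
  ultimately have "cls P (transfer y1) = 0" by simp
  hence "exact P (transfer y1)" using cyc_transfer[OF y1] by(simp add: cls_eq_0_iff)
  then obtain v where v: "transfer y1 = dl P v" by(auto elim: exactE)
  \<comment> \<open>\<open>y1\<close> has an exact transfer; this correction makes the transfer
    vanish as a cochain, so that \<open>y2\<close> descends to \<open>P\<close>.\<close>
  define y2 where "y2 = y1 + dl S (cup S ?e (pb S q v))"
  have y2: "cyc S y2" unfolding y2_def using y1 by(intro cyc_add) simp_all
  have "transfer y2 = 0"
   by(simp add: y2_def transfer_add transfer_dl transfer_cup trE cup_unit_cch_left v)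
  then obtain z where z: "cch_on S y2 = pb S q z" by(elim transfer_eq_0[THEN exE]) (rule that)
  have "pb S q (dl P z) = pb S q 0"
  proof -
   have "pb S q (dl P z) = dl S (cch_on S y2)" by(simp add: z pb_dl[OF q])
   thus ?thesis using y2 by(simp add: cyc_def)
  qed
  hence "cch_on P (dl P z) = cch_on P 0" by(rule pb_inj)
  hence zc: "cyc P z" by(simp add: cyc_def)
  obtain w where w: "ALL i<Suc k. w i : cohs U" "cls P z = (\<Sum>i<Suc k. cpow P ?x i * pull P pj U (w i))"
   using free_over_span[OF free cls_in_cohs[OF zc]] by(elim exE conjE) (rule that)
  have "cls S y2 = pull S q P (cls P z)"
  proof -
   have "cls S y2 = cls S (cch_on S y2)"
    using y2 exact_cch_on_add[of S y2] by(simp add: cls_eq_iff add.commute)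
   thus ?thesis by(simp add: z pull_cls[OF q zc])
  qed
  also have "... = (\<Sum>i<Suc k. cpow S 0 i * pull S (pj o q) U (w i))"
   unfolding w(2) pull_sum pull_mult pull_cpow[OF q] qx0
   using w(1) pull_pull[OF q pj] by(intro sum.cong refl) simp
  also have "... = (\<Sum>i\<in>{0}. cpow S 0 i * pull S (pj o q) U (w i))"
   by(intro sum.mono_neutral_right) (auto simp: cpow_def power_0_left split: if_splits)
  also have "... = pull S (pj o q) U (w 0)" using w qpj by(simp add: cpow_0 one_at_mult)
  finally have y2w: "cls S y2 = pull S (pj o q) U (w 0)" .
  have "cls S y2 = cls S y1"
  proof -
   have "y2 + y1 = dl S (cup S ?e (pb S q v))"
    using add.commute[of y2 y1] by(simp add: y2_def flip: add.assoc)
   thus ?thesis using y1 y2 by(simp add: cls_eq_iff)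
  qed
  also have "... = Y + cls S g * pull S (pj o q) U (u k)"
   using y g cpc c qpj by(simp add: y1_def cls_add cls_cup cyc_cup pull_cls)
  finally have "Y = pull S (pj o q) U (w 0) + cls S g * pull S (pj o q) U (u k)"
   unfolding y2w by(simp add: add.assoc)
  thus "EX u :: nat => _. (ALL i<2. u i : cohs U) & Y = (\<Sum>i<2. (if i = 0 then one_at S else cls S g) * pull S (pj o q) U (u i))"
   using w(1) u(1) qpj by(intro exI[of _ "%i. if i = 0 then w 0 else u k"]) (simp add: numeral_2_eq_2 one_at_mult)
 next
  fix ab :: "nat => 'u coh" and i :: nat
  assume ab: "ALL i<2. ab i : cohs U" and i: "i < 2"
   and 0: "(\<Sum>i<2. (if i = 0 then one_at S else cls S g) * pull S (pj o q) U (ab i)) = 0"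
  obtain a where a: "cyc U a" "ab 0 = cls U a" by(rule cohsE[of "ab 0" U]) (use ab in simp)
  obtain b where b: "cyc U b" "ab 1 = cls U b" by(rule cohsE[of "ab 1" U]) (use ab in simp)
  let ?pa = "pb S (pj o q) a" and ?pb = "pb S (pj o q) b"
  have pa: "?pa = pb S q (pb P pj a)" and pb: "?pb = pb S q (pb P pj b)" by(simp_all add: pb_pb[OF q])
  have cpa: "cyc S ?pa" and cpb: "cyc S ?pb" using a b qpj by(simp_all add: cyc_pb)
  have zz: "pull S (pj o q) U (ab 0) + cls S g * pull S (pj o q) U (ab 1) = 0"
   using 0 ab qpj by(simp add: numeral_2_eq_2 one_at_mult)
  hence "cls S (?pa + cup S g ?pb) = 0"
   using a b g cpa cpb qpj by(simp add: cls_add cls_cup cyc_cup pull_cls)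
  then obtain c where c: "cch_on S (?pa + cup S g ?pb) = dl S c"
   using g cpa cpb by(auto simp: cls_eq_0_iff cyc_add cyc_cup elim: exactE)
  have "transfer (?pa + cup S g ?pb) = dl P (transfer c)"
   using transfer_cch_on[of "?pa + cup S g ?pb"] by(simp add: c transfer_dl)
  moreover have "transfer (?pa + cup S g ?pb) = cup P ?xk (pb P pj b)"
   by(simp add: transfer_add pa pb transfer_pb transfer_cup trg)
  ultimately have "exact P (cup P ?xk (pb P pj b))" by simp
  hence "cpow P ?x k * pull P pj U (ab 1) = 0"
   using x b pj by(simp add: cls_eq_0_iff cyc_cup cyc_pb pull_cls flip: cls_cch_power cls_cup)
  hence "(\<Sum>i<Suc k. cpow P ?x i * pull P pj U (if i = k then ab 1 else 0)) = 0" by simp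
  hence b0: "ab 1 = 0"
   using free_over_indep[OF free, of "%i. if i = k then ab 1 else 0" k] ab by simp
  hence "pull S (pj o q) U (ab 0) = 0" using zz by simp
  \<comment> \<open>The section \<open>si\<close> of the composite projection recovers the remaining
    coefficient.\<close>
  hence "pull U si S (pull S (pj o q) U (ab 0)) = 0" by simp
  hence "pull U ((pj o q) o si) U (ab 0) = 0" using pull_pull[OF sec(1) qpj, of "ab 0"] ab by simp
  hence "ab 0 = 0" using pull_id[of U "(pj o q) o si" "ab 0"] sec(2) ab by simp
  thus "ab i = 0" using b0 i by(cases "i = 0") (simp_all add: less_2_cases_iff)
 qed
qed

end

section \<open>Real projective spaces\<close>

definition sph :: "nat => (nat => real) set" where
 "sph k = {v. (ALL a>=k. v a = 0) & (\<Sum>a<k. (v a)\<^sup>2) = 1}"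

definition outer :: "(nat => real) => nat \<times> nat => real" where
 "outer v = (%(a, b). v a * v b)"

definition Sphere :: "nat => (nat => real) topology" where
 "Sphere k = subt (powertop_real UNIV) (sph k)"

text \<open>A line is encoded by the orthogonal projection onto it.\<close>

definition RP :: "nat => (nat \<times> nat => real) topology" where
 "RP k = subt (powertop_real UNIV) (outer ` sph k)"

definition lead :: "(nat => real) => real" where
 "lead v = v (LEAST b. v b ~= 0)"

text \<open>The unit vector of a line whose first nonzero coordinate is positive.\<close>

definition vsel :: "(nat \<times> nat => real) => nat => real" where
 "vsel q = (let b = (LEAST b. q (b, b) ~= 0) in (%a. q (a, b) / sqrt (q (b, b))))"

lemma topspace_Sphere [simp]: "topspace (Sphere k) = sph k"
 and topspace_RP [simp]: "topspace (RP k) = outer ` sph k"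
 by(simp_all add: Sphere_def RP_def)

lemma outer_apply [simp]: "outer v (a, b) = v a * v b"
 by(simp add: outer_def)

lemma vsel_outer: "vsel (outer v) = (%a. sgn (lead v) * v a)"
 by(simp add: vsel_def Let_def lead_def fun_eq_iff real_sgn_eq flip: p2_eq)

lemma sph_nonzero:
 assumes "v : sph k" obtains a where "a < k" "v a ~= 0"
proof -
 have "(\<Sum>a<k. (v a)\<^sup>2) ~= 0" using assms by(simp add: sph_def)
 then obtain a where "a : {..<k}" "(v a)\<^sup>2 ~= 0" by(rule sum.not_neutral_contains_not_neutral)
 thus thesis using that by simp
qed

lemma lead_scale:
 assumes v: "v : sph k" and c: "c ~= 0" and w: "!!a. a < k ==> w a = c * v a"
 shows "lead w = c * lead v"
proof -
 obtain a where a: "a < k" "v a ~= 0" using v by(rule sph_nonzero)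
 define b where "b = (LEAST b. v b ~= 0)"
 have b: "v b ~= 0" "b <= a"
  unfolding b_def by(rule LeastI[of "%b. v b ~= 0", OF a(2)], rule Least_le[of "%b. v b ~= 0", OF a(2)])
 have "(LEAST b. w b ~= 0) = b"
 proof (rule Least_equality)
  show "w b ~= 0" using w[of b] a b c by simp
  fix y assume y: "w y ~= 0"
  show "b <= y"
  proof (rule ccontr)
   assume "~ b <= y"
   hence "v y = 0" "y < k" using not_less_Least[of y "%b. v b ~= 0"] a b by(auto simp: b_def)
   thus False using w[of y] y by simp
  qed
 qed
 thus ?thesis using w[of b] a b by(simp add: lead_def flip: b_def)
qed

lemma lead_nonzero: assumes "v : sph k" shows "lead v ~= 0"
proof -
 obtain a where "v a ~= 0" using assms by(rule sph_nonzero)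
 thus ?thesis unfolding lead_def by(rule LeastI)
qed

lemma sph_uminus: "v : sph k ==> (%a. - v a) : sph k"
 by(simp add: sph_def)

lemma lead_uminus: "v : sph k ==> lead (%a. - v a) = - lead v"
 using lead_scale[of v k "-1" "%a. - v a"] by simp

lemma outer_uminus [simp]: "outer (%a. - v a) = outer v"
 by(simp add: outer_def)

lemma outer_eq:
 assumes v: "v : sph k" and w: "w : sph k" and eq: "outer v = outer w"
 shows "w = v \<or> w = (%a. - v a)"
proof -
 have "(%a. sgn (lead v) * v a) = (%a. sgn (lead w) * w a)" using eq by(metis vsel_outer)
 hence "sgn (lead v) * v a = sgn (lead w) * w a" for a by(rule fun_cong)
 thus ?thesis using lead_nonzero[OF v] lead_nonzero[OF w]
  by(cases "lead v > 0"; cases "lead w > 0") (auto simp: fun_eq_iff minus_equation_iff)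
qed

lemma cmap_into_RP:
 "cmap X (RP k) f \<longleftrightarrow>
  (ALL a b. cmap X eur (%x. f x (a, b))) & f ` topspace X <= outer ` sph k"
 by(simp add: RP_def cm_into continuous_map_componentwise_UNIV image_subset_iff_funcset)

lemma cmap_into_Sphere:
 "cmap X (Sphere k) f \<longleftrightarrow>
  (ALL a. cmap X eur (%x. f x a)) & f ` topspace X <= sph k"
 by(simp add: Sphere_def cm_into continuous_map_componentwise_UNIV image_subset_iff_funcset)

lemma cmap_RP_coord: "cmap (RP k) eur (%q. q (a, b))"
 using cmap_into_RP[of "RP k" k "%q. q"] by simp

lemma cmap_Sphere_coord: "cmap (Sphere k) eur (%v. v a)"
 using cmap_into_Sphere[of "Sphere k" k "%q. q"] by simp

lemma cmap_via_RP:
 assumes "cmap X (RP k) f" shows "cmap X eur (%x. f x (a, b))"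
 using cm_comp[OF assms cmap_RP_coord] by(simp add: o_def)

lemma cmap_via_Sphere:
 assumes "cmap X (Sphere k) f" shows "cmap X eur (%x. f x a)"
 using cm_comp[OF assms cmap_Sphere_coord] by(simp add: o_def)

lemma line_field_vsel: "line_field k (RP k) vsel"
 unfolding line_field_def
proof (intro conjI ballI)
 fix q assume "q : topspace (RP k)"
 then obtain v where v: "v : sph k" "q = outer v" by auto
 have s: "(sgn (lead v))\<^sup>2 = 1" using lead_nonzero[OF v(1)] by(simp add: sgn_if)
 show "(\<Sum>a<k. (vsel q a)\<^sup>2) = 1"
  using v s by(simp add: vsel_outer power_mult_distrib sph_def flip: sdl)
 show "ALL a>=k. vsel q a = 0" using v by(simp add: vsel_outer sph_def)
next
 have "vsel q a * vsel q b = q (a, b)" if q: "q : topspace (RP k)" for q a b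
 proof -
  from q obtain v where v: "v : sph k" "q = outer v" by auto
  have "sgn (lead v) * sgn (lead v) = 1" using lead_nonzero[OF v(1)] by(simp add: sgn_if)
  thus ?thesis by(simp add: v vsel_outer algebra_simps)
 qed
 thus "ALL a b. cmap (RP k) eur (%q. vsel q a * vsel q b)"
  by(intro allI cm_eq[OF cmap_RP_coord]) simp
qed

lemma dl_0_pcch:
 assumes "!!x. x : topspace X ==> ~ P x" shows "dl X (pcch P) = 0"
proof -
 have "cch_on X (pcch P) = 0"
 proof (intro ext)
  fix p s show "cch_on X (pcch P) p s = 0 p s"
   using assms by(auto simp: cch_on_def pcch_def ssx_d cm_def cch_apply Pi_iff)
 qed
 thus ?thesis using dl_cch_on[of X "pcch P"] by(simp add: coboundary_0)
qed

text \<open>The inner product is a bilinear form that is never negative, so the correcting 0-cochain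
  vanishes and the characters agree as cochains, not just up to a coboundary.\<close>

lemma chi_eq_positive:
 assumes v: "line_field d X v" and v': "line_field d' X v'" 
  and pos: "!!x. x : topspace X ==> (\<Sum>a<d. v x a * v' x a) > 0" and "d <= d'"
 shows "chi X v = chi X v'"
proof -
 let ?ph = "%x. \<Sum>a<d. v x a * v' x a"
 have "chi X v + chi X v' = dl X (pcch (%x. ?ph x < 0))"
 proof (rule chi_bilinear[OF v v', where m="%a b x. if a = b then 1 else 0"])
  fix x assume "x : topspace X"
  thus "?ph x ~= 0" using pos[of x] by simp
  have "(\<Sum>a<d. \<Sum>b<d'. (if a = b then 1 else 0) * v x a * v' x b) = (\<Sum>a<d. \<Sum>b<d'. if b = a then v x a * v' x a else 0)"
   by(intro sum.cong refl) auto
  also have "... = ?ph x" using \<open>d <= d'\<close> by(intro sum.cong refl) (auto simp: sum.delta)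
  finally show "?ph x = (\<Sum>a<d. \<Sum>b<d'. (if a = b then 1 else 0) * v x a * v' x b)" by simp
 qed simp
 also have "... = 0" using pos by(intro dl_0_pcch) (simp add: less_le_not_le)
 finally show ?thesis by(simp add: cch_add_eq_0)
qed

text \<open>The projection onto the image of a line under the diagonal map with entries
  \<open>e\<close> (the first \<open>k\<close>) and \<open>e'\<close> (the last). The denominator is
  the squared length of the image of a unit vector.\<close>

definition rescale :: "nat => real => real => (nat \<times> nat => real) => nat \<times> nat => real" where
 "rescale k e e' q = (%(a, b). q (a, b) * (if a < k then e else e') * (if b < k then e else e') /
  (e\<^sup>2 * (\<Sum>c<k. q (c, c)) + e'\<^sup>2 * q (k, k)))"

lemma rescale_outer:
 assumes v: "v : sph (Suc k)" and N: "N = e\<^sup>2 * (\<Sum>c<k. (v c)\<^sup>2) + e'\<^sup>2 * (v k)\<^sup>2" "N > 0"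
 shows "rescale k e e' (outer v) = outer (%a. v a * (if a < k then e else e') / sqrt N)"
  "(%a. v a * (if a < k then e else e') / sqrt N) : sph (Suc k)"
proof -
 show "rescale k e e' (outer v) = outer (%a. v a * (if a < k then e else e') / sqrt N)"
  using N by(auto simp: rescale_def fun_eq_iff p2_eq[symmetric] real_sqrt_mult_self)
 have "(\<Sum>a<Suc k. (v a * (if a < k then e else e') / sqrt N)\<^sup>2) = (\<Sum>a<Suc k. (v a * (if a < k then e else e'))\<^sup>2) / N"
  using N(2) by(simp add: power_divide sum_divide_distrib add_divide_distrib)
 also have "(\<Sum>a<Suc k. (v a * (if a < k then e else e'))\<^sup>2) = N"
  by(simp add: N(1) power_mult_distrib sdl mult.commute)
 finally show "(%a. v a * (if a < k then e else e') / sqrt N) : sph (Suc k)"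
  using v N(2) by(simp add: sph_def)
qed

lemma rescale_coords:
 "(\<Sum>c<k. rescale k e e' q (c, c)) = e\<^sup>2 * (\<Sum>c<k. q (c, c)) / (e\<^sup>2 * (\<Sum>c<k. q (c, c)) + e'\<^sup>2 * q (k, k))"
 "rescale k e e' q (k, k) = e'\<^sup>2 * q (k, k) / (e\<^sup>2 * (\<Sum>c<k. q (c, c)) + e'\<^sup>2 * q (k, k))"
 by(simp_all add: rescale_def p2_eq sum_divide_distrib sdl ac_simps)

text \<open>The deformations of the pieces of projective space all let the two factors of
  \<open>rescale\<close> depend on time and on the line.\<close>

lemma rescale_homotopic:
 fixes U :: "'u topology" and k :: nat and e e' :: "real => (nat \<times> nat => real) => real" and C :: "('u \<times> (nat \<times> nat => real)) set"
 defines "Z == subt (ptop U (RP (Suc k))) C"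
 assumes e: "cmap (ptop (top_of_set {0..1}) Z) eur (%z. e (fst z) (snd (snd z)))"
  and e': "cmap (ptop (top_of_set {0..1}) Z) eur (%z. e' (fst z) (snd (snd z)))"
  and pos: "!!t u q. t : {0..1} ==> (u, q) : topspace Z ==>
   (e t q)\<^sup>2 * (\<Sum>c<k. q (c, c)) + (e' t q)\<^sup>2 * q (k, k) > 0"
  and C: "!!t u q. t : {0..1} ==> (u, q) : topspace Z ==> (u, rescale k (e t q) (e' t q) q) : C"
  and f: "!!u q. (u, q) : topspace Z ==> f (u, q) = (u, rescale k (e 0 q) (e' 0 q) q)"
  and g: "!!u q. (u, q) : topspace Z ==> g (u, q) = (u, rescale k (e 1 q) (e' 1 q) q)"
 shows "homotopic_with (%_. True) Z Z f g"
proof -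
 let ?D = "ptop (top_of_set {0..1::real}) Z"
 let ?h = "%z :: real \<times> 'u \<times> (nat \<times> nat => real). (fst (snd z), rescale k (e (fst z) (snd (snd z))) (e' (fst z) (snd (snd z))) (snd (snd z)))"
 have c2: "cmap ?D (ptop U (RP (Suc k))) snd"
  using cm_snd[of "top_of_set {0..1::real}" Z] unfolding Z_def by(simp only: cm_into)
 have cq: "cmap ?D eur (%z. snd (snd z) (a, b))" for a b
  using cmap_via_RP[OF cm_comp[OF c2 cm_snd]] by(simp add: o_def)
 have cu: "cmap ?D U (%z. fst (snd z))"
  using cm_comp[OF c2 cm_fst] by(simp add: o_def)
 have "cmap ?D (RP (Suc k)) (%z. snd (?h z))"
  unfolding cmap_into_RP
 proof (intro conjI allI image_subsetI)
  fix a b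
  have "cmap ?D eur (%z. (e (fst z) (snd (snd z)))\<^sup>2 * (\<Sum>c<k. snd (snd z) (c, c)) + (e' (fst z) (snd (snd z)))\<^sup>2 * snd (snd z) (k, k))"
   by(intro continuous_map_add cm_mult continuous_map_real_pow cm_sum cq e e') auto
  moreover have "cmap ?D eur (%z. snd (snd z) (a, b) * (if a < k then e (fst z) (snd (snd z)) else e' (fst z) (snd (snd z))) * (if b < k then e (fst z) (snd (snd z)) else e' (fst z) (snd (snd z))))"
   using e e' cq[of a b] by(cases "a < k"; cases "b < k") (simp_all add: cm_mult)
  ultimately show "cmap ?D eur (%z. snd (?h z) (a, b))"
   unfolding rescale_def snd_conv prod.case
  proof (intro cm_div)
   fix z assume "z : topspace ?D"
   then obtain t u q where z: "z = (t, u, q)" "t : {0..1}" "(u, q) : topspace Z" by(cases z) auto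
   thus "(e (fst z) (snd (snd z)))\<^sup>2 * (\<Sum>c<k. snd (snd z) (c, c)) + (e' (fst z) (snd (snd z)))\<^sup>2 * snd (snd z) (k, k) ~= 0"
    using pos[OF z(2,3)] by simp
  qed
 next
  fix z assume "z : topspace ?D"
  then obtain t u q where z: "z = (t, u, q)" "t : {0..1}" "(u, q) : topspace Z" by(cases z) auto
  then obtain v where v: "v : sph (Suc k)" "q = outer v" by(auto simp: Z_def)
  show "snd (?h z) : outer ` sph (Suc k)"
   using pos[OF z(2,3)] rescale_outer[OF v(1) refl, of "e t q" "e' t q"] by(simp add: z v p2_eq)
 qed
 hence "cmap ?D (ptop U (RP (Suc k))) ?h"
  using cu by(simp add: cm_pair)
 hence "cmap ?D Z ?h"
  unfolding Z_def cm_into using C by(auto simp: Z_def)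
 thus ?thesis
  using f g by(subst homotopic_with) (auto intro!: exI[of _ ?h])
qed

section \<open>The tautological class on the product of a base with a projective space\<close>

abbreviation RP_class :: "'u topology => nat => ('u \<times> (nat \<times> nat => real)) cochain" where
 "RP_class U k == chi (ptop U (RP k)) (vsel o snd)"

lemma line_field_prod_RP: "line_field k (ptop U (RP k)) (vsel o snd)"
 by(rule line_field_compose[OF line_field_vsel cm_snd])

lemma cyc_RP_class: "cyc (ptop U (RP k)) (RP_class U k)"
 by(rule cyc_chi[OF line_field_prod_RP])

lemma cmap_prod_RP_coord: "cmap (ptop U (RP k)) eur (%x. snd x (a, b))"
 by(rule cmap_via_RP[OF cm_snd])

lemma cmap_prod_Sphere_coord: "cmap (ptop U (Sphere k)) eur (%x. snd x a)"
 by(rule cmap_via_Sphere[OF cm_snd])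

lemma cmap_outer: "cmap (Sphere k) (RP k) outer"
 unfolding cmap_into_RP by(auto intro!: cm_mult cmap_Sphere_coord)

text \<open>Lifts exist by \<open>line_lift_exists\<close>. Two lifts have inner product 1 or -1 at
  every point, with constant sign over the simplex.\<close>

lemma sphere_double_cover:
 fixes U :: "'u topology"
 shows "double_cover (ptop U (Sphere k)) (ptop U (RP k)) (%z. (fst z, outer (snd z))) (%z. (fst z, %a. - snd z a))"
  (is "double_cover ?S ?P ?q ?T")
proof
 show q: "cmap ?S ?P ?q"
  by(intro cm_pair cm_fst)
   (use cm_comp[OF cm_snd cmap_outer] in \<open>simp add: o_def\<close>)
 have "cmap ?S (Sphere k) (%z a. - snd z a)"
  unfolding cmap_into_Sphere
  by(auto intro!: continuous_map_minus cmap_prod_Sphere_coord sph_uminus)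
 thus T: "cmap ?S ?S ?T" by(intro cm_pair cm_fst)
 show "?q (?T z) = ?q z" "?T (?T z) = z" for z :: "'u \<times> (nat => real)" by simp_all
next
 fix p s assume s: "ssx p ?P s"
 hence sc: "cmap (sx_top p) ?P s" and se: "s : extensional (stdx p)"
  by(simp_all add: ssx_d)
 obtain c where c: "!!t. t : stdx p ==> c t = 1 \<or> c t = -1"
   "!!a. cmap (sx_top p) eur (%t. c t * vsel (snd (s t)) a)"
  using line_lift_exists[OF line_field_prod_RP s] by(auto simp: line_lift_def)
 have st: "s t : topspace U \<times> outer ` sph k" if "t : stdx p" for t
  using sc that by(auto simp: cm_def Pi_iff)
 have key: "(%a. c t * vsel (snd (s t)) a) : sph k & outer (%a. c t * vsel (snd (s t)) a) = snd (s t)"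
  if t: "t : stdx p" for t
 proof -
  obtain v where v: "v : sph k" "snd (s t) = outer v" using st[OF t] by auto
  have "c t * sgn (lead v) = 1 \<or> c t * sgn (lead v) = -1"
   using c(1)[OF t] lead_nonzero[OF v(1)] by(auto simp: sgn_if)
  hence "(%a. c t * vsel (snd (s t)) a) = v \<or> (%a. c t * vsel (snd (s t)) a) = (%a. - v a)"
   by(auto simp: v vsel_outer fun_eq_iff simp flip: mult.assoc)
  thus ?thesis using v sph_uminus by auto
 qed
 let ?l = "restrict (%t. (fst (s t), %a. c t * vsel (snd (s t)) a)) (stdx p)"
 have "cmap (sx_top p) ?S (%t. (fst (s t), %a. c t * vsel (snd (s t)) a))"
 proof (intro cm_pair)
  show "cmap (sx_top p) U (%t. fst (s t))"
   using cm_comp[OF sc cm_fst] by(simp add: o_def)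
  show "cmap (sx_top p) (Sphere k) (%t a. c t * vsel (snd (s t)) a)"
   unfolding cmap_into_Sphere using c(2) key by auto
 qed
 hence "cmap (sx_top p) ?S ?l" by(rule cm_eq) auto
 hence "ssx p ?S ?l" by(simp add: ssx_d)
 moreover have "smap p ?q ?l = s"
  using key se by(auto simp: simplex_map_def fun_eq_iff extensional_def prod_eq_iff)
 ultimately show "EX t. ssx p ?S t & smap p ?q t = s" by blast
next
 fix p t t' assume t: "ssx p ?S t" and t': "ssx p ?S t'"
  and eq: "smap p ?q t = smap p ?q t'"
 have tc: "cmap (sx_top p) ?S t" "cmap (sx_top p) ?S t'"
  and te: "t : extensional (stdx p)" "t' : extensional (stdx p)"
  using t t' by(simp_all add: ssx_d)
 let ?f = "%x. \<Sum>a<k. snd (t x) a * snd (t' x) a"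
 have coord: "cmap (sx_top p) eur (%x. snd (w x) a)"
  if "cmap (sx_top p) ?S w" for w a
  using cm_comp[OF that cmap_prod_Sphere_coord] by(simp add: o_def)
 have f: "cmap (sx_top p) eur ?f"
  by(intro cm_sum cm_mult coord tc) simp
 have alt: "fst (t' x) = fst (t x) & (?f x = 1 & snd (t' x) = snd (t x) \<or> ?f x = -1 & snd (t' x) = (%a. - snd (t x) a))"
  if x: "x : stdx p" for x
 proof -
  have us: "snd (t x) : sph k" "snd (t' x) : sph k"
   using tc x by(auto simp: cm_def Pi_iff mem_Times_iff)
  have "?q (t x) = ?q (t' x)" using fun_cong[OF eq, of x] x by(simp add: simplex_map_def)
  thus ?thesis using outer_eq[OF us] us(1)
   by(auto simp: sph_def sum_negf simp flip: p2_eq)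
 qed
 have const: "?f x < 0 \<longleftrightarrow> ?f y < 0" if "x : stdx p" "y : stdx p" for x y
 proof (rule sx_sign_constant[OF f _ that])
  fix x assume "x : stdx p"
  thus "?f x ~= 0" using alt[of x] by auto
 qed
 show "t' = t \<or> t' = smap p ?T t"
 proof (cases "EX x:stdx p. ?f x < 0")
  case True
  hence neg: "?f x < 0" if "x : stdx p" for x using const that by blast
  have "t' x = smap p ?T t x" for x
  proof (cases "x : stdx p")
   case x: True
   thus ?thesis using alt[OF x] neg[OF x] by(auto simp: simplex_map_def prod_eq_iff)
  next
   case False thus ?thesis using te by(auto simp: simplex_map_def extensional_def)
  qed
  thus ?thesis by(intro disjI2 ext)
 next
  case False
  have "t' x = t x" for x
  proof (cases "x : stdx p")
   case x: True
   hence "~ ?f x < 0" using False by blast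
   thus ?thesis using alt[OF x] by(auto simp: prod_eq_iff)
  next
   case False thus ?thesis using te by(auto simp: extensional_def)
  qed
  thus ?thesis by(intro disjI1 ext)
 qed
qed

lemma openin_coord_nonzero:
 "cmap X eur f ==> openin X {x : topspace X. f x ~= 0}"
 using openin_continuous_map_preimage[of X eur f "- {0}"] by(simp add: open_Compl)

lemma RP_class_chart:
 fixes U :: "'u topology"
 assumes i: "i < k" and W: "!!x. x : W ==> snd x (i, i) ~= 0"
 defines "Y == subt (ptop U (RP k)) W"
 shows "chi Y (vsel o snd) = dl Y (pcch (%x. vsel (snd x) i < 0))"
proof -
 have lf: "line_field k Y (vsel o snd)" unfolding Y_def by(rule line_field_sub[OF line_field_prod_RP])
 show ?thesis
 proof (rule chi_linear[OF lf, where m="%a x. if a = i then 1 else 0"])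
  fix x assume x: "x : topspace Y"
  then obtain v where v: "v : sph k" "snd x = outer v" by(auto simp: Y_def)
  show "vsel (snd x) i ~= 0" using x W[of x] v(2) lead_nonzero[OF v(1)] by(auto simp: vsel_outer sgn_if Y_def)
  show "vsel (snd x) i = (\<Sum>a<k. (if a = i then 1 else 0) * (vsel o snd) x a)"
   using i by(simp add: if_distrib[of "%z. z * _"] sum.delta cong: if_cong)
 qed simp
qed

text \<open>The \<open>k + 1\<close> charts where one coordinate is nonzero cover the space, and the
  class vanishes on each of them.\<close>

lemma RP_power_exact:
 obtains al where "cch_power (ptop U (RP (Suc k))) (RP_class U (Suc k)) (Suc k) = dl (ptop U (RP (Suc k))) al"
proof -
 let ?X = "ptop U (RP (Suc k))" and ?x = "RP_class U (Suc k)"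
 let ?U = "%i. {x : topspace ?X. snd x (i, i) ~= 0}"
 have c: "cyc ?X ?x" by(rule cyc_RP_class)
 have "one_at ?X * prod_list (map (%_. cls ?X ?x) [0..<Suc k]) = 0"
 proof (rule cup_length_classes)
  show "openin ?X (?U i)" for i by(rule openin_coord_nonzero[OF cmap_prod_RP_coord])
  show "topspace ?X <= (\<Union>i\<in>set [0..<Suc k]. ?U i)"
  proof
   fix x assume x: "x : topspace ?X"
   then obtain v where v: "v : sph (Suc k)" "snd x = outer v" by auto
   then obtain a where "a < Suc k" "v a ~= 0" by(auto elim: sph_nonzero)
   thus "x : (\<Union>i\<in>set [0..<Suc k]. ?U i)" using x v(2) by(intro UN_I[of a]) (simp_all del: upt_Suc)
  qed
  fix i assume "i : set [0..<Suc k]"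
  hence ik: "i < Suc k" by auto
  let ?Y = "subt ?X (?U i)"
  have "chi ?Y (vsel o snd) = dl ?Y (pcch (%x. vsel (snd x) i < 0))"
   by(rule RP_class_chart[OF ik]) simp
  hence "exact ?Y ?x" by(intro exactI) (simp only: cch_on_chi_sub)
  thus "restr ?X (?U i) (cls ?X ?x) = 0" using c by(simp add: restr_cls cls_eq_0_iff cyc_sub)
 qed (use c in simp)
 hence "cpow ?X (cls ?X ?x) (Suc k) = 0" by(simp add: cpow_def map_replicate_const del: upt_Suc)
 hence "exact ?X (cch_power ?X ?x (Suc k))" using c by(simp add: cls_eq_0_iff cyc_cup flip: cls_cch_power)
 thus thesis using that by(auto elim: exactE)
qed

lemma free_over_id: "free_over U (%u. u) U 1 (%i. one_at U)"
proof -
 have "pull U (%u. u) U a = a" if "a : cohs U" for a using that by(intro pull_id) auto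
 thus ?thesis by(auto simp: free_over_def one_at_mult intro!: exI[of _ "%_. _"])
qed

lemma rescale_unit: 
 assumes "q : topspace (RP (Suc k))" shows "rescale k 1 1 q = q"
proof -
 from assms obtain v where v: "v : sph (Suc k)" "q = outer v" by auto
 hence "(\<Sum>c<k. q (c, c)) + q (k, k) = 1" by(simp add: sph_def p2_eq)
 thus ?thesis by(simp add: rescale_def fun_eq_iff)
qed

lemma rescale_first:
 assumes v: "v : sph (Suc k)" and N: "(\<Sum>c<k. (v c)\<^sup>2) ~= 0"
 defines "w == %a. v a * (if a < k then 1 else 0) / sqrt (\<Sum>c<k. (v c)\<^sup>2)"
 shows "rescale k 1 0 (outer v) = outer w" "w : sph k" "lead w = lead v / sqrt (\<Sum>c<k. (v c)\<^sup>2)"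
proof -
 have N': "(\<Sum>c<k. (v c)\<^sup>2) > 0" using N sum_nonneg[of "{..<k}" "%c. (v c)\<^sup>2"] by(simp add: less_le)
 note * = rescale_outer[OF v refl, of 1 0]
 show "rescale k 1 0 (outer v) = outer w" using * N' by(simp add: w_def)
 show w: "w : sph k" using *(2) N' by(simp add: w_def sph_def)
 have "lead v = sqrt (\<Sum>c<k. (v c)\<^sup>2) * lead w"
  using N by(intro lead_scale[OF w]) (simp_all add: w_def)
 thus "lead w = lead v / sqrt (\<Sum>c<k. (v c)\<^sup>2)" using N by simp
qed

lemma pb_pcch:
 assumes "cmap X Y f" "!!x. x : topspace X ==> P (f x) \<longleftrightarrow> Q x"
 shows "pb X f (pcch P) = cch_on X (pcch Q)"
proof (intro ext)
 fix p s
 show "pb X f (pcch P) p s = cch_on X (pcch Q) p s"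
 proof (cases "p = 0 & ssx 0 X s")
  case True
  hence "s (vertex 0) : topspace X" by(auto simp: ssx_d cm_def Pi_iff)
  thus ?thesis using True assms(2) by(simp add: pb_d cch_on_def pcch_def simplex_map_def)
 qed (auto simp: pb_d cch_on_def pcch_def)
qed

lemma cch_power_on [simp]: "cch_power X (cch_on X c) i = cch_power X c i"
 by(induction i) simp_all

text \<open>Lines other than the last coordinate axis. Over \<open>U\<close>, this piece retracts
  onto \<open>RP k\<close>, whereas \<open>rp_near\<close>, the lines not in the hyperplane of the
  first \<open>k\<close> coordinates, contracts to the axis. Their intersection is a sphere up to
  homotopy.\<close>

definition rp_away :: "'u topology => nat => ('u \<times> (nat \<times> nat => real)) set" where
 "rp_away U k = {z : topspace (ptop U (RP (Suc k))). (\<Sum>c<k. snd z (c, c)) ~= 0}"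

definition rp_near :: "'u topology => nat => ('u \<times> (nat \<times> nat => real)) set" where
 "rp_near U k = {z : topspace (ptop U (RP (Suc k))). snd z (k, k) ~= 0}"

definition rp_drop :: "nat => 'u \<times> (nat \<times> nat => real) => 'u \<times> (nat \<times> nat => real)" where
 "rp_drop k z = (fst z, rescale k 1 0 (snd z))"

text \<open>The equator consists of the lines through \<open>(v, 1)\<close> with \<open>v\<close> a
  unit vector, at equal angle to the axis and to the hyperplane.\<close>

definition lift_equator :: "nat => 'u \<times> (nat => real) => 'u \<times> (nat \<times> nat => real)" where
 "lift_equator k z = (fst z, outer (%a. (if a = k then 1 else snd z a) / sqrt 2))"

text \<open>Recovers the first \<open>k\<close> coordinates, scaled to length 1, of the vector on
  the line whose last coordinate is positive: the entries \<open>(a, k)\<close> are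
  \<open>v a * v k\<close>, and the root is the length of this part of the column.\<close>

definition to_equator :: "nat => 'u \<times> (nat \<times> nat => real) => 'u \<times> (nat => real)" where
 "to_equator k z = (fst z, %a. if a < k then snd z (a, k) / sqrt (snd z (k, k) * (\<Sum>c<k. snd z (c, c))) else 0)"

lemma openin_rp: "openin (ptop U (RP (Suc k))) (rp_away U k)" "openin (ptop U (RP (Suc k))) (rp_near U k)"
 unfolding rp_away_def rp_near_def
 by(intro openin_coord_nonzero cm_sum cmap_prod_RP_coord; simp)+

lemma RP_sum: "q : topspace (RP (Suc k)) ==> (\<Sum>c<k. q (c, c)) + q (k, k) = 1"
 and RP_nonneg: "q : topspace (RP (Suc k)) ==> 0 <= q (c, c)"
 by(auto simp: sph_def p2_eq)

lemma RP_sum_nonneg: "q : topspace (RP (Suc k)) ==> 0 <= (\<Sum>c<k. q (c, c))"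
 by(intro sum_nonneg RP_nonneg)

lemma RP_zero: "q : topspace (RP k) ==> k <= a \<or> k <= b ==> q (a, b) = 0"
 by(auto simp: sph_def)

lemma rp_cover: "topspace (ptop U (RP (Suc k))) <= rp_away U k Un rp_near U k"
 using RP_sum[of _ k] by(force simp: rp_away_def rp_near_def simp del: topspace_RP)

lemma cont_rp_drop:
 assumes "W <= rp_away U k"
 shows "cmap (subt (ptop U (RP (Suc k))) W) (ptop U (RP k)) (rp_drop k)"
 unfolding rp_drop_def
proof (intro cm_pair)
 let ?Y = "subt (ptop U (RP (Suc k))) W"
 show "cmap ?Y U fst" by(intro cm_sub cm_fst)
 have c: "cmap ?Y eur (%z. snd z (a, b))" for a b
  by(intro cm_sub cmap_prod_RP_coord)
 show "cmap ?Y (RP k) (%z. rescale k 1 0 (snd z))"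
  unfolding cmap_into_RP
 proof (intro conjI allI image_subsetI)
  fix a b
  have s: "cmap ?Y eur (%z. \<Sum>c<k. snd z (c, c))" by(intro cm_sum c) simp
  have "cmap ?Y eur (%z. if a < k & b < k then snd z (a, b) / (\<Sum>c<k. snd z (c, c)) else 0)"
   using cm_div[OF c s] assms by(auto simp: rp_away_def)
  thus "cmap ?Y eur (%z. rescale k 1 0 (snd z) (a, b))"
   by(rule cm_eq) (auto simp: rescale_def)
 next
  fix z assume "z : topspace ?Y"
  then obtain v where v: "v : sph (Suc k)" "snd z = outer v" "(\<Sum>c<k. (v c)\<^sup>2) ~= 0"
   using assms by(auto simp: rp_away_def p2_eq)
  thus "rescale k 1 0 (snd z) : outer ` sph k" using rescale_first[OF v(1,3)] by simp
 qed
qed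

text \<open>Dropping the last coordinate preserves the leading sign and leaves a vector with
  positive inner product with the original one, so \<open>chi_eq_positive\<close> applies.\<close>

lemma chi_rp_drop:
 fixes U :: "'u topology"
 assumes W: "W <= rp_away U k"
 defines "Y == subt (ptop U (RP (Suc k))) W"
 shows "pb Y (rp_drop k) (RP_class U k) = cch_on Y (RP_class U (Suc k))"
proof -
 have cm: "cmap Y (ptop U (RP k)) (rp_drop k)" unfolding Y_def by(rule cont_rp_drop[OF W])
 have "pb Y (rp_drop k) (RP_class U k) = chi Y ((vsel o snd) o rp_drop k)" by(rule pb_chi[OF cm])
 also have "... = chi Y (vsel o snd)"
 proof (rule chi_eq_positive)
  show "line_field k Y ((vsel o snd) o rp_drop k)" by(rule line_field_compose[OF line_field_prod_RP cm])
  show "line_field (Suc k) Y (vsel o snd)" unfolding Y_def by(rule line_field_sub[OF line_field_prod_RP])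
  fix z assume "z : topspace Y"
  then obtain v where v: "v : sph (Suc k)" "snd z = outer v" "(\<Sum>c<k. (v c)\<^sup>2) ~= 0"
   using W by(auto simp: Y_def rp_away_def p2_eq)
  let ?n = "sqrt (\<Sum>c<k. (v c)\<^sup>2)"
  have n: "?n > 0" using v(3) sum_nonneg[of "{..<k}" "%c. (v c)\<^sup>2"] by(simp add: less_le)
  define w where "w = (%a. v a * (if a < k then 1 else 0) / ?n)"
  note w = rescale_first[OF v(1,3), folded w_def]
  have s: "sgn (lead w) = sgn (lead v)" "sgn (lead v) * sgn (lead v) = 1"
   using n lead_nonzero[OF v(1)] by(simp_all add: w(3) sgn_divide)
  have "(\<Sum>a<k. ((vsel o snd) o rp_drop k) z a * (vsel o snd) z a) = (\<Sum>a<k. (sgn (lead v) * sgn (lead v)) * (v a)\<^sup>2 / ?n)"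
   using s(1) by(intro sum.cong refl) (simp add: rp_drop_def v w(1) vsel_outer w_def p2_eq)
  also have "... = (\<Sum>a<k. (v a)\<^sup>2) / ?n" using lead_nonzero[OF v(1)] by(simp add: sum_divide_distrib)
  also have "... > 0" using n by simp
  finally show "(\<Sum>a<k. ((vsel o snd) o rp_drop k) z a * (vsel o snd) z a) > 0" .
 qed simp
 also have "... = cch_on Y (RP_class U (Suc k))" unfolding Y_def by(simp only: cch_on_chi_sub)
 finally show ?thesis .
qed

lemma sph_Suc: "v : sph k ==> v : sph (Suc k)"
 by(simp add: sph_def)

lemma free_over_rp_away:
 fixes U :: "'u topology"
 assumes free: "free_over (ptop U (RP k)) fst U m (cpow (ptop U (RP k)) (cls (ptop U (RP k)) (RP_class U k)))"
 defines "Y == subt (ptop U (RP (Suc k))) (rp_away U k)"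
 shows "free_over Y fst U m (cpow Y (cls Y (RP_class U (Suc k))))"
proof (rule free_over_transfer[where f="%z. z" and r="rp_drop k" and W'="ptop U (RP k)"])
 let ?P = "ptop U (RP k)" and ?X = "ptop U (RP (Suc k))"
 have "cmap (RP k) (RP (Suc k)) (%q. q)"
  unfolding cmap_into_RP using cmap_RP_coord sph_Suc by auto
 from cm_comp[OF cm_snd this] have "cmap ?P (RP (Suc k)) (%z. snd z)" by(simp add: o_def)
 hence c: "cmap ?P ?X (%z. z)" using cm_pair[OF cm_fst, of U "RP k" "RP (Suc k)" snd] by simp
 moreover have "(\<Sum>c<k. q (c, c)) ~= 0 & q : outer ` sph (Suc k)" if "q : outer ` sph k" for q :: "nat \<times> nat => real"
  using that by(auto simp: sph_def simp flip: p2_eq)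
 ultimately show f: "cmap ?P Y (%z. z)"
  unfolding Y_def cm_into rp_away_def by(simp add: image_subset_iff Pi_iff mem_Times_iff)
 show "cmap Y ?P (rp_drop k)" unfolding Y_def by(rule cont_rp_drop) simp
 show "cmap Y U fst" unfolding Y_def by(intro cm_sub cm_fst)
 show "cmap ?P U fst" by(rule cm_fst)
 show "fst (rp_drop k z) = fst z" for z :: "'u \<times> (nat \<times> nat => real)" by(simp add: rp_drop_def)
 show "homotopic_with (%_. True) Y Y ((%z. z) o rp_drop k) id"
  unfolding Y_def
 proof (rule rescale_homotopic[where e="%_ _. 1" and e'="%t _. t" and k=k], goal_cases)
  case (3 t u q)
  hence "q : topspace (RP (Suc k))" "(\<Sum>c<k. q (c, c)) ~= 0" by(auto simp: rp_away_def)
  thus ?case using RP_sum_nonneg[of q k] RP_nonneg[of q k k] by(simp add: add_pos_nonneg del: topspace_RP)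
 next
  case (4 t u q)
  hence q: "q : topspace (RP (Suc k))" "(\<Sum>c<k. q (c, c)) ~= 0" and "u : topspace U" by(auto simp: rp_away_def)
  have p: "(\<Sum>c<k. q (c, c)) + t\<^sup>2 * q (k, k) > 0"
   using q RP_sum_nonneg[of q k] RP_nonneg[of q k k] by(simp add: add_pos_nonneg del: topspace_RP)
  obtain v where v: "v : sph (Suc k)" "q = outer v" using q by auto
  have "rescale k 1 t q : outer ` sph (Suc k)"
   using rescale_outer[OF v(1) refl, of 1 t] p by(simp add: v p2_eq)
  thus ?case using p q \<open>u : _\<close> by(simp add: rp_away_def rescale_coords)
 qed (auto simp: rp_drop_def rescale_unit intro!: continuous_map_into_fulltopology[OF cm_fst])
 have coc: "cyc Y (RP_class U (Suc k))" unfolding Y_def by(rule cyc_sub[OF cyc_RP_class])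
 thus "cpow Y (cls Y (RP_class U (Suc k))) i : cohs Y" for i by simp
 have "pb ?P (%z. z) (RP_class U (Suc k)) = RP_class U k" using pb_chi[OF c, of "vsel o snd"] by(simp add: o_def)
 hence "pull ?P (%z. z) Y (cls Y (RP_class U (Suc k))) = cls ?P (RP_class U k)" using coc by(simp add: pull_cls[OF f])
 thus "free_over ?P fst U m (%i. pull ?P (%z. z) Y (cpow Y (cls Y (RP_class U (Suc k))) i))"
  using free by(simp add: pull_cpow[OF f])
qed simp_all

lemma free_over_rp_near:
 fixes U :: "'u topology" and k :: nat
 defines "Y == subt (ptop U (RP (Suc k))) (rp_near U k)"
 shows "free_over Y fst U 1 (%i. one_at Y)"
proof (rule free_over_transfer[where r=fst and f="%u. (u, outer (%a. if a = k then 1 else 0))" and W'=U])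
 let ?X = "ptop U (RP (Suc k))" and ?f = "%u. (u, outer (%a. if a = k then 1 else 0))"
 have e: "(%a. if a = k then 1 else 0) : sph (Suc k)" by(simp add: sph_def)
 have c: "cmap U ?X ?f"
  by(intro cm_pair continuous_map_id[unfolded id_def]) (use e in auto)
 thus f: "cmap U Y ?f" using e by(auto simp: Y_def cm_into rp_near_def)
 show c2: "cmap Y U fst" unfolding Y_def by(intro cm_sub cm_fst)
 thus "cmap Y U fst" .
 show "cmap U U (%u. u)" by(rule continuous_map_id[unfolded id_def])
 show "homotopic_with (%_. True) Y Y (?f o fst) id"
  unfolding Y_def
 proof (rule rescale_homotopic[where e="%t _. t" and e'="%_ _. 1" and k=k], goal_cases)
  case (3 t u q)
  hence "q : topspace (RP (Suc k))" "q (k, k) ~= 0" by(auto simp: rp_near_def)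
  thus ?case using RP_sum_nonneg[of q k] RP_nonneg[of q k k] by(simp add: add_nonneg_pos del: topspace_RP)
 next
  case (4 t u q)
  hence q: "q : topspace (RP (Suc k))" "q (k, k) ~= 0" and "u : topspace U" by(auto simp: rp_near_def)
  have p: "t\<^sup>2 * (\<Sum>c<k. q (c, c)) + q (k, k) > 0"
   using q RP_sum_nonneg[of q k] RP_nonneg[of q k k] by(simp add: add_nonneg_pos del: topspace_RP)
  obtain v where v: "v : sph (Suc k)" "q = outer v" using q by auto
  have "rescale k t 1 q : outer ` sph (Suc k)"
   using rescale_outer[OF v(1) refl, of t 1] p by(simp add: v p2_eq)
  thus ?case using p q \<open>u : _\<close> by(simp add: rp_near_def rescale_coords)
 next
  case (5 u q)
  hence q: "q : topspace (RP (Suc k))" "q (k, k) ~= 0" by(auto simp: rp_near_def)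
  have "outer (%a. if a = k then 1 else 0) (a, b) = rescale k 0 1 q (a, b)" for a b
   using q(2) RP_zero[OF q(1), of a b] by(cases a k rule: linorder_cases; cases b k rule: linorder_cases) (simp_all add: rescale_def)
  thus ?case by(simp add: fun_eq_iff)
 qed (auto simp: rescale_unit intro!: continuous_map_into_fulltopology[OF cm_fst])
 show "free_over U (%u. u) U 1 (%i. pull U ?f Y (one_at Y))" by(simp only: pull_one_at[OF f] free_over_id)
qed simp_all

lemma lift_equator_outer:
 assumes "v : sph k"
 defines "w == %a. (if a = k then 1 else v a) / sqrt 2"
 shows "w : sph (Suc k)" "lead w = lead v / sqrt 2" "(\<Sum>c<k. (w c)\<^sup>2) = 1 / 2" "w k = 1 / sqrt 2"
  "rescale k 1 0 (outer w) = outer v"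
proof -
 show s: "(\<Sum>c<k. (w c)\<^sup>2) = 1 / 2"
  using assms by(simp add: w_def sph_def power_divide flip: sum_divide_distrib)
 show wk: "w k = 1 / sqrt 2" by(simp add: w_def)
 show "w : sph (Suc k)" using s wk assms by(simp add: sph_def power_divide w_def)
 show "lead w = lead v / sqrt 2" using lead_scale[OF assms(1), of "1 / sqrt 2" w] by(simp add: w_def)
 have "rescale k 1 0 (outer w) (a, b) = v a * v b" for a b
 proof -
  have "rescale k 1 0 (outer w) (a, b) = (if a < k & b < k then w a * w b / (1 / 2) else 0)"
   by(auto simp: rescale_def s simp flip: p2_eq)
  thus ?thesis using assms(1) by(auto simp: w_def sph_def)
 qed
 thus "rescale k 1 0 (outer w) = outer v" by(simp add: fun_eq_iff)
qed

lemma cont_lift_equator: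
 fixes U :: "'u topology"
 shows "cmap (ptop U (Sphere k)) (subt (ptop U (RP (Suc k))) (rp_away U k Int rp_near U k)) (lift_equator k)"
proof -
 let ?S = "ptop U (Sphere k)" and ?X = "ptop U (RP (Suc k))"
 have c: "cmap ?S ?X (lift_equator k)"
  unfolding lift_equator_def
 proof (intro cm_pair cm_fst)
  have *: "cmap ?S eur (%z. (if a = k then 1 else snd z a) / sqrt 2)" for a
   using cmap_prod_Sphere_coord[of U k a] by(cases "a = k") (simp_all add: cm_div)
  show "cmap ?S (RP (Suc k)) (%z. outer (%a. (if a = k then 1 else snd z a) / sqrt 2))"
   unfolding cmap_into_RP outer_apply
   using lift_equator_outer(1)[of _ k] cm_mult[OF * *] by auto
 qed
 moreover have "lift_equator k z : rp_away U k Int rp_near U k" if "z : topspace ?S" for z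
 proof -
  have v: "snd z : sph k" using that by auto
  show ?thesis using that lift_equator_outer[OF v]
   by(auto simp: lift_equator_def rp_away_def rp_near_def mem_Times_iff simp flip: p2_eq)
 qed
 ultimately show ?thesis by(auto simp: cm_into)
qed

lemma equator_point:
 assumes "z : topspace (subt (ptop U (RP (Suc k))) (rp_away U k Int rp_near U k))"
 obtains v where "v : sph (Suc k)" "snd z = outer v" "(\<Sum>c<k. (v c)\<^sup>2) > 0" "v k ~= 0"
proof -
 obtain v where v: "v : sph (Suc k)" "snd z = outer v" using assms by auto
 have "(\<Sum>c<k. (v c)\<^sup>2) ~= 0" "v k ~= 0" using assms v(2) by(auto simp: rp_away_def rp_near_def p2_eq)
 thus thesis using that[OF v] sum_nonneg[of "{..<k}" "%c. (v c)\<^sup>2"] by(simp add: less_le)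
qed

lemma cont_to_equator:
 fixes U :: "'u topology"
 shows "cmap (subt (ptop U (RP (Suc k))) (rp_away U k Int rp_near U k)) (ptop U (Sphere k)) (to_equator k)"
  (is "cmap ?Y ?S _")
 unfolding to_equator_def
proof (intro cm_pair)
 show "cmap ?Y U fst" by(intro cm_sub cm_fst)
 have c: "cmap ?Y eur (%z. snd z (a, b))" for a b
  by(intro cm_sub cmap_prod_RP_coord)
 have s: "cmap ?Y eur (%z. sqrt (snd z (k, k) * (\<Sum>c<k. snd z (c, c))))"
  by(intro continuous_map_sqrt cm_mult c cm_sum) simp
 show "cmap ?Y (Sphere k) (%z a. if a < k then snd z (a, k) / sqrt (snd z (k, k) * (\<Sum>c<k. snd z (c, c))) else 0)"
  unfolding cmap_into_Sphere
 proof (intro conjI allI image_subsetI)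
  fix a
  have "cmap ?Y eur (%z. snd z (a, k) / sqrt (snd z (k, k) * (\<Sum>c<k. snd z (c, c))))"
   by(rule cm_div[OF c s]) (auto simp: rp_away_def rp_near_def)
  thus "cmap ?Y eur (%z. if a < k then snd z (a, k) / sqrt (snd z (k, k) * (\<Sum>c<k. snd z (c, c))) else 0)"
   by(cases "a < k") simp_all
 next
  fix z assume "z : topspace ?Y"
  then obtain v where v: "v : sph (Suc k)" "snd z = outer v" "(\<Sum>c<k. (v c)\<^sup>2) > 0" "v k ~= 0"
   by(rule equator_point)
  have sq: "(snd z (a, k) / sqrt (snd z (k, k) * (\<Sum>c<k. snd z (c, c))))\<^sup>2 = (v a)\<^sup>2 / (\<Sum>c<k. (v c)\<^sup>2)" for a
   using v(3,4) by(simp add: v(2) power_divide power_mult_distrib flip: p2_eq)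
  show "(%a. if a < k then snd z (a, k) / sqrt (snd z (k, k) * (\<Sum>c<k. snd z (c, c))) else 0) : sph k"
   using v(3) by(simp add: sph_def sq flip: sum_divide_distrib)
 qed
qed

lemma lift_to_equator:
 assumes q: "(u, q) : topspace (subt (ptop U (RP (Suc k))) (rp_away U k Int rp_near U k))"
 shows "lift_equator k (to_equator k (u, q)) = (u, rescale k (1 / sqrt (\<Sum>c<k. q (c, c))) (1 / sqrt (q (k, k))) q)"
proof -
 obtain v where v: "v : sph (Suc k)" "q = outer v" "(\<Sum>c<k. (v c)\<^sup>2) > 0" "v k ~= 0"
  using equator_point[OF q] by auto
 define s where "s = (\<Sum>c<k. (v c)\<^sup>2)"
 have s: "s > 0" "(\<Sum>c<k. v c * v c) = s" using v(3) by(simp_all add: s_def p2_eq)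
 have v0: "v a = 0" if "k < a" for a using v(1) that by(simp add: sph_def)
 have r: "sqrt (v k * v k) = \<bar>v k\<bar>" by(simp flip: p2_eq)
 have N: "(1 / sqrt s)\<^sup>2 * s + (1 / \<bar>v k\<bar>)\<^sup>2 * (v k * v k) = 2"
  using s v(4) by(simp add: power_divide flip: p2_eq)
 have rs: "sqrt (v k * v k * s) = \<bar>v k\<bar> * sqrt s" by(simp only: real_sqrt_mult[of "v k * v k"] r)
 have a: "\<bar>v k\<bar> * \<bar>v k\<bar> = v k * v k" by simp
 have "outer (%a. (if a = k then 1 else if a < k then v a * v k / (\<bar>v k\<bar> * sqrt s) else 0) / sqrt 2) (a, b) =
  v a * v b * (if a < k then 1 / sqrt s else 1 / \<bar>v k\<bar>) * (if b < k then 1 / sqrt s else 1 / \<bar>v k\<bar>) / 2" for a b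
  using s(1) v(4) v0[of a] v0[of b] a
  by(cases a k rule: linorder_cases; cases b k rule: linorder_cases) (simp_all add: field_simps)
 moreover have "rescale k (1 / sqrt s) (1 / \<bar>v k\<bar>) (outer v) (a, b) =
  v a * v b * (if a < k then 1 / sqrt s else 1 / \<bar>v k\<bar>) * (if b < k then 1 / sqrt s else 1 / \<bar>v k\<bar>) / 2" for a b
  by(simp only: rescale_def prod.case outer_apply s(2) N)
 ultimately have "outer (%a. (if a = k then 1 else if a < k then v a * v k / (\<bar>v k\<bar> * sqrt s) else 0) / sqrt 2) ab =
   rescale k (1 / sqrt s) (1 / \<bar>v k\<bar>) (outer v) ab" for ab by(cases ab) (simp only:)
 hence "outer (%a. (if a = k then 1 else if a < k then v a * v k / (\<bar>v k\<bar> * sqrt s) else 0) / sqrt 2) =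
   rescale k (1 / sqrt s) (1 / \<bar>v k\<bar>) (outer v)" ..
 thus ?thesis
  by(simp add: lift_equator_def to_equator_def v(2) s(2) rs r cong: if_cong)
qed

lemma homotopic_equator:
 fixes U :: "'u topology" and k :: nat
 defines "Y == subt (ptop U (RP (Suc k))) (rp_away U k Int rp_near U k)"
 shows "homotopic_with (%_. True) Y Y (lift_equator k o to_equator k) id"
 unfolding Y_def
\<comment> \<open>At \<open>t = 0\<close> both parts of the vector are scaled to length 1, which is
  the equator; at \<open>t = 1\<close> the factors are 1.\<close>
proof (rule rescale_homotopic[where k=k and e="%t q. t + (1 - t) / sqrt (\<Sum>c<k. q (c, c))" and e'="%t q. t + (1 - t) / sqrt (q (k, k))"])
 let ?Y = "subt (ptop U (RP (Suc k))) (rp_away U k Int rp_near U k)"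
 let ?D = "ptop (top_of_set {0..1::real}) ?Y"
 have c1: "cmap ?D eur fst" by(rule continuous_map_into_fulltopology[OF cm_fst])
 have "cmap ?D eur ((%z. snd z (a, b)) o snd)" for a b
  by(rule cm_comp[OF cm_snd cm_sub[OF cmap_prod_RP_coord]])
 hence c2: "cmap ?D eur (%z. snd (snd z) (a, b))" for a b by(simp add: o_def)
 have pos: "(\<Sum>c<k. q (c, c)) > 0" "q (k, k) > 0" "q : topspace (RP (Suc k))" "u : topspace U"
  if uq: "(u, q) : topspace ?Y" for u q
 proof -
  obtain v where v: "v : sph (Suc k)" "q = outer v" "(\<Sum>c<k. (v c)\<^sup>2) > 0" "v k ~= 0"
   using equator_point[OF uq] by auto
  thus "(\<Sum>c<k. q (c, c)) > 0" "q (k, k) > 0" by(simp_all flip: p2_eq)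
  show "q : topspace (RP (Suc k))" "u : topspace U" using uq by auto
 qed
 have s: "cmap ?D eur (%z. sqrt (\<Sum>c<k. snd (snd z) (c, c)))" 
  "cmap ?D eur (%z. sqrt (snd (snd z) (k, k)))"
  by(intro continuous_map_sqrt c2 cm_sum; simp)+
 have d: "cmap ?D eur (%z. 1 - fst z)" by(intro continuous_map_diff c1) simp
 have nz: "sqrt (\<Sum>c<k. snd (snd z) (c, c)) ~= 0" "sqrt (snd (snd z) (k, k)) ~= 0" if "z : topspace ?D" for z
 proof -
  obtain t u q where z: "z = (t, u, q)" "(u, q) : topspace ?Y" using \<open>z : topspace ?D\<close> by(cases z) auto
  show "sqrt (\<Sum>c<k. snd (snd z) (c, c)) ~= 0" "sqrt (snd (snd z) (k, k)) ~= 0" using pos[OF z(2)] by(simp_all add: z(1))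
 qed
 show "cmap ?D eur (%z. fst z + (1 - fst z) / sqrt (\<Sum>c<k. snd (snd z) (c, c)))"
  by(rule continuous_map_add[OF c1 cm_div[OF d s(1) nz(1)]])
 show "cmap ?D eur (%z. fst z + (1 - fst z) / sqrt (snd (snd z) (k, k)))"
  by(rule continuous_map_add[OF c1 cm_div[OF d s(2) nz(2)]])
 have mix: "t + (1 - t) / r > 0" if "t : {0..1}" "r > 0" for t r :: real
  using that by(cases "t = 0") (auto intro!: add_pos_nonneg)
 fix t u q assume t: "t : {0..1::real}" and uq: "(u, q) : topspace ?Y"
 let ?e = "t + (1 - t) / sqrt (\<Sum>c<k. q (c, c))" and ?e' = "t + (1 - t) / sqrt (q (k, k))"
 have e: "?e > 0" "?e' > 0" using mix[OF t] pos[OF uq] by simp_all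
 show p: "?e\<^sup>2 * (\<Sum>c<k. q (c, c)) + ?e'\<^sup>2 * q (k, k) > 0" using e pos[OF uq] by(intro add_pos_pos) simp_all
 obtain v where v: "v : sph (Suc k)" "q = outer v" using pos(3)[OF uq] by auto
 have "rescale k ?e ?e' q : outer ` sph (Suc k)"
  using rescale_outer[OF v(1) refl, of ?e ?e'] p by(simp add: v p2_eq)
 thus "(u, rescale k ?e ?e' q) : rp_away U k Int rp_near U k"
  using e p pos[OF uq] by(simp add: rp_near_def rp_away_def rescale_coords)
next
 fix u q assume uq: "(u, q) : topspace (subt (ptop U (RP (Suc k))) (rp_away U k Int rp_near U k))"
 show "(lift_equator k o to_equator k) (u, q) = (u, rescale k (0 + (1 - 0) / sqrt (\<Sum>c<k. q (c, c))) (0 + (1 - 0) / sqrt (q (k, k))) q)"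
  using lift_to_equator[OF uq] by simp
 show "id (u, q) = (u, rescale k (1 + (1 - 1) / sqrt (\<Sum>c<k. q (c, c))) (1 + (1 - 1) / sqrt (q (k, k))) q)"
  using uq by(simp add: rescale_unit)
qed

lemma chi_lift_equator:
 fixes U :: "'u topology" and k :: nat
 defines "S == ptop U (Sphere k)" and "X == ptop U (RP (Suc k))"
 shows "pb S (lift_equator k) (RP_class U (Suc k)) = pb S (%z. (fst z, outer (snd z))) (RP_class U k)"
proof -
 let ?q = "%z. (fst z, outer (snd z))"
 interpret double_cover S "ptop U (RP k)" ?q "%z. (fst z, %a. - snd z a)"
  unfolding S_def by(rule sphere_double_cover)
 have J: "cmap S X (lift_equator k)"
  using cont_lift_equator[of U k] unfolding S_def X_def cm_into by simp
 have "chi S ((vsel o snd) o ?q) = chi S ((vsel o snd) o lift_equator k)"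
 proof (rule chi_eq_positive)
  show "line_field k S ((vsel o snd) o ?q)" by(rule line_field_compose[OF line_field_prod_RP q])
  show "line_field (Suc k) S ((vsel o snd) o lift_equator k)"
   using J unfolding X_def by(rule line_field_compose[OF line_field_prod_RP])
  fix z assume "z : topspace S"
  hence v: "snd z : sph k" by(auto simp: S_def)
  have s: "sgn (lead (snd z) / sqrt 2) = sgn (lead (snd z))" by(simp add: sgn_divide)
  have "(\<Sum>a<k. ((vsel o snd) o ?q) z a * ((vsel o snd) o lift_equator k) z a) = (\<Sum>a<k. (snd z a)\<^sup>2 / sqrt 2)"
   using lead_nonzero[OF v] by(intro sum.cong refl)
    (auto simp: lift_equator_def vsel_outer lift_equator_outer(2)[OF v] s sgn_if p2_eq zero_less_divide_iff)
  also have "... = 1 / sqrt 2" using v by(simp add: sph_def flip: sum_divide_distrib)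
  finally show "(\<Sum>a<k. ((vsel o snd) o ?q) z a * ((vsel o snd) o lift_equator k) z a) > 0" by simp
 qed simp
 thus ?thesis using pb_chi[OF q, of "vsel o snd"] pb_chi[OF J, of "vsel o snd"] by(simp add: X_def)
qed

text \<open>The Gysin argument on the sphere, moved to the intersection of the two pieces.
  \<open>g\<close> is the sum of the primitives of the \<open>k\<close>-th power on the pieces, and
  along \<open>lift_equator\<close> it becomes the class of \<open>free_over_sphere\<close>.\<close>

lemma free_over_equator:
 fixes U :: "'u topology" and k' :: nat
 defines "k == Suc k'"
 defines "P == ptop U (RP k)" and "X == ptop U (RP (Suc k))"
 defines "Y == subt X (rp_away U k Int rp_near U k)" 
 assumes free: "free_over P fst U k (cpow P (cls P (RP_class U k)))"
  and al': "cch_power P (RP_class U k) k = dl P al'"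
 defines "g == pb Y (rp_drop k) al' + cup Y (cch_power Y (RP_class U (Suc k)) k') (pcch (%z. vsel (snd z) k < 0))"
 assumes g: "cyc Y g"
 shows "free_over Y fst U 2 (%i. if i = 0 then one_at Y else cls Y g)"
proof (rule free_over_transfer)
 show "homotopic_with (%_. True) Y Y (lift_equator k o to_equator k) id"
  unfolding Y_def X_def by(rule homotopic_equator)
 let ?S = "ptop U (Sphere k)" and ?x = "RP_class U k" and ?\<xi> = "RP_class U (Suc k)"
 let ?q = "%z. (fst z, outer (snd z))" and ?T = "%z. (fst z, %a. - snd z a)" and ?J = "lift_equator k"
 let ?E = "%z. lead (snd z) < 0"
 interpret double_cover ?S P ?q ?T unfolding P_def by(rule sphere_double_cover)
 show J: "cmap ?S Y ?J" unfolding Y_def X_def by(rule cont_lift_equator)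
 show "cmap Y ?S (to_equator k)" unfolding Y_def X_def by(rule cont_to_equator)
 show "cmap Y U fst" unfolding Y_def X_def by(intro cm_sub cm_fst)
 show "cmap ?S U fst" by(rule cm_fst)
 show "(if i = 0 then one_at Y else cls Y g) : cohs Y" for i :: nat using g by simp
 have x: "cyc P ?x" unfolding P_def by(rule cyc_RP_class)
 have pj: "cmap P U fst" unfolding P_def by(rule cm_fst)
 \<comment> \<open>A section of the sphere bundle exists because \<open>k\<close> is
   positive.\<close>
 have e0: "(%a. if a = 0 then 1 else 0) : sph k" by(auto simp: sph_def k_def sum.lessThan_Suc_shift simp del: sum.lessThan_Suc)
 have sec: "cmap U ?S (%u. (u, %a. if a = 0 then 1 else 0))"
  by(intro cm_pair continuous_map_id[unfolded id_def]) (use e0 in auto)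
 have E: "?E (?T z) \<longleftrightarrow> ~ ?E z" if "z : topspace ?S" for z
 proof -
  have v: "snd z : sph k" using that by auto
  show ?thesis using lead_uminus[OF v] lead_nonzero[OF v] by auto
 qed
 have lf: "line_field k ?S ((vsel o snd) o ?q)"
  using q unfolding P_def by(rule line_field_compose[OF line_field_prod_RP])
 have qx: "pb ?S ?q ?x = dl ?S (pcch ?E)"
 proof -
  let ?ph = "%z. \<Sum>a<k. snd z a * ((vsel o snd) o ?q) z a"
  have sg: "?ph z = sgn (lead (snd z)) & lead (snd z) ~= 0" if "z : topspace ?S" for z
  proof -
   have v: "snd z : sph k" using that by auto
   have "?ph z = sgn (lead (snd z)) * (\<Sum>a<k. (snd z a)\<^sup>2)"
    by(simp add: vsel_outer sdl p2_eq ac_simps)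
   thus ?thesis using v lead_nonzero[OF v] by(simp add: sph_def)
  qed
  have "pb ?S ?q ?x = chi ?S ((vsel o snd) o ?q)" using pb_chi[OF q, of "vsel o snd"] by(simp add: P_def)
  also have "... = dl ?S (pcch (%z. ?ph z < 0))"
   using sg by(intro chi_linear[OF lf, where m="%a z. snd z a"] cmap_prod_Sphere_coord) (simp_all add: sgn_if)
  also have "... = dl ?S (cch_on ?S (pcch (%z. ?ph z < 0)))" by simp
  also have "cch_on ?S (pcch (%z. ?ph z < 0)) = cch_on ?S (pcch ?E)"
  proof -
   have i: "cmap ?S ?S (%z. z)" by(rule continuous_map_id[unfolded id_def])
   have "pb ?S (%z. z) (pcch ?E) = cch_on ?S (pcch (%z. ?ph z < 0))"
   proof (rule pb_pcch[OF i])
    fix z assume "z : topspace ?S"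
    thus "lead (snd z) < 0 \<longleftrightarrow> ?ph z < 0" using sg[of z] by(simp only: sgn_less)
   qed
   moreover have "pb ?S (%z. z) (pcch ?E) = cch_on ?S (pcch ?E)" by(intro pb_pcch[OF i]) simp
   ultimately show ?thesis by simp
  qed
  finally show ?thesis unfolding dl_cch_on .
 qed
 let ?g = "pb ?S ?q al' + cup ?S (pb ?S ?q (cch_power P ?x k')) (pcch ?E)"
 have fS: "free_over ?S (fst o ?q) U 2 (%i. if i = 0 then one_at ?S else cls ?S ?g)"
 proof (rule free_over_sphere(2)[where si="%u. (u, %a. if a = 0 then 1 else 0)" and x="?x" and E="?E" and k=k' and al=al'])
  show "free_over P fst U (Suc k') (cpow P (cls P ?x))" using free unfolding k_def .
  show "cch_power P ?x (Suc k') = dl P al'" using al' unfolding k_def .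
  show "?E (?T z) \<longleftrightarrow> ~ ?E z" if "z : topspace ?S" for z using that by(rule E)
  show "fst (?q (u, %a. if a = 0 then 1 else 0)) = u" for u :: 'u by simp
 qed (fact pj sec x qx)+
 have "pb ?S ?J g = ?g"
 proof -
  have "pb ?S ?J (pb Y (rp_drop k) al') = pb ?S (rp_drop k o ?J) al'" by(rule pb_pb[OF J])
  also have "... = pb ?S ?q al'"
  proof (rule pb_cong)
   fix z assume "z : topspace ?S"
   hence v: "snd z : sph k" by auto
   show "(rp_drop k o ?J) z = ?q z" using lift_equator_outer(5)[OF v] by(simp add: rp_drop_def lift_equator_def)
  qed
  finally have 1: "pb ?S ?J (pb Y (rp_drop k) al') = pb ?S ?q al'" .
  have 2: "pb ?S ?J (cch_power Y ?\<xi> k') = pb ?S ?q (cch_power P ?x k')"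
   using chi_lift_equator[of U k] by(simp add: pb_cch_power[OF J] pb_cch_power[OF q])
  have 3: "pb ?S ?J (pcch (%z. vsel (snd z) k < 0)) = cch_on ?S (pcch ?E)"
  proof (rule pb_pcch[OF J])
   fix z assume "z : topspace ?S"
   hence v: "snd z : sph k" by auto
   show "vsel (snd (?J z)) k < 0 \<longleftrightarrow> lead (snd z) < 0"
    using lift_equator_outer(2)[OF v] lead_nonzero[OF v] by(auto simp: lift_equator_def vsel_outer sgn_if zero_less_divide_iff)
  qed
  show ?thesis by(simp add: g_def pb_add pb_cup[OF J] 1 2 3)
 qed
 hence "pull ?S ?J Y (cls Y g) = cls ?S ?g" by(simp add: pull_cls[OF J g])
 hence "pull ?S ?J Y (if i = 0 then one_at Y else cls Y g) = (if i = 0 then one_at ?S else cls ?S ?g)" for i :: nat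
  by(simp add: pull_one_at[OF J])
 thus "free_over ?S fst U 2 (%i. pull ?S ?J Y (if i = 0 then one_at Y else cls Y g))"
  using fS by(simp add: o_def)
qed (simp_all add: lift_equator_def to_equator_def)

text \<open>Away from the axis a primitive of the \<open>k\<close>-th power is pulled back from
  \<open>RP k\<close>. Near the axis the class itself is the coboundary of the 0-cochain
  \<open>?e\<close>, so \<open>x ^ (k - 1)\<close> times \<open>?e\<close> is a primitive. These are
  the data for \<open>free_over_join\<close>.\<close>

lemma free_over_RP_step:
 fixes U :: "'u topology" and k' :: nat
 defines "k == Suc k'"
 defines "P == ptop U (RP k)" and "X == ptop U (RP (Suc k))"
 assumes free: "free_over P fst U k (cpow P (cls P (RP_class U k)))"
 shows "free_over X fst U (Suc k) (cpow X (cls X (RP_class U (Suc k))))"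
proof -
 let ?\<xi> = "RP_class U (Suc k)" and ?A = "rp_away U k" and ?B = "rp_near U k"
 let ?XA = "subt X ?A" and ?XB = "subt X ?B" and ?Y = "subt X (?A Int ?B)"
 let ?e = "pcch (%z :: 'u \<times> (nat \<times> nat => real). vsel (snd z) k < 0)"
 obtain al' where al': "cch_power P (RP_class U k) k = dl P al'"
  using RP_power_exact[of U k'] unfolding P_def k_def .
 let ?al = "pb ?XA (rp_drop k) al'" and ?be = "cup ?XB (cch_power ?XB ?\<xi> k') ?e"
 have \<xi>: "cyc X ?\<xi>" unfolding X_def by(rule cyc_RP_class)
 have drop: "cmap ?XA P (rp_drop k)" unfolding X_def P_def by(rule cont_rp_drop) simp
 have "pb ?XA (rp_drop k) (RP_class U k) = cch_on ?XA ?\<xi>" unfolding X_def by(rule chi_rp_drop) simp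
 hence "pb ?XA (rp_drop k) (cch_power P (RP_class U k) k) = cch_power ?XA ?\<xi> k"
  by(simp add: pb_cch_power[OF drop])
 hence al: "cch_power ?XA ?\<xi> k = dl ?XA ?al" by(simp add: al' pb_dl[OF drop])
 have chart: "cch_on ?XB ?\<xi> = dl ?XB ?e"
  using RP_class_chart[of k "Suc k" ?B U] unfolding X_def by(simp add: cch_on_chi_sub rp_near_def)
 have "dl ?XB ?be = cup ?XB (cch_power ?XB ?\<xi> k') (cch_on ?XB ?\<xi>)"
  using cyc_cch_power[OF cyc_sub[OF \<xi>, of ?B], of k'] by(simp only: leibniz chart cyc_def cup_0 add_0)
 hence be: "cch_power ?XB ?\<xi> k = dl ?XB ?be" by(simp add: k_def)
 have YA: "subt ?XA ?B = ?Y" and YB: "subt ?XB ?A = ?Y" by(simp_all add: subtopology_subtopology Int_commute)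
 let ?g = "pb ?Y (rp_drop k) al' + cup ?Y (cch_power ?Y ?\<xi> k') ?e"
 have gal: "cch_on ?Y ?al = pb ?Y (rp_drop k) al'" using pb_sub[of ?XA ?B "rp_drop k" al'] by(simp add: YA)
 have gbe: "cch_on ?Y ?be = cup ?Y (cch_power ?Y ?\<xi> k') ?e"
  using cup_sub[of ?XB ?A "cch_power ?XB ?\<xi> k'" ?e] cch_on_cch_power[of ?XB ?A ?\<xi> k'] cup_cch_on(1)[of ?Y "cch_power ?XB ?\<xi> k'" ?e]
  by(simp add: YB)
 have g: "?g = cch_on ?Y (?al + ?be)" by(simp add: cch_on_add gal gbe)
 have coc: "cyc ?Y (?al + ?be)"
 proof -
  have "dl ?Y ?al = cch_power ?Y ?\<xi> k"
   using dl_sub[of ?XA ?B ?al] cch_on_cch_power[of ?XA ?B ?\<xi> k] by(simp add: YA flip: al)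
  moreover have "dl ?Y ?be = cch_power ?Y ?\<xi> k"
   using dl_sub[of ?XB ?A ?be] cch_on_cch_power[of ?XB ?A ?\<xi> k] by(simp add: YB flip: be)
  ultimately show ?thesis by(simp add: cyc_def coboundary_add)
 qed
 have clsg: "cls ?Y ?g = cls ?Y (?al + ?be)"
  unfolding g using coc exact_cch_on_add[of ?Y "?al + ?be"] by(simp add: cls_eq_iff)
 show ?thesis
 proof (rule free_over_join[OF _ _ _ _ \<xi> _ al be])
  show "openin X ?A" "openin X ?B" unfolding X_def by(rule openin_rp)+
  show "topspace X <= ?A Un ?B" unfolding X_def by(rule rp_cover)
  show "cmap X U fst" unfolding X_def by(rule cm_fst)
  show "0 < k" by(simp add: k_def)
  show "exact ?XB ?\<xi>" using chart by(rule exactI)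
  show "free_over ?XA fst U k (cpow ?XA (cls ?XA ?\<xi>))"
   using free_over_rp_away[OF free[unfolded P_def]] by(simp add: X_def)
  show "free_over ?XB fst U 1 (%i. one_at ?XB)" unfolding X_def by(rule free_over_rp_near)
  have "free_over ?Y fst U 2 (%i. if i = 0 then one_at ?Y else cls ?Y ?g)"
   unfolding X_def k_def
   by(rule free_over_equator[OF free[unfolded P_def k_def] al'[unfolded P_def k_def]])
    (use coc g in \<open>simp add: X_def k_def\<close>)
  thus "free_over ?Y fst U 2 (%i. if i = 0 then one_at ?Y else cls ?Y (?al + ?be))" by(simp only: clsg)
 qed
qed

text \<open>The step from \<open>RP k\<close> needs a point on the sphere, so \<open>RP 1\<close>, a
  single point, is treated separately; \<open>RP 0\<close> is empty and has no cohomology.\<close>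

theorem free_over_RP:
 "free_over (ptop U (RP k)) fst U k (cpow (ptop U (RP k)) (cls (ptop U (RP k)) (RP_class U k)))"
proof (induction k)
 case 0
 let ?X = "ptop U (RP 0)"
 have "y = 0" if y: "y : cohs ?X" for y
 proof -
  obtain c where c: "cyc ?X c" "y = cls ?X c" using y by(rule cohsE)
  have "topspace ?X = {}" by(simp add: sph_def)
  hence "~ ssx p ?X s" for p s
   using nonempty_standard_simplex[of p] by(auto simp: ssx_d cm_def Pi_iff)
  hence "cch_on ?X c = dl ?X 0" by(simp add: cch_on_def coboundary_0 fun_eq_iff cch_apply)
  hence "exact ?X c" by(rule exactI)
  thus ?thesis using c by(simp add: cls_eq_0_iff)
 qed
 thus ?case by(simp add: free_over_def)
next
 case (Suc k)
 show ?case
 proof (cases k)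
  case 0
  let ?X = "ptop U (RP 1)" and ?e = "%a :: nat. if a = 0 then 1 else 0 :: real"
  have pt: "q = outer ?e" if "q : topspace (RP 1)" for q
  proof -
   obtain v where v: "v : sph 1" "q = outer v" using \<open>q : topspace (RP 1)\<close> by auto
   have "v 0 * v 0 = 1" "!!a. a ~= 0 ==> v a = 0" using v by(auto simp: sph_def p2_eq)
   thus ?thesis using v(2) by(auto simp: fun_eq_iff)
  qed
  have e: "?e : sph 1" by(auto simp: sph_def)
  have f: "cmap U ?X (%u. (u, outer ?e))"
   by(intro cm_pair continuous_map_id[unfolded id_def]) (use e in auto)
  have "free_over ?X fst U 1 (%i. one_at ?X)"
  proof (rule free_over_transfer[OF f cm_fst])
   show "cmap ?X U fst" by(rule cm_fst)
   show "cmap U U (%u. u)" by(rule continuous_map_id[unfolded id_def])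
   show "homotopic_with (%_. True) ?X ?X ((%u. (u, outer ?e)) o fst) id"
   proof (rule homotopic_with_equal)
    show "cmap ?X ?X ((%u. (u, outer ?e)) o fst)" by(rule cm_comp[OF cm_fst f])
    show "((%u. (u, outer ?e)) o fst) z = id z" if "z : topspace ?X" for z
     using pt[of "snd z"] that by(auto simp: prod_eq_iff mem_Times_iff)
   qed auto
   show "free_over U (%u. u) U 1 (%i. pull U (%u. (u, outer ?e)) ?X (one_at ?X))"
    by(simp only: pull_one_at[OF f] free_over_id)
  qed simp_all
  thus ?thesis using 0 free_over_cong[of ?X fst U 1 "%i. one_at ?X" "cpow ?X (cls ?X (RP_class U 1))"]
   by(simp add: cpow_0 o_def)
 next
  case (Suc k')
  thus ?thesis using Suc.IH free_over_RP_step[of U k'] by(simp only:)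
 qed
qed

section \<open>The Leray--Hirsch theorem for finite covers\<close>

text \<open>Glued as functions, the cocycles have a coboundary that vanishes on small simplices. Its
  primitive from \<open>small_cyc_exact\<close> vanishes there too, so subtracting it makes a
  cocycle without changing the restrictions.\<close>

lemma glue_cyc:
 fixes X :: "'a topology"
 assumes op: "openin X A" "openin X B" and cover: "topspace X <= A Un B"
  and a: "cyc (subt X A) a" and b: "cyc (subt X B) b"
  and ab: "cch_on (subt X (A Int B)) a = cch_on (subt X (A Int B)) b"
 obtains u where "cyc X u" "cch_on (subt X A) u = cch_on (subt X A) a"
  "cch_on (subt X B) u = cch_on (subt X B) b"
proof -
 define u where "u = (%p s. if ssx p (subt X A) s then a p s else if ssx p (subt X B) s then b p s else 0)"
 have both: "ssx p (subt X (A Int B)) s" if "ssx p (subt X A) s" "ssx p (subt X B) s" for p s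
  using that by(auto simp: ssx_d cm_into)
 have uA: "cch_on (subt X A) u = cch_on (subt X A) a" by(simp add: cch_on_def u_def fun_eq_iff)
 have ab': "a p s = b p s" if "ssx p (subt X A) s" "ssx p (subt X B) s" for p s
  using fun_cong[OF fun_cong[OF ab, of p], of s] both[OF that] by(simp add: cch_on_def)
 have uB: "cch_on (subt X B) u = cch_on (subt X B) b"
  using ab' by(simp add: cch_on_def u_def fun_eq_iff)
 have cA: "cyc (subt X A) u" and cB: "cyc (subt X B) u"
  using cyc_cch_on[of "subt X A" u] cyc_cch_on[of "subt X B" u] a b by(simp_all add: uA uB)
 have small: "dl X u p s = 0" if "V : {A, B}" "ssx p (subt X V) s" for p s V
 proof -
  have "cch_on (subt X V) (dl X u) = 0"
   using cA cB that(1) by(auto simp: dl_sub cyc_def)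
  hence "cch_on (subt X V) (dl X u) p s = 0" by(simp add: cch_apply)
  thus ?thesis using that(2) by(simp add: cch_on_def)
 qed
 obtain e where e: "cch_on X (dl X u) = dl X e"
  "!!p s V. V : {A, B} ==> ssx p (subt X V) s ==> e p s = 0"
  by(rule small_cyc_exact[of "{A, B}" X "dl X u"]) (use op cover small in auto)
 have e0: "cch_on (subt X V) e = 0" if "V : {A, B}" for V
  using e(2)[OF that] by(simp add: cch_on_def fun_eq_iff cch_apply)
 show thesis
 proof (rule that[of "u + e"])
  show "cyc X (u + e)" using e(1) by(simp add: cyc_def coboundary_add)
 qed (simp_all add: cch_on_add e0 uA uB)
qed

text \<open>The connecting map of the Mayer-Vietoris sequence on cocycles: \<open>e\<close> extends
  \<open>c\<close> by zero to \<open>A\<close>, and \<open>w\<close> is its coboundary on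
  \<open>A\<close> and 0 on \<open>B\<close>.\<close>

lemma connecting_cyc:
 fixes X :: "'a topology"
 assumes op: "openin X A" "openin X B" and cover: "topspace X <= A Un B"
  and c: "cyc (subt X (A Int B)) c"
 obtains w e where "cyc X w" "cch_on (subt X A) w = dl (subt X A) e"
  "cch_on (subt X B) w = 0" "cch_on (subt X (A Int B)) e = cch_on (subt X (A Int B)) c"
proof -
 let ?e = "cch_on (subt X (A Int B)) c"
 have AB: "subt (subt X A) B = subt X (A Int B)" by(simp add: subtopology_subtopology)
 have "cch_on (subt X (A Int B)) (dl (subt X A) ?e) = cch_on (subt X (A Int B)) 0"
  using c dl_sub[of "subt X A" B ?e] by(simp add: AB cyc_def)
 then obtain w where "cyc X w" "cch_on (subt X A) w = dl (subt X A) ?e"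
  "cch_on (subt X B) w = 0"
  by(rule glue_cyc[OF op cover, of "dl (subt X A) ?e" 0, rotated 2]) simp_all
 thus thesis by(rule that) simp
qed

text \<open>The Leray-Hirsch comparison map, kept at cochain level because the gluing below
  manipulates primitives and not only classes.\<close>

definition lh :: "'w topology => ('w => 'b) => 'w cochain => nat => (nat => 'b cochain) => 'w cochain" where
 "lh W pj x n u = (\<Sum>i<n. cup W (cch_power W x i) (pb W pj (u i)))"

lemma lh_add: "lh W pj x n (%i. u i + v i) = lh W pj x n u + lh W pj x n v"
 by(simp add: lh_def pb_add cup_add_right sum.distrib)

lemma lh_dl:
 assumes "cmap W B pj" "cyc W x"
 shows "dl W (lh W pj x n u) = lh W pj x n (%i. dl B (u i))"
 using cyc_cch_power[OF assms(2)]
 by(simp add: lh_def dl_sum leibniz cyc_def cup_0 pb_dl[OF assms(1)])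

lemma lh_cong:
 assumes "cmap W B pj" "!!i. i < n ==> cch_on B (u i) = cch_on B (v i)"
 shows "lh W pj x n u = lh W pj x n v"
proof -
 have "pb W pj (u i) = pb W pj (v i)" if "i < n" for i
  using assms(2)[OF that] pb_cch_on[OF assms(1), of "u i"] pb_cch_on[OF assms(1), of "v i"] by simp
 thus ?thesis by(simp add: lh_def)
qed

lemma cch_on_sum: "cch_on X (\<Sum>i\<in>I. c i) = (\<Sum>i\<in>I. cch_on X (c i))"
 by(rule sum_additive[of "cch_on X"]) (simp_all add: cch_on_add)

lemma lh_sub: "cch_on (subt W A) (lh W pj x n u) = lh (subt W A) pj x n u"
proof -
 let ?Y = "subt W A"
 have "cch_on ?Y (cup W (cch_power W x i) (pb W pj (u i))) = cup ?Y (cch_power ?Y x i) (pb ?Y pj (u i))" for i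
  using cup_cch_on(1)[of ?Y "cch_power W x i"] cup_cch_on(2)[of ?Y _ "pb W pj (u i)"]
  by(simp add: cup_sub cch_on_cch_power pb_sub)
 thus ?thesis by(simp add: lh_def cch_on_sum)
qed

lemma lh_cls:
 assumes "cmap W B pj" "cyc W x" "!!i. i < n ==> cyc B (u i)"
 shows "cyc W (lh W pj x n u)"
  "cls W (lh W pj x n u) = (\<Sum>i<n. cpow W (cls W x) i * pull W pj B (cls B (u i)))"
proof -
 have *: "cyc W (cup W (cch_power W x i) (pb W pj (u i)))" if "i < n" for i
  using assms that by(intro cyc_cup cyc_cch_power cyc_pb) auto
 thus "cyc W (lh W pj x n u)" unfolding lh_def by(intro cyc_sum) simp
 have "cls W (\<Sum>i<m. cup W (cch_power W x i) (pb W pj (u i))) = (\<Sum>i<m. cpow W (cls W x) i * pull W pj B (cls B (u i)))" if "m <= n" for m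
  using that
 proof (induction m)
  case (Suc m)
  have "cyc W (\<Sum>i<m. cup W (cch_power W x i) (pb W pj (u i)))" by(intro cyc_sum *) (use Suc in auto)
  thus ?case using Suc * assms by(simp add: cls_add cls_cup cyc_pb[OF assms(1)] cls_cch_power pull_cls)
 qed simp
 thus "cls W (lh W pj x n u) = (\<Sum>i<n. cpow W (cls W x) i * pull W pj B (cls B (u i)))"
  unfolding lh_def by simp
qed

lemma cohs_choose:
 fixes n :: nat
 assumes "ALL i<n. U i : cohs B"
 shows "EX u. (ALL i<n. cyc B (u i)) & (ALL i<n. U i = cls B (u i))"
proof (intro exI[of _ "%i. SOME c. cyc B c & U i = cls B c"] conjI allI impI)
 fix i :: nat assume "i < n"
 then obtain c where c: "cyc B c" "U i = cls B c" using assms cohsE[of "U i" B thesis] by simp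
 hence "EX c. cyc B c & U i = cls B c" by(intro exI[of _ c] conjI)
 from someI_ex[OF this] show "cyc B (SOME c. cyc B c & U i = cls B c)" "U i = cls B (SOME c. cyc B c & U i = cls B c)"
  by simp_all
qed

lemma free_over_lh_span:
 assumes "free_over W pj B n (cpow W (cls W x))" "cmap W B pj" "cyc W x" "cyc W y"
 shows "EX u. (ALL i<n. cyc B (u i)) & exact W (y + lh W pj x n u)"
proof -
 obtain U where U: "ALL i<n. U i : cohs B" "cls W y = (\<Sum>i<n. cpow W (cls W x) i * pull W pj B (U i))"
  using free_over_span[OF assms(1) cls_in_cohs[OF assms(4)]] by(elim exE conjE) (rule that)
 obtain u where u: "ALL i<n. cyc B (u i)" "ALL i<n. U i = cls B (u i)"
  using cohs_choose[OF U(1)] by(elim exE conjE) (rule that)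
 note l = lh_cls[OF assms(2,3), of n u]
 have "cls W (lh W pj x n u) = cls W y" using l(2) u U(2) by simp
 hence "exact W (y + lh W pj x n u)" using l(1) u assms(4) cls_eq_iff[of W y "lh W pj x n u"] by simp
 thus ?thesis using u(1) by(intro exI[of _ u] conjI)
qed

lemma free_over_lh_indep:
 assumes "free_over W pj B n (cpow W (cls W x))" "cmap W B pj" "cyc W x"
  "!!i. i < n ==> cyc B (u i)" "exact W (lh W pj x n u)" "i < n"
 shows "exact B (u i)"
proof -
 have c: "cyc W (lh W pj x n u)" by(rule lh_cls(1)[OF assms(2,3)]) (rule assms(4))
 have "cls W (lh W pj x n u) = (\<Sum>i<n. cpow W (cls W x) i * pull W pj B (cls B (u i)))"
  by(rule lh_cls(2)[OF assms(2,3)]) (rule assms(4))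
 hence 0: "(\<Sum>i<n. cpow W (cls W x) i * pull W pj B (cls B (u i))) = 0"
  using assms(5) unfolding cls_eq_0_iff[OF c, symmetric] by(rule trans[OF sym])
 have "cls B (u i) = 0"
  using free_over_indep[OF assms(1) cls_in_cohs[OF assms(4)] 0 assms(6)] .
 thus ?thesis unfolding cls_eq_0_iff[OF assms(4)[OF assms(6)]] .
qed

lemma free_overI_lh:
 assumes pj: "cmap W B pj" and x: "cyc W x"
  and span: "!!y. cyc W y ==> EX u. (ALL i<n. cyc B (u i)) & exact W (y + lh W pj x n u)"
  and indep: "!!u i. (ALL i<n. cyc B (u i)) ==> exact W (lh W pj x n u) ==> i < n ==> exact B (u i)"
 shows "free_over W pj B n (cpow W (cls W x))"
 unfolding free_over_def
proof (intro conjI ballI allI impI)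
 fix Y assume "Y : cohs W"
 then obtain y where y: "cyc W y" "Y = cls W y" by(rule cohsE)
 obtain u where u: "ALL i<n. cyc B (u i)" "exact W (y + lh W pj x n u)" using span[OF y(1)] by(elim exE conjE) (rule that)
 note l = lh_cls[OF pj x, of n u]
 have "Y = (\<Sum>i<n. cpow W (cls W x) i * pull W pj B (cls B (u i)))"
  using l u y cls_eq_iff[of W y "lh W pj x n u"] by simp
 thus "EX u. (ALL i<n. u i : cohs B) & Y = (\<Sum>i<n. cpow W (cls W x) i * pull W pj B (u i))"
  using u(1) by(intro exI[of _ "%i. cls B (u i)"]) simp
next
 fix U i assume U: "ALL i<n. U i : cohs B" "(\<Sum>i<n. cpow W (cls W x) i * pull W pj B (U i)) = 0" and i: "i < n"
 obtain u where u: "ALL i<n. cyc B (u i)" "ALL i<n. U i = cls B (u i)"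
  using cohs_choose[OF U(1)] by(elim exE conjE) (rule that)
 note l = lh_cls[OF pj x, of n u]
 have "exact W (lh W pj x n u)" using l U(2) u cls_eq_0_iff[of W "lh W pj x n u"] by simp
 thus "U i = 0" using indep[of u i] u i by(simp add: cls_eq_0_iff)
qed

lemma index_choice:
 fixes n :: nat
 assumes "ALL i<n. EX c. Q i c" shows "EX u. ALL i<n. Q i (u i)"
 using bchoice[of "{..<n}" Q] assms by auto

lemma exact_choose:
 fixes n :: nat
 assumes "ALL i<n. exact X (u i)" shows "EX e. ALL i<n. cch_on X (u i) = dl X (e i)"
 by(rule index_choice[where Q="%i c. cch_on X (u i) = dl X c"]) (use assms in \<open>simp add: exact_def\<close>)

lemma cch_on_lh [simp]: "cch_on W (lh W pj x n u) = lh W pj x n u"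
 by(simp add: lh_def cch_on_sum)

locale two_covers =
 fixes W :: "'w topology" and pj :: "'w => 'b" and B :: "'b topology" and x :: "'w cochain" and n :: nat
  and V1 V2 :: "'b set"
 assumes pj: "cmap W B pj" and x: "cyc W x"
  and op: "openin B V1" "openin B V2" and cover: "topspace B <= V1 Un V2"
begin

definition over :: "'b set => 'w set" where
 "over V = {w : topspace W. pj w : V}"

abbreviation WV :: "'b set => 'w topology" where "WV V == subt W (over V)"
abbreviation BV :: "'b set => 'b topology" where "BV V == subt B V"

abbreviation Ph :: "'b set => (nat => 'b cochain) => 'w cochain" where
 "Ph V == lh (WV V) pj x n"

lemma pjV: "cmap (WV V) (BV V) pj"
 using pj by(auto simp: cm_into over_def intro: cm_sub)

lemma xV: "cyc (WV V) x" using x by(rule cyc_sub)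

lemma over_Int: "over V1 Int over V2 = over (V1 Int V2)" by(auto simp: over_def)

lemma op_over: "openin W (over V1)" "openin W (over V2)"
 unfolding over_def using openin_continuous_map_preimage[OF pj] op by auto

lemma cover_over: "topspace W <= over V1 Un over V2"
 using cover pj by(auto simp: over_def cm_def Pi_iff)

lemma sub_V12: "subt (BV V1) V2 = BV (V1 Int V2)" "subt (BV V2) V1 = BV (V1 Int V2)"
  "subt (WV V1) (over V2) = WV (V1 Int V2)" "subt (WV V2) (over V1) = WV (V1 Int V2)"
 by(simp_all add: subtopology_subtopology Int_commute flip: over_Int)

lemma Ph_restr: "cch_on (WV (V1 Int V2)) (Ph V1 u) = Ph (V1 Int V2) u" "cch_on (WV (V1 Int V2)) (Ph V2 u) = Ph (V1 Int V2) u"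
 using lh_sub[of "WV V1" "over V2" pj x n u] lh_sub[of "WV V2" "over V1" pj x n u] by(simp_all only: sub_V12)

lemma Ph_total: "cch_on (WV V) (lh W pj x n u) = Ph V u" by(rule lh_sub)

lemma Ph_dl: "dl (WV V) (Ph V u) = Ph V (%i. dl (BV V) (u i))"
 by(rule lh_dl[OF pjV xV])

lemma Ph_cong: "(!!i. i < n ==> cch_on (BV V) (u i) = cch_on (BV V) (v i)) ==> Ph V u = Ph V v"
 by(rule lh_cong[OF pjV])

abbreviation free :: "'b set => bool" where
 "free V == free_over (WV V) pj (BV V) n (cpow (WV V) (cls (WV V) x))"

lemma cob_V12: "dl (BV (V1 Int V2)) a = cch_on (BV (V1 Int V2)) (dl (BV V1) a)"
  "dl (BV (V1 Int V2)) a = cch_on (BV (V1 Int V2)) (dl (BV V2) a)"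
  "dl (WV (V1 Int V2)) y = cch_on (WV (V1 Int V2)) (dl (WV V1) y)"
  "dl (WV (V1 Int V2)) y = cch_on (WV (V1 Int V2)) (dl (WV V2) y)"
 using dl_sub[of "BV V1" V2 a] dl_sub[of "BV V2" V1 a] 
  dl_sub[of "WV V1" "over V2" y] dl_sub[of "WV V2" "over V1" y] by(simp_all only: sub_V12)

lemma exact_V12: "exact (WV V1) y ==> exact (WV (V1 Int V2)) y" "exact (WV V2) y ==> exact (WV (V1 Int V2)) y"
 using exact_sub[of "WV V1" y "over V2"] exact_sub[of "WV V2" y "over V1"] by(simp_all only: sub_V12)

text \<open>Half of a five lemma chase. Over each piece the coefficients are exact, and their
  primitives can be corrected by cocycles so that they account for the primitive \<open>zt\<close>
  of the combination. On the intersection freeness then makes the primitives differ by a coboundary,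
  and Mayer-Vietoris applies.\<close>

lemma glue_indep:
 assumes free: "free V1" "free V2" "free (V1 Int V2)"
  and u: "ALL i<n. cyc B (u i)" "exact W (lh W pj x n u)" and i: "i < n"
 shows "exact B (u i)"
proof -
 let ?V = "V1 Int V2"
 obtain zt where zt: "cch_on W (lh W pj x n u) = dl W zt" using u(2) by(rule exactE)
 have key: "EX al. EX a. (ALL i<n. cch_on (BV V) (u i) = dl (BV V) (al i)) & (ALL i<n. cyc (BV V) (a i)) &
   exact (WV V) (zt + Ph V (%i. al i + a i))" if fV: "free V" for V
 proof -
  have "exact (WV V) (Ph V u)"
   using exact_sub[OF u(2), of "over V"] exact_cch_on[of "WV V" "lh W pj x n u"] by(simp only: Ph_total)
  hence ex: "exact (BV V) (u i)" if "i < n" for i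
   using u(1) by(intro free_over_lh_indep[OF fV pjV xV _ _ that]) (simp_all add: cyc_sub)
  have "ALL i<n. exact (BV V) (u i)" using ex by blast
  from exact_choose[OF this] obtain al where al: "ALL i<n. cch_on (BV V) (u i) = dl (BV V) (al i)"
   by(elim exE) (rule that)
  have "dl (WV V) (Ph V al) = Ph V u"
   unfolding Ph_dl by(rule Ph_cong) (use al in simp)
  moreover have "dl (WV V) zt = Ph V u"
   using dl_sub[of W "over V" zt] cch_on_sub[of W "over V" "lh W pj x n u"] by(simp add: Ph_total flip: zt)
  ultimately have c: "cyc (WV V) (zt + Ph V al)" by(simp add: cyc_def coboundary_add)
  obtain a where a: "ALL i<n. cyc (BV V) (a i)" "exact (WV V) (zt + Ph V al + Ph V a)"
   using free_over_lh_span[OF fV pjV xV c] by(elim exE conjE) (rule that)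
  show ?thesis using al a by(intro exI[of _ al] exI[of _ a]) (simp add: lh_add add.assoc)
 qed
 obtain al a where al: "ALL i<n. cch_on (BV V1) (u i) = dl (BV V1) (al i)" and a: "ALL i<n. cyc (BV V1) (a i)"
   and ea: "exact (WV V1) (zt + Ph V1 (%i. al i + a i))"
  using key[OF free(1)] by(elim exE conjE) (rule that)
 obtain be b where be: "ALL i<n. cch_on (BV V2) (u i) = dl (BV V2) (be i)" and b: "ALL i<n. cyc (BV V2) (b i)"
   and eb: "exact (WV V2) (zt + Ph V2 (%i. be i + b i))"
  using key[OF free(2)] by(elim exE conjE) (rule that)
 let ?c = "%i. (al i + a i) + (be i + b i)"
 have "exact (WV ?V) ((zt + Ph V1 (%i. al i + a i)) + (zt + Ph V2 (%i. be i + b i)))"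
  by(rule exact_add[OF exact_V12(1)[OF ea] exact_V12(2)[OF eb]])
 hence "exact (WV ?V) (cch_on (WV ?V) ((zt + Ph V1 (%i. al i + a i)) + (zt + Ph V2 (%i. be i + b i))))" by simp
 also have "cch_on (WV ?V) ((zt + Ph V1 (%i. al i + a i)) + (zt + Ph V2 (%i. be i + b i))) =
   (cch_on (WV ?V) zt + cch_on (WV ?V) zt) + (Ph ?V (%i. al i + a i) + Ph ?V (%i. be i + b i))"
  by(simp only: cch_on_add Ph_restr ac_simps)
 also have "... = Ph ?V ?c" by(simp only: cch_add_self add_0 lh_add)
 finally have e: "exact (WV ?V) (Ph ?V ?c)" .
 have "cyc (BV ?V) (?c i)" if "i < n" for i
 proof -
  have "dl (BV ?V) (?c i) = dl (BV ?V) (al i + a i) + dl (BV ?V) (be i + b i)" by(rule coboundary_add)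
  also have "... = cch_on (BV ?V) (cch_on (BV V1) (u i)) + cch_on (BV ?V) (cch_on (BV V2) (u i))"
   unfolding cob_V12(1)[of "al i + a i"] cob_V12(2)[of "be i + b i"]
   using al be a b that by(simp add: coboundary_add cyc_def)
  also have "... = 0"
   using cch_on_sub[of "BV V1" V2 "u i"] cch_on_sub[of "BV V2" V1 "u i"] by(simp add: sub_V12)
  finally show ?thesis by(simp add: cyc_def)
 qed
 hence "exact (BV ?V) (?c i)" by(rule free_over_lh_indep[OF free(3) pjV xV _ e i])
 thus ?thesis
  by(intro mayer_vietoris_exact[OF op cover, of "u i" "al i + a i" "be i + b i"])
   (use u(1) al be a b i in \<open>simp_all add: coboundary_add cyc_def\<close>)
qed

text \<open>The other half of the chase. The local coefficients agree up to coboundaries on the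
  intersection, hence glue to \<open>u\<close>. What is left of \<open>y\<close> is exact on both
  pieces; the obstruction on the intersection has coefficients \<open>c\<close>, and their images
  \<open>?w\<close> under the connecting map remove it.\<close>

lemma glue_span:
 assumes free: "free V1" "free V2" "free (V1 Int V2)" and y: "cyc W y"
 shows "EX u. (ALL i<n. cyc B (u i)) & exact W (y + lh W pj x n u)"
proof -
 let ?V = "V1 Int V2"
 obtain a where a: "ALL i<n. cyc (BV V1) (a i)" "exact (WV V1) (y + Ph V1 a)"
  using free_over_lh_span[OF free(1) pjV xV cyc_sub[OF y]] by(elim exE conjE) (rule that)
 obtain b where b: "ALL i<n. cyc (BV V2) (b i)" "exact (WV V2) (y + Ph V2 b)"
  using free_over_lh_span[OF free(2) pjV xV cyc_sub[OF y]] by(elim exE conjE) (rule that)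
 have "exact (WV ?V) (cch_on (WV ?V) ((y + Ph V1 a) + (y + Ph V2 b)))"
  using exact_add[OF exact_V12(1)[OF a(2)] exact_V12(2)[OF b(2)]] by simp
 also have "cch_on (WV ?V) ((y + Ph V1 a) + (y + Ph V2 b)) = (cch_on (WV ?V) y + cch_on (WV ?V) y) + (Ph ?V a + Ph ?V b)"
  by(simp only: cch_on_add Ph_restr ac_simps)
 also have "... = Ph ?V (%i. a i + b i)" by(simp only: cch_add_self add_0 lh_add)
 finally have e: "exact (WV ?V) (Ph ?V (%i. a i + b i))" .
 have "cyc (BV ?V) (a i + b i)" if "i < n" for i
  using a(1) b(1) that cob_V12(1)[of "a i"] cob_V12(2)[of "b i"] by(simp add: cyc_def coboundary_add)
 hence ex: "exact (BV ?V) (a i + b i)" if "i < n" for i by(rule free_over_lh_indep[OF free(3) pjV xV _ e that])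
 have "ALL i<n. exact (BV ?V) (a i + b i)" using ex by blast
 from exact_choose[OF this] obtain ga where ga: "ALL i<n. cch_on (BV ?V) (a i + b i) = dl (BV ?V) (ga i)"
  by(elim exE) (rule that)
 \<comment> \<open>Changes the coefficients over \<open>V1\<close> within their classes so that they
   agree with \<open>b\<close> on the intersection as cochains.\<close>
 let ?a = "%i. a i + dl (BV V1) (ga i)"
 have iu: "ALL i<n. EX c. cyc B c & cch_on (BV V1) c = cch_on (BV V1) (?a i) & cch_on (BV V2) c = cch_on (BV V2) (b i)"
 proof (intro allI impI)
  fix i assume i: "i < n"
  have "cch_on (BV ?V) (?a i) = cch_on (BV ?V) (a i) + cch_on (BV ?V) (a i + b i)"
   using ga i by(simp add: cch_on_add flip: cob_V12(1))
  also have "... = cch_on (BV ?V) (b i)" by(simp only: cch_on_add cch_add_left_cancel)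
  finally have ab: "cch_on (BV ?V) (?a i) = cch_on (BV ?V) (b i)" .
  have c: "cyc (BV V1) (?a i)" "cyc (BV V2) (b i)" using a(1) b(1) i by(simp_all add: cyc_add)
  obtain c where "cyc B c" "cch_on (BV V1) c = cch_on (BV V1) (?a i)" "cch_on (BV V2) c = cch_on (BV V2) (b i)"
   by(rule glue_cyc[OF op cover c ab])
  thus "EX c. cyc B c & cch_on (BV V1) c = cch_on (BV V1) (?a i) & cch_on (BV V2) c = cch_on (BV V2) (b i)"
   by(intro exI[of _ c] conjI)
 qed
 obtain u where u: "ALL i<n. cyc B (u i) & cch_on (BV V1) (u i) = cch_on (BV V1) (?a i) & cch_on (BV V2) (u i) = cch_on (BV V2) (b i)"
  using index_choice[where n=n and Q="%i c. cyc B c & cch_on (BV V1) c = cch_on (BV V1) (?a i) & cch_on (BV V2) c = cch_on (BV V2) (b i)", OF iu]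
  by(elim exE) (rule that)
 let ?y = "y + lh W pj x n u"
 have u1: "Ph V1 u = Ph V1 a + dl (WV V1) (Ph V1 ga)"
  unfolding Ph_dl lh_add[symmetric] by(rule Ph_cong) (use u in simp)
 have u2: "Ph V2 u = Ph V2 b" by(rule Ph_cong) (use u in simp)
 have "exact (WV V1) (y + Ph V1 a + dl (WV V1) (Ph V1 ga))" by(rule exact_add[OF a(2) exact_dl])
 hence "exact (WV V1) (cch_on (WV V1) ?y)"
  using exact_cch_on[of "WV V1" "y + Ph V1 u"] by(simp add: cch_on_add Ph_total u1 add.assoc)
 then obtain et1 where et1: "cch_on (WV V1) ?y = dl (WV V1) et1" by(rule exactE) (simp add: that)
 have "exact (WV V2) (cch_on (WV V2) ?y)"
  using exact_cch_on[of "WV V2" "y + Ph V2 b"] b(2) by(simp add: cch_on_add Ph_total u2)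
 then obtain et2 where et2: "cch_on (WV V2) ?y = dl (WV V2) et2" by(rule exactE) (simp add: that)
 have "cch_on (WV ?V) (cch_on (WV V1) ?y) = cch_on (WV ?V) (cch_on (WV V2) ?y)"
  using cch_on_sub[of "WV V1" "over V2" ?y] cch_on_sub[of "WV V2" "over V1" ?y] by(simp only: sub_V12)
 hence cet: "cyc (WV ?V) (et1 + et2)"
  unfolding et1 et2 by(simp add: cyc_def coboundary_add cch_add_eq_0 flip: cob_V12(3,4))
 obtain c where c: "ALL i<n. cyc (BV ?V) (c i)" "exact (WV ?V) (et1 + et2 + Ph ?V c)"
  using free_over_lh_span[OF free(3) pjV xV cet] by(elim exE conjE) (rule that)
 have iw: "ALL i<n. EX we. cyc B (fst we) & cch_on (BV V1) (fst we) = dl (BV V1) (snd we) & cch_on (BV V2) (fst we) = 0 &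
   cch_on (BV ?V) (snd we) = cch_on (BV ?V) (c i)"
 proof (intro allI impI)
  fix i assume "i < n"
  hence ci: "cyc (BV ?V) (c i)" using c(1) by simp
  obtain w e where "cyc B w" "cch_on (BV V1) w = dl (BV V1) e" "cch_on (BV V2) w = 0" "cch_on (BV ?V) e = cch_on (BV ?V) (c i)"
   by(rule connecting_cyc[OF op cover ci])
  thus "EX we. cyc B (fst we) & cch_on (BV V1) (fst we) = dl (BV V1) (snd we) & cch_on (BV V2) (fst we) = 0 &
   cch_on (BV ?V) (snd we) = cch_on (BV ?V) (c i)" by(intro exI[of _ "(w, e)"]) simp
 qed
 obtain we where we: "ALL i<n. cyc B (fst (we i)) & cch_on (BV V1) (fst (we i)) = dl (BV V1) (snd (we i)) & cch_on (BV V2) (fst (we i)) = 0 &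
   cch_on (BV ?V) (snd (we i)) = cch_on (BV ?V) (c i)"
  using index_choice[where n=n and Q="%i we. cyc B (fst we) & cch_on (BV V1) (fst we) = dl (BV V1) (snd we) & cch_on (BV V2) (fst we) = 0 &
   cch_on (BV ?V) (snd we) = cch_on (BV ?V) (c i)", OF iw]
  by(elim exE) (rule that)
 let ?w = "%i. fst (we i)" and ?e = "%i. snd (we i)"
 have w1: "Ph V1 ?w = dl (WV V1) (Ph V1 ?e)" unfolding Ph_dl by(rule Ph_cong) (use we in simp)
 have w2: "Ph V2 ?w = 0"
 proof -
  have "Ph V2 ?w = Ph V2 (%i. 0)" by(rule Ph_cong) (use we in simp)
  thus ?thesis by(simp add: lh_def cup_0)
 qed
 have we12: "Ph ?V ?e = Ph ?V c" by(rule Ph_cong) (use we in simp)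
 have cw: "cyc W (lh W pj x n u)" "cyc W (lh W pj x n ?w)" by(rule lh_cls(1)[OF pj x], use u we in simp)+
 have "exact W (?y + lh W pj x n ?w)"
 proof (rule mayer_vietoris_exact[OF op_over cover_over, of _ "et1 + Ph V1 ?e" et2])
  show "cyc W (?y + lh W pj x n ?w)" by(rule cyc_add[OF cyc_add[OF y cw(1)] cw(2)])
  show "cch_on (WV V1) (?y + lh W pj x n ?w) = dl (WV V1) (et1 + Ph V1 ?e)"
   using et1 cch_on_add[of "WV V1" ?y "lh W pj x n ?w"] by(simp only: Ph_total w1 coboundary_add)
  show "cch_on (WV V2) (?y + lh W pj x n ?w) = dl (WV V2) et2"
   using et2 cch_on_add[of "WV V2" ?y "lh W pj x n ?w"] by(simp only: Ph_total w2 add_0_right)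
  have "cch_on (WV ?V) (et1 + Ph V1 ?e + et2) = cch_on (WV ?V) (et1 + et2 + Ph ?V c)"
   using Ph_restr(1)[of ?e] cch_on_idem[of "WV ?V" "Ph V1 ?e"] by(simp add: cch_on_add we12 ac_simps)
  thus "exact (subt W (over V1 Int over V2)) (et1 + Ph V1 ?e + et2)"
   unfolding over_Int using c(2) exact_cch_on[of "WV ?V" "et1 + Ph V1 ?e + et2"] exact_cch_on[of "WV ?V" "et1 + et2 + Ph ?V c"] by simp
 qed
 thus ?thesis using u we
  by(intro exI[of _ "%i. u i + ?w i"]) (simp add: lh_add cyc_add add.assoc)
qed

lemma free_over_glue:
 assumes "free V1" "free V2" "free (V1 Int V2)"
 shows "free_over W pj B n (cpow W (cls W x))"
proof (rule free_overI_lh[OF pj x])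
 fix y assume "cyc W y"
 thus "EX u. (ALL i<n. cyc B (u i)) & exact W (y + lh W pj x n u)" by(rule glue_span[OF assms])
next
 fix u i assume "ALL i<n. cyc B (u i)" "exact W (lh W pj x n u)" "i < n"
 thus "exact B (u i)" by(rule glue_indep[OF assms])
qed

end

theorem free_over_finite_cover:
 fixes W :: "'w topology" and B :: "'b topology" and pj :: "'w => 'b" and m n :: nat
 defines "piece == %V. subt W {w : topspace W. pj w : V}"
 assumes pj: "cmap W B pj" and x: "cyc W x"
  and op: "!!j. j <= m ==> openin B (U j)" and cover: "topspace B <= (\<Union>j\<le>m. U j)"
  and local: "!!V j. openin B V ==> j <= m ==> V <= U j ==>
   free_over (piece V) pj (subt B V) n (cpow (piece V) (cls (piece V) x))"
 shows "free_over W pj B n (cpow W (cls W x))"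
proof -
 let ?free = "%V. free_over (piece V) pj (subt B V) n (cpow (piece V) (cls (piece V) x))"
 \<comment> \<open>Quantified over all open \<open>V\<close>, because gluing also needs the
   intersection with the next set, which is covered by the earlier ones.\<close>
 have claim: "?free V" if "openin B V" "V <= (\<Union>j\<le>k. U j)" "k <= m" for V k
  using that
 proof (induction k arbitrary: V)
  case 0
  thus ?case using local[of V 0] by simp
 next
  case (Suc k)
  let ?V1 = "V Int (\<Union>j\<le>k. U j)" and ?V2 = "V Int U (Suc k)"
  have o1: "openin B ?V1" and o2: "openin B ?V2"
   using Suc.prems(1,3) op by(auto intro!: openin_Int openin_Union)
  have cV: "cmap (piece V) (subt B V) pj"
   using pj by(auto simp: piece_def cm_into intro: cm_sub)
  interpret two_covers "piece V" pj "subt B V" x n ?V1 ?V2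
  proof
   show "cyc (piece V) x" unfolding piece_def using x by(rule cyc_sub)
   show "openin (subt B V) ?V1" "openin (subt B V) ?V2"
    using o1 o2 Suc.prems(1) by(auto simp: openin_open_subtopology)
   show "topspace (subt B V) <= ?V1 Un ?V2" using Suc.prems(2) by(auto simp: atMost_Suc)
  qed (rule cV)
  have eq: "WV V' = piece V'" "BV V' = subt B V'" if "V' <= V" for V'
  proof -
   have "{w : topspace W. pj w : V} Int {w : topspace W Int {w : topspace W. pj w : V}. pj w : V'} = {w : topspace W. pj w : V'}"
    using that by auto
   thus "WV V' = piece V'" unfolding over_def by(simp add: piece_def subtopology_subtopology)
   show "BV V' = subt B V'" using that by(simp add: subtopology_subtopology Int_absorb1)
  qed
  show ?case
  proof (rule free_over_glue)
   have m: "k <= m" using Suc.prems(3) by simp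
   show "free ?V1" unfolding eq[OF Int_lower1] by(rule Suc.IH[OF o1 Int_lower2 m])
   show "free ?V2" unfolding eq[OF Int_lower1] by(rule local[OF o2 Suc.prems(3) Int_lower2])
   have V12: "?V1 Int ?V2 <= V" "?V1 Int ?V2 <= (\<Union>j\<le>k. U j)" by auto
   show "free (?V1 Int ?V2)" unfolding eq[OF V12(1)] by(rule Suc.IH[OF openin_Int[OF o1 o2] V12(2) m])
  qed
 qed
 have "{w : topspace W. pj w : topspace B} = topspace W" using pj by(auto simp: cm_def Pi_iff)
 thus ?thesis using claim[OF openin_topspace cover] by(simp add: piece_def)
qed

section \<open>Projective bundles of subbundles of trivial bundles\<close>

text \<open>\<open>E t\<close> is an arbitrary set of vectors here; \<open>local_frame\<close>
  supplies the linear structure. Lines are encoded as points of \<open>RP d\<close>, so no quotient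
  topology appears.\<close>

definition pbun :: "'t topology => ('t => (nat => real) set) => nat => ('t \<times> (nat \<times> nat => real)) topology" where
 "pbun T E d = subt (ptop T (RP d)) {z. snd z : outer ` (E (fst z) Int sph d)}"

abbreviation taut :: "'t topology => ('t => (nat => real) set) => nat => ('t \<times> (nat \<times> nat => real)) cochain" where
 "taut T E d == chi (pbun T E d) (vsel o snd)"

lemma topspace_pbun:
 "z : topspace (pbun T E d) \<longleftrightarrow> fst z : topspace T & (EX v:E (fst z) Int sph d. snd z = outer v)"
 by(auto simp: pbun_def mem_Times_iff)

lemma cmap_into_pbun:
 "cmap X (pbun T E d) f \<longleftrightarrow> cmap X T (fst o f) & cmap X (RP d) (snd o f) &
  (ALL x:topspace X. snd (f x) : outer ` (E (fst (f x)) Int sph d))"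
 by(simp add: pbun_def cm_into continuous_map_pairwise image_subset_iff_funcset Pi_iff)

lemma cont_pbun_fst: "cmap (pbun T E d) T fst"
 and continuous_proj_bundle_snd: "cmap (pbun T E d) (RP d) snd"
 unfolding pbun_def
 by(intro cm_sub cm_fst cm_snd)+

lemma line_field_pbun: "line_field d (pbun T E d) (vsel o snd)"
 by(rule line_field_compose[OF line_field_vsel continuous_proj_bundle_snd])

lemma cyc_taut: "cyc (pbun T E d) (taut T E d)"
 by(rule cyc_chi[OF line_field_pbun])

text \<open>The orthogonal projection onto the image of a line under the matrix \<open>A\<close>:
  \<open>A q A^T\<close> divided by its trace.\<close>

definition conj_proj :: "nat => nat => (nat => nat => real) => (nat \<times> nat => real) => nat \<times> nat => real" where
 "conj_proj m d A q = (%(i, k). if i < m & k < m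
  then (\<Sum>a<d. \<Sum>b<d. A i a * A k b * q (a, b)) / (\<Sum>j<m. \<Sum>a<d. \<Sum>b<d. A j a * A j b * q (a, b)) else 0)"

lemma conj_sum: "(\<Sum>a<d. \<Sum>b<d. A i a * A k b * outer v (a, b)) = (\<Sum>a<d. A i a * v a) * (\<Sum>b<d. A k b * v b)" for d :: nat
 by(simp add: sum_product ac_simps)

lemma conj_proj_outer:
 fixes m d :: nat
 defines "w == %A v i. if i < m then \<Sum>a<d. A i a * v a else 0"
 assumes pos: "EX i<m. (\<Sum>a<d. A i a * v a) ~= 0"
 obtains c where "c > 0" "conj_proj m d A (outer v) = outer (%i. c * w A v i)" "(%i. c * w A v i) : sph m"
proof -
 let ?N = "\<Sum>i<m. (w A v i)\<^sup>2"
 have N: "?N > 0"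
 proof -
  obtain i where "i < m" "w A v i ~= 0" using pos by(auto simp: w_def)
  thus ?thesis by(intro sum_pos2[of _ i]) auto
 qed
 have N': "(\<Sum>j<m. \<Sum>a<d. \<Sum>b<d. A j a * A j b * outer v (a, b)) = ?N"
  unfolding conj_sum by(simp add: w_def p2_eq)
 have "conj_proj m d A (outer v) (i, k) = outer (%i. (1 / sqrt ?N) * w A v i) (i, k)" for i k
  using N unfolding conj_proj_def prod.case N' unfolding conj_sum by(simp add: w_def)
 hence "conj_proj m d A (outer v) = outer (%i. (1 / sqrt ?N) * w A v i)" by(intro ext) (auto simp only: split_paired_all)
 moreover have "(%i. (1 / sqrt ?N) * w A v i) : sph m"
  using N by(simp add: sph_def power_divide w_def flip: sum_divide_distrib)
 ultimately show thesis using N by(intro that[of "1 / sqrt ?N"]) simp_all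
qed

lemma cont_conj_proj:
 assumes q: "cmap X (RP d) q" and A: "!!i a. i < m ==> a < d ==> cmap X eur (%x. A x i a)"
  and nz: "!!x v. x : topspace X ==> v : sph d ==> q x = outer v ==> EX i<m. (\<Sum>a<d. A x i a * v a) ~= 0"
 shows "cmap X (RP m) (%x. conj_proj m d (A x) (q x))"
 unfolding cmap_into_RP
proof (intro conjI allI image_subsetI)
 have qv: "EX v:sph d. q x = outer v" if "x : topspace X" for x
  using q that by(auto simp: cmap_into_RP)
 fix i k
 have c: "cmap X eur (%x. \<Sum>a<d. \<Sum>b<d. A x i a * A x k b * q x (a, b))" if "i < m" "k < m" for i k
  using that by(intro cm_sum cm_mult A cmap_via_RP[OF q]) auto
 show "cmap X eur (%x. conj_proj m d (A x) (q x) (i, k))"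
 proof (cases "i < m & k < m")
  case True
  have "(\<Sum>j<m. \<Sum>a<d. \<Sum>b<d. A x j a * A x j b * q x (a, b)) ~= 0" if x: "x : topspace X" for x
  proof -
   obtain v where v: "v : sph d" "q x = outer v" using qv[OF x] by blast
   obtain i where "i < m" "(\<Sum>a<d. A x i a * v a) ~= 0" using nz[OF x v] by blast
   hence "(\<Sum>j<m. ((\<Sum>a<d. A x j a * v a))\<^sup>2) > 0" by(intro sum_pos2[of _ i]) auto
   thus ?thesis unfolding v(2) conj_sum by(simp add: p2_eq)
  qed
  hence "cmap X eur (%x. (\<Sum>a<d. \<Sum>b<d. A x i a * A x k b * q x (a, b)) / (\<Sum>j<m. \<Sum>a<d. \<Sum>b<d. A x j a * A x j b * q x (a, b)))"
   using True by(intro cm_div cm_sum[where I="{..<m}"] c) auto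
  thus ?thesis using True by(simp add: conj_proj_def)
 qed (auto simp: conj_proj_def)
 fix x assume x: "x : topspace X"
 obtain v where v: "v : sph d" "q x = outer v" using qv[OF x] by blast
 obtain c where "c > 0" "conj_proj m d (A x) (outer v) = outer (%i. c * (if i < m then \<Sum>a<d. A x i a * v a else 0))"
  "(%i. c * (if i < m then \<Sum>a<d. A x i a * v a else 0)) : sph m"
  using conj_proj_outer[OF nz[OF x v]] .
 thus "conj_proj m d (A x) (q x) : outer ` sph m" using v(2) by auto
qed

text \<open>The form pairing \<open>A v\<close> with \<open>v'\<close> has no zeros, since
  \<open>A v\<close> is a nonzero multiple of the unit vector \<open>v'\<close>.\<close>

lemma chi_linear_map:
 assumes v: "line_field d X v" and v': "line_field d' X v'"
  and A: "!!i a. i < d' ==> a < d ==> cmap X eur (%x. A x i a)"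
  and c: "!!x. x : topspace X ==> EX c~=0. ALL i<d'. (\<Sum>a<d. A x i a * v x a) = c * v' x i"
 shows "exact X (chi X v + chi X v')"
proof -
 let ?ph = "%x. \<Sum>a<d. \<Sum>i<d'. A x i a * v x a * v' x i"
 have "chi X v + chi X v' = dl X (pcch (%x. ?ph x < 0))"
 proof (rule chi_bilinear[OF v v', where m="%a i x. A x i a"])
  fix x assume x: "x : topspace X"
  obtain c where c: "c ~= 0" "ALL i<d'. (\<Sum>a<d. A x i a * v x a) = c * v' x i" using c[OF x] by blast
  have "?ph x = (\<Sum>i<d'. (\<Sum>a<d. A x i a * v x a) * v' x i)" by(subst sum.swap) (simp add: sdr)
  also have "... = c * (\<Sum>i<d'. (v' x i)\<^sup>2)" using c(2) by(simp add: sdl p2_eq mult.assoc)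
  finally show "?ph x ~= 0" using c(1) v' x by(simp add: line_field_def)
 qed (use A in auto)
 thus ?thesis using exact_dl[of X] by simp
qed

text \<open>\<open>N t\<close> parametrizes \<open>E t\<close> by \<open>n\<close> coordinates, and
  \<open>M t\<close> is a left inverse that is defined on all vectors.\<close>

definition local_frame :: "'t topology => ('t => (nat => real) set) => nat => nat => bool" where
 "local_frame T E d n \<longleftrightarrow> (EX M N. (ALL i<n. ALL a<d. cmap T eur (%t. M t i a) & cmap T eur (%t. N t a i)) &
  (ALL t:topspace T. (ALL c. (%a. if a < d then \<Sum>i<n. N t a i * c i else 0) : E t) &
   (ALL c. ALL i<n. (\<Sum>a<d. M t i a * (\<Sum>k<n. N t a k * c k)) = c i) &
   (ALL v:E t. ALL a<d. (\<Sum>i<n. N t a i * (\<Sum>b<d. M t i b * v b)) = v a)))"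

lemma local_frame_pull:
 assumes "local_frame T E d n" "cmap T' T f" shows "local_frame T' (E o f) d n"
proof -
 obtain M N where MN: "ALL i<n. ALL a<d. cmap T eur (%t. M t i a) & cmap T eur (%t. N t a i)"
  "ALL t:topspace T. (ALL c. (%a. if a < d then \<Sum>i<n. N t a i * c i else 0) : E t) &
   (ALL c. ALL i<n. (\<Sum>a<d. M t i a * (\<Sum>k<n. N t a k * c k)) = c i) &
   (ALL v:E t. ALL a<d. (\<Sum>i<n. N t a i * (\<Sum>b<d. M t i b * v b)) = v a)"
  using assms(1) unfolding local_frame_def by blast
 have "cmap T' eur (%t. M (f t) i a) & cmap T' eur (%t. N (f t) a i)"
  if "i < n" "a < d" for i a
  using MN(1) that cm_comp[OF assms(2), of eur "%t. M t i a"]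
   cm_comp[OF assms(2), of eur "%t. N t a i"] by(simp add: o_def)
 moreover have "f t : topspace T" if "t : topspace T'" for t using assms(2) that by(auto simp: cm_def)
 ultimately show ?thesis using MN(2) unfolding local_frame_def
  by(intro exI[of _ "%t. M (f t)"] exI[of _ "%t. N (f t)"]) simp
qed

lemma sph_scale:
 assumes "v : sph d" "(%a. c * v a) : sph d" shows "outer (%a. c * v a) = outer v"
proof -
 have "c\<^sup>2 = 1" using assms by(simp add: sph_def power_mult_distrib flip: sdl)
 hence "c * c = 1" by(simp add: p2_eq)
 thus ?thesis by(simp add: outer_def fun_eq_iff)
qed

text \<open>\<open>M\<close> and \<open>N\<close> identify the projectivized bundle with the product
  of \<open>T\<close> and \<open>RP n\<close>, compatibly with the tautological classes.\<close>

lemma free_over_local_frame: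
 assumes "local_frame T E d n"
 shows "free_over (pbun T E d) fst T n (cpow (pbun T E d) (cls (pbun T E d) (taut T E d)))"
proof -
 obtain M N where cont: "!!i a. i < n ==> a < d ==> cmap T eur (%t. M t i a)" "!!i a. a < d ==> i < n ==> cmap T eur (%t. N t a i)"
  and inE: "!!t c. t : topspace T ==> (%a. if a < d then \<Sum>i<n. N t a i * c i else 0) : E t"
  and MN: "!!t c i. t : topspace T ==> i < n ==> (\<Sum>a<d. M t i a * (\<Sum>k<n. N t a k * c k)) = c i"
  and NM: "!!t v a. t : topspace T ==> v : E t ==> a < d ==> (\<Sum>i<n. N t a i * (\<Sum>b<d. M t i b * v b)) = v a"
  using assms unfolding local_frame_def by blast
 let ?W = "pbun T E d" and ?W' = "ptop T (RP n)"
 define F where "F z = (fst z, conj_proj n d (M (fst z)) (snd z))" for z :: "'a \<times> (nat \<times> nat => real)"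
 define G where "G z = (fst z, conj_proj d n (N (fst z)) (snd z))" for z :: "'a \<times> (nat \<times> nat => real)"
 have Mnz: "EX i<n. (\<Sum>a<d. M t i a * v a) ~= 0" if t: "t : topspace T" and v: "v : E t" "v : sph d" for t v
 proof (rule ccontr)
  assume "~ ?thesis"
  hence "v a = 0" if "a < d" for a using NM[OF t v(1) that] by simp
  thus False using v(2) by(simp add: sph_def)
 qed
 have Nnz: "EX a<d. (\<Sum>i<n. N t a i * c i) ~= 0" if t: "t : topspace T" and c: "c : sph n" for t c
 proof (rule ccontr)
  assume "~ ?thesis"
  hence "c i = 0" if "i < n" for i using MN[OF t that, of c] by simp
  thus False using c by(simp add: sph_def)
 qed
 have Fv: "EX c>0. F (t, outer v) = (t, outer (%i. c * (if i < n then \<Sum>a<d. M t i a * v a else 0))) &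
  (%i. c * (if i < n then \<Sum>a<d. M t i a * v a else 0)) : sph n"
  if "t : topspace T" "v : E t" "v : sph d" for t v
  by(rule conj_proj_outer[OF Mnz[OF that]]) (auto simp: F_def)
 have Gv: "EX c>0. G (t, outer v) = (t, outer (%a. c * (if a < d then \<Sum>i<n. N t a i * v i else 0))) &
  (%a. c * (if a < d then \<Sum>i<n. N t a i * v i else 0)) : sph d Int E t"
  if t: "t : topspace T" and v: "v : sph n" for t v
 proof -
  obtain c where c: "c > 0" "conj_proj d n (N t) (outer v) = outer (%a. c * (if a < d then \<Sum>i<n. N t a i * v i else 0))"
   "(%a. c * (if a < d then \<Sum>i<n. N t a i * v i else 0)) : sph d"
   by(rule conj_proj_outer[OF Nnz[OF t v]])
  have "(%a. c * (if a < d then \<Sum>i<n. N t a i * v i else 0)) = (%a. if a < d then \<Sum>i<n. N t a i * (c * v i) else 0)"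
   by(auto simp: fun_eq_iff sdl ac_simps)
  thus ?thesis using c inE[OF t, of "%i. c * v i"] by(auto simp: G_def)
 qed
 have cF: "cmap ?W ?W' F" unfolding F_def
 proof (intro cm_pair cont_conj_proj cont_pbun_fst continuous_proj_bundle_snd)
  show "cmap ?W eur (%z. M (fst z) i a)" if "i < n" "a < d" for i a
   using cm_comp[OF cont_pbun_fst cont(1)[OF that]] by(simp add: o_def)
  fix z v assume z: "z : topspace ?W" and v: "v : sph d" "snd z = outer v"
  then obtain v' where v': "v' : E (fst z)" "v' : sph d" "outer v = outer v'" and t: "fst z : topspace T"
   by(auto simp: topspace_pbun)
  obtain i where i: "i < n" "(\<Sum>a<d. M (fst z) i a * v' a) ~= 0" using Mnz[OF t v'(1,2)] by blast
  show "EX i<n. (\<Sum>a<d. M (fst z) i a * v a) ~= 0"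
   using outer_eq[OF v'(2) v(1) v'(3)[symmetric]] i by(intro exI[of _ i]) (auto simp: sum_negf)
 qed
 have cG: "cmap ?W' ?W G" unfolding cmap_into_pbun
 proof (intro conjI ballI)
  show "cmap ?W' T (fst o G)" using cm_fst by(simp add: G_def o_def)
  have "cmap ?W' (RP d) (%z. conj_proj d n (N (fst z)) (snd z))"
  proof (intro cont_conj_proj cm_snd)
   show "cmap ?W' eur (%z. N (fst z) a i)" if "a < d" "i < n" for a i
    using cm_comp[OF cm_fst cont(2)[OF that]] by(simp add: o_def)
  qed (use Nnz in auto)
  thus "cmap ?W' (RP d) (snd o G)" by(simp add: G_def o_def)
  fix z assume "z : topspace ?W'"
  thus "snd (G z) : outer ` (E (fst (G z)) Int sph d)" using Gv[of "fst z"] by(cases z) fastforce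
 qed
 have GF: "G (F z) = z" if z: "z : topspace ?W" for z
 proof -
  obtain v where v: "v : E (fst z)" "v : sph d" "snd z = outer v" and t: "fst z : topspace T"
   using z by(auto simp: topspace_pbun)
  let ?w = "%i. if i < n then \<Sum>a<d. M (fst z) i a * v a else 0"
  obtain c where c: "c > 0" "F z = (fst z, outer (%i. c * ?w i))" "(%i. c * ?w i) : sph n"
   using Fv[OF t v(1,2)] unfolding v(3)[symmetric] prod.collapse by(elim exE conjE) (rule that)
  obtain c' where c': "c' > 0" "G (F z) = (fst z, outer (%a. c' * (if a < d then \<Sum>i<n. N (fst z) a i * (c * ?w i) else 0)))"
   "(%a. c' * (if a < d then \<Sum>i<n. N (fst z) a i * (c * ?w i) else 0)) : sph d"
   using Gv[OF t c(3)] unfolding c(2)[symmetric] Int_iff by(elim exE conjE) (rule that)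
  have "(%a. c' * (if a < d then \<Sum>i<n. N (fst z) a i * (c * ?w i) else 0)) = (%a. (c' * c) * v a)"
  proof
   fix a
   have "(\<Sum>i<n. N (fst z) a i * (c * ?w i)) = c * v a" if "a < d"
    using NM[OF t v(1) that] by(simp add: mult.left_commute[of _ c] flip: sdl)
   thus "c' * (if a < d then \<Sum>i<n. N (fst z) a i * (c * ?w i) else 0) = (c' * c) * v a"
    using v(2) by(auto simp: sph_def)
  qed
  thus ?thesis using c' sph_scale[OF v(2)] v(3) by(simp add: prod_eq_iff)
 qed
 show ?thesis
 proof (rule free_over_transfer[OF cG cF cont_pbun_fst cm_fst])
  show "fst (G z) = fst z" "fst (F z) = fst z" for z by(simp_all add: F_def G_def)
  show "homotopic_with (%_. True) ?W ?W (G o F) id"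
   using GF by(intro homotopic_with_equal cm_comp[OF cF cG]) auto
  show "cpow ?W (cls ?W (taut T E d)) i : cohs ?W" for i by simp
  have lfG: "line_field d ?W' ((vsel o snd) o G)" by(rule line_field_compose[OF line_field_pbun cG])
  have "exact ?W' (chi ?W' (vsel o snd) + chi ?W' ((vsel o snd) o G))"
  proof (rule chi_linear_map[OF line_field_prod_RP lfG, where A="%z. N (fst z)"])
   show "cmap ?W' eur (%z. N (fst z) a i)" if "a < d" "i < n" for a i
    using cm_comp[OF cm_fst cont(2)[OF that]] by(simp add: o_def)
   fix z assume "z : topspace ?W'"
   then obtain v where v: "fst z : topspace T" "v : sph n" "snd z = outer v" by auto
   obtain c where c: "c > 0" "G z = (fst z, outer (%a. c * (if a < d then \<Sum>i<n. N (fst z) a i * v i else 0)))"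
    "(%a. c * (if a < d then \<Sum>i<n. N (fst z) a i * v i else 0)) : sph d"
    using Gv[OF v(1,2)] unfolding v(3)[symmetric] prod.collapse Int_iff by(elim exE conjE) (rule that)
   let ?w = "%a. c * (if a < d then \<Sum>i<n. N (fst z) a i * v i else 0)"
   have s: "sgn (lead ?w) ~= 0" "sgn (lead v) ~= 0" "sgn (lead ?w) * sgn (lead ?w) = 1"
    using lead_nonzero[OF c(3)] lead_nonzero[OF v(2)] by(auto simp: sgn_if)
   have "(\<Sum>i<n. N (fst z) a i * (vsel o snd) z i) = sgn (lead v) * sgn (lead ?w) / c * ((vsel o snd) o G) z a" if "a < d" for a
   proof -
    have "(\<Sum>i<n. N (fst z) a i * (vsel o snd) z i) = sgn (lead v) * (\<Sum>i<n. N (fst z) a i * v i)"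
     by(simp add: v(3) vsel_outer sdl ac_simps)
    also have "... = sgn (lead v) * (sgn (lead ?w) * sgn (lead ?w)) / c * ?w a" using that c(1) s(3) by simp
    finally show ?thesis by(simp add: c(2) vsel_outer)
   qed
   thus "EX c~=0. ALL a<d. (\<Sum>i<n. N (fst z) a i * (vsel o snd) z i) = c * ((vsel o snd) o G) z a"
    using s c(1) by(intro exI[of _ "sgn (lead v) * sgn (lead ?w) / c"]) simp
  qed
  moreover have "pull ?W' G ?W (cls ?W (taut T E d)) = cls ?W' (chi ?W' ((vsel o snd) o G))"
   using pull_cls[OF cG cyc_taut] pb_chi[OF cG, of "vsel o snd"] by simp
  ultimately have "pull ?W' G ?W (cls ?W (taut T E d)) = cls ?W' (RP_class T n)"
   using cls_eq_iff[OF cyc_RP_class cyc_chi[OF lfG]] by simp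
  thus "free_over ?W' fst T n (%i. pull ?W' G ?W (cpow ?W (cls ?W (taut T E d)) i))"
   using free_over_RP[of T n] by(simp add: pull_cpow[OF cG])
 qed
qed

lemma pbun_sub:
 "subt (pbun T E d) {w : topspace (pbun T E d). fst w : V} = pbun (subt T V) E d"
proof -
 let ?C = "{z. snd z : outer ` (E (fst z) Int sph d)}"
 have 1: "pbun (subt T V) E d = subt (ptop T (RP d)) (V \<times> topspace (RP d) Int ?C)"
  unfolding pbun_def using prod_topology_subtopology(1)[of T V "RP d"] by(simp add: subtopology_subtopology)
 have 2: "subt (pbun T E d) {w : topspace (pbun T E d). fst w : V} =
  subt (ptop T (RP d)) (?C Int {w : topspace (pbun T E d). fst w : V})"
  unfolding pbun_def[of T] by(simp add: subtopology_subtopology)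
 have 3: "topspace (ptop T (RP d)) Int (?C Int {w : topspace (pbun T E d). fst w : V}) =
  topspace (ptop T (RP d)) Int (V \<times> topspace (RP d) Int ?C)"
  by(auto simp: pbun_def)
 show ?thesis unfolding 1 2 using arg_cong[OF 3, of "subt (ptop T (RP d))"] unfolding subtopology_restrict .
qed

lemma cls_cch_on: assumes c: "cyc X c" shows "cls X (cch_on X c) = cls X c"
proof -
 have "cyc X (cch_on X c)" using c by simp
 from cls_eq_iff[OF this c] exact_cch_on_add[of X c] show ?thesis by(simp only:)
qed

theorem free_over_pbun:
 fixes U :: "nat => _" and m :: nat
 assumes op: "!!j. j <= m ==> openin T (U j)" and cover: "topspace T <= (\<Union>j\<le>m. U j)"
  and lf: "!!j. j <= m ==> local_frame (subt T (U j)) E d n"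
 shows "free_over (pbun T E d) fst T n (cpow (pbun T E d) (cls (pbun T E d) (taut T E d)))"
proof (rule free_over_finite_cover[where U=U and m=m])
 show "cmap (pbun T E d) T fst" "cyc (pbun T E d) (taut T E d)"
  by(rule cont_pbun_fst cyc_taut)+
 fix V j assume V: "openin T V" "j <= m" "V <= U j"
 let ?A = "{w : topspace (pbun T E d). fst w : V}" and ?S = "subt T V"
 have "cmap ?S (subt T (U j)) (%t. t)"
  using V(3) by(auto simp: cm_into cmap_sub_id)
 from local_frame_pull[OF lf[OF V(2)] this] have "local_frame ?S E d n" by(simp add: o_def)
 note free = free_over_local_frame[OF this]
 have "cch_on (subt (pbun T E d) ?A) (taut T E d) = taut ?S E d"
  unfolding cch_on_chi_sub unfolding pbun_sub ..
 hence "cls (pbun ?S E d) (taut T E d) = cls (pbun ?S E d) (taut ?S E d)"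
  using cls_cch_on[OF cyc_sub[OF cyc_taut], of T E d ?A] by(simp only: pbun_sub)
 thus "free_over (subt (pbun T E d) ?A) fst ?S n
  (cpow (subt (pbun T E d) ?A) (cls (subt (pbun T E d) ?A) (taut T E d)))"
  using free by(simp only: pbun_sub)
qed (use op cover in auto)

section \<open>Configurations in the plane and interpolation\<close>

definition cpx :: "real^2 => complex" where
 "cpx p = Complex (p $ 1) (p $ 2)"

definition fval :: "nat => (nat => real) => real^2 => complex" where
 "fval n v z = (\<Sum>k<n. Complex (v (2 * k)) (v (2 * k + 1)) * cpx z ^ k)"

text \<open>The regular bundle inside a trivial bundle: a function on a configuration becomes the
 coefficient vector of its complex interpolation polynomial.\<close>

definition espace :: "nat => (real^2) set => (nat => real) set" where
 "espace n S = {v. (ALL a>=2*n. v a = 0) & (ALL z:S. Im (fval n v z) = 0)}"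

text \<open>With \<open>imc\<close>, the coordinates of the real linear forms that send coefficients
  to the real and imaginary part of the polynomial at \<open>z\<close>; see \<open>re_fval\<close>
  and \<open>im_fval\<close>.\<close>

definition rec :: "real^2 => nat => real" where
 "rec z a = (if even a then Re (cpx z ^ (a div 2)) else - Im (cpx z ^ (a div 2)))"

definition imc :: "real^2 => nat => real" where
 "imc z a = (if even a then Im (cpx z ^ (a div 2)) else Re (cpx z ^ (a div 2)))"

definition lagp :: "(real^2) set => real^2 => complex poly" where
 "lagp S z = (\<Prod>w\<in>S - {z}. Polynomial.smult (inverse (cpx z - cpx w)) [:- cpx w, 1:])"

definition lagc :: "(real^2) set => real^2 => nat => real" where
 "lagc S z a = (if even a then Re (poly.coeff (lagp S z) (a div 2)) else Im (poly.coeff (lagp S z) (a div 2)))"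

definition lag :: "nat => (real^2) set => (real^2 => real) => nat => real" where
 "lag n S g a = (if a < 2 * n then \<Sum>z\<in>S. lagc S z a * g z else 0)"

lemma cpx_eq [simp]: "cpx z = cpx w \<longleftrightarrow> z = w"
 by(simp add: cpx_def vec_eq_iff forall_2)

lemma sum_double: "(\<Sum>a<2 * n. f a) = (\<Sum>k<n. f (2 * k) + f (2 * k + 1))" for n :: nat and f :: "nat => real"
 by(induction n) (simp_all add: ac_simps)

lemma re_fval: "(\<Sum>a<2 * n. rec z a * v a) = Re (fval n v z)"
 and im_fval: "(\<Sum>a<2 * n. imc z a * v a) = Im (fval n v z)"
 unfolding sum_double by(simp_all add: rec_def imc_def fval_def Re_sum Im_sum algebra_simps sum.distrib sum_subtractf sum_negf)

lemma poly_lagp: "finite S ==> z : S ==> w : S ==> poly (lagp S z) (cpx w) = (if w = z then 1 else 0)"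
proof -
 assume S: "finite S" "z : S" "w : S"
 have "poly (lagp S z) (cpx w) = (\<Prod>u\<in>S - {z}. (cpx w - cpx u) / (cpx z - cpx u))"
  by(simp add: lagp_def poly_prod divide_inverse algebra_simps)
 thus ?thesis using S by(auto simp: prod_zero_iff intro!: prod.neutral)
qed

lemma degree_lagp: assumes "finite S" "z : S" shows "degree (lagp S z) < card S"
proof -
 have "degree (lagp S z) <= sum (degree o (%w. Polynomial.smult (inverse (cpx z - cpx w)) [:- cpx w, 1:])) (S - {z})"
  unfolding lagp_def by(rule degree_prod_sum_le) (use assms in simp)
 also have "... <= (\<Sum>w\<in>S - {z}. 1)" by(intro sum_mono) auto
 also have "... = card (S - {z})" by(simp only: card_eq_sum)
 also have "... < card S" by(rule card_Diff1_less[OF assms])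
 finally show ?thesis .
qed

lemma poly_sum_coeff: "degree p < n ==> poly p x = (\<Sum>k<n. poly.coeff p k * x ^ k)" for p :: "complex poly"
 unfolding poly_altdef by(rule sum.mono_neutral_left) (auto simp: coeff_eq_0)

lemma fval_lag:
 assumes "finite S" "card S = n" "w : S" shows "fval n (lag n S g) w = of_real (g w)"
proof -
 have c: "Complex (lag n S g (2 * k)) (lag n S g (2 * k + 1)) = (\<Sum>z\<in>S. poly.coeff (lagp S z) k * of_real (g z))" if "k < n" for k
  using that by(simp add: complex_eq_iff lag_def lagc_def Re_sum Im_sum)
 have "fval n (lag n S g) w = (\<Sum>k<n. \<Sum>z\<in>S. of_real (g z) * (poly.coeff (lagp S z) k * cpx w ^ k))"
  unfolding fval_def using c by(intro sum.cong refl) (simp add: sdr sdl ac_simps)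
 also have "... = (\<Sum>z\<in>S. of_real (g z) * poly (lagp S z) (cpx w))"
  using degree_lagp[OF assms(1)] unfolding assms(2)
  by(subst sum.swap) (intro sum.cong refl, simp add: poly_sum_coeff[of _ n] sdl)
 also have "... = (\<Sum>z\<in>S. if z = w then of_real (g w) else 0)"
  using assms by(intro sum.cong refl) (auto simp: poly_lagp)
 finally show ?thesis using assms by simp
qed

lemma lag_espace: "finite S ==> card S = n ==> lag n S g : espace n S"
 by(simp add: espace_def fval_lag) (simp add: lag_def)

lemma fval_add: "fval n (%a. v a - w a) z = fval n v z - fval n w z"
proof -
 have "Complex (v a - w a) (v b - w b) = Complex (v a) (v b) - Complex (w a) (w b)" for a b by(simp add: complex_eq_iff)
 thus ?thesis by(simp add: fval_def left_diff_distrib sum_subtractf)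
qed

lemma fval_scale: "fval n (%a. c * v a) z = of_real c * fval n v z"
proof -
 have "Complex (c * v a) (c * v b) = of_real c * Complex (v a) (v b)" for a b by(simp add: complex_eq_iff)
 thus ?thesis by(simp add: fval_def sdl mult.assoc)
qed

text \<open>A polynomial of degree below \<open>n\<close> with \<open>n\<close> distinct roots is
  zero; \<open>cpx\<close> is injective, so distinct points are distinct roots.\<close>

lemma fval_zero:
 assumes S: "finite S" "card S = n" and v: "!!a. 2 * n <= a ==> v a = 0" and z: "!!z. z : S ==> fval n v z = 0"
 shows "v a = 0"
proof -
 define p where "p = (\<Sum>k<n. Polynomial.monom (Complex (v (2 * k)) (v (2 * k + 1))) k)"
 have coeff: "poly.coeff p k = (if k < n then Complex (v (2 * k)) (v (2 * k + 1)) else 0)" for k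
  by(simp add: p_def coeff_sum)
 have pz: "poly p (cpx z) = fval n v z" for z by(simp add: p_def poly_sum poly_monom fval_def)
 have "p = 0"
 proof (rule ccontr)
  assume "p ~= 0"
  hence "degree p < n" using coeff by(metis leading_coeff_0_iff)
  moreover have "card (cpx ` S) <= card {x. poly p x = 0}"
   using z \<open>p ~= 0\<close> by(intro card_mono poly_roots_finite) (auto simp: pz)
  moreover have "card (cpx ` S) = n" using S(2) by(subst card_image) (auto simp: inj_on_def)
  ultimately show False using card_poly_roots_bound[of p] \<open>p ~= 0\<close> by linarith
 qed
 hence "Complex (v (2 * k)) (v (2 * k + 1)) = 0" if "k < n" for k using coeff[of k] that by simp
 hence "v (2 * k) = 0 & v (2 * k + 1) = 0" if "k < n" for k using that by(simp add: complex_eq_iff)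
 from this[of "a div 2"] show ?thesis using v[of a] by(cases "even a"; cases "a < 2 * n") auto
qed

lemma lag_fval:
 assumes S: "finite S" "card S = n" and v: "v : espace n S" shows "lag n S (%z. Re (fval n v z)) = v"
proof
 fix a
 have "lag n S (%z. Re (fval n v z)) a - v a = 0"
 proof (rule fval_zero[OF S, of "%a. lag n S (%z. Re (fval n v z)) a - v a"])
  fix z assume "z : S"
  thus "fval n (%a. lag n S (%z. Re (fval n v z)) a - v a) z = 0"
   using v fval_lag[OF S] by(simp add: fval_add complex_eq_iff espace_def)
 qed (use v in \<open>simp add: espace_def lag_def\<close>)
 thus "lag n S (%z. Re (fval n v z)) a = v a" by simp
qed

section \<open>Continuity on ordered and unordered configurations\<close>

lemma cmap_mult: 
 fixes f g :: "'a => complex"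
 shows "cmap X euclidean f ==> cmap X euclidean g ==> cmap X euclidean (%x. f x * g x)"
 by(simp add: continuous_map_atin tendsto_mult)

lemma cmap_inverse: 
 fixes f :: "'a => complex"
 shows "cmap X euclidean f ==> (!!x. x : topspace X ==> f x ~= 0) ==> cmap X euclidean (%x. inverse (f x))"
 by(simp add: continuous_map_atin tendsto_inverse)

lemma cmap_power: 
 fixes f :: "'a => complex"
 shows "cmap X euclidean f ==> cmap X euclidean (%x. f x ^ k)"
 by(simp add: continuous_map_atin tendsto_power)

lemma cmap_Re_Im:
 "cmap X euclidean f ==> cmap X eur (%x. Re (f x))"
 "cmap X euclidean f ==> cmap X eur (%x. Im (f x))"
 by(simp_all add: continuous_map_atin tendsto_Re tendsto_Im)

lemma cmap_cpx:
 "cmap X euclidean f ==> cmap X euclidean (%x. cpx (f x))"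
 unfolding cpx_def by(simp add: continuous_map_atin) (intro ballI tendsto_Complex tendsto_vec_nth; blast)

lemma cmap_coord:
 "cmap X euclidean f ==> cmap X eur (%x. (f x :: real^2) $ i)"
 by(simp add: continuous_map_atin tendsto_vec_nth)

lemma cmap_coeff_prod:
 fixes A B :: "'i => 'a => complex"
 assumes "finite K" "!!l. l : K ==> cmap X euclidean (A l)" "!!l. l : K ==> cmap X euclidean (B l)"
 shows "cmap X euclidean (%x. poly.coeff (\<Prod>l\<in>K. Polynomial.smult (A l x) [:B l x, 1:]) m)"
 using assms
proof (induction K arbitrary: m)
 case (insert l K)
 have "poly.coeff (\<Prod>l\<in>insert l K. Polynomial.smult (A l x) [:B l x, 1:]) m =
  A l x * (B l x * poly.coeff (\<Prod>l\<in>K. Polynomial.smult (A l x) [:B l x, 1:]) m + (if m = 0 then 0 else poly.coeff (\<Prod>l\<in>K. Polynomial.smult (A l x) [:B l x, 1:]) (m - 1)))" for x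
  using insert.hyps by(cases m) (simp_all add: mult_pCons_left coeff_pCons algebra_simps)
 moreover have "cmap X euclidean (%x. if m = 0 then 0 else poly.coeff (\<Prod>l\<in>K. Polynomial.smult (A l x) [:B l x, 1:]) (m - 1))"
  using insert by(cases "m = 0") simp_all
 ultimately show ?case using insert by(simp add: cmap_mult continuous_map_add)
qed simp

abbreviation "Y_plane n == ordered_config (euclidean :: (real^2) topology) n"

lemma Y_point: "x : topspace (Y_plane n) ==> inj_on x {..<n}"
 and continuous_map_point: "k < n ==> cmap (Y_plane n) euclidean (%x. x k)"
 using continuous_map_product_projection[of k "{..<n}" "%_. euclidean :: (real^2) topology"]
 by(simp_all add: topspace_ordered_config ordered_config_def cm_sub)

lemma B_point: "S : topspace (Bp n) \<longleftrightarrow> (EX x:topspace (Y_plane n). S = x ` {..<n})"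
 by(auto simp: config_space_def)

lemma B_card: "S : topspace (Bp n) ==> finite S & card S = n"
 unfolding B_point using Y_point[of _ n] by(auto simp: card_image simp del: topspace_ordered_config)

lemma quotient_config: "quotient_map (Y_plane n) (Bp n) (%x. x ` {..<n})"
 unfolding config_space_def by(rule quotient_map_quotient_topology)

text \<open>A sum over the points does not see their numbering, so continuity can be tested on
  ordered configurations.\<close>

lemma cont_config_sum:
 assumes V: "openin (Bp n) V"
  and h: "!!k. k < n ==> cmap (subt (Y_plane n) {x : topspace (Y_plane n). x ` {..<n} : V}) eur (%x. h (x ` {..<n}) (x k))"
 shows "cmap (subt (Bp n) V) eur (%S. \<Sum>z\<in>S. h S z)"
proof (rule continuous_compose_quotient_map)
 let ?Y = "subt (Y_plane n) {x : topspace (Y_plane n). x ` {..<n} : V}"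
 show "quotient_map ?Y (subt (Bp n) V) (%x. x ` {..<n})"
  by(rule quotient_map_restriction[OF quotient_config refl]) (use V in simp)
 have "cmap ?Y eur (%x. \<Sum>k<n. h (x ` {..<n}) (x k))"
  by(intro cm_sum h) auto
 thus "cmap ?Y eur ((%S. \<Sum>z\<in>S. h S z) o (%x. x ` {..<n}))"
  by(rule cm_eq) (auto simp: sum.reindex Y_point)
qed

lemma cont_lagp:
 assumes "k < n"
 shows "cmap (Y_plane n) euclidean (%x. poly.coeff (lagp (x ` {..<n}) (x k)) m)"
proof -
 have "cmap (Y_plane n) euclidean (%x. poly.coeff (\<Prod>l\<in>{..<n} - {k}. Polynomial.smult (inverse (cpx (x k) - cpx (x l))) [:- cpx (x l), 1:]) m)"
 proof (rule cmap_coeff_prod)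
  fix l assume l: "l : {..<n} - {k}"
  have c: "cmap (Y_plane n) euclidean (%x. cpx (x l))" if "l < n" for l
   by(intro cmap_cpx continuous_map_point that)
  show "cmap (Y_plane n) euclidean (%x. - cpx (x l))" using l by(intro continuous_map_minus c) simp
  show "cmap (Y_plane n) euclidean (%x. inverse (cpx (x k) - cpx (x l)))"
   using l assms Y_point by(intro cmap_inverse continuous_map_diff c) (auto dest!: inj_onD)
 qed simp
 thus ?thesis
 proof (rule cm_eq)
  fix x assume "x : topspace (Y_plane n)"
  hence i: "inj_on x {..<n}" by(rule Y_point)
  hence "x ` {..<n} - {x k} = x ` ({..<n} - {k})" using assms by(auto simp: inj_on_def)
  thus "poly.coeff (\<Prod>l\<in>{..<n} - {k}. Polynomial.smult (inverse (cpx (x k) - cpx (x l))) [:- cpx (x l), 1:]) m = poly.coeff (lagp (x ` {..<n}) (x k)) m"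
   using inj_on_subset[OF i] by(simp add: lagp_def prod.reindex)
 qed
qed

lemma cont_lagc: "k < n ==> cmap (Y_plane n) eur (%x. lagc (x ` {..<n}) (x k) a)"
 by(cases "even a") (simp_all add: lagc_def cmap_Re_Im cont_lagp)

lemma cont_rec: "k < n ==> cmap (Y_plane n) eur (%x. rec (x k) a)"
 and continuous_imc: "k < n ==> cmap (Y_plane n) eur (%x. imc (x k) a)"
 by(cases "even a"; simp add: rec_def imc_def cmap_Re_Im cmap_power cmap_cpx continuous_map_point)+

text \<open>Linear forms used to order the points of a configuration; two distinct points have the
  same value for at most one \<open>j\<close>.\<close>

definition slope :: "nat => real^2 => real" where
 "slope j z = z $ 1 + real j * z $ 2"

definition generic_configs :: "nat => nat => (real^2) set set" where
 "generic_configs n j = {S : topspace (Bp n). inj_on (slope j) S}"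

definition rank_below :: "nat => (real^2) set => real^2 => nat" where
 "rank_below j S z = card {w : S. slope j w < slope j z}"

text \<open>A continuous version of the indicator of rank \<open>i\<close>.\<close>

definition rank_bump :: "nat => nat => (real^2) set => real^2 => real" where
 "rank_bump j i S z = max 0 (1 - \<bar>real (rank_below j S z) - real i\<bar>)"

lemma rank_bump: "rank_bump j i S z = (if rank_below j S z = i then 1 else 0)"
 by(auto simp: rank_bump_def max_def abs_if)

lemma bij_rank_below:
 assumes S: "finite S" and inj: "inj_on (slope j) S"
 shows "bij_betw (rank_below j S) S {..<card S}"
proof -
 have "rank_below j S z < rank_below j S w" if "z : S" "w : S" "slope j z < slope j w" for z w
  unfolding rank_below_def by(rule psubset_card_mono) (use S that in auto)
 hence "inj_on (rank_below j S) S"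
  using inj by(auto simp: inj_on_def) (metis linorder_neqE_linordered_idom nat_neq_iff)
 moreover have "rank_below j S ` S <= {..<card S}"
  unfolding rank_below_def using S by(auto intro!: psubset_card_mono)
 ultimately show ?thesis using S by(simp add: bij_betw_def card_image card_subset_eq)
qed

text \<open>If every one of the \<open>n * n + 1\<close> forms failed, each would have a pair of
  distinct points with equal values. Different forms have different pairs, but there are only
  \<open>n * n\<close> ordered pairs.\<close>

lemma generic_cover: "topspace (Bp n) <= (\<Union>j\<le>n * n. generic_configs n j)"
proof
 fix S assume S: "S : topspace (Bp n)"
 have fS: "finite S" "card S = n" using B_card[OF S] by auto
 show "S : (\<Union>j\<le>n * n. generic_configs n j)"
 proof (rule ccontr)
  assume neg: "~ ?thesis"
  have "EX p. fst p : S & snd p : S & fst p ~= snd p & slope j (fst p) = slope j (snd p)" if "j <= n * n" for j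
  proof -
   have "~ inj_on (slope j) S" using neg that S by(auto simp: generic_configs_def)
   thus ?thesis by(auto simp: inj_on_def)
  qed
  then obtain p where p: "!!j. j <= n * n ==> fst (p j) : S & snd (p j) : S & fst (p j) ~= snd (p j) & slope j (fst (p j)) = slope j (snd (p j))"
   by metis
  have "inj_on p {..n * n}"
  proof (rule inj_onI, rule ccontr)
   fix i j assume ij: "i : {..n * n}" "j : {..n * n}" "p i = p j" "i ~= j"
   define z w where "z = fst (p i)" and "w = snd (p i)"
   have e: "z $ 1 + real i * z $ 2 = w $ 1 + real i * w $ 2" "z $ 1 + real j * z $ 2 = w $ 1 + real j * w $ 2" "z ~= w"
    using p[of i] p[of j] ij by(auto simp: slope_def z_def w_def)
   have "(real i - real j) * (z $ 2 - w $ 2) = 0" using e(1,2) by(simp add: algebra_simps)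
   hence "z $ 2 = w $ 2" using ij(4) by simp
   hence "z = w" using e(1) by(simp add: vec_eq_iff forall_2)
   thus False using e(3) by simp
  qed
  moreover have "p ` {..n * n} <= S \<times> S" using p by(intro image_subsetI) (simp add: mem_Times_iff)
  ultimately have "card {..n * n} <= card (S \<times> S)" using fS(1) by(intro card_inj_on_le) auto
  thus False by(simp add: card_cartesian_product fS)
 qed
qed

lemma cont_slope: "k < n ==> cmap (Y_plane n) eur (%x. slope j (x k))"
 unfolding slope_def
 by(intro continuous_map_add cm_mult cmap_coord continuous_map_point) simp_all

lemma openin_generic: "openin (Bp n) (generic_configs n j)"
proof -
 let ?U = "topspace (Y_plane n) Int (\<Inter>k\<in>{..<n}. \<Inter>l\<in>{..<n} - {k}. {x : topspace (Y_plane n). slope j (x k) - slope j (x l) ~= 0})"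
 have "{x : topspace (Y_plane n). x ` {..<n} : generic_configs n j} = ?U"
 proof -
  have "inj_on (slope j) (x ` {..<n}) \<longleftrightarrow> (ALL k<n. ALL l<n. k ~= l --> slope j (x k) ~= slope j (x l))" if "x : topspace (Y_plane n)" for x
   using Y_point[OF that] by(auto simp: inj_on_def)
  thus ?thesis by(auto simp: generic_configs_def B_point)
 qed
 moreover have "openin (Y_plane n) ?U"
 proof -
  have o: "openin (Y_plane n) {x : topspace (Y_plane n). slope j (x k) - slope j (x l) ~= 0}" if "k < n" "l < n" for k l
   by(intro openin_coord_nonzero continuous_map_diff cont_slope that)
  have "openin (Y_plane n) (topspace (Y_plane n) Int (\<Inter>l\<in>{..<n} - {k}. {x : topspace (Y_plane n). slope j (x k) - slope j (x l) ~= 0}))" if "k < n" for k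
   using o[OF that] by(intro openin_Int_Inter) auto
  hence "openin (Y_plane n) (topspace (Y_plane n) Int (\<Inter>k\<in>{..<n}. topspace (Y_plane n) Int (\<Inter>l\<in>{..<n} - {k}. {x : topspace (Y_plane n). slope j (x k) - slope j (x l) ~= 0})))"
   by(intro openin_Int_Inter) auto
  moreover have "topspace (Y_plane n) Int (\<Inter>k\<in>{..<n}. topspace (Y_plane n) Int (\<Inter>l\<in>{..<n} - {k}. {x : topspace (Y_plane n). slope j (x k) - slope j (x l) ~= 0})) = ?U"
   by auto
  ultimately show ?thesis by simp
 qed
 ultimately show ?thesis
  unfolding config_space_def openin_quotient_topology by(auto simp: generic_configs_def config_space_def)
qed

text \<open>The rank is a sum of terms \<open>(1 + d / abs d) / 2\<close> over differences
  \<open>d\<close> of slopes, and these are nonzero on generic configurations.\<close>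

lemma cont_rank_bump:
 assumes k: "k < n"
 shows "cmap (subt (Y_plane n) {x : topspace (Y_plane n). x ` {..<n} : generic_configs n j}) eur
  (%x. rank_bump j i (x ` {..<n}) (x k))"
proof -
 let ?Y = "subt (Y_plane n) {x : topspace (Y_plane n). x ` {..<n} : generic_configs n j}"
 let ?d = "%l x. slope j (x k) - slope j (x l)"
 have nz: "?d l x ~= 0" if "x : topspace ?Y" "l < n" "l ~= k" for x l
 proof -
  have "inj_on (slope j) (x ` {..<n})" "inj_on x {..<n}" using that(1) Y_point by(auto simp: generic_configs_def)
  hence "x l ~= x k & (slope j (x l) = slope j (x k) --> x l = x k)" using that(2,3) k by(auto simp: inj_on_def)
  thus ?thesis by auto
 qed
 have c: "cmap ?Y eur (?d l)" if "l < n" for l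
  using that k by(intro cm_sub continuous_map_diff cont_slope)
 have "cmap ?Y eur (%x. \<Sum>l\<in>{..<n} - {k}. (1 + ?d l x / \<bar>?d l x\<bar>) / 2)"
 proof (intro cm_sum)
  fix l assume l: "l : {..<n} - {k}"
  have "cmap ?Y eur (%x. ?d l x / \<bar>?d l x\<bar>)"
   by(rule cm_div[OF c continuous_map_real_abs[OF c]]) (use l nz in auto)
  thus "cmap ?Y eur (%x. (1 + ?d l x / \<bar>?d l x\<bar>) / 2)"
   by(intro cm_div[OF continuous_map_add]) auto
 qed simp
 moreover have "(\<Sum>l\<in>{..<n} - {k}. (1 + ?d l x / \<bar>?d l x\<bar>) / 2) = real (rank_below j (x ` {..<n}) (x k))" if x: "x : topspace ?Y" for x
 proof -
  have i: "inj_on x {..<n}" using x Y_point by auto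
  have "{w : x ` {..<n}. slope j w < slope j (x k)} = x ` {l : {..<n} - {k}. 0 < ?d l x}" by auto
  hence "rank_below j (x ` {..<n}) (x k) = card {l : {..<n} - {k}. 0 < ?d l x}"
   unfolding rank_below_def using inj_on_subset[OF i] by(simp add: card_image subset_iff)
  also have "real ... = (\<Sum>l\<in>{..<n} - {k}. if 0 < ?d l x then 1 else 0)"
   by(simp add: sum.inter_filter[symmetric])
  also have "... = (\<Sum>l\<in>{..<n} - {k}. (1 + ?d l x / \<bar>?d l x\<bar>) / 2)"
  proof (intro sum.cong refl)
   fix l assume "l : {..<n} - {k}"
   hence "?d l x ~= 0" using nz[OF x] by simp
   hence "?d l x / \<bar>?d l x\<bar> = (if 0 < ?d l x then 1 else - 1)" by(simp add: divide_eq_eq abs_if)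
   thus "(if 0 < ?d l x then 1 else 0) = (1 + ?d l x / \<bar>?d l x\<bar>) / 2" by simp
  qed
  finally show ?thesis by simp
 qed
 ultimately have "cmap ?Y eur (%x. real (rank_below j (x ` {..<n}) (x k)))"
  by(rule cm_eq)
 thus ?thesis unfolding rank_bump_def
  by(intro continuous_map_real_max continuous_map_diff continuous_map_real_abs) auto
qed

text \<open>Ordering the points by slope turns functions on the configuration into
  \<open>n\<close>-tuples. \<open>?M\<close> evaluates a polynomial at the \<open>i\<close>-th
  point, \<open>?N\<close> interpolates; \<open>rank_bump\<close> picks that point inside a
  symmetric sum.\<close>

lemma local_frame_config: "local_frame (subt (Bp n) (generic_configs n j)) (espace n) (2 * n) n"
 unfolding local_frame_def
proof (intro exI conjI allI impI ballI)
 let ?V = "generic_configs n j"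
 let ?M = "%S i a. \<Sum>z\<in>S. rank_bump j i S z * rec z a" and ?N = "%S a i. \<Sum>z\<in>S. rank_bump j i S z * lagc S z a"
 show "cmap (subt (Bp n) ?V) eur (%S. ?M S i a)" for i a
  by(intro cont_config_sum openin_generic cm_mult cont_rank_bump cm_sub cont_rec)
 show "cmap (subt (Bp n) ?V) eur (%S. ?N S a i)" for i a
  by(intro cont_config_sum openin_generic cm_mult cont_rank_bump cm_sub cont_lagc)
 fix S assume "S : topspace (subt (Bp n) ?V)"
 hence S: "finite S" "card S = n" "inj_on (slope j) S" using B_card by(auto simp: generic_configs_def)
 have bij: "bij_betw (rank_below j S) S {..<n}" using bij_rank_below[OF S(1,3)] S(2) by simp
 define zt where "zt = inv_into S (rank_below j S)"
 have zt: "bij_betw zt {..<n} S" unfolding zt_def by(rule bij_betw_inv_into[OF bij])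
 have r: "rank_below j S (zt i) = i" if "i < n" for i
  using bij that unfolding zt_def by(simp add: bij_betw_def f_inv_into_f)
 have ztr: "zt (rank_below j S z) = z" if "z : S" for z using bij that unfolding zt_def by(simp add: bij_betw_def)
 have ztS: "zt i : S" if "i < n" for i using zt that by(auto simp: bij_betw_def)
 have pick: "(\<Sum>z\<in>S. rank_bump j i S z * h z) = h (zt i)" if i: "i < n" for i and h :: "real^2 => real"
 proof -
  have "rank_bump j i S z * h z = (if z = zt i then h (zt i) else 0)" if z: "z : S" for z
   using r[OF i] ztr[OF z] by(auto simp: rank_bump)
  hence "(\<Sum>z\<in>S. rank_bump j i S z * h z) = (\<Sum>z\<in>S. if z = zt i then h (zt i) else 0)" by(intro sum.cong refl)
  thus ?thesis using S(1) ztS[OF i] by simp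
 qed
 have sumS: "(\<Sum>i<n. h (zt i)) = sum h S" for h :: "real^2 => real" by(rule sum.reindex_bij_betw[OF zt])
 have N: "(%a. if a < 2 * n then \<Sum>i<n. ?N S a i * c i else 0) = lag n S (c o rank_below j S)" for c
 proof
  fix a
  have "(\<Sum>i<n. ?N S a i * c i) = (\<Sum>i<n. lagc S (zt i) a * c (rank_below j S (zt i)))"
   by(intro sum.cong refl) (simp add: pick r)
  thus "(if a < 2 * n then \<Sum>i<n. ?N S a i * c i else 0) = lag n S (c o rank_below j S) a"
   using sumS[of "%z. lagc S z a * c (rank_below j S z)"] by(simp add: lag_def)
 qed
 show "(%a. if a < 2 * n then \<Sum>i<n. ?N S a i * c i else 0) : espace n S" for c
  unfolding N by(rule lag_espace[OF S(1,2)])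
 show "(\<Sum>a<2 * n. ?M S i a * (\<Sum>k<n. ?N S a k * c k)) = c i" if i: "i < n" for c i
 proof -
  have "(\<Sum>a<2 * n. ?M S i a * (\<Sum>k<n. ?N S a k * c k)) = (\<Sum>a<2 * n. rec (zt i) a * lag n S (c o rank_below j S) a)"
  proof (intro sum.cong refl)
   fix a assume "a : {..<2 * n}"
   hence "lag n S (c o rank_below j S) a = (\<Sum>k<n. ?N S a k * c k)" using fun_cong[OF N[of c], of a] by simp
   thus "?M S i a * (\<Sum>k<n. ?N S a k * c k) = rec (zt i) a * lag n S (c o rank_below j S) a"
    by(simp only: pick[OF i])
  qed
  thus ?thesis using fval_lag[OF S(1,2) ztS[OF i]] r[OF i] by(simp add: re_fval)
 qed
 show "(\<Sum>i<n. ?N S a i * (\<Sum>b<2 * n. ?M S i b * v b)) = v a" if v: "v : espace n S" and a: "a < 2 * n" for v a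
 proof -
  have "(\<Sum>i<n. ?N S a i * (\<Sum>b<2 * n. ?M S i b * v b)) = (\<Sum>i<n. lagc S (zt i) a * Re (fval n v (zt i)))"
   by(intro sum.cong refl) (simp add: pick flip: re_fval)
  also have "... = v a" using sumS[of "%z. lagc S z a * Re (fval n v z)"] fun_cong[OF lag_fval[OF S(1,2) v], of a] a by(simp add: lag_def)
  finally show ?thesis .
 qed
qed

theorem free_over_config:
 assumes f: "cmap T (Bp n) f"
 shows "free_over (pbun T (espace n o f) (2 * n)) fst T n
  (cpow (pbun T (espace n o f) (2 * n)) (cls (pbun T (espace n o f) (2 * n)) (taut T (espace n o f) (2 * n))))"
proof (rule free_over_pbun[where m="n * n" and U="%j. {t : topspace T. f t : generic_configs n j}"])
 show "openin T {t : topspace T. f t : generic_configs n j}" for j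
  using f openin_generic by(rule openin_continuous_map_preimage)
 show "topspace T <= (\<Union>j\<le>n * n. {t : topspace T. f t : generic_configs n j})"
  using generic_cover[of n] f by(force simp: cm_def Pi_iff)
 fix j
 have "cmap (subt T {t : topspace T. f t : generic_configs n j}) (subt (Bp n) (generic_configs n j)) f"
  using f by(auto simp: cm_into cm_sub)
 thus "local_frame (subt T {t : topspace T. f t : generic_configs n j}) (espace n o f) (2 * n) n"
  by(rule local_frame_pull[OF local_frame_config])
qed

section \<open>The projectivization of the regular bundle\<close>

abbreviation "Tot n == bundle_total (\<xi>_plane n)"
abbreviation "NZ n == nonzero_vectors (\<xi>_plane n)"
abbreviation "Proj n == projectivization (\<xi>_plane n)"
abbreviation "line n == line_through (\<xi>_plane n)"
abbreviation "Zn n == pbun (Bp n) (espace n) (2 * n)"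

lemma bundle_simps [simp]:
 "bundle_base (\<xi>_plane n) = Bp n" "bundle_proj (\<xi>_plane n) = fst"
 "vscale (\<xi>_plane n) c (S, g) = (S, \<lambda>p\<in>S. c * g p)"
 by(simp_all add: regular_bundle_def)

lemma quotient_label: "quotient_map (ptop (Y_plane n) (labels n)) (Tot n) (label_config n)"
 by(simp add: regular_bundle_def quotient_map_quotient_topology)

lemma topspace_Tot: "(S, g) : topspace (Tot n) \<longleftrightarrow> S : topspace (Bp n) & g : extensional S"
proof -
 have "topspace (Tot n) = label_config n ` (topspace (Y_plane n) \<times> ({..<n} \<rightarrow>\<^sub>E UNIV))"
  by(simp add: regular_bundle_def)
 moreover have "(S, g) : label_config n ` (topspace (Y_plane n) \<times> ({..<n} \<rightarrow>\<^sub>E UNIV))"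
  if S: "S : topspace (Bp n)" and g: "g : extensional S"
 proof -
  obtain x where x: "x : topspace (Y_plane n)" "S = x ` {..<n}" using S by(auto simp: B_point)
  have "label_config n (x, \<lambda>k\<in>{..<n}. g (x k)) = (S, g)"
   using label_eqI[OF Y_point[OF x(1)], of g] g x(2) by simp
  thus ?thesis using x(1) by(intro image_eqI[of _ _ "(x, \<lambda>k\<in>{..<n}. g (x k))"]) auto
 qed
 ultimately show ?thesis by(auto simp: B_point label_config_def)
qed

text \<open>Unlike quotient maps, open maps are stable under products with an identity; in
  \<open>cont_evl\<close> this yields a quotient map.\<close>

lemma open_map_times_id:
 assumes "open_map X Y q" shows "open_map (ptop X R) (ptop Y R) (%z. (q (fst z), snd z))"
 unfolding open_map_def
proof (intro allI impI)
 fix U assume U: "openin (ptop X R) U"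
 show "openin (ptop Y R) ((%z. (q (fst z), snd z)) ` U)"
  unfolding openin_prod_topology_alt
 proof (intro allI impI)
  fix y c assume "(y, c) : (%z. (q (fst z), snd z)) ` U"
  then obtain x where x: "(x, c) : U" "y = q x" by auto
  then obtain A C where A: "openin X A" "openin R C" "x : A" "c : C" "A \<times> C <= U"
   using U[unfolded openin_prod_topology_alt, rule_format, OF x(1)] by(elim exE conjE) (rule that)
  have "openin Y (q ` A)" using assms A(1) by(simp add: open_map_def)
  moreover have "q ` A \<times> C <= (%z. (q (fst z), snd z)) ` U" using A(5) by force
  ultimately show "EX A C. openin Y A & openin R C & y : A & c : C & A \<times> C <= (%z. (q (fst z), snd z)) ` U"
   using A x(2) by(intro exI[of _ "q ` A"] exI[of _ C] conjI) auto
 qed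
qed

definition evl :: "nat => (real^2) set \<times> (nat => real) => (real^2) set \<times> (real^2 => real)" where
 "evl n z = (fst z, \<lambda>p\<in>fst z. Re (fval n (snd z) p))"

lemma cont_evl: "cmap (ptop (Bp n) (powertop_real UNIV)) (Tot n) (evl n)"
proof (rule continuous_compose_quotient_map)
 let ?YR = "ptop (Y_plane n) (powertop_real (UNIV :: nat set))" and ?q = "%z :: (nat => real^2) \<times> (nat => real). (fst z ` {..<n}, snd z)"
 have cq: "cmap ?YR (ptop (Bp n) (powertop_real UNIV)) ?q"
  using cm_comp[OF cm_fst quotient_imp_continuous_map[OF quotient_config]]
  by(intro cm_pair cm_snd) (simp add: o_def)
 show "quotient_map ?YR (ptop (Bp n) (powertop_real UNIV)) ?q"
 proof (rule continuous_open_imp_quotient_map[OF cq])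
  show "open_map ?YR (ptop (Bp n) (powertop_real UNIV)) ?q"
   by(rule open_map_times_id[OF open_map_config])
  show "?q ` topspace ?YR = topspace (ptop (Bp n) (powertop_real UNIV))"
   by(force simp: B_point image_iff)
 qed
 let ?l = "%z. (fst z, \<lambda>k\<in>{..<n}. Re (fval n (snd z) (fst z k)))"
 have "cmap ?YR (ptop (Y_plane n) (labels n)) ?l"
 proof (intro cm_pair cm_fst)
  have "cmap ?YR eur (%z. Re (fval n (snd z) (fst z k)))" if "k < n" for k
   unfolding re_fval[symmetric]
  proof (intro cm_sum cm_mult)
   show "cmap ?YR eur (%z. rec (fst z k) a)" for a
    using cm_comp[OF cm_fst cont_rec[OF that]] by(simp add: o_def)
   show "cmap ?YR eur (%z. snd z a)" for a
    using cm_comp[OF cm_snd continuous_map_product_projection[of a UNIV]] by(simp add: o_def)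
  qed simp
  thus "cmap ?YR (labels n) (%z. \<lambda>k\<in>{..<n}. Re (fval n (snd z) (fst z k)))"
   by(auto simp: continuous_map_componentwise)
 qed
 from cm_comp[OF this quotient_imp_continuous_map[OF quotient_label]]
 show "cmap ?YR (Tot n) (evl n o ?q)"
 proof (rule cm_eq)
  fix z assume "z : topspace ?YR"
  hence i: "inj_on (fst z) {..<n}" using Y_point[of "fst z" n] by(auto simp: mem_Times_iff)
  show "(label_config n o ?l) z = (evl n o ?q) z"
   using label_eqI[OF i, of "\<lambda>p\<in>fst z ` {..<n}. Re (fval n (snd z) p)"] by(simp add: evl_def)
 qed
qed

lemma cont_Tot_lag: "cmap (Tot n) eur (%e. lag n (fst e) (snd e) a)"
proof (rule continuous_compose_quotient_map[OF quotient_label])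
 let ?YR = "ptop (Y_plane n) (labels n)"
 have "cmap ?YR eur (%z. if a < 2 * n then \<Sum>k<n. lagc (fst z ` {..<n}) (fst z k) a * snd z k else 0)"
 proof -
  have "cmap ?YR eur (%z. \<Sum>k<n. lagc (fst z ` {..<n}) (fst z k) a * snd z k)"
  proof (intro cm_sum cm_mult)
   fix k assume "k : {..<n}"
   hence k: "k < n" by simp
   show "cmap ?YR eur (%z. lagc (fst z ` {..<n}) (fst z k) a)"
    using cm_comp[OF cm_fst cont_lagc[OF k]] by(simp add: o_def)
   show "cmap ?YR eur (%z. snd z k)"
    using cm_comp[OF cm_snd continuous_map_product_projection[of k "{..<n}"]] k by(simp add: o_def)
  qed simp
  thus ?thesis by(cases "a < 2 * n") simp_all
 qed
 thus "cmap ?YR eur ((%e. lag n (fst e) (snd e) a) o label_config n)"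
 proof (rule cm_eq)
  fix z assume "z : topspace ?YR"
  hence i: "inj_on (fst z) {..<n}" using Y_point[of "fst z" n] by(auto simp: mem_Times_iff)
  have "fst (label_config n z) = fst z ` {..<n}" by(cases z) (simp add: label_config_def)
  moreover have "snd (label_config n z) (fst z k) = snd z k" if "k < n" for k
   using label_value[OF i that, of "snd z"] by simp
  ultimately show "(if a < 2 * n then \<Sum>k<n. lagc (fst z ` {..<n}) (fst z k) a * snd z k else 0) = ((%e. lag n (fst e) (snd e) a) o label_config n) z"
   using i by(simp add: lag_def sum.reindex)
 qed
qed

lemma cont_Tot_fst: "cmap (Tot n) (Bp n) fst"
proof (rule continuous_compose_quotient_map[OF quotient_label])
 have "fst o label_config n = (%x. x ` {..<n}) o fst" by(auto simp: fun_eq_iff label_config_def)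
 thus "cmap (ptop (Y_plane n) (labels n)) (Bp n) (fst o label_config n)"
  using cm_comp[OF cm_fst quotient_imp_continuous_map[OF quotient_config]] by metis
qed

definition lnorm :: "nat => (real^2) set \<times> (real^2 => real) => real" where
 "lnorm n e = sqrt (\<Sum>a<2 * n. (lag n (fst e) (snd e) a)\<^sup>2)"

definition nlag :: "nat => (real^2) set \<times> (real^2 => real) => nat => real" where
 "nlag n e a = lag n (fst e) (snd e) a / lnorm n e"

lemma NZ_iff: "(S, g) : NZ n \<longleftrightarrow> S : topspace (Bp n) & g : extensional S & (EX p:S. g p ~= 0)"
 by(auto simp: nonzero_vectors_def topspace_Tot fun_eq_iff extensional_def)

lemma lnorm_pos: assumes "e : NZ n" shows "lnorm n e > 0"
proof -
 obtain S g where e: "e = (S, g)" by(cases e)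
 then obtain p where S: "S : topspace (Bp n)" and p: "p : S" "g p ~= 0" using assms by(auto simp: NZ_iff)
 have "EX a<2*n. lag n S g a ~= 0"
 proof (rule ccontr)
  assume "~ ?thesis"
  hence "fval n (lag n S g) p = 0" by(simp add: fval_def) (intro sum.neutral ballI, simp add: complex_eq_iff)
  thus False using fval_lag[of S n p g] B_card[OF S] p by simp
 qed
 then obtain a where "a < 2 * n" "lag n S g a ~= 0" by blast
 hence "(\<Sum>a<2 * n. (lag n S g a)\<^sup>2) > 0" by(intro sum_pos2[of _ a]) auto
 thus ?thesis by(simp add: lnorm_def e)
qed

lemma espace_scale: "v : espace n S ==> (%a. c * v a) : espace n S"
 by(simp add: espace_def fval_scale)

lemma lag_scale: "lag n S (\<lambda>p\<in>S. c * g p) a = c * lag n S g a"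
 by(simp add: lag_def sdl ac_simps)

lemma nlag:
 assumes e: "e : NZ n"
 shows "nlag n e : sph (2 * n)" "nlag n e : espace n (fst e)"
  "evl n (fst e, nlag n e) = vscale (\<xi>_plane n) (1 / lnorm n e) e"
proof -
 obtain S g where Sg: "e = (S, g)" by(cases e)
 hence S: "finite S" "card S = n" and g: "g : extensional S" using e B_card[of S n] by(auto simp: NZ_iff)
 have p: "lnorm n e > 0" using e by(rule lnorm_pos)
 hence "(\<Sum>a<2 * n. (nlag n e a)\<^sup>2) = 1"
  by(simp add: nlag_def power_divide flip: sum_divide_distrib) (simp add: lnorm_def)
 thus "nlag n e : sph (2 * n)" by(simp add: sph_def nlag_def lag_def)
 have s: "nlag n e = (%a. (1 / lnorm n e) * lag n S g a)" by(simp add: nlag_def Sg fun_eq_iff)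
 show "nlag n e : espace n (fst e)" unfolding s using espace_scale[OF lag_espace[OF S, of g], of "1 / lnorm n e"] by(simp add: Sg)
 show "evl n (fst e, nlag n e) = vscale (\<xi>_plane n) (1 / lnorm n e) e"
 proof -
  have "fval n (nlag n e) p = of_real (1 / lnorm n e * g p)" if "p : S" for p
   unfolding s fval_scale fval_lag[OF S that] by simp
  thus ?thesis by(simp add: evl_def Sg fun_eq_iff)
 qed
qed

lemma nlag_evl:
 assumes S: "S : topspace (Bp n)" and v: "v : espace n S" "v : sph (2 * n)"
 shows "evl n (S, v) : NZ n" "nlag n (evl n (S, v)) = v"
proof -
 have fS: "finite S" "card S = n" using B_card[OF S] by auto
 have l: "lag n S (\<lambda>p\<in>S. Re (fval n v p)) = v"
  using lag_fval[OF fS v(1)] lag_scale[of n S 1 "%p. Re (fval n v p)"] by(simp add: fun_eq_iff)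
 have "EX p:S. Re (fval n v p) ~= 0"
 proof (rule ccontr)
  assume "~ ?thesis"
  hence "lag n S (%z. Re (fval n v z)) a = 0" for a by(simp add: lag_def)
  thus False using v(2) lag_fval[OF fS v(1)] sph_nonzero[OF v(2)] by metis
 qed
 thus "evl n (S, v) : NZ n" using S by(auto simp: evl_def NZ_iff)
 have "lnorm n (evl n (S, v)) = 1" using l v(2) by(simp add: lnorm_def evl_def sph_def)
 thus "nlag n (evl n (S, v)) = v" by(simp add: nlag_def fun_eq_iff) (simp add: evl_def l)
qed

lemma NZ_scale: "e : NZ n ==> c ~= 0 ==> vscale (\<xi>_plane n) c e : NZ n"
 by(cases e) (auto simp: NZ_iff)

lemma nlag_scale:
 assumes e: "e : NZ n" and c: "c ~= 0"
 shows "nlag n (vscale (\<xi>_plane n) c e) = (%a. sgn c * nlag n e a)" "fst (vscale (\<xi>_plane n) c e) = fst e"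
proof -
 obtain S g where Sg: "e = (S, g)" by(cases e)
 show "fst (vscale (\<xi>_plane n) c e) = fst e" by(simp add: Sg)
 have "lnorm n (vscale (\<xi>_plane n) c e) = \<bar>c\<bar> * lnorm n e"
  by(simp add: lnorm_def Sg lag_scale power_mult_distrib real_sqrt_mult flip: sdl)
 thus "nlag n (vscale (\<xi>_plane n) c e) = (%a. sgn c * nlag n e a)"
  using c by(simp add: nlag_def Sg lag_scale fun_eq_iff real_sgn_eq)
qed

lemma vscale_vscale: "vscale (\<xi>_plane n) c (vscale (\<xi>_plane n) d e) = vscale (\<xi>_plane n) (c * d) e"
 by(cases e) (auto simp: mult.assoc restrict_def)

lemma vscale_1: "e : topspace (Tot n) ==> vscale (\<xi>_plane n) 1 e = e"
 by(cases e) (auto simp: topspace_Tot extensional_def)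

lemma line_scale: "c ~= 0 ==> line n (vscale (\<xi>_plane n) c e) = line n e"
proof -
 assume "c ~= 0"
 hence "vscale (\<xi>_plane n) d e = vscale (\<xi>_plane n) (d / c) (vscale (\<xi>_plane n) c e)" for d
  unfolding vscale_vscale by simp
 hence "vscale (\<xi>_plane n) d e : range (%d. vscale (\<xi>_plane n) d (vscale (\<xi>_plane n) c e))" for d by(rule image_eqI) simp
 thus ?thesis unfolding line_through_def vscale_vscale by blast
qed

lemma line_memE:
 assumes "e : NZ n" "e' : line n e" "e' : NZ n"
 obtains c where "c ~= 0" "e' = vscale (\<xi>_plane n) c e"
proof -
 obtain c where c: "e' = vscale (\<xi>_plane n) c e" using assms(2) by(auto simp: line_through_def)
 have "c ~= 0" using assms(3) c by(cases e) (auto simp: NZ_iff)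
 thus thesis using that c by blast
qed

lemma NZ_Tot: "e : NZ n ==> e : topspace (Tot n)" by(simp add: nonzero_vectors_def)

lemma line_self: "e : NZ n ==> e : line n e"
 using vscale_1[OF NZ_Tot] unfolding line_through_def by(metis rangeI)

lemma topspace_Proj: "topspace (Proj n) = line n ` NZ n"
 using NZ_Tot by(auto simp: projectivization_def)

lemma quotient_line: "quotient_map (subt (Tot n) (NZ n)) (Proj n) (line n)"
 unfolding projectivization_def by(rule quotient_map_quotient_topology)

definition rep :: "nat => ((real^2) set \<times> (real^2 => real)) set => (real^2) set \<times> (real^2 => real)" where
 "rep n l = (SOME e. e : NZ n & e : l)"

lemma rep: assumes "l : topspace (Proj n)" shows "rep n l : NZ n" "rep n l : l" "l = line n (rep n l)"
proof -
 obtain e where e: "e : NZ n" "l = line n e" using assms by(auto simp: topspace_Proj)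
 have "rep n l : NZ n & rep n l : l" unfolding rep_def by(rule someI[of _ e]) (use e line_self[OF e(1)] in simp)
 thus "rep n l : NZ n" "rep n l : l" by auto
 then obtain c where "c ~= 0" "rep n l = vscale (\<xi>_plane n) c e" using line_memE[OF e(1)] e(2) by metis
 thus "l = line n (rep n l)" using e(2) line_scale by simp
qed

text \<open>With inverse \<open>from_Z\<close> this identifies the abstract projectivization with
  \<open>Zn n\<close>, a space of lines in coefficient space, where freeness is already
  known.\<close>

definition to_Z :: "nat => ((real^2) set \<times> (real^2 => real)) set => (real^2) set \<times> (nat \<times> nat => real)" where
 "to_Z n l = (fst (rep n l), outer (nlag n (rep n l)))"

definition from_Z :: "nat => (real^2) set \<times> (nat \<times> nat => real) => ((real^2) set \<times> (real^2 => real)) set" where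
 "from_Z n z = line n (evl n (fst z, vsel (snd z)))"

lemma outer_sgn: "c ~= 0 ==> outer (%a. sgn c * v a) = outer v"
 by(auto simp: outer_def fun_eq_iff sgn_if)

lemma to_Z_line: assumes e: "e : NZ n" shows "to_Z n (line n e) = (fst e, outer (nlag n e))"
proof -
 have l: "line n e : topspace (Proj n)" using e by(auto simp: topspace_Proj)
 obtain c where c: "c ~= 0" "rep n (line n e) = vscale (\<xi>_plane n) c e"
  using line_memE[OF e rep(2)[OF l] rep(1)[OF l]] .
 thus ?thesis using nlag_scale[OF e c(1)] outer_sgn[OF c(1)] by(simp add: to_Z_def)
qed

lemma cont_nlag_products:
 "cmap (subt (Tot n) (NZ n)) eur (%e. nlag n e a)"
 unfolding nlag_def lnorm_def
proof (intro cm_div continuous_map_sqrt cm_sum continuous_map_real_pow cm_sub cont_Tot_lag)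
 fix e assume "e : topspace (subt (Tot n) (NZ n))"
 thus "sqrt (\<Sum>a<2 * n. (lag n (fst e) (snd e) a)\<^sup>2) ~= 0" using lnorm_pos[of e n] by(auto simp: lnorm_def)
qed simp

lemma cont_to_Z: "cmap (Proj n) (Zn n) (to_Z n)"
proof (rule continuous_compose_quotient_map[OF quotient_line])
 let ?X = "subt (Tot n) (NZ n)"
 have "cmap ?X (Zn n) (%e. (fst e, outer (nlag n e)))"
  unfolding cmap_into_pbun o_def fst_conv snd_conv
 proof (intro conjI ballI)
  show "cmap ?X (Bp n) (%e. fst e)" by(intro cm_sub cont_Tot_fst)
  show "cmap ?X (RP (2 * n)) (%e. outer (nlag n e))"
   unfolding cmap_into_RP outer_apply using nlag(1) cm_mult[OF cont_nlag_products cont_nlag_products] by auto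
  show "outer (nlag n e) : outer ` (espace n (fst e) Int sph (2 * n))" if "e : topspace ?X" for e
   using that nlag(1,2)[of e n] by auto
 qed
 thus "cmap ?X (Zn n) (to_Z n o line n)" by(rule cm_eq) (simp add: to_Z_line)
qed

lemma Zn_point:
 assumes "z : topspace (Zn n)"
 shows "fst z : topspace (Bp n)" "vsel (snd z) : espace n (fst z)" "vsel (snd z) : sph (2 * n)" "outer (vsel (snd z)) = snd z"
proof -
 obtain v where v: "fst z : topspace (Bp n)" "v : espace n (fst z)" "v : sph (2 * n)" "snd z = outer v"
  using assms by(auto simp: topspace_pbun)
 show "fst z : topspace (Bp n)" by(rule v(1))
 have l: "lead v ~= 0" using v(3) by(rule lead_nonzero)
 have vs: "vsel (snd z) = (%a. sgn (lead v) * v a)" by(simp add: v(4) vsel_outer)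
 show "vsel (snd z) : espace n (fst z)" unfolding vs by(rule espace_scale[OF v(2)])
 show "outer (vsel (snd z)) = snd z" unfolding vs using outer_sgn[OF l] v(4) by simp
 show "vsel (snd z) : sph (2 * n)"
  using v(3) sph_uminus[OF v(3)] l unfolding vs by(auto simp: sgn_if)
qed

lemma from_to_Z: "l : topspace (Proj n) ==> from_Z n (to_Z n l) = l"
proof -
 assume l: "l : topspace (Proj n)"
 let ?e = "rep n l"
 have e: "?e : NZ n" using rep(1)[OF l] .
 have s: "lead (nlag n ?e) ~= 0" using nlag(1)[OF e] by(rule lead_nonzero)
 have sc: "evl n (fst ?e, vsel (outer (nlag n ?e))) = vscale (\<xi>_plane n) (sgn (lead (nlag n ?e))) (evl n (fst ?e, nlag n ?e))"
  by(simp add: vsel_outer evl_def fval_scale restrict_def fun_eq_iff)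
 have "from_Z n (to_Z n l) = line n (vscale (\<xi>_plane n) (sgn (lead (nlag n ?e)) * (1 / lnorm n ?e)) ?e)"
  unfolding from_Z_def to_Z_def fst_conv snd_conv sc nlag(3)[OF e] vscale_vscale ..
 also have "... = line n ?e" by(rule line_scale) (use s lnorm_pos[OF e] in \<open>simp add: sgn_if\<close>)
 finally show ?thesis using rep(3)[OF l] by simp
qed

lemma to_from_Z: "z : topspace (Zn n) ==> to_Z n (from_Z n z) = z"
 unfolding from_Z_def using Zn_point[of z n] nlag_evl[of "fst z" n "vsel (snd z)"]
 by(simp add: to_Z_line) (simp add: evl_def)

text \<open>\<open>vsel\<close> is not continuous. Where the \<open>b\<close>-th diagonal entry is
  nonzero, the \<open>b\<close>-th column of the projection spans the same line and varies
  continuously; the pasted maps agree because scaling does not change \<open>line\<close>.\<close>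

lemma cont_from_Z: "cmap (Zn n) (Proj n) (from_Z n)"
proof (rule pasting_lemma[where I="{..<2 * n}" and T="%b. {z : topspace (Zn n). snd z (b, b) ~= 0}" and f="%b z. line n (evl n (fst z, %a. snd z (a, b)))"])
 let ?T = "%b. {z : topspace (Zn n). snd z (b, b) ~= 0}"
 have c: "cmap (Zn n) eur (%z. snd z (a, b))" for a b
  by(rule cmap_via_RP[OF continuous_proj_bundle_snd])
 show "openin (Zn n) (?T b)" for b by(rule openin_coord_nonzero[OF c])
 have key: "EX c~=0. evl n (fst z, %a. snd z (a, b)) = vscale (\<xi>_plane n) c (evl n (fst z, vsel (snd z)))" if z: "z : ?T b" for z b
 proof -
  have zT: "z : topspace (Zn n)" and nz: "snd z (b, b) ~= 0" using z by auto
  let ?v = "vsel (snd z)"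
  have "snd z (a, b) = ?v b * ?v a" for a using fun_cong[OF Zn_point(4)[OF zT], of "(a, b)"] by(simp add: mult.commute)
  moreover from this nz have "?v b ~= 0" by auto
  ultimately show ?thesis by(intro exI[of _ "?v b"]) (simp add: evl_def fval_scale restrict_def fun_eq_iff)
 qed
 show "cmap (subt (Zn n) (?T b)) (Proj n) (%z. line n (evl n (fst z, %a. snd z (a, b))))" for b
 proof -
  let ?X = "subt (Zn n) (?T b)"
  have "cmap ?X (ptop (Bp n) (powertop_real UNIV)) (%z. (fst z, %a. snd z (a, b)))"
   by(intro cm_pair cm_sub cont_pbun_fst)
    (simp add: continuous_map_componentwise_UNIV c)
  from cm_comp[OF this cont_evl]
  have "cmap ?X (Tot n) (%z. evl n (fst z, %a. snd z (a, b)))" by(simp add: o_def)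
  moreover have "evl n (fst z, %a. snd z (a, b)) : NZ n" if z: "z : topspace ?X" for z
  proof -
   have zT: "z : ?T b" using z by simp
   hence "z : topspace (Zn n)" by simp
   from nlag_evl(1)[OF Zn_point(1-3)[OF this]] NZ_scale key[OF zT] show ?thesis by metis
  qed
  ultimately have "cmap ?X (subt (Tot n) (NZ n)) (%z. evl n (fst z, %a. snd z (a, b)))"
   by(auto simp: cm_into)
  from cm_comp[OF this quotient_imp_continuous_map[OF quotient_line]] show ?thesis by(simp add: o_def)
 qed
 have eq: "line n (evl n (fst z, %a. snd z (a, b))) = from_Z n z" if "z : ?T b" for z b
  using key[OF that] line_scale unfolding from_Z_def by metis
 show "line n (evl n (fst z, %a. snd z (a, i))) = line n (evl n (fst z, %a. snd z (a, j)))"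
  if "z : topspace (Zn n) Int ?T i Int ?T j" for i j z using eq[of z i] eq[of z j] that by blast
 show "EX j. j : {..<2 * n} & z : ?T j & from_Z n z = line n (evl n (fst z, %a. snd z (a, j)))" if z: "z : topspace (Zn n)" for z
 proof -
  obtain b where b: "b < 2 * n" "vsel (snd z) b ~= 0" using sph_nonzero[OF Zn_point(3)[OF z]] .
  have "snd z (b, b) ~= 0" using fun_cong[OF Zn_point(4)[OF z], of "(b, b)"] b(2) by(metis mult_eq_0_iff outer_apply)
  thus ?thesis using b(1) z eq[of z b] by(intro exI[of _ b]) simp
 qed
qed

lemma projectivization_proj_line: "l : topspace (Proj n) ==> projectivization_proj (\<xi>_plane n) l = fst (rep n l)"
proof -
 assume l: "l : topspace (Proj n)"
 have "fst ` l = {fst (rep n l)}"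
  by(subst rep(3)[OF l]) (cases "rep n l"; auto simp: line_through_def image_iff)
 thus ?thesis by(simp add: projectivization_proj_def)
qed

section \<open>The tautological line bundle and its orientation cocycle\<close>

abbreviation "Taut n == tautological_bundle (\<xi>_plane n)"
abbreviation "tau n == line_bundle_cocycle (Taut n)"

lemma taut_simps [simp]:
 "bundle_base (Taut n) = Proj n" "bundle_proj (Taut n) = fst" "vscale (Taut n) c (l, v) = (l, vscale (\<xi>_plane n) c v)"
 "bundle_total (Taut n) = subt (ptop (Proj n) (Tot n)) {(l, v). v : l}"
 by(simp_all add: tautological_bundle_def)

lemma nonzero_taut: "z : nonzero_vectors (Taut n) \<longleftrightarrow> fst z : topspace (Proj n) & snd z : fst z & snd z : NZ n"
 by(cases z) (auto simp: nonzero_vectors_def[of "Taut n"] nonzero_vectors_def[of "\<xi>_plane n"])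

definition chosen :: "nat => ((real^2) set \<times> (real^2 => real)) set => (real^2) set \<times> (real^2 => real)" where
 "chosen n l = snd (chosen_vector (Taut n) l)"

text \<open>The vectors chosen by \<open>chosen_vector\<close>, as unit coefficient vectors: a
  \<open>line_field\<close> whose character is \<open>tau n\<close>.\<close>

definition vP :: "nat => ((real^2) set \<times> (real^2 => real)) set => nat => real" where
 "vP n l = nlag n (chosen n l)"

lemma chosen:
 assumes l: "l : topspace (Proj n)"
 shows "chosen_vector (Taut n) l = (l, chosen n l)" "chosen n l : NZ n" "chosen n l : l"
proof -
 have "chosen_vector (Taut n) l : nonzero_vectors (Taut n) & bundle_proj (Taut n) (chosen_vector (Taut n) l) = l"
  unfolding chosen_vector_def by(rule someI[of _ "(l, rep n l)"]) (use l rep[OF l] in \<open>simp add: nonzero_taut\<close>)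
 thus "chosen_vector (Taut n) l = (l, chosen n l)" "chosen n l : NZ n" "chosen n l : l"
  by(auto simp: nonzero_taut chosen_def prod_eq_iff)
qed

lemma same_line:
 assumes l: "l : topspace (Proj n)" and e: "e : l" "e : NZ n" and e': "e' : l" "e' : NZ n"
 obtains c where "c ~= 0" "e' = vscale (\<xi>_plane n) c e"
proof -
 obtain a where a: "a ~= 0" "e = vscale (\<xi>_plane n) a (rep n l)" using line_memE[OF rep(1)[OF l]] e rep(3)[OF l] by metis
 obtain b where b: "b ~= 0" "e' = vscale (\<xi>_plane n) b (rep n l)" using line_memE[OF rep(1)[OF l]] e' rep(3)[OF l] by metis
 show thesis by(rule that[of "b / a"]) (use a b in \<open>simp_all add: vscale_vscale\<close>)
qed

lemma nlag_same_line:
 assumes "l : topspace (Proj n)" "e : l" "e : NZ n" "e' : l" "e' : NZ n"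
 shows "fst e' = fst e" "nlag n e' = nlag n e \<or> nlag n e' = (%a. - nlag n e a)"
proof -
 obtain c where c: "c ~= 0" "e' = vscale (\<xi>_plane n) c e" by(rule same_line[OF assms])
 show "fst e' = fst e" "nlag n e' = nlag n e \<or> nlag n e' = (%a. - nlag n e a)"
  using nlag_scale[OF assms(3) c(1)] c by(auto simp: sgn_if)
qed

lemma vP_rep:
 assumes l: "l : topspace (Proj n)"
 shows "vP n l = nlag n (rep n l) \<or> vP n l = (%a. - nlag n (rep n l) a)" "outer (vP n l) = snd (to_Z n l)" "fst (chosen n l) = fst (to_Z n l)"
proof -
 note s = nlag_same_line[OF l rep(2,1)[OF l] chosen(3,2)[OF l]]
 thus a: "vP n l = nlag n (rep n l) \<or> vP n l = (%a. - nlag n (rep n l) a)" by(simp add: vP_def)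
 thus "outer (vP n l) = snd (to_Z n l)" by(auto simp: to_Z_def)
 show "fst (chosen n l) = fst (to_Z n l)" using s(1) by(simp add: to_Z_def)
qed

lemma line_field_vP: "line_field (2 * n) (Proj n) (vP n)"
 unfolding line_field_def
proof (intro conjI ballI)
 fix l assume "l : topspace (Proj n)"
 hence v: "vP n l : sph (2 * n)" using nlag(1)[OF chosen(2)] by(simp add: vP_def)
 show "ALL a>=2 * n. vP n l a = 0" "(\<Sum>a<2 * n. (vP n l a)\<^sup>2) = 1" using v by(simp_all add: sph_def)
next
 have "cmap (Proj n) (RP (2 * n)) (snd o to_Z n)"
  by(rule cm_comp[OF cont_to_Z continuous_proj_bundle_snd])
 note c = cmap_via_RP[OF this]
 have e: "(snd o to_Z n) l (a, b) = vP n l a * vP n l b" if "l : topspace (Proj n)" for l a b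
  using vP_rep(2)[OF that] by(metis comp_apply outer_apply)
 show "ALL a b. cmap (Proj n) eur (%l. vP n l a * vP n l b)"
  by(intro allI) (rule cm_eq[OF c e])
qed

text \<open>Normalizing a path of nonzero vectors gives a lift whose sign is 1 at both ends.
  Conversely a lift with equal end signs, multiplied by that sign, starts and ends on the chosen
  rays.\<close>

lemma preserves_rays_iff:
 assumes s: "ssx 1 (Proj n) s" and c: "line_lift (vP n) 1 s c"
 shows "preserves_rays (Taut n) s \<longleftrightarrow> c (vertex 0) = c (vertex 1)"
proof
 let ?De = "stdx 1" and ?X = "subt (bundle_total (Taut n)) (nonzero_vectors (Taut n))"
 have sc: "cmap (sx_top 1) (Proj n) s" and se: "s : extensional ?De" using s by(simp_all add: ssx_d)
 have sP: "s x : topspace (Proj n)" if "x : ?De" for x using sc that by(auto simp: cm_def Pi_iff)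
 have vert: "vertex 0 : ?De" "vertex 1 : ?De" by simp_all
 {
  assume "preserves_rays (Taut n) s"
  then obtain t where t: "ssx 1 ?X t" "smap 1 fst t = s"
   and tv: "ALL i<=1. EX c>0. t (vertex i) = vscale (Taut n) c (chosen_vector (Taut n) (s (vertex i)))"
   unfolding preserves_rays_def Let_def by auto
  have tc: "cmap (sx_top 1) ?X t" using t(1) by(simp add: ssx_d)
  have t1: "fst (t x) = s x" if "x : ?De" for x using fun_cong[OF t(2), of x] that by(simp add: simplex_map_def)
  have tx: "snd (t x) : s x" "snd (t x) : NZ n" if "x : ?De" for x
   using tc t1[OF that] that by(auto simp: cm_def Pi_iff nonzero_taut)
  define c' where "c' x = (if nlag n (snd (t x)) = vP n (s x) then 1 else -1 :: real)" for x
  have c'v: "c' x * vP n (s x) a = nlag n (snd (t x)) a" if x: "x : ?De" for x a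
   using nlag_same_line(2)[OF sP[OF x] chosen(3,2)[OF sP[OF x]] tx[OF x]] by(auto simp: c'_def vP_def)
  have "cmap (sx_top 1) (subt (Tot n) (NZ n)) (%x. snd (t x))"
  proof -
   have "cmap ?X (Tot n) snd"
    by(simp add: cm_sub cm_snd)
   from cm_comp[OF tc this] show ?thesis using tx by(auto simp: cm_into o_def)
  qed
  from cm_comp[OF this cont_nlag_products]
  have "cmap (sx_top 1) eur (%x. c' x * vP n (s x) a)" for a
   by(rule cm_eq) (simp add: c'v)
  hence "line_lift (vP n) 1 s c'" by(simp add: line_lift_def c'_def)
  moreover have "c' (vertex i) = 1" if i: "i <= 1" for i
  proof -
   have v: "vertex i : ?De" using i vert by(cases i) auto
   obtain d where d: "d > 0" "t (vertex i) = vscale (Taut n) d (chosen_vector (Taut n) (s (vertex i)))" using tv i by blast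
   hence "snd (t (vertex i)) = vscale (\<xi>_plane n) d (chosen n (s (vertex i)))" by(simp add: chosen(1)[OF sP[OF v]])
   thus ?thesis using nlag_scale(1)[OF chosen(2)[OF sP[OF v]], of d] d(1) by(simp add: c'_def vP_def)
  qed
  ultimately show "c (vertex 0) = c (vertex 1)" using line_lift_unique[OF line_field_vP s c _ vert, of c'] by simp
 }
 assume c01: "c (vertex 0) = c (vertex 1)"
 have c1: "c x = 1 \<or> c x = -1" if "x : ?De" for x using c that by(simp add: line_lift_def)
 let ?k = "c (vertex 0)"
 define u where "u x = evl n (fst (to_Z n (s x)), %a. ?k * (c x * vP n (s x) a))" for x
 let ?t = "restrict (%x. (s x, u x)) ?De"
 have ux: "u x = vscale (\<xi>_plane n) (?k * c x / lnorm n (chosen n (s x))) (chosen n (s x))" if x: "x : ?De" for x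
 proof -
  let ?e = "chosen n (s x)"
  have "u x = vscale (\<xi>_plane n) (?k * c x) (evl n (fst ?e, nlag n ?e))"
   unfolding u_def vP_rep(3)[OF sP[OF x], symmetric]
   by(simp add: vP_def evl_def restrict_def fun_eq_iff mult.assoc[symmetric] fval_scale)
  thus ?thesis by(simp add: nlag(3)[OF chosen(2)[OF sP[OF x]]] vscale_vscale)
 qed
 have nz: "?k * c x / lnorm n (chosen n (s x)) ~= 0" if "x : ?De" for x
  using c1[OF that] c1[OF vert(1)] lnorm_pos[OF chosen(2)[OF sP[OF that]]] by auto
 have "cmap (sx_top 1) (ptop (Bp n) (powertop_real UNIV)) (%x. (fst (to_Z n (s x)), %a. ?k * (c x * vP n (s x) a)))"
 proof (intro cm_pair)
  show "cmap (sx_top 1) (Bp n) (%x. fst (to_Z n (s x)))"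
   using cm_comp[OF sc cm_comp[OF cont_to_Z cont_pbun_fst]] by(simp add: o_def)
  show "cmap (sx_top 1) (powertop_real UNIV) (%x a. ?k * (c x * vP n (s x) a))"
   using c by(simp add: line_lift_def continuous_map_componentwise_UNIV cm_mult)
 qed
 from cm_comp[OF this cont_evl] have uc: "cmap (sx_top 1) (Tot n) u"
  by(rule cm_eq) (simp add: u_def)
 have "cmap (sx_top 1) ?X (%x. (s x, u x))"
  unfolding taut_simps cm_into
 proof (intro conjI cm_pair sc uc)
  have "u x : s x & u x : NZ n" if x: "x : ?De" for x
  proof -
   let ?e = "chosen n (s x)"
   note ch = chosen[OF sP[OF x]]
   have "s x = line n ?e"
    using same_line[OF sP[OF x] rep(2,1)[OF sP[OF x]] ch(3,2)] line_scale rep(3)[OF sP[OF x]] by metis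
   hence "u x : s x" using ux[OF x] by(auto simp: line_through_def)
   thus ?thesis using ux[OF x] NZ_scale[OF ch(2) nz[OF x]] by simp
  qed
  thus "(%x. (s x, u x)) : topspace (sx_top 1) \<rightarrow> {(l, v). v : l}"
   "(%x. (s x, u x)) : topspace (sx_top 1) \<rightarrow> nonzero_vectors (Taut n)"
   using sP by(auto simp: nonzero_taut)
 qed
 hence "cmap (sx_top 1) ?X ?t" by(rule cm_eq) simp
 hence "ssx 1 ?X ?t" by(simp add: ssx_d)
 moreover have "smap 1 (bundle_proj (Taut n)) ?t = s"
  using se by(auto simp: simplex_map_def fun_eq_iff extensional_def)
 moreover have "EX d>0. ?t (vertex i) = vscale (Taut n) d (chosen_vector (Taut n) (s (vertex i)))" if i: "i <= 1" for i
 proof -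
  have v: "vertex i : ?De" and ci: "?k * c (vertex i) = 1" using i vert c01 c1[OF vert(1)] by(cases i; auto)+
  show ?thesis using v ux[OF v] ci lnorm_pos[OF chosen(2)[OF sP[OF v]]] chosen(1)[OF sP[OF v]]
   by(intro exI[of _ "1 / lnorm n (chosen n (s (vertex i)))"]) simp
 qed
 ultimately show "preserves_rays (Taut n) s" unfolding preserves_rays_def Let_def by(intro exI[of _ ?t]) auto
qed

lemma tau_eq_chi: "tau n = chi (Proj n) (vP n)"
proof (intro ext)
 fix p s
 show "tau n p s = chi (Proj n) (vP n) p s"
 proof (cases "p = 1 & ssx 1 (Proj n) s")
  case True
  obtain c where c: "line_lift (vP n) 1 s c" using line_lift_exists[OF line_field_vP] True by blast
  thus ?thesis using chi_lift[OF line_field_vP _ c] preserves_rays_iff[OF _ c] True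
   by(auto simp: line_bundle_cocycle_def)
 next
  case False
  thus ?thesis by(auto simp: line_bundle_cocycle_def chi_def)
 qed
qed

lemma cyc_tau: "cyc (Proj n) (tau n)"
 unfolding tau_eq_chi by(rule cyc_chi[OF line_field_vP])

lemma cls_tau: "cls (Proj n) (tau n) = pull (Proj n) (to_Z n) (Zn n) (cls (Zn n) (taut (Bp n) (espace n) (2 * n)))"
proof -
 let ?v = "(vsel o snd) o to_Z n"
 have lf: "line_field (2 * n) (Proj n) ?v" by(rule line_field_compose[OF line_field_pbun cont_to_Z])
 have "exact (Proj n) (chi (Proj n) (vP n) + chi (Proj n) ?v)"
 proof (rule chi_linear_map[OF line_field_vP lf, where A="%_ i a. if a = i then 1 else 0"])
  fix l assume l: "l : topspace (Proj n)"
  let ?w = "nlag n (rep n l)"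
  have w: "lead ?w ~= 0" "?v l = (%a. sgn (lead ?w) * ?w a)"
   using lead_nonzero[OF nlag(1)[OF rep(1)[OF l]]] by(simp_all add: to_Z_def vsel_outer)
  have s: "(\<Sum>a<2*n. (if a = i then 1 else 0) * vP n l a) = vP n l i" if "i < 2 * n" for i
   using that by(simp add: if_distrib[of "%z. z * _"] sum.delta cong: if_cong)
  obtain ep where ep: "ep ~= 0" "!!i. vP n l i = ep * ?w i"
   using vP_rep(1)[OF l] that[of 1] that[of "-1"] by auto
  have "vP n l i = (ep * sgn (lead ?w)) * ?v l i" for i
  proof -
   have "sgn (lead ?w) * sgn (lead ?w) = 1" using w(1) by(simp add: sgn_if)
   thus ?thesis unfolding w(2) ep(2) by(simp add: algebra_simps) 
  qed
  thus "EX c~=0. ALL i<2*n. (\<Sum>a<2*n. (if a = i then 1 else 0) * vP n l a) = c * ?v l i"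
   using s ep(1) w(1) by(intro exI[of _ "ep * sgn (lead ?w)"]) (simp add: sgn_0_0)
 qed simp
 hence "cls (Proj n) (tau n) = cls (Proj n) (chi (Proj n) ?v)"
  using cls_eq_iff[OF cyc_chi[OF line_field_vP] cyc_chi[OF lf]] by(simp only: tau_eq_chi)
 also have "chi (Proj n) ?v = pb (Proj n) (to_Z n) (taut (Bp n) (espace n) (2 * n))"
  using pb_chi[OF cont_to_Z, of n "vsel o snd"] by simp
 finally show ?thesis by(simp add: pull_cls[OF cont_to_Z cyc_taut])
qed

abbreviation "pjP n == projectivization_proj (\<xi>_plane n)"

lemma projectivization_proj_to_Z: "l : topspace (Proj n) ==> pjP n l = fst (to_Z n l)"
 by(simp add: projectivization_proj_line to_Z_def)

lemma cont_pjP: "cmap (Proj n) (Bp n) (pjP n)"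
 using cm_comp[OF cont_to_Z cont_pbun_fst]
 by(rule cm_eq) (simp add: projectivization_proj_to_Z)

lemma pull_tau: "pull (Zn n) (from_Z n) (Proj n) (cls (Proj n) (tau n)) = cls (Zn n) (taut (Bp n) (espace n) (2 * n))"
 unfolding cls_tau
 using pull_pull[OF cont_from_Z cont_to_Z cls_in_cohs[OF cyc_taut]]
  pull_id[of "Zn n" "to_Z n o from_Z n", OF _ cls_in_cohs[OF cyc_taut]]
 by(simp add: to_from_Z)

theorem free_over_Proj: "free_over (Proj n) (pjP n) (Bp n) n (cpow (Proj n) (cls (Proj n) (tau n)))"
proof (rule free_over_transfer[OF cont_from_Z cont_to_Z cont_pjP cont_pbun_fst])
 show "pjP n (from_Z n z) = fst z" if "z : topspace (Zn n)" for z
 proof -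
  have "from_Z n z : topspace (Proj n)" using cont_from_Z that by(auto simp: cm_def Pi_iff)
  thus ?thesis using to_from_Z[OF that] by(simp add: projectivization_proj_to_Z)
 qed
 show "fst (to_Z n l) = pjP n l" if "l : topspace (Proj n)" for l using that by(simp add: projectivization_proj_to_Z)
 show "homotopic_with (%_. True) (Proj n) (Proj n) (from_Z n o to_Z n) id"
  using from_to_Z by(intro homotopic_with_equal cm_comp[OF cont_to_Z cont_from_Z]) auto
 show "cpow (Proj n) (cls (Proj n) (tau n)) i : cohs (Proj n)" for i by simp
 have "espace n o (%S. S) = espace n" by(simp add: o_def)
 thus "free_over (Zn n) fst (Bp n) n (%i. pull (Zn n) (from_Z n) (Proj n) (cpow (Proj n) (cls (Proj n) (tau n)) i))"
  using free_over_config[OF continuous_map_id[unfolded id_def], of n] by(simp add: pull_cpow[OF cont_from_Z] pull_tau)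
qed

section \<open>Stiefel--Whitney classes\<close>

abbreviation "cocycles X == carrier (cocycle_ring X)"
abbreviation "coset X c == coboundaries X +>\<^bsub>cocycle_ring X\<^esub> c"

text \<open>Embeds the cohomology ring of the statement, made of cosets of cochains with finitely
  many nonzero degrees, into the type \<open>coh\<close>; all representatives of a coset have the
  same class.\<close>

definition kap :: "'a topology => 'a cochain set => 'a coh" where
 "kap X A = cls X (SOME c. c : A)"

lemma cycs_iff: "c : cocycles X \<longleftrightarrow> c : cochains X & cyc X c"
 by(simp add: cocycle_ring_def cyc_def)

lemma cyc_cycs: "c : cocycles X ==> cyc X c" by(simp add: cycs_iff)

lemma coset_hom: "coset X : ring_hom (cocycle_ring X) (HRg X)"
 unfolding cohomology_ring_def by(rule ideal.rcos_ring_hom[OF ideal_coboundaries])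

lemma mem_coset: "d : coset X c \<longleftrightarrow> (EX h:cochains X. d = dl X h + c)"
 by(auto simp: a_r_coset_def' coboundaries_def cocycle_ring_def)

lemma cch_on_cchs: "c : cochains X ==> cch_on X c = c"
proof (intro ext)
 fix p s assume "c : cochains X"
 hence "~ ssx p X s ==> c p s = 0" unfolding cochains_def by blast
 thus "cch_on X c p s = c p s" by(auto simp: cch_on_def)
qed

lemma kap_coset: assumes c: "c : cocycles X" shows "kap X (coset X c) = cls X c"
proof -
 have "c : coset X c" unfolding mem_coset using zero_cochains by(intro bexI[of _ 0]) (simp_all add: coboundary_0)
 hence "(SOME d. d : coset X c) : coset X c" by(rule someI[where P="%d. d : coset X c"])
 from mem_coset[THEN iffD1, OF this] obtain h where h: "(SOME d. d : coset X c) = dl X h + c" by(elim bexE) (rule that)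
 have cc: "cyc X c" "cyc X (dl X h + c)" using c by(simp_all add: cycs_iff cyc_add)
 have "exact X ((dl X h + c) + c)" by(simp add: add.assoc)
 thus ?thesis unfolding kap_def h cls_eq_iff[OF cc(2,1)] .
qed

lemma cohomology_carrierE:
 assumes "A : carrier (HRg X)" obtains c where "c : cocycles X" "A = coset X c"
 using assms by(auto simp: cohomology_ring_def FactRing_def A_RCOSETS_def')

lemma coset_carrier: "c : cocycles X ==> coset X c : carrier (HRg X)"
 by(rule ring_hom_closed[OF coset_hom])

lemma kap_in: "A : carrier (HRg X) ==> kap X A : cohs X"
 by(elim cohomology_carrierE) (simp add: kap_coset cyc_cycs)

text \<open>A primitive may be nonzero in infinitely many degrees. As \<open>c + d\<close> vanishes
  above some degree \<open>K\<close>, cutting the primitive off above \<open>K\<close> does not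
  change its coboundary.\<close>

lemma coset_eq_exact:
 assumes c: "c : cocycles X" "d : cocycles X" and e: "exact X (c + d)" shows "coset X c = coset X d"
proof -
 have cd: "c + d : cochains X" using c by(simp add: cycs_iff add_cochains)
 obtain h where "cch_on X (c + d) = dl X h" using e by(rule exactE)
 hence h: "c + d = dl X h" using cch_on_cchs[OF cd] by simp
 have "finite {p. (c + d) p ~= 0}" using cd by(simp add: cochains_def)
 then obtain K where "ALL p:{p. (c + d) p ~= 0}. p <= K" using finite_nat_set_iff_bounded_le by blast
 hence K: "(c + d) p = 0" if "K < p" for p using that by(metis (mono_tags) mem_Collect_eq not_le)
 define h' where "h' = (%p s. if p <= K then cch_on X h p s else 0)"
 have h'0: "h' p = 0" if "K < p" for p using that by(simp add: h'_def zero_fun_def)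
 have "{p. h' p ~= 0} <= {..K}" using h'0 by(metis (mono_tags) atMost_iff mem_Collect_eq not_le subsetI)
 hence fin: "finite {p. h' p ~= 0}" by(rule finite_subset) simp
 have "ssx p X s" if "h' p s ~= 0" for p s
  using that by(simp add: h'_def cch_on_def split: if_splits)
 with fin have h'c: "h' : cochains X" unfolding cochains_def by blast
 have "dl X h' p s = (c + d) p s" for p s
 proof (cases "p <= Suc K")
  case True
  hence "h' (p - 1) = cch_on X h (p - 1)" by(intro ext) (simp add: h'_def)
  hence "dl X h' p s = dl X (cch_on X h) p s" unfolding coboundary_def by(simp only:)
  thus ?thesis by(simp add: h)
 next
  case False
  hence "(c + d) p = 0" using K[of p] by simp
  moreover have "h' (p - 1) = 0" using False h'0[of "p - 1"] by simp
  hence "dl X h' p s = 0" by(simp add: coboundary_def zero_fun_def)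
  ultimately show ?thesis by(simp add: zero_fun_def)
 qed
 hence cob: "dl X h' = c + d" by(intro ext)
 have 1: "dl X g + c = dl X (g + h') + d" "dl X g + d = dl X (g + h') + c" for g
  by(simp only: coboundary_add cob add.assoc cch_add_self add_0_right)
   (simp only: coboundary_add cob add.assoc add.commute[of d c] cch_add_left_cancel)
 have sub: "coset X a <= coset X b" if "!!g. dl X g + a = dl X (g + h') + b" for a b
 proof
  fix z assume z: "z : coset X a"
  from mem_coset[THEN iffD1, OF z] obtain g where "g : cochains X" "z = dl X g + a" by(elim bexE) (rule that)
  thus "z : coset X b" unfolding mem_coset using that add_cochains[OF _ h'c] by(intro bexI[of _ "g + h'"]) simp_all
 qed
 show ?thesis by(intro subset_antisym sub 1)
qed

lemma kap_inj:
 assumes "A : carrier (HRg X)" "A' : carrier (HRg X)" "kap X A = kap X A'" shows "A = A'"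
proof -
 obtain c where c: "c : cocycles X" "A = coset X c" using assms(1) by(rule cohomology_carrierE)
 obtain d where d: "d : cocycles X" "A' = coset X d" using assms(2) by(rule cohomology_carrierE)
 have "cls X c = cls X d" using assms(3) c d by(simp add: kap_coset)
 thus ?thesis using c d cls_eq_iff[OF cyc_cycs[OF c(1)] cyc_cycs[OF d(1)]] coset_eq_exact[OF c(1) d(1)] by simp
qed

lemma cyc_ring_simps [simp]:
 "mult (cocycle_ring X) = cup X" "add (cocycle_ring X) = (+)" "one (cocycle_ring X) = unc X" "zero (cocycle_ring X) = 0"
 by(simp_all add: cocycle_ring_def)

lemma kap_mult:
 assumes "A : carrier (HRg X)" "A' : carrier (HRg X)"
 shows "kap X (A \<otimes>\<^bsub>HRg X\<^esub> A') = kap X A * kap X A'" "kap X (A \<oplus>\<^bsub>HRg X\<^esub> A') = kap X A + kap X A'"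
proof -
 obtain c where c: "c : cocycles X" "A = coset X c" using assms(1) by(rule cohomology_carrierE)
 obtain d where d: "d : cocycles X" "A' = coset X d" using assms(2) by(rule cohomology_carrierE)
 have cl: "cup X c d : cocycles X" "c + d : cocycles X"
  using c(1) d(1) by(simp_all add: cycs_iff cup_cochains cyc_cup add_cochains cyc_add)
 show "kap X (A \<otimes>\<^bsub>HRg X\<^esub> A') = kap X A * kap X A'"
  unfolding c(2) d(2) ring_hom_mult[OF coset_hom c(1) d(1), symmetric] cyc_ring_simps kap_coset[OF c(1)] kap_coset[OF d(1)] kap_coset[OF cl(1)]
  by(rule cls_cup[OF cyc_cycs[OF c(1)] cyc_cycs[OF d(1)]])
 show "kap X (A \<oplus>\<^bsub>HRg X\<^esub> A') = kap X A + kap X A'"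
  unfolding c(2) d(2) ring_hom_add[OF coset_hom c(1) d(1), symmetric] cyc_ring_simps kap_coset[OF c(1)] kap_coset[OF d(1)] kap_coset[OF cl(2)]
  by(rule cls_add[OF cyc_cycs[OF c(1)] cyc_cycs[OF d(1)]])
qed

lemma kap_one: "kap X \<one>\<^bsub>HRg X\<^esub> = one_at X" and kap_zero: "kap X \<zero>\<^bsub>HRg X\<^esub> = 0"
proof -
 have u: "unc X : cocycles X" by(simp add: cycs_iff unit_cochains cyc_unit)
 show "kap X \<one>\<^bsub>HRg X\<^esub> = one_at X"
  unfolding one_at_def kap_coset[OF u, symmetric] ring_hom_one[OF coset_hom, of X, symmetric] cyc_ring_simps ..
 have z: "(0::'a cochain) : cocycles X" by(simp add: cycs_iff zero_cochains)
 show "kap X \<zero>\<^bsub>HRg X\<^esub> = 0"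
  unfolding ring_hom_zero[OF coset_hom ring_cocycle_ring ring_cohomology_ring, of X, symmetric] cyc_ring_simps kap_coset[OF z] by simp
qed

lemma kap_finsum:
 assumes "finite I" "!!i. i : I ==> f i : carrier (HRg X)"
 shows "kap X (\<Oplus>\<^bsub>HRg X\<^esub>i\<in>I. f i) = (\<Sum>i\<in>I. kap X (f i))"
proof -
 interpret R: ring "HRg X" by(rule ring_cohomology_ring)
 show ?thesis using assms
 proof (induction I)
  case (insert i I)
  hence "finsum (HRg X) f I : carrier (HRg X)" by(intro R.finsum_closed) auto
  thus ?case using insert by(simp add: R.finsum_insert Pi_iff kap_mult)
 qed (simp add: kap_zero)
qed

lemma kap_pow: "A : carrier (HRg X) ==> kap X (A [^]\<^bsub>HRg X\<^esub> (k::nat)) = cpow X (kap X A) k"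
proof -
 interpret R: ring "HRg X" by(rule ring_cohomology_ring)
 assume "A : carrier (HRg X)"
 thus ?thesis by(induction k) (simp_all add: kap_one cpow_0 class_power_Suc kap_mult)
qed

lemma pb_cchs: "c : cochains Y ==> pb X f c : cochains X"
proof -
 assume c: "c : cochains Y"
 have "{p. pb X f c p ~= 0} <= {p. c p ~= 0}" by(auto simp: pb_d zero_fun_def)
 thus ?thesis using c by(auto simp: cochains_def pb_d intro: finite_subset split: if_splits)
qed

lemma cohomology_map:
 assumes f: "cmap X Y f" and A: "A : carrier (HRg Y)"
 shows "cohomology_map X f A : carrier (HRg X)" "kap X (cohomology_map X f A) = pull X f Y (kap Y A)"
proof -
 obtain c where c: "c : cocycles Y" "A = coset Y c" using A by(rule cohomology_carrierE)
 have pc: "pb X f c : cocycles X" using c(1) pb_cchs[of c Y X f] by(simp add: cycs_iff cyc_pb[OF f])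
 have e: "coset X (pb X f d) = coset X (pb X f c)" if d: "d : A" for d
 proof -
  from mem_coset[THEN iffD1, OF d[unfolded c(2)]] obtain h where h: "h : cochains Y" "d = dl Y h + c" by(elim bexE) (rule that)
  have "pb X f d = dl X (pb X f h) + pb X f c" by(simp add: h(2) pb_add pb_dl[OF f])
  moreover from this have "pb X f d : cocycles X"
   using pc h(1) pb_cchs[of h Y X f] by(simp add: cycs_iff add_cochains coboundary_cochains cyc_add)
  ultimately show ?thesis by(intro coset_eq_exact[OF _ pc]) (simp_all add: add.assoc)
 qed
 have "c : coset Y c" unfolding mem_coset using zero_cochains by(intro bexI[of _ 0]) (simp_all add: coboundary_0)
 hence "A ~= {}" unfolding c(2) by blast
 from SUP_eq_const[OF this e] have m: "cohomology_map X f A = coset X (pb X f c)" unfolding cohomology_map_def .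
 show "cohomology_map X f A : carrier (HRg X)" unfolding m by(rule coset_carrier[OF pc])
 show "kap X (cohomology_map X f A) = pull X f Y (kap Y A)"
  unfolding m unfolding c(2) kap_coset[OF pc] kap_coset[OF c(1)] pull_cls[OF f cyc_cycs[OF c(1)]] ..
qed

section \<open>Homogeneous components of cochains and classes\<close>

definition deg :: "nat => 'a cochain => 'a cochain" where
 "deg k c = (%p s. if p = k then c p s else 0)"

lemma deg_add: "deg k (a + b) = deg k a + deg k b"
 by(simp add: deg_def fun_eq_iff cch_apply)

lemma deg_0 [simp]: "deg k 0 = 0" by(simp add: deg_def fun_eq_iff cch_apply)

lemma deg_sum: "deg k (\<Sum>i\<in>I. c i) = (\<Sum>i\<in>I. deg k (c i))"
 by(rule sum_additive[of "deg k"]) (simp_all add: deg_add)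

lemma deg_cch_on: "deg k (cch_on X c) = cch_on X (deg k c)" by(auto simp: deg_def cch_on_def fun_eq_iff)

lemma deg_dl: "deg (Suc k) (dl X c) = dl X (deg k c)" "deg 0 (dl X c) = 0"
proof -
 show "deg (Suc k) (dl X c) = dl X (deg k c)"
 proof (intro ext)
  fix p s show "deg (Suc k) (dl X c) p s = dl X (deg k c) p s"
   by(cases p) (simp_all add: deg_def coboundary_def)
 qed
 show "deg 0 (dl X c) = 0" by(simp add: deg_def coboundary_def fun_eq_iff cch_apply)
qed

lemma deg_pb: "deg k (pb X f c) = pb X f (deg k c)"
 by(auto simp: deg_def pb_d fun_eq_iff)

lemma deg_cup: assumes a: "deg i a = a" shows "deg (i + k) (cup X a c) = cup X a (deg k c)"
proof (intro ext)
 fix p s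
 have a0: "a j t = 0" if "j ~= i" for j t using fun_cong[OF fun_cong[OF a, of j], of t] that by(simp add: deg_def)
 have "(\<Sum>j\<le>p. a j (front_face j s) * deg k c (p - j) (back_face j (p - j) s)) =
   (if p = i + k then \<Sum>j\<le>p. a j (front_face j s) * c (p - j) (back_face j (p - j) s) else 0)"
 proof (cases "p = i + k")
  case True
  have "a j (front_face j s) * deg k c (p - j) (back_face j (p - j) s) = a j (front_face j s) * c (p - j) (back_face j (p - j) s)" for j
   using a0[of j] True by(cases "j = i") (simp_all add: deg_def)
  thus ?thesis unfolding if_P[OF True] by(simp only:)
 next
  case False
  have "a j (front_face j s) * deg k c (p - j) (back_face j (p - j) s) = 0" if "j <= p" for j
   using a0[of j] False that by(cases "j = i") (auto simp: deg_def)
  thus ?thesis unfolding if_not_P[OF False] by(intro sum.neutral ballI) simp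
 qed
 thus "deg (i + k) (cup X a c) p s = cup X a (deg k c) p s" by(simp add: deg_def[of "i + k"] cup_def)
qed

lemma deg_cch_power: assumes "deg 1 x = x" shows "deg i (cch_power X x i) = cch_power X x i"
proof (induction i)
 case 0 thus ?case by(auto simp: deg_def unit_cochain_def fun_eq_iff)
next
 case (Suc i) thus ?case using deg_cup[of i "cch_power X x i" 1 X x] assms by simp
qed

lemma exact_deg: assumes "exact X c" shows "exact X (deg k c)"
proof -
 obtain e where e: "cch_on X c = dl X e" using assms by(rule exactE)
 have "cch_on X (deg k c) = deg k (dl X e)" by(simp add: e flip: deg_cch_on)
 show ?thesis
 proof (cases k)
  case 0
  hence "cch_on X (deg k c) = dl X 0" using \<open>cch_on X (deg k c) = _\<close> by(simp add: deg_dl coboundary_0)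
  thus ?thesis by(rule exactI)
 next
  case (Suc q)
  hence "cch_on X (deg k c) = dl X (deg q e)" using \<open>cch_on X (deg k c) = _\<close> by(simp add: deg_dl)
  thus ?thesis by(rule exactI)
 qed
qed

lemma cyc_deg: "cyc X c ==> cyc X (deg k c)"
 using deg_dl(1)[of k X c] by(simp add: cyc_def)

lemma deg_cycs: assumes "cyc X c" shows "deg k (cch_on X c) : cocycles X"
proof -
 have "{p. deg k (cch_on X c) p ~= 0} <= {k}" by(auto simp: deg_def zero_fun_def)
 hence "deg k (cch_on X c) : cochains X"
  by(auto simp: cochains_def deg_def cch_on_def intro: finite_subset split: if_splits)
 thus ?thesis using assms by(simp add: cycs_iff cyc_deg)
qed

lemma cohomology_group_deg: assumes "cyc X c" shows "coset X (deg k (cch_on X c)) : cohomology_group k X"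
proof -
 have "deg k (cch_on X c) : coset X (deg k (cch_on X c))"
  unfolding mem_coset using zero_cochains by(intro bexI[of _ 0]) (simp_all add: coboundary_0)
 thus ?thesis unfolding cohomology_group_def using coset_carrier[OF deg_cycs[OF assms]]
  by(intro CollectI conjI bexI[of _ "deg k (cch_on X c)"]) (auto simp: deg_def zero_fun_def)
qed

lemma tau_cycs: "tau n : cocycles (Proj n)" "deg 1 (tau n) = tau n"
proof -
 show d: "deg 1 (tau n) = tau n" by(auto simp: deg_def line_bundle_cocycle_def fun_eq_iff)
 have "cch_on (Proj n) (tau n) = tau n" unfolding tau_eq_chi by simp
 thus "tau n : cocycles (Proj n)" using deg_cycs[OF cyc_tau[of n], of 1] d by simp
qed

abbreviation "xta n == cls (Proj n) (tau n)"

lemma sw_relation_kap: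
 assumes w': "ALL k. w k : carrier (HRg (Bp n))"
 defines "R == \<Oplus>\<^bsub>HRg (Proj n)\<^esub>k\<in>{..n}. cohomology_map (Proj n) (pjP n) (w k) \<otimes>\<^bsub>HRg (Proj n)\<^esub> line_bundle_class (Taut n) [^]\<^bsub>HRg (Proj n)\<^esub> (n - k)"
 shows "R : carrier (HRg (Proj n))"
  "kap (Proj n) R = (\<Sum>k\<le>n. cpow (Proj n) (xta n) (n - k) * pull (Proj n) (pjP n) (Bp n) (kap (Bp n) (w k)))"
proof -
 have w: "w k : carrier (HRg (Bp n))" for k using w' by simp
 interpret R: ring "HRg (Proj n)" by(rule ring_cohomology_ring)
 have x: "line_bundle_class (Taut n) : carrier (HRg (Proj n))" "kap (Proj n) (line_bundle_class (Taut n)) = xta n"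
  using coset_carrier[OF tau_cycs(1)] kap_coset[OF tau_cycs(1)] by(simp_all add: line_bundle_class_def)
 have t: "cohomology_map (Proj n) (pjP n) (w k) \<otimes>\<^bsub>HRg (Proj n)\<^esub> line_bundle_class (Taut n) [^]\<^bsub>HRg (Proj n)\<^esub> (n - k) : carrier (HRg (Proj n))" for k
  using cohomology_map(1)[OF cont_pjP w] x by simp
 show "R : carrier (HRg (Proj n))" unfolding R_def using t by(intro R.finsum_closed) simp
 show "kap (Proj n) R = (\<Sum>k\<le>n. cpow (Proj n) (xta n) (n - k) * pull (Proj n) (pjP n) (Bp n) (kap (Bp n) (w k)))"
  unfolding R_def using t x cohomology_map[OF cont_pjP w]
  by(simp add: kap_finsum kap_mult kap_pow mult.commute)
qed

text \<open>Expanding the \<open>n\<close>-th power of \<open>tau n\<close> in lower powers gives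
  coefficients of mixed degree; the power is homogeneous of degree \<open>n\<close>, so only the
  component of degree \<open>n - i\<close> of the \<open>i\<close>-th coefficient is kept.\<close>

lemma ex_sw_classes: "EX w. sw_classes n (\<xi>_plane n) w"
proof -
 let ?B = "Bp n" and ?P = "Proj n"
 obtain u where u: "ALL i<n. cyc ?B (u i)" "exact ?P (cch_power ?P (tau n) n + lh ?P (pjP n) (tau n) n u)"
  using free_over_lh_span[OF free_over_Proj cont_pjP cyc_tau cyc_cch_power[OF cyc_tau], of n n] by(elim exE conjE) (rule that)
 let ?u = "%i. deg (n - i) (cch_on ?B (u i))"
 have lh: "deg n (lh ?P (pjP n) (tau n) n u) = lh ?P (pjP n) (tau n) n ?u"
  unfolding lh_def deg_sum
 proof (intro sum.cong refl)
  fix i assume "i : {..<n}"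
  hence "deg n (cup ?P (cch_power ?P (tau n) i) (pb ?P (pjP n) (u i))) = cup ?P (cch_power ?P (tau n) i) (pb ?P (pjP n) (deg (n - i) (u i)))"
   using deg_cup[where k="n - i" and X="?P" and c="pb ?P (pjP n) (u i)" and i=i and a="cch_power ?P (tau n) i", OF deg_cch_power[OF tau_cycs(2)]]
   by(simp add: deg_pb)
  thus "deg n (cup ?P (cch_power ?P (tau n) i) (pb ?P (pjP n) (u i))) = cup ?P (cch_power ?P (tau n) i) (pb ?P (pjP n) (?u i))"
   by(simp add: deg_cch_on pb_cch_on[OF cont_pjP])
 qed
 have e: "exact ?P (cch_power ?P (tau n) n + lh ?P (pjP n) (tau n) n ?u)"
  using exact_deg[OF u(2), of n] by(simp add: deg_add lh deg_cch_power[OF tau_cycs(2)])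
 have cu: "cyc ?B (?u i)" if "i < n" for i using u(1) that by(intro cyc_deg) simp
 have l: "cyc ?P (lh ?P (pjP n) (tau n) n ?u)"
  "cls ?P (lh ?P (pjP n) (tau n) n ?u) = (\<Sum>i<n. cpow ?P (xta n) i * pull ?P (pjP n) ?B (cls ?B (?u i)))"
  by(rule lh_cls(1)[OF cont_pjP cyc_tau cu], assumption) (rule lh_cls(2)[OF cont_pjP cyc_tau cu])
 have lcls: "cpow ?P (xta n) n = (\<Sum>i<n. cpow ?P (xta n) i * pull ?P (pjP n) ?B (cls ?B (?u i)))"
  using e unfolding cls_eq_iff[OF cyc_cch_power[OF cyc_tau] l(1), of n, symmetric] l(2) cls_cch_power[OF cyc_tau] .
 define w where "w k = (if k = 0 then \<one>\<^bsub>HRg ?B\<^esub> else if k <= n then coset ?B (?u (n - k)) else \<zero>\<^bsub>HRg ?B\<^esub>)" for k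
 interpret RB: ring "HRg ?B" by(rule ring_cohomology_ring)
 have wg: "w k : cohomology_group k ?B" for k
 proof -
  have "\<one>\<^bsub>HRg ?B\<^esub> = coset ?B (deg 0 (cch_on ?B (unc ?B)))"
  proof -
   have "deg 0 (cch_on ?B (unc ?B)) = unc ?B" by(auto simp: deg_def cch_on_def unit_cochain_def fun_eq_iff)
   thus ?thesis using ring_hom_one[OF coset_hom, of ?B] by simp
  qed
  moreover have "\<zero>\<^bsub>HRg ?B\<^esub> = coset ?B (deg k (cch_on ?B 0))"
   using ring_hom_zero[OF coset_hom ring_cocycle_ring ring_cohomology_ring, of ?B] by simp
  ultimately show ?thesis unfolding w_def
   using cohomology_group_deg[OF cyc_unit, of ?B 0] cohomology_group_deg[OF cyc_0, of ?B k] cohomology_group_deg[of ?B "u (n - k)" k] u(1) by auto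
 qed
 hence wc: "ALL k. w k : carrier (HRg ?B)" by(simp add: cohomology_group_def)
 note R = sw_relation_kap[OF wc]
 interpret RP: ring "HRg ?P" by(rule ring_cohomology_ring)
 have kw: "kap ?B (w k) = cls ?B (?u (n - k))" if "0 < k" "k <= n" for k
  using that kap_coset[OF deg_cycs[of ?B "u (n - k)" k]] u(1) by(simp add: w_def)
 have "(\<Sum>k\<le>n. cpow ?P (xta n) (n - k) * pull ?P (pjP n) ?B (kap ?B (w k))) =
  cpow ?P (xta n) n * pull ?P (pjP n) ?B (one_at ?B) + (\<Sum>k\<in>{1..n}. cpow ?P (xta n) (n - k) * pull ?P (pjP n) ?B (cls ?B (?u (n - k))))"
 proof -
  have "{..n} = insert 0 {1..n}" by auto
  thus ?thesis using kw by(simp add: w_def[of 0] kap_one)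
 qed
 also have "(\<Sum>k\<in>{1..n}. cpow ?P (xta n) (n - k) * pull ?P (pjP n) ?B (cls ?B (?u (n - k)))) = (\<Sum>i<n. cpow ?P (xta n) i * pull ?P (pjP n) ?B (cls ?B (?u i)))"
  by(rule sum.reindex_bij_witness[of _ "%i. n - i" "%k. n - k"]) auto
 also have "cpow ?P (xta n) n * pull ?P (pjP n) ?B (one_at ?B) = cpow ?P (xta n) n"
  using one_at_mult[OF cpow_in] by(simp add: pull_one_at[OF cont_pjP] mult.commute)
 finally have "(\<Sum>k\<le>n. cpow ?P (xta n) (n - k) * pull ?P (pjP n) ?B (kap ?B (w k))) = 0" by(simp flip: lcls)
 hence "(\<Oplus>\<^bsub>HRg ?P\<^esub>k\<in>{..n}. cohomology_map ?P (pjP n) (w k) \<otimes>\<^bsub>HRg ?P\<^esub> line_bundle_class (Taut n) [^]\<^bsub>HRg ?P\<^esub> (n - k)) = \<zero>\<^bsub>HRg ?P\<^esub>"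
  using R(2) kap_inj[OF R(1) RP.zero_closed] by(simp add: kap_zero)
 hence "sw_classes n (\<xi>_plane n) w" unfolding sw_classes_def Let_def using wg by(simp add: w_def)
 thus ?thesis by(rule exI[of _ w])
qed

lemma sw_classes_relation:
 assumes "sw_classes n (\<xi>_plane n) w"
 defines "wc == %k. kap (Bp n) (w k)"
 shows "w k : carrier (HRg (Bp n))" "wc k : cohs (Bp n)" "wc 0 = one_at (Bp n)" "n < k ==> wc k = 0"
  "(\<Sum>k\<le>n. cpow (Proj n) (xta n) (n - k) * pull (Proj n) (pjP n) (Bp n) (wc k)) = 0"
proof -
 have c: "ALL k. w k : carrier (HRg (Bp n))" using assms by(auto simp: sw_classes_def Let_def cohomology_group_def)
 thus "w k : carrier (HRg (Bp n))" "wc k : cohs (Bp n)" unfolding wc_def by(simp_all add: kap_in)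
 show "wc 0 = one_at (Bp n)" "n < k ==> wc k = 0" using assms(1) by(simp_all add: sw_classes_def Let_def wc_def kap_one kap_zero)
 show "(\<Sum>k\<le>n. cpow (Proj n) (xta n) (n - k) * pull (Proj n) (pjP n) (Bp n) (wc k)) = 0"
  unfolding wc_def sw_relation_kap(2)[OF c, symmetric] using assms(1) by(simp add: sw_classes_def Let_def kap_zero)
qed

text \<open>Both families start with the unit, so the difference of the two relations involves only
  powers below \<open>n\<close>, which are independent.\<close>

lemma sw_classes_unique:
 assumes "sw_classes n (\<xi>_plane n) w" "sw_classes n (\<xi>_plane n) w'" shows "w = w'"
proof
 fix k
 let ?B = "Bp n" and ?P = "Proj n"
 note W = sw_classes_relation[OF assms(1)] and W' = sw_classes_relation[OF assms(2)]
 let ?d = "%k. kap ?B (w k) + kap ?B (w' k)"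
 have d0: "?d 0 = 0" using W(3) W'(3) by simp
 have "(\<Sum>k\<le>n. cpow ?P (xta n) (n - k) * pull ?P (pjP n) ?B (?d k)) = 0"
  using W(5) W'(5) by(simp add: pull_add distrib_left sum.distrib)
 moreover have "{..n} = insert 0 {1..n}" by auto
 ultimately have "(\<Sum>k\<in>{1..n}. cpow ?P (xta n) (n - k) * pull ?P (pjP n) ?B (?d k)) = 0" using d0 by simp
 also have "(\<Sum>k\<in>{1..n}. cpow ?P (xta n) (n - k) * pull ?P (pjP n) ?B (?d k)) = (\<Sum>i<n. cpow ?P (xta n) i * pull ?P (pjP n) ?B (?d (n - i)))"
  by(rule sum.reindex_bij_witness[of _ "%i. n - i" "%k. n - k"]) auto
 finally have "?d (n - i) = 0" if "i < n" for i
  using free_over_indep[OF free_over_Proj, of n "%i. ?d (n - i)" i] W(2) W'(2) that by simp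
 from this[of "n - k"] have "?d k = 0" using d0 W(4)[of k] W'(4)[of k] by(cases "k = 0"; cases "k <= n") auto
 thus "w k = w' k" using kap_inj[OF W(1) W'(1)] by(simp add: coh_add_eq_0)
qed

definition wc :: "nat => nat => (real^2) set coh" where
 "wc n k = kap (Bp n) (sw_class n (\<xi>_plane n) k)"

lemma sw_classes_sw_class: "sw_classes n (\<xi>_plane n) (sw_class n (\<xi>_plane n))"
proof -
 have "EX! w. sw_classes n (\<xi>_plane n) w" using ex_sw_classes sw_classes_unique by blast
 thus ?thesis unfolding sw_class_def by(rule theI')
qed

lemmas wc = sw_classes_relation[OF sw_classes_sw_class, folded wc_def]

lemma wc_product:
 assumes "foldr (\<otimes>\<^bsub>HRg (Bp n)\<^esub>) (map (%i. sw_class n (\<xi>_plane n) (f i)) is) \<one>\<^bsub>HRg (Bp n)\<^esub> ~= \<zero>\<^bsub>HRg (Bp n)\<^esub>"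
 shows "one_at (Bp n) * prod_list (map (%i. wc n (f i)) is) ~= 0"
proof -
 interpret R: ring "HRg (Bp n)" by(rule ring_cohomology_ring)
 let ?F = "%is. foldr (\<otimes>\<^bsub>HRg (Bp n)\<^esub>) (map (%i. sw_class n (\<xi>_plane n) (f i)) is) \<one>\<^bsub>HRg (Bp n)\<^esub>"
 have F: "?F is : carrier (HRg (Bp n)) & kap (Bp n) (?F is) = one_at (Bp n) * prod_list (map (%i. wc n (f i)) is)" for "is"
  by(induction "is") (simp_all add: kap_one kap_mult wc(1) wc_def mult.left_commute)
 show ?thesis
 proof
  assume "one_at (Bp n) * prod_list (map (%i. wc n (f i)) is) = 0"
  hence "kap (Bp n) (?F is) = kap (Bp n) \<zero>\<^bsub>HRg (Bp n)\<^esub>" using F[of "is"] by(simp only: kap_zero)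
  from kap_inj[OF conjunct1[OF F] R.zero_closed this] show False using assms by simp
 qed
qed

section \<open>Squares of Stiefel--Whitney classes vanish\<close>

text \<open>In characteristic two the orbits of length two cancel.\<close>

lemma sum_involution:
 fixes f :: "'i => 'a coh"
 assumes "finite A" "!!x. x : A ==> ta x : A" "!!x. x : A ==> ta (ta x) = x" "!!x. x : A ==> f (ta x) = f x"
  "!!x. x : A ==> ta x = x ==> f x = 0"
 shows "sum f A = 0"
 using assms
proof (induction A rule: finite_psubset_induct)
 case (psubset A)
 show ?case
 proof (cases "A = {}")
  case False
  then obtain x where x: "x : A" by blast
  have fA: "finite A" using psubset.hyps by simp
  let ?A = "A - {x, ta x}"
  have cl: "ta y : ?A" if "y : ?A" for y using that psubset.prems(1,2) x by(metis Diff_iff insert_iff empty_iff)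
  have "sum f ?A = 0"
   by(rule psubset.IH) (use x cl psubset.prems in auto)
  moreover have "sum f {x, ta x} = 0" using psubset.prems(3,4)[OF x] by(cases "ta x = x") auto
  moreover have "sum f A = sum f ?A + sum f {x, ta x}" using fA x psubset.prems(1) by(intro sum.subset_diff) auto
  ultimately show ?thesis by simp
 qed simp
qed

lemma sum_square: "finite K ==> (\<Sum>k\<in>K. f k) * (\<Sum>k\<in>K. f k) = (\<Sum>k\<in>K. f k * f k)" for f :: "'i => 'a coh"
proof (induction K rule: finite_induct)
 case (insert k K)
 have "(f k + sum f K) * (f k + sum f K) = f k * f k + (f k * sum f K + f k * sum f K) + sum f K * sum f K"
  by(simp only: distrib_left distrib_right ac_simps)
 thus ?case using insert by simp
qed simp

lemma cpow_mult: "cpow X a i * cpow X a j = cpow X a (i + j)"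
proof -
 have "cpow X a i * cpow X a j = (one_at X * one_at X) * a ^ (i + j)"
  by(simp only: cpow_def power_add ac_simps)
 thus ?thesis by(simp add: one_at_mult cpow_def)
qed

abbreviation "tz n == cls (Zn n) (taut (Bp n) (espace n) (2 * n))"

lemma relation_Z: "(\<Sum>k\<le>n. cpow (Zn n) (tz n) (n - k) * pull (Zn n) fst (Bp n) (wc n k)) = 0"
proof -
 have "pull (Zn n) (from_Z n) (Proj n) (pull (Proj n) (pjP n) (Bp n) (wc n k)) = pull (Zn n) fst (Bp n) (wc n k)" for k
 proof -
  have "(pjP n o from_Z n) z = fst z" if "z : topspace (Zn n)" for z
  proof -
   have "from_Z n z : topspace (Proj n)" using cont_from_Z that by(auto simp: cm_def Pi_iff)
   thus ?thesis using to_from_Z[OF that] by(simp add: projectivization_proj_to_Z)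
  qed
  from pull_cong[OF cm_comp[OF cont_from_Z cont_pjP] this wc(2)]
  show ?thesis unfolding pull_pull[OF cont_from_Z cont_pjP wc(2)] .
 qed
 thus ?thesis
  using arg_cong[OF wc(5)[of n], of "pull (Zn n) (from_Z n) (Proj n)"]
  by(simp add: pull_sum pull_mult pull_cpow[OF cont_from_Z] pull_tau)
qed

lemma relation_pull:
 assumes f: "cmap X (Zn n) f"
 shows "(\<Sum>k\<le>n. cpow X (pull X f (Zn n) (tz n)) (n - k) * pull X (fst o f) (Bp n) (wc n k)) = 0"
 using arg_cong[OF relation_Z[of n], of "pull X f (Zn n)"] pull_pull[OF f cont_pbun_fst wc(2)]
 by(simp add: pull_sum pull_mult pull_cpow[OF f])

text \<open>\<open>c p\<close> is a linear form on the trivial bundle for each point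
  \<open>p\<close>. Its values at the points of a configuration, followed by interpolation, define a
  bundle map \<open>A\<close> into \<open>espace n\<close>; where it is nonzero it induces
  \<open>f\<close> from \<open>W\<close> to \<open>Zn n\<close>, which pulls the tautological class
  back to the class of the trivial bundle. Hence the relation of \<open>Zn n\<close> holds on
  \<open>W\<close>.\<close>

lemma relation_on_open:
 fixes c :: "real^2 => nat => real" and n :: nat
 defines "Q == ptop (Bp n) (RP (2 * n))"
 defines "p == \<Sum>k\<le>n. cpow Q (cls Q (RP_class (Bp n) (2 * n))) (n - k) * pull Q fst (Bp n) (wc n k)"
 assumes c: "!!k a. k < n ==> cmap (Y_plane n) eur (%x. c (x k) a)"
  and W: "openin Q W" "!!z v. z : W ==> snd z = outer v ==> EX p:fst z. (\<Sum>a<2*n. c p a * v a) ~= 0"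
 shows "restr Q W p = 0"
proof -
 let ?X = "subt Q W"
 define A where "A S i a = (\<Sum>p\<in>S. lagc S p i * c p a)" for S i a
 have cA: "cmap (Bp n) eur (%S. A S i a)" for i a
 proof -
  have "cmap (subt (Bp n) (topspace (Bp n))) eur (%S. A S i a)" unfolding A_def
   by(intro cont_config_sum openin_topspace cm_mult cm_sub cont_lagc c)
  thus ?thesis by simp
 qed
 have Av: "(\<Sum>a<2*n. A S i a * v a) = lag n S (%p. \<Sum>a<2*n. c p a * v a) i" if "i < 2 * n" for S i v
 proof -
  have "(\<Sum>a<2*n. A S i a * v a) = (\<Sum>p\<in>S. \<Sum>a<2*n. lagc S p i * (c p a * v a))"
   unfolding A_def by(subst sum.swap) (simp add: sdr mult.assoc)
  thus ?thesis using that by(simp add: lag_def sdl)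
 qed
 have cz: "cmap ?X eur (%z. A (fst z) i a)" for i a
  using cm_comp[OF cm_sub[OF cm_fst] cA] unfolding Q_def by(simp add: o_def)
 have cs: "cmap ?X (RP (2 * n)) snd" unfolding Q_def by(intro cm_sub cm_snd)
 have nz: "EX i<2*n. (\<Sum>a<2*n. A (fst z) i a * v a) ~= 0" if z: "z : topspace ?X" "snd z = outer v" for z v
 proof (rule ccontr)
  assume neg: "~ ?thesis"
  let ?g = "%p. \<Sum>a<2*n. c p a * v a"
  obtain p where p: "p : fst z" "?g p ~= 0" using W(2)[of z v] z by auto
  have S: "finite (fst z)" "card (fst z) = n" using z(1) B_card[of "fst z" n] by(auto simp: Q_def)
  have "lag n (fst z) ?g i = 0" for i using neg Av[of i "fst z" v] by(cases "i < 2 * n") (auto simp: lag_def)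
  hence "fval n (lag n (fst z) ?g) p = 0" by(simp add: fval_def) (intro sum.neutral ballI, simp add: complex_eq_iff)
  thus False using fval_lag[OF S p(1), of ?g] p(2) by(metis of_real_eq_0_iff)
 qed
 define f where "f z = (fst z, conj_proj (2 * n) (2 * n) (A (fst z)) (snd z))" for z
 have fz: "EX d>0. EX w:espace n (fst z) Int sph (2 * n). snd (f z) = outer w & (ALL i<2*n. w i = d * (\<Sum>a<2*n. A (fst z) i a * v a))"
  if z: "z : topspace ?X" "snd z = outer v" for z v
 proof -
  have S: "finite (fst z)" "card (fst z) = n" using z(1) B_card[of "fst z" n] by(auto simp: Q_def)
  obtain d where d: "d > 0" "conj_proj (2 * n) (2 * n) (A (fst z)) (outer v) = outer (%i. d * (if i < 2 * n then \<Sum>a<2*n. A (fst z) i a * v a else 0))"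
   "(%i. d * (if i < 2 * n then \<Sum>a<2*n. A (fst z) i a * v a else 0)) : sph (2 * n)"
   by(rule conj_proj_outer[OF nz[OF z]])
  have "(%i. if i < 2 * n then \<Sum>a<2*n. A (fst z) i a * v a else 0) = lag n (fst z) (%p. \<Sum>a<2*n. c p a * v a)"
   by(auto simp: fun_eq_iff Av) (simp add: lag_def)
  hence "(%i. d * (if i < 2 * n then \<Sum>a<2*n. A (fst z) i a * v a else 0)) : espace n (fst z)"
   using espace_scale[OF lag_espace[OF S], of d] by(simp add: fun_eq_iff)
  thus ?thesis using d z(2)
   by(intro exI[of _ d] conjI bexI[of _ "%i. d * (if i < 2 * n then \<Sum>a<2*n. A (fst z) i a * v a else 0)"]) (simp_all add: f_def)
 qed
 have cf: "cmap ?X (Zn n) f"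
  unfolding cmap_into_pbun
 proof (intro conjI ballI)
  show "cmap ?X (Bp n) (fst o f)"
   using cm_sub[OF cm_fst, of "Bp n" "RP (2 * n)" W] by(simp add: f_def o_def Q_def)
  show "cmap ?X (RP (2 * n)) (snd o f)"
   unfolding f_def o_def snd_conv by(rule cont_conj_proj[OF cs cz]) (rule nz)
  fix z assume z: "z : topspace ?X"
  then obtain v where "snd z = outer v" by(auto simp: Q_def)
  from fz[OF z this] obtain w where w: "w : espace n (fst z) Int sph (2 * n)" "snd (f z) = outer w" by(elim exE conjE bexE) (rule that)
  have "fst (f z) = fst z" by(simp add: f_def)
  thus "snd (f z) : outer ` (espace n (fst (f z)) Int sph (2 * n))" using imageI[OF w(1), of outer] by(simp only: w(2))
 qed
 have lf: "line_field (2 * n) ?X (vsel o snd)" unfolding Q_def by(rule line_field_sub[OF line_field_prod_RP])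
 have lf': "line_field (2 * n) ?X ((vsel o snd) o f)" by(rule line_field_compose[OF line_field_pbun cf])
 have "exact ?X (chi ?X (vsel o snd) + chi ?X ((vsel o snd) o f))"
 proof (rule chi_linear_map[OF lf lf', where A="%z. A (fst z)"])
  fix z assume z: "z : topspace ?X"
  then obtain v0 where v0: "snd z = outer v0" "v0 : sph (2 * n)" by(auto simp: Q_def)
  let ?v = "vsel (snd z)"
  have ov: "snd z = outer ?v" unfolding v0(1) vsel_outer using outer_sgn[OF lead_nonzero[OF v0(2)]] by simp
  obtain d w where d0: "d > 0" "w : espace n (fst z) Int sph (2 * n)" "snd (f z) = outer w" "ALL i<2*n. w i = d * (\<Sum>a<2*n. A (fst z) i a * ?v a)"
   using fz[OF z ov] by(elim exE conjE bexE) (rule that)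
  note d = d0(1) IntD2[OF d0(2)] d0(3,4)
  have l: "lead w ~= 0" "sgn (lead w) * sgn (lead w) = 1" using lead_nonzero[OF d(2)] by(simp_all add: sgn_if)
  have "(\<Sum>a<2*n. A (fst z) i a * ?v a) = sgn (lead w) / d * vsel (snd (f z)) i" if "i < 2 * n" for i
  proof -
   have "sgn (lead w) / d * vsel (snd (f z)) i = (sgn (lead w) * sgn (lead w)) * w i / d" by(simp add: d(3) vsel_outer)
   thus ?thesis using d(1,4) that l(2) by simp
  qed
  thus "EX c~=0. ALL i<2*n. (\<Sum>a<2*n. A (fst z) i a * (vsel o snd) z a) = c * ((vsel o snd) o f) z i"
   using l(1) d(1) by(intro exI[of _ "sgn (lead w) / d"]) (simp add: sgn_0_0)
 qed (rule cz)
 hence e: "cls ?X (chi ?X (vsel o snd)) = cls ?X (chi ?X ((vsel o snd) o f))"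
  unfolding cls_eq_iff[OF cyc_chi[OF lf] cyc_chi[OF lf']] .
 have pf: "pull ?X f (Zn n) (tz n) = cls ?X (chi ?X ((vsel o snd) o f))"
  unfolding pull_cls[OF cf cyc_taut] pb_chi[OF cf] ..
 have r: "restr Q W (cls Q (RP_class (Bp n) (2 * n))) = cls ?X (chi ?X (vsel o snd))"
  unfolding Q_def restr_cls[OF cyc_RP_class]
  using cls_cch_on[OF cyc_sub[OF cyc_RP_class], of "Bp n" "2 * n" W] unfolding cch_on_chi_sub by simp
 have id: "cmap ?X Q (%x. x)" by(rule cmap_sub_id)
 have pw: "restr Q W (pull Q fst (Bp n) (wc n k)) = pull ?X (fst o f) (Bp n) (wc n k)" for k
 proof -
  have "fst o f = fst" by(simp add: f_def fun_eq_iff)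
  thus ?thesis using pull_restr[OF cm_fst wc(2)] by(simp add: Q_def)
 qed
 show ?thesis
  using relation_pull[OF cf] unfolding pf e[symmetric] r[symmetric] p_def
  by(simp only: pull_sum pull_mult pull_cpow[OF id] pw)
qed

lemma wc_square: assumes "0 < k" shows "wc n k * wc n k = 0"
proof (cases "k <= n")
 case k: True
 let ?Q = "ptop (Bp n) (RP (2 * n))"
 let ?y = "cls ?Q (RP_class (Bp n) (2 * n))" and ?pl = "pull ?Q fst (Bp n)"
 let ?p = "\<Sum>k\<le>n. cpow ?Q ?y (n - k) * ?pl (wc n k)"
 have fB: "cmap ?Q (Bp n) fst" by(rule cm_fst)
 \<comment> \<open>The sum of the squares of the forms on a unit vector of the line, written in
   entries of the projection to make it continuous.\<close>
 define G where "G c z = (\<Sum>p\<in>fst z. \<Sum>a<2*n. \<Sum>b<2*n. c p a * c p b * snd z (a, b))" for c :: "real^2 => nat => real" and z :: "(real^2) set \<times> (nat \<times> nat => real)"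
 have Gv: "G c z = (\<Sum>p\<in>fst z. (\<Sum>a<2*n. c p a * v a)\<^sup>2)" if "snd z = outer v" for c z v
  unfolding G_def that by(intro sum.cong refl) (simp add: p2_eq sum_product ac_simps)
 define W where "W c = {z : topspace ?Q. G c z ~= 0}" for c
 have oW: "openin ?Q (W c)" if c: "!!k a. k < n ==> cmap (Y_plane n) eur (%x. c (x k) a)" for c
  unfolding W_def
 proof (rule openin_coord_nonzero)
  have "cmap (subt (Bp n) (topspace (Bp n))) eur (%S. \<Sum>p\<in>S. c p a * c p b)" for a b
   by(intro cont_config_sum openin_topspace cm_mult cm_sub c)
  from cm_comp[OF fB this[unfolded subtopology_topspace]]
  have "cmap ?Q eur (%z. \<Sum>a<2*n. \<Sum>b<2*n. (\<Sum>p\<in>fst z. c p a * c p b) * snd z (a, b))"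
   by(intro cm_sum cm_mult cmap_prod_RP_coord) (simp_all add: o_def)
  thus "cmap ?Q eur (G c)"
  proof (rule cm_eq)
   fix z
   show "(\<Sum>a<2*n. \<Sum>b<2*n. (\<Sum>p\<in>fst z. c p a * c p b) * snd z (a, b)) = G c z"
    unfolding G_def sdr by(subst (2) sum.swap, subst sum.swap) (simp only: sum.swap[of _ "fst z"])
  qed
 qed
 have nW: "EX p:fst z. (\<Sum>a<2*n. c p a * v a) ~= 0" if "z : W c" "snd z = outer v" for c z v
 proof (rule ccontr)
  assume "~ ?thesis"
  hence "G c z = 0" unfolding Gv[OF that(2)] by(intro sum.neutral) auto
  thus False using that(1) by(simp add: W_def)
 qed
 have sq: "0 = one_at ?Q * prod_list (map (%_. ?p) [rec, imc])"
 proof (rule cup_length_classes[symmetric, where U=W])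
  show "?p : cohs ?Q" by(intro cohs_sum cohs_mult cpow_in pull_in[OF fB wc(2)])
  show "openin ?Q (W c)" if "c : set [rec, imc]" for c using that oW[of rec] oW[of imc] cont_rec continuous_imc by auto
  show "restr ?Q (W c) ?p = 0" if "c : set [rec, imc]" for c
   using that relation_on_open[of n rec "W rec", OF cont_rec] relation_on_open[of n imc "W imc", OF continuous_imc]
    oW[of rec] oW[of imc] cont_rec continuous_imc nW by auto
  show "topspace ?Q <= (\<Union>c\<in>set [rec, imc]. W c)"
  proof
   fix z assume z: "z : topspace ?Q"
   then obtain v where v: "snd z = outer v" "v : sph (2 * n)" by auto
   have S: "finite (fst z)" "card (fst z) = n" using z B_card[of "fst z" n] by auto
   obtain a where a: "v a ~= 0" using v(2) by(rule sph_nonzero)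
   \<comment> \<open>A nonzero polynomial of degree below \<open>n\<close> is nonzero at one of the
     \<open>n\<close> points, so its real or imaginary part is.\<close>
   obtain p where p: "p : fst z" "fval n v p ~= 0"
    using fval_zero[OF S, of v a] a v(2) by(auto simp: sph_def)
   hence "(\<Sum>a<2*n. rec p a * v a) ~= 0 \<or> (\<Sum>a<2*n. imc p a * v a) ~= 0" by(simp add: re_fval im_fval complex_eq_iff)
   moreover have "G c z ~= 0" if "(\<Sum>a<2*n. c p a * v a) ~= 0" for c
    unfolding Gv[OF v(1)] using sum_pos2[OF S(1) p(1), of "%p. (\<Sum>a<2*n. c p a * v a)\<^sup>2"] that by simp
   ultimately show "z : (\<Union>c\<in>set [rec, imc]. W c)" using z by(auto simp: W_def)
  qed
 qed
 have pc: "?p : cohs ?Q" by(intro cohs_sum cohs_mult cpow_in pull_in[OF fB wc(2)])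
 have "?p * ?p = 0" using sq pc by(simp add: one_at_mult)
 have 0: "(\<Sum>k\<le>n. cpow ?Q ?y (2 * (n - k)) * ?pl (wc n k * wc n k)) = 0"
 proof -
  have "cpow ?Q ?y (n - k) * ?pl (wc n k) * (cpow ?Q ?y (n - k) * ?pl (wc n k)) =
    (cpow ?Q ?y (n - k) * cpow ?Q ?y (n - k)) * ?pl (wc n k * wc n k)" for k
   by(simp only: pull_mult ac_simps)
  hence "cpow ?Q ?y (n - k) * ?pl (wc n k) * (cpow ?Q ?y (n - k) * ?pl (wc n k)) =
    cpow ?Q ?y (2 * (n - k)) * ?pl (wc n k * wc n k)" for k
   by(simp only: cpow_mult mult_2)
  thus ?thesis using \<open>?p * ?p = 0\<close> unfolding sum_square[OF finite_atMost] by simp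
 qed
 have top: "cpow ?Q ?y (2 * n) = 0"
 proof -
  obtain m where m: "2 * n = Suc m" using k assms by(cases "2 * n") auto
  obtain al where "cch_power ?Q (RP_class (Bp n) (2 * n)) (2 * n) = dl ?Q al"
   using RP_power_exact[of "Bp n" m] unfolding m[symmetric] .
  hence "exact ?Q (cch_power ?Q (RP_class (Bp n) (2 * n)) (2 * n))" by simp
  thus ?thesis
   unfolding cls_cch_power[OF cyc_RP_class, symmetric] cls_eq_0_iff[OF cyc_cch_power[OF cyc_RP_class]] .
 qed
 \<comment> \<open>The coefficients of the squared relation in the basis of powers below
   \<open>2 * n\<close>; the summand \<open>k = 0\<close> is killed by \<open>top\<close>.\<close>
 define u where "u i = (if even i then wc n (n - i div 2) * wc n (n - i div 2) else 0)" for i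
 have "(\<Sum>i<2 * n. cpow ?Q ?y i * ?pl (u i)) = (\<Sum>j<n. cpow ?Q ?y (2 * j) * ?pl (u (2 * j)))"
 proof -
  have "(\<Sum>i<2 * m. cpow ?Q ?y i * ?pl (u i)) = (\<Sum>j<m. cpow ?Q ?y (2 * j) * ?pl (u (2 * j)))" for m
   by(induction m) (simp_all add: u_def)
  thus ?thesis .
 qed
 also have "... = (\<Sum>k\<in>{1..n}. cpow ?Q ?y (2 * (n - k)) * ?pl (wc n k * wc n k))"
  by(rule sum.reindex_bij_witness[of _ "%k. n - k" "%j. n - j"]) (auto simp: u_def)
 also have "... = (\<Sum>k\<le>n. cpow ?Q ?y (2 * (n - k)) * ?pl (wc n k * wc n k))"
 proof -
  have "{..n} = insert 0 {1..n}" by auto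
  thus ?thesis using top by simp
 qed
 finally have "u i = 0" if "i < 2 * n" for i
  using free_over_indep[OF free_over_RP[of "Bp n" "2 * n"], of u i] that 0 wc(2) by(simp add: u_def)
 from this[of "2 * (n - k)"] show ?thesis using k assms by(simp add: u_def)
qed (use wc(4) in simp)

text \<open>The total class squares to 1: the summands \<open>j\<close> and \<open>m - j\<close>
  cancel, and a middle one is a square.\<close>

lemma wc_convolution: assumes "0 < m" shows "(\<Sum>j\<le>m. wc n j * wc n (m - j)) = 0"
proof (rule sum_involution[where ta="%j. m - j"])
 fix j assume "j : {..m}" "m - j = j"
 thus "wc n j * wc n (m - j) = 0" using wc_square[of j n] assms by(cases "j = 0") auto
qed (auto simp: mult.commute)

text \<open>The relation is multiplied by the truncated sum of
  \<open>wc n j * x ^ (k - 1 - j)\<close> over \<open>j < k\<close>. By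
  \<open>wc_convolution\<close> the coefficients \<open>s m\<close> vanish for
  \<open>0 < m < k\<close>, which leaves \<open>x ^ (n - 1 + k)\<close> plus powers below
  \<open>n\<close>, and \<open>s k = wc n k\<close> is the coefficient of
  \<open>x ^ (n - 1)\<close>.\<close>

lemma top_power:
 assumes f: "cmap X (Zn n) f" and n: "0 < n"
 obtains c where "!!i. i < n ==> c i : cohs (Bp n)" "c (n - 1) = wc n k"
  "cpow X (pull X f (Zn n) (tz n)) (n - 1 + k) = (\<Sum>i<n. cpow X (pull X f (Zn n) (tz n)) i * pull X (fst o f) (Bp n) (c i))"
proof -
 let ?a = "cpow X (pull X f (Zn n) (tz n))" and ?p = "pull X (fst o f) (Bp n)"
 have cf: "cmap X (Bp n) (fst o f)" by(rule cm_comp[OF f cont_pbun_fst])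
 define s where "s m = (\<Sum>j<k. if j <= m then wc n j * wc n (m - j) else 0)" for m
 have a1: "?a i * one_at X = ?a i" for i by(metis mult.commute one_at_mult cpow_in)
 have s_in: "s m : cohs (Bp n)" for m unfolding s_def by(intro cohs_sum) (simp add: wc(2))
 show thesis
 proof (cases "k = 0")
  case True
  have "?a (n - 1) = (\<Sum>i<n. if i = n - 1 then ?a (n - 1) else 0)" using n by simp
  also have "... = (\<Sum>i<n. ?a i * ?p (if i = n - 1 then wc n 0 else 0))"
   using a1 by(intro sum.cong refl) (simp add: wc(3) pull_one_at[OF cf])
  finally show thesis using True n wc(2)[of n 0] by(intro that[of "%i. if i = n - 1 then wc n 0 else 0"]) auto
 next
  case k: False
  have s0: "s 0 = one_at (Bp n)"
  proof -
   have "s 0 = (\<Sum>j\<in>{0}. wc n j * wc n (0 - j))" unfolding s_def using k by(intro sum.mono_neutral_cong_right) auto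
   thus ?thesis by(simp add: wc(3) one_at_mult)
  qed
  have sm: "s m = (\<Sum>j\<in>{..m} - {j. k <= j}. wc n j * wc n (m - j))" for m
   unfolding s_def by(rule sum.mono_neutral_cong_right) auto
  have s_mid: "s m = 0" if "0 < m" "m < k" for m
  proof -
   have "{..m} - {j. k <= j} = {..m}" using that by auto
   thus ?thesis using wc_convolution[OF that(1)] by(simp add: sm)
  qed
  have s_k: "s k = wc n k"
  proof -
   have "{..k} = insert k ({..k} - {j. k <= j})" by auto
   hence "(\<Sum>j\<le>k. wc n j * wc n (k - j)) = wc n k * wc n 0 + s k" by(subst sm) (metis (no_types, lifting) Diff_iff diff_self_eq_0 finite_atMost finite_Diff mem_Collect_eq order_refl sum.insert)
   hence "wc n k * wc n 0 + s k = 0" using wc_convolution[of k n] k by simp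
   thus ?thesis using one_at_mult[OF wc(2), of n k] by(simp add: coh_add_eq_0 wc(3) mult.commute)
  qed
  have "0 = (\<Sum>j<k. ?p (wc n j) * ?a (k - 1 - j)) * (\<Sum>i\<le>n. ?a (n - i) * ?p (wc n i))" by(simp add: relation_pull[OF f])
  also have "... = (\<Sum>j<k. \<Sum>i\<le>n. ?p (wc n j * wc n i) * ?a (n + k - 1 - (j + i)))"
  proof -
   have "?p (wc n j) * ?a (k - 1 - j) * (?a (n - i) * ?p (wc n i)) = ?p (wc n j * wc n i) * ?a (n + k - 1 - (j + i))" if "j < k" "i <= n" for j i
   proof -
    have "k - 1 - j + (n - i) = n + k - 1 - (j + i)" using that by simp
    thus ?thesis using cpow_mult[of X _ "k - 1 - j" "n - i"] by(simp add: pull_mult ac_simps)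
   qed
   thus ?thesis by(simp add: sum_product)
  qed
  also have "... = (\<Sum>j<k. \<Sum>m<n + k. ?p (if j <= m then wc n j * wc n (m - j) else 0) * ?a (n + k - 1 - m))"
  proof (rule sum.cong[OF refl])
   fix j assume j: "j : {..<k}"
   have "(\<Sum>m<n + k. ?p (if j <= m then wc n j * wc n (m - j) else 0) * ?a (n + k - 1 - m)) =
     (\<Sum>m\<in>{j..j + n}. ?p (wc n j * wc n (m - j)) * ?a (n + k - 1 - m))"
    using j by(intro sum.mono_neutral_cong_right) (auto simp: wc(4))
   also have "... = (\<Sum>i\<le>n. ?p (wc n j * wc n i) * ?a (n + k - 1 - (j + i)))"
    by(rule sum.reindex_bij_witness[of _ "%i. j + i" "%m. m - j"]) auto
   finally show "(\<Sum>i\<le>n. ?p (wc n j * wc n i) * ?a (n + k - 1 - (j + i))) = (\<Sum>m<n + k. ?p (if j <= m then wc n j * wc n (m - j) else 0) * ?a (n + k - 1 - m))" by(rule sym)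
  qed
  also have "... = (\<Sum>m<n + k. ?p (s m) * ?a (n + k - 1 - m))"
   by(subst sum.swap) (simp add: s_def pull_sum sdr)
  also have "... = (\<Sum>i<n + k. ?a i * ?p (s (n + k - 1 - i)))"
   by(rule sum.reindex_bij_witness[of _ "%i. n + k - 1 - i" "%i. n + k - 1 - i"]) (auto simp: mult.commute)
  also have "... = (\<Sum>i<n. ?a i * ?p (s (n + k - 1 - i))) + (\<Sum>i\<in>{n..<n + k}. ?a i * ?p (s (n + k - 1 - i)))"
   by(subst sum.union_disjoint[symmetric]) (auto simp: ivl_disj_un)
  also have "(\<Sum>i\<in>{n..<n + k}. ?a i * ?p (s (n + k - 1 - i))) = (\<Sum>i\<in>{n + k - 1}. ?a i * ?p (s (n + k - 1 - i)))"
  proof (intro sum.mono_neutral_right ballI)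
   fix i assume "i : {n..<n + k} - {n + k - 1}"
   hence "s (n + k - 1 - i) = 0" by(intro s_mid) auto
   thus "?a i * ?p (s (n + k - 1 - i)) = 0" by simp
  qed (use k in auto)
  also have "... = ?a (n + k - 1)" using s0 a1 by(simp add: pull_one_at[OF cf])
  finally have "0 = (\<Sum>i<n. ?a i * ?p (s (n + k - 1 - i))) + ?a (n + k - 1)" .
  from iffD1[OF coh_add_eq_0 sym[OF this]] have "?a (n + k - 1) = (\<Sum>i<n. ?a i * ?p (s (n + k - 1 - i)))" by(rule sym)
  moreover have "n - 1 + k = n + k - 1" using n by simp
  ultimately have "?a (n - 1 + k) = (\<Sum>i<n. ?a i * ?p (s (n + k - 1 - i)))" by(simp only:)
  moreover have "s (n + k - 1 - (n - 1)) = wc n k" using s_k n by simp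
  ultimately show thesis by(intro that[of "%i. s (n + k - 1 - i)"]) (rule s_in)
 qed
qed

section \<open>Fibre powers of the projectivized regular bundle\<close>

text \<open>In characteristic two this is the determinant of the matrix with entries
  \<open>g k i\<close>.\<close>

definition alt :: "nat => (nat => nat => 'a coh) => 'a coh" where
 "alt r g = (\<Sum>si | si permutes {..<r}. \<Prod>k<r. g k (si k))"

text \<open>Each added term is the same sum with two equal columns \<open>t\<close> and
  \<open>m\<close>, and composing with their transposition pairs off its summands.\<close>

lemma alt_add_column:
 assumes "t < r" "!!i. h i = g t i + (\<Sum>m<t. e m * g m i)"
 shows "alt r (g(t := h)) = alt r g"
proof -
 let ?P = "%si. \<Prod>k\<in>{..<r} - {t}. g k (si k)"
 have fin: "finite {si. si permutes {..<r}}" by(simp add: finite_permutations)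
 have z: "(\<Sum>si | si permutes {..<r}. g m (si t) * ?P si) = 0" if m: "m < t" for m
 proof (rule sum_involution[OF fin, where ta="%si. si o Transposition.transpose t m"])
  have mr: "m : {..<r} - {t}" "{..<r} - {t} = insert m ({..<r} - {t, m})" using m assms(1) by auto
  fix si assume si: "si : {si. si permutes {..<r}}"
  show "si o Transposition.transpose t m : {si. si permutes {..<r}}"
   using si m assms(1) by(auto intro!: permutes_compose permutes_swap_id)
  show "si o Transposition.transpose t m o Transposition.transpose t m = si" by(simp add: fun_eq_iff)
  have P: "?P rh = g m (rh m) * (\<Prod>k\<in>{..<r} - {t, m}. g k (rh k))" for rh by(simp add: mr(2))
  have "(\<Prod>k\<in>{..<r} - {t, m}. g k ((si o Transposition.transpose t m) k)) = (\<Prod>k\<in>{..<r} - {t, m}. g k (si k))"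
   by(rule prod.cong) (auto simp: transpose_apply_other)
  thus "g m ((si o Transposition.transpose t m) t) * ?P (si o Transposition.transpose t m) = g m (si t) * ?P si"
   unfolding P by(simp add: ac_simps)
  assume "si o Transposition.transpose t m = si"
  from fun_cong[OF this, of t] have "si m = si t" by simp
  thus "g m (si t) * ?P si = 0" using permutes_inj[of si "{..<r}"] si m by(auto dest: injD)
 qed
 have pr: "(\<Prod>k<r. (g(t := f)) k (si k)) = f (si t) * ?P si" for f si
  using assms(1) by(subst prod.remove[of _ t]) (auto intro!: arg_cong2[of _ _ _ _ times] prod.cong)
 have "alt r (g(t := h)) = (\<Sum>si | si permutes {..<r}. g t (si t) * ?P si) +
   (\<Sum>m<t. e m * (\<Sum>si | si permutes {..<r}. g m (si t) * ?P si))"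
  unfolding alt_def pr assms(2) by(simp add: distrib_right sum.distrib sdl sdr mult.assoc sum.swap[of _ "{..<t}"])
 thus ?thesis using pr[of "g t"] z by(simp add: alt_def)
qed

text \<open>Supplies the column operations for \<open>vandermonde\<close>: the coefficients of the
  lower powers do not depend on \<open>y\<close>, so they are the same in all rows.\<close>

lemma monic_product:
 fixes x :: "nat => 'a coh"
 shows "EX e. ALL y. (\<Prod>i<k. y + x i) = y ^ k + (\<Sum>m<k. e m * y ^ m)"
proof (induction k)
 case (Suc k)
 then obtain e where e: "!!y. (\<Prod>i<k. y + x i) = y ^ k + (\<Sum>m<k. e m * y ^ m)" by auto
 let ?e = "%m. (if m = k then x k else x k * e m) + (if m = 0 then 0 else e (m - 1))"
 have "(\<Prod>i<Suc k. y + x i) = y ^ Suc k + (\<Sum>m<Suc k. ?e m * y ^ m)" for y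
 proof -
  have "(\<Sum>m<Suc k. ?e m * y ^ m) = (\<Sum>m<Suc k. (if m = k then x k else x k * e m) * y ^ m) + (\<Sum>m<Suc k. (if m = 0 then 0 else e (m - 1)) * y ^ m)"
   by(simp only: distrib_right sum.distrib)
  also have "(\<Sum>m<Suc k. (if m = 0 then 0 else e (m - 1)) * y ^ m) = y * (\<Sum>m<k. e m * y ^ m)"
   by(subst sum.lessThan_Suc_shift) (simp add: sdl ac_simps)
  also have "(\<Sum>m<Suc k. (if m = k then x k else x k * e m) * y ^ m) = x k * y ^ k + x k * (\<Sum>m<k. e m * y ^ m)"
   by(simp add: sdl ac_simps)
  finally show ?thesis by(simp add: e algebra_simps)
 qed
 thus ?case by(intro exI[of _ ?e] allI)
qed simp

text \<open>Signs do not matter in characteristic two, so this is Vandermonde's determinant: by column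
operations the monomials become \<open>\<Prod>i<k. y + x i\<close>, for which only the identity contributes.\<close>

lemma vandermonde:
 fixes x :: "nat => 'a coh"
 shows "(\<Sum>si | si permutes {..<r}. \<Prod>k<r. x (si k) ^ k) = (\<Prod>k<r. \<Prod>i<k. x k + x i)"
proof -
 define q where "q k y = (\<Prod>i<k. y + x i)" for k y
 define h where "h t = (%k i. if k < t then x i ^ k else q k (x i))" for t
 have st: "alt r (h t) = alt r (h (Suc t))" if tr: "t < r" for t
 proof -
  obtain e where e: "!!y. q t y = y ^ t + (\<Sum>m<t. e m * y ^ m)" using monic_product[of x t] by(auto simp: q_def)
  have "h t = (h (Suc t))(t := %i. q t (x i))" by(auto simp: h_def fun_eq_iff)
  thus ?thesis using alt_add_column[OF tr, where h="%i. q t (x i)" and g="h (Suc t)" and e=e] by(simp add: h_def e)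
 qed
 have "alt r (h t) = alt r (h 0)" if "t <= r" for t using that by(induction t) (simp_all add: st)
 from this[of r] have "(\<Sum>si | si permutes {..<r}. \<Prod>k<r. x (si k) ^ k) = (\<Sum>si | si permutes {..<r}. \<Prod>k<r. q k (x (si k)))"
  by(simp add: alt_def h_def)
 also have "... = (\<Sum>si\<in>{id}. \<Prod>k<r. q k (x (si k)))"
 proof (rule sum.mono_neutral_right)
  show "ALL si:{si. si permutes {..<r}} - {id}. (\<Prod>k<r. q k (x (si k))) = 0"
  proof
   \<comment> \<open>A permutation with \<open>k <= si k\<close> for all \<open>k\<close> is the
     identity; any other one has some \<open>si k < k\<close>, and then
     \<open>q k (x (si k))\<close> contains the factor \<open>x (si k) + x (si k)\<close>.\<close>
   fix si assume "si : {si. si permutes {..<r}} - {id}"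
   hence "~ (ALL k:{..<r}. k <= si k)" using permutes_natset_ge[of si "{..<r}"] by auto
   then obtain k where k: "k < r" "si k < k" by(auto simp: not_le)
   have "q k (x (si k)) = 0" unfolding q_def using k(2) by(intro prod_zero bexI[of _ "si k"]) (simp_all add: coh_add_eq_0)
   thus "(\<Prod>k<r. q k (x (si k))) = 0" using k(1) by(intro prod_zero) auto
  qed
 qed (auto simp: finite_permutations permutes_id)
 finally show ?thesis by(simp add: q_def)
qed

text \<open>Replacing \<open>si\<close> by its inverse only reindexes the product, so permutations
  that are not involutions cancel in pairs. An involution other than the identity exchanges some
  \<open>j\<close> with \<open>si j\<close>; both contribute the same class, whose square is
  0.\<close>

lemma wc_hankel:
 assumes "0 < c"
 shows "(\<Sum>si | si permutes {..<r}. \<Prod>i<r. wc n (c + i + inv_into UNIV si i)) = (\<Prod>i<r. wc n (c + 2 * i))"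
proof -
 let ?J = "{si. si permutes {..<r}}" and ?f = "%si. \<Prod>i<r. wc n (c + i + inv_into UNIV si i)"
 have fin: "finite ?J" by(simp add: finite_permutations)
 have inv_id: "inv_into UNIV (id :: nat => nat) = id" by(rule Hilbert_Choice.inv_id)
 have "sum ?f (?J - {id}) = 0"
 proof (rule sum_involution[where ta="inv_into UNIV"])
  fix si assume si: "si : ?J - {id}"
  hence p: "si permutes {..<r}" by simp
  show ii: "inv_into UNIV (inv_into UNIV si) = si" by(rule permutes_inv_inv[OF p])
  show "inv_into UNIV si : ?J - {id}" using si permutes_inv[OF p] ii inv_id by auto
  have "?f si = (\<Prod>i<r. wc n (c + si i + inv_into UNIV si (si i)))" by(subst prod.permute[OF p]) (simp add: o_def)
  thus "?f (inv_into UNIV si) = ?f si" by(simp add: ii permutes_inverses(2)[OF p] ac_simps)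
  assume s: "inv_into UNIV si = si"
  obtain j where j: "si j ~= j" using si by(auto simp: fun_eq_iff)
  have jr: "j < r" using j p by(meson lessThan_iff permutes_not_in)
  have sr: "si j < r" using permutes_in_image[OF p, of j] jr by simp
  have sj: "si (si j) = j" using permutes_inverses(2)[OF p, of j] s by simp
  have "{..<r} = insert j (insert (si j) ({..<r} - {j, si j}))" using jr sr by auto
  hence "?f si = wc n (c + j + si j) * (wc n (c + j + si j) * (\<Prod>i\<in>{..<r} - {j, si j}. wc n (c + i + si i)))"
   unfolding s by(rule ssubst[where P="%A. (\<Prod>i\<in>A. wc n (c + i + si i)) = _"]) (use j sj in \<open>simp add: add.assoc add.commute[of "si j"]\<close>)
  thus "?f si = 0" using wc_square[of "c + j + si j" n] assms by(simp flip: mult.assoc)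
 qed (use fin in auto)
 thus ?thesis using sum.remove[OF fin, of id ?f] by(simp add: permutes_id mult_2 add.assoc)
qed

text \<open>The vectors are only determined up to sign, but the square of the form is a polynomial
  in the continuous products of their coordinates, so \<open>W\<close> is open.\<close>

lemma open_nonzero_bilinear:
 assumes v: "line_field d X v" and v': "line_field d' X v'"
  and m: "!!a b. cmap X eur (m a b)"
 defines "W == {x : topspace X. (\<Sum>a<d. \<Sum>b<d'. m a b x * v x a * v' x b) ~= 0}"
 shows "openin X W" "restr X W (cls X (chi X v) + cls X (chi X v')) = 0"
proof -
 have vv: "cmap X eur (%x. v x a * v x b)" "cmap X eur (%x. v' x a * v' x b)" for a b
  using v v' by(simp_all add: line_field_def)
 have "cmap X eur (%x. \<Sum>a<d. \<Sum>c<d. \<Sum>b<d'. \<Sum>e<d'. (m a e x * m c b x) * ((v x a * v x c) * (v' x b * v' x e)))"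
  by(intro cm_sum cm_mult m vv) simp_all
 hence "cmap X eur (%x. (\<Sum>a<d. \<Sum>b<d'. m a b x * v x a * v' x b)\<^sup>2)"
  by(simp add: p2_eq sdl sdr ac_simps)
 from openin_coord_nonzero[OF this] show o: "openin X W" by(simp add: W_def)
 let ?X = "subt X W"
 have l: "line_field d ?X v" "line_field d' ?X v'" by(simp_all add: line_field_sub v v')
 have "chi ?X v + chi ?X v' = dl ?X (pcch (%x. (\<Sum>a<d. \<Sum>b<d'. m a b x * v x a * v' x b) < 0))"
  by(rule chi_bilinear[OF l]) (use m in \<open>auto simp: W_def intro: cm_sub\<close>)
 hence "cls ?X (chi ?X v) = cls ?X (chi ?X v')"
  unfolding cls_eq_iff[OF cyc_chi[OF l(1)] cyc_chi[OF l(2)]] by simp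
 moreover have R: "restr X W (cls X (chi X u)) = cls ?X (chi ?X u)" if "line_field k X u" for k u
  unfolding restr_cls[OF cyc_chi[OF that]]
  using cls_cch_on[OF cyc_sub[OF cyc_chi[OF that]], of W] unfolding cch_on_chi_sub by simp
 ultimately show "restr X W (cls X (chi X v) + cls X (chi X v')) = 0" unfolding pull_add R[OF v] R[OF v'] by simp
qed

lemma open_nonzero_linear:
 assumes v: "line_field d X v" and m: "!!a. cmap X eur (m a)"
 defines "W == {x : topspace X. (\<Sum>a<d. m a x * v x a) ~= 0}"
 shows "openin X W" "restr X W (cls X (chi X v)) = 0"
proof -
 have vv: "cmap X eur (%x. v x a * v x b)" for a b using v by(simp add: line_field_def)
 have "cmap X eur (%x. \<Sum>a<d. \<Sum>b<d. (m a x * m b x) * (v x a * v x b))"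
  by(intro cm_sum cm_mult m vv) simp_all
 hence "cmap X eur (%x. (\<Sum>a<d. m a x * v x a)\<^sup>2)"
  by(simp add: p2_eq sum_product ac_simps)
 from openin_coord_nonzero[OF this] show o: "openin X W" by(simp add: W_def)
 let ?X = "subt X W"
 have l: "line_field d ?X v" using v by(rule line_field_sub)
 have "chi ?X v = dl ?X (pcch (%x. (\<Sum>a<d. m a x * v x a) < 0))"
  by(rule chi_linear[OF l]) (use m in \<open>auto simp: W_def intro: cm_sub\<close>)
 hence "cls ?X (chi ?X v) = 0" unfolding cls_eq_0_iff[OF cyc_chi[OF l]] by simp
 moreover have "restr X W (cls X (chi X v)) = cls ?X (chi ?X v)"
  unfolding restr_cls[OF cyc_chi[OF v]]
  using cls_cch_on[OF cyc_sub[OF cyc_chi[OF v]], of W] unfolding cch_on_chi_sub by simp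
 ultimately show "restr X W (cls X (chi X v)) = 0" by simp
qed

text \<open>The \<open>r\<close>-fold fibre power of \<open>Zn n\<close> over the configuration
  space. Components from \<open>r\<close> on are fixed to 0, so that all fibre powers have the same
  type.\<close>

definition Tw :: "nat => nat => ((real^2) set \<times> (nat => nat \<times> nat => real)) topology" where
 "Tw n r = subt (ptop (Bp n) (product_topology (%_. powertop_real UNIV) UNIV))
  {z. (ALL i<r. snd z i : outer ` (espace n (fst z) Int sph (2*n))) & (ALL i>=r. snd z i = (%_. 0))}"

lemma cmap_into_Tw:
 "cmap X (Tw n r) f \<longleftrightarrow> cmap X (Bp n) (fst o f) &
  (ALL i a b. cmap X eur (%x. snd (f x) i (a, b))) &
  (ALL x:topspace X. (ALL i<r. snd (f x) i : outer ` (espace n (fst (f x)) Int sph (2*n))) & (ALL i>=r. snd (f x) i = (%_. 0)))"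
 unfolding Tw_def cm_into continuous_map_pairwise continuous_map_componentwise_UNIV
 by(simp add: o_def image_subset_iff_funcset[symmetric] image_subset_iff)

lemma cont_Tw:
 shows "cmap (Tw n r) (Bp n) fst" "cmap (Tw n r) eur (%z. snd z i (a, b))"
  and Tw_point: "z : topspace (Tw n r) ==> i < r ==> snd z i : outer ` (espace n (fst z) Int sph (2*n))"
   "z : topspace (Tw n r) ==> r <= i ==> snd z i = (%_. 0)"
 using cmap_into_Tw[of "Tw n r" n r "%z. z"] by(simp_all add: o_def)

abbreviation "pr i == %z. (fst z, snd z i)"
abbreviation "dropc r == %z. (fst z, (snd z)(r := %_. 0))"

lemma cont_pr: "i < r ==> cmap (Tw n r) (Zn n) (pr i)"
 unfolding cmap_into_pbun cmap_into_RP
 using cont_Tw(1,2)[of n r] Tw_point(1)[of _ n r i] by(fastforce simp: o_def)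

lemma cont_dropc: "cmap (Tw n (Suc r)) (Tw n r) (dropc r)"
proof -
 have "cmap (Tw n (Suc r)) eur (%z. ((snd z)(r := %_. 0)) i (a, b))" for i a b
  by(cases "i = r") (simp_all add: cont_Tw)
 moreover have "((snd z)(r := %_. 0)) i = (%_. 0)" if "z : topspace (Tw n (Suc r))" "r <= i" for z i
  using Tw_point(2)[OF that(1), of i] that(2) by(cases "i = r") simp_all
 ultimately show ?thesis unfolding cmap_into_Tw
  using cont_Tw(1)[of n "Suc r"] Tw_point(1)[of _ n "Suc r"] by(simp add: o_def)
qed

abbreviation "xc n r i == pull (Tw n r) (pr i) (Zn n) (tz n)"

lemma xc_in: "i < r ==> xc n r i : cohs (Tw n r)"
 by(intro pull_in cont_pr cls_in_cohs cyc_taut)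

lemma pull_xc: "i < r ==> pull (Tw n (Suc r)) (dropc r) (Tw n r) (xc n r i) = xc n (Suc r) i"
 by(subst pull_pull[OF cont_dropc cont_pr cls_in_cohs[OF cyc_taut]]) (simp_all add: o_def)

text \<open>Forgetting the last line exhibits \<open>Tw n (Suc r)\<close> as the projectivized
  pullback of the regular bundle to \<open>Tw n r\<close>.\<close>

lemma free_over_Tw: "free_over (Tw n (Suc r)) (dropc r) (Tw n r) n (cpow (Tw n (Suc r)) (xc n (Suc r) r))"
proof -
 let ?W = "Tw n (Suc r)" and ?W' = "pbun (Tw n r) (espace n o fst) (2 * n)"
 let ?b = "%y. (fst (fst y), (snd (fst y))(r := snd y))"
 have W': "fst y : topspace (Tw n r)" "snd y : outer ` (espace n (fst (fst y)) Int sph (2*n))" if "y : topspace ?W'" for y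
  using that by(auto simp: topspace_pbun)
 have cs: "cmap ?W' eur (%y. snd y (a, b))" for a b
  using cm_comp[OF continuous_proj_bundle_snd cmap_RP_coord] by(simp add: o_def)
 have c1: "cmap ?W' (Tw n r) fst" by(rule cont_pbun_fst)
 have cc: "cmap ?W' eur (%y. ((snd (fst y))(r := snd y)) i (a, b))" for i a b
  using cm_comp[OF c1 cont_Tw(2)[of n r i a b]] cs by(cases "i = r") (simp_all add: o_def)
 have cb: "cmap ?W' ?W ?b" unfolding cmap_into_Tw
 proof (intro conjI allI ballI impI)
  show "cmap ?W' (Bp n) (fst o ?b)"
   using cm_comp[OF c1 cont_Tw(1)] by(simp add: o_def)
  show "cmap ?W' eur (%x. snd (?b x) i (a, b))" for i a b using cc by simp
  fix y i assume y: "y : topspace ?W'"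
  show "snd (?b y) i : outer ` (espace n (fst (?b y)) Int sph (2*n))" if "i < Suc r"
   using W'(2)[OF y] Tw_point(1)[OF W'(1)[OF y], of i] that by(cases "i = r") simp_all
  show "snd (?b y) i = (%_. 0)" if "Suc r <= i" using Tw_point(2)[OF W'(1)[OF y], of i] that by simp
 qed
 have cf: "cmap ?W ?W' (%z. (dropc r z, snd z r))"
  unfolding cmap_into_pbun cmap_into_RP
  using cont_dropc[of n r] cont_Tw(2)[of n "Suc r" r] Tw_point(1)[of _ n "Suc r" r] by(simp add: o_def image_subset_iff) blast
 have fb: "?b (dropc r z, snd z r) = z" for z :: "(real^2) set \<times> (nat => nat \<times> nat => real)" by(simp add: fun_upd_idem prod_eq_iff)
 show ?thesis
 proof (rule free_over_transfer[OF cb cf cont_dropc c1])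
  show "dropc r (?b y) = fst y" if "y : topspace ?W'" for y
   using Tw_point(2)[OF W'(1)[OF that], of r] by(simp add: prod_eq_iff fun_upd_idem)
  show "fst (dropc r x, snd x r) = dropc r x" for x :: "(real^2) set \<times> (nat => nat \<times> nat => real)" by simp
  show "homotopic_with (%_. True) ?W ?W (?b o (%z. (dropc r z, snd z r))) id"
   by(rule homotopic_with_equal[OF TrueI TrueI cm_comp[OF cf cb]]) (simp add: fun_upd_idem prod_eq_iff)
  show "cpow ?W (xc n (Suc r) r) i : cohs ?W" for i by simp
  have ceq: "cmap ?W' (Zn n) (pr r o ?b)" by(rule cm_comp[OF cb cont_pr]) simp
  have "pull ?W' ?b ?W (xc n (Suc r) r) = pull ?W' (pr r o ?b) (Zn n) (tz n)"
   by(rule pull_pull[OF cb cont_pr cls_in_cohs[OF cyc_taut]]) simp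
  also have "... = cls ?W' (chi ?W' (vsel o snd o (pr r o ?b)))"
   unfolding pull_cls[OF ceq cyc_taut] pb_chi[OF ceq] ..
  also have "vsel o snd o (pr r o ?b) = vsel o snd" by(simp add: fun_eq_iff)
  finally have "(%i. pull ?W' ?b ?W (cpow ?W (xc n (Suc r) r) i)) = cpow ?W' (cls ?W' (taut (Tw n r) (espace n o fst) (2 * n)))"
   unfolding pull_cpow[OF cb] by(rule ssubst) (rule refl)
  thus "free_over ?W' fst (Tw n r) n (%i. pull ?W' ?b ?W (cpow ?W (xc n (Suc r) r) i))"
   using free_over_config[OF cont_Tw(1)[of n r]] by simp
 qed
qed

text \<open>By \<open>top_power\<close> the coefficient of \<open>x ^ (n - 1)\<close> in each factor
  is a class \<open>wc\<close>. Freeness of the powers of the last class lets that coefficient be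
  extracted and moved into \<open>b\<close>, after which one line fewer is left.\<close>

lemma top_coefficient:
 assumes n: "0 < n" and b: "!!j. j : J ==> b j : cohs (Bp n)"
  and z: "(\<Sum>j\<in>J. pull (Tw n r) fst (Bp n) (b j) * (\<Prod>i<r. cpow (Tw n r) (xc n r i) (n - 1 + k j i))) = 0"
 shows "(\<Sum>j\<in>J. b j * (\<Prod>i<r. wc n (k j i))) = 0"
 using b z
proof (induction r arbitrary: b)
 case 0
 have s: "cmap (Bp n) (Tw n 0) (%S. (S, %_ _. 0))"
  unfolding cmap_into_Tw by(simp add: o_def)
 have "pull (Bp n) (%S. (S, %_ _. 0)) (Tw n 0) (pull (Tw n 0) fst (Bp n) (b j)) = b j" if "j : J" for j
  unfolding pull_pull[OF s cont_Tw(1) 0(1)[OF that]] by(rule pull_id) (simp_all add: 0(1)[OF that])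
 thus ?case using arg_cong[OF 0(2), of "pull (Bp n) (%S. (S, %_ _. 0)) (Tw n 0)"] by(simp add: pull_sum)
next
 case (Suc r)
 let ?W = "Tw n (Suc r)" and ?B = "Bp n"
 have fpr: "fst o pr r = (fst :: (real^2) set \<times> (nat => nat \<times> nat => real) => _)" by(simp add: fun_eq_iff)
 have "EX c. (ALL i<n. c i : cohs ?B) & c (n - 1) = wc n (k j r) &
   cpow ?W (xc n (Suc r) r) (n - 1 + k j r) = (\<Sum>i<n. cpow ?W (xc n (Suc r) r) i * pull ?W fst ?B (c i))" (is "EX c. ?P j c") for j
 proof (rule top_power[OF cont_pr[of r "Suc r" n, OF lessI] n, of "k j r", unfolded fpr])
  fix c assume c: "!!i. i < n ==> c i : cohs ?B" "c (n - 1) = wc n (k j r)"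
   "cpow ?W (xc n (Suc r) r) (n - 1 + k j r) = (\<Sum>i<n. cpow ?W (xc n (Suc r) r) i * pull ?W fst ?B (c i))"
  show "EX c. ?P j c" by(rule exI[of _ c], intro conjI allI impI) (rule c; assumption)+
 qed
 hence "EX c. ALL j. ?P j (c j)" by(intro choice allI)
 then obtain c where "ALL j. ?P j (c j)" ..
 hence c: "!!j i. i < n ==> c j i : cohs ?B" "!!j. c j (n - 1) = wc n (k j r)"
   "!!j. cpow ?W (xc n (Suc r) r) (n - 1 + k j r) = (\<Sum>i<n. cpow ?W (xc n (Suc r) r) i * pull ?W fst ?B (c j i))"
  by(simp_all only:)
 let ?u = "%m. \<Sum>j\<in>J. pull (Tw n r) fst ?B (b j * c j m) * (\<Prod>i<r. cpow (Tw n r) (xc n r i) (n - 1 + k j i))"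
 have u_in: "?u m : cohs (Tw n r)" if "m < n" for m
  by(intro cohs_sum cohs_mult_any pull_in cont_Tw cohs_mult c(1) that Suc.prems(1))
 have pf: "pull ?W (dropc r) (Tw n r) (pull (Tw n r) fst ?B a) = pull ?W fst ?B a" if "a : cohs ?B" for a
  by(subst pull_pull[OF cont_dropc cont_Tw(1) that]) (simp add: o_def)
 \<comment> \<open>The empty product is left out because it is the unit of the whole type, which a
   pullback turns into \<open>one_at\<close>.\<close>
 have pp: "pull ?W (dropc r) (Tw n r) (\<Prod>i<s. cpow (Tw n r) (xc n r i) (e i)) = (\<Prod>i<s. cpow ?W (xc n (Suc r) i) (e i))" if "s <= r" "0 < s" for s e
  using that
 proof (induction s)
  case (Suc s)
  have st: "pull ?W (dropc r) (Tw n r) (cpow (Tw n r) (xc n r s) (e s)) = cpow ?W (xc n (Suc r) s) (e s)"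
   unfolding pull_cpow[OF cont_dropc] using pull_xc[of s r n] Suc.prems by simp
  show ?case
  proof (cases "s = 0")
   case True show ?thesis using st unfolding True prod.lessThan_Suc lessThan_0 prod.empty mult_1 .
  next
   case False
   hence "s <= r" "0 < s" using Suc.prems by simp_all
   from Suc.IH[OF this] show ?thesis unfolding prod.lessThan_Suc pull_mult st by(rule arg_cong)
  qed
 qed simp
 have "(\<Sum>m<n. cpow ?W (xc n (Suc r) r) m * pull ?W (dropc r) (Tw n r) (?u m)) =
   (\<Sum>j\<in>J. pull ?W fst ?B (b j) * (\<Prod>i<Suc r. cpow ?W (xc n (Suc r) i) (n - 1 + k j i)))"
 proof -
  let ?P = "%j. \<Prod>i<r. cpow ?W (xc n (Suc r) i) (n - 1 + k j i)"
  have K: "pull ?W (dropc r) (Tw n r) (pull (Tw n r) fst ?B (b j * c j m) * (\<Prod>i<r. cpow (Tw n r) (xc n r i) (n - 1 + k j i))) =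
    pull ?W fst ?B (b j) * pull ?W fst ?B (c j m) * (\<Prod>i<r. cpow ?W (xc n (Suc r) i) (n - 1 + k j i))" if "m < n" "j : J" for m j
  proof (cases "r = 0")
   case True thus ?thesis using pf[OF cohs_mult[OF Suc.prems(1)[OF that(2)] c(1)[OF that(1)]]] by(simp only: lessThan_0 prod.empty mult_1_right pull_mult)
  next
   case False
   hence "0 < r" by simp
   show ?thesis unfolding pull_mult pp[OF order_refl \<open>0 < r\<close>] pf[OF Suc.prems(1)[OF that(2)]] pf[OF c(1)[OF that(1)]] ..
  qed
  let ?t = "%m j. cpow ?W (xc n (Suc r) r) m * (pull ?W fst ?B (b j) * pull ?W fst ?B (c j m) * ?P j)"
  have "(\<Sum>m<n. cpow ?W (xc n (Suc r) r) m * pull ?W (dropc r) (Tw n r) (?u m)) = (\<Sum>m<n. \<Sum>j\<in>J. ?t m j)"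
   unfolding pull_sum sdl by(rule sum.cong[OF refl], rule sum.cong[OF refl], rule arg_cong[OF K]) (simp_all only: lessThan_iff)
  also have "... = (\<Sum>j\<in>J. \<Sum>m<n. ?t m j)" by(rule sum.swap)
  also have "... = (\<Sum>j\<in>J. pull ?W fst ?B (b j) * (?P j * (\<Sum>m<n. cpow ?W (xc n (Suc r) r) m * pull ?W fst ?B (c j m))))"
   by(simp only: sdl mult.assoc mult.commute mult.left_commute)
  finally show ?thesis by(simp only: prod.lessThan_Suc c(3))
 qed
 hence "?u (n - 1) = 0"
  using Suc.prems(2) n by(intro free_over_indep[OF free_over_Tw[of n r], of ?u "n - 1"] u_in) (simp_all only: diff_less zero_less_one)
 from Suc.IH[of "%j. b j * c j (n - 1)", OF _ this] show ?case
  using Suc.prems(1) n c(1)[of "n - 1"] by(simp add: c(2)[unfolded One_nat_def] ac_simps)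
qed

lemma one_at_cpows: fixes s :: nat shows "one_at X * (\<Prod>i<s. cpow X (x i) (e i)) = one_at X * (\<Prod>i<s. x i ^ e i)"
proof (induction s)
 case (Suc s)
 have "one_at X * (\<Prod>i<Suc s. cpow X (x i) (e i)) = (one_at X * (\<Prod>i<s. cpow X (x i) (e i))) * (one_at X * x s ^ e s)"
  by(simp only: prod.lessThan_Suc cpow_def mult.assoc)
 also have "... = (one_at X * one_at X) * (\<Prod>i<Suc s. x i ^ e i)"
  unfolding Suc prod.lessThan_Suc by(simp only: mult.assoc mult.commute mult.left_commute)
 finally show ?case by(simp only: one_at_mult one_at_in)
qed simp

lemma prod_lessThan_add: "(\<Prod>k<N + m. f k) = (\<Prod>k<N. f k) * (\<Prod>j<m. f (N + j))" for f :: "nat => 'a coh"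
 by(induction m) (simp_all add: mult.assoc)

text \<open>Otherwise the fibre power of the projectivized bundle is covered by the sets where some relation or
some orthogonality fails, so the product of the \<open>x i ^ N\<close> and \<open>x i + x j\<close> vanishes. After multiplication
with the \<open>x i ^ i\<close> its top coefficient is a Hankel determinant.\<close>

lemma orthogonal_relations:
 fixes e :: "nat => (real^2) set => real^2 => real"
 assumes nN: "n <= N" and nz: "one_at (Bp n) * (\<Prod>i<r. wc n (N - n + 1 + 2 * i)) ~= 0"
  and e: "!!k i. k < N ==> i < n ==> cmap (Y_plane n) eur (%x. e k (x ` {..<n}) (x i))"
 shows "EX S:topspace (Bp n). EX g. (ALL i<r. EX p:S. g i p ~= 0) & (ALL i<r. ALL j<i. (\<Sum>p\<in>S. g i p * g j p) = 0) &
  (ALL i<r. ALL k<N. (\<Sum>p\<in>S. g i p * e k S p) = 0)"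
proof (cases "r = 0")
 case True
 hence "one_at (Bp n) * prod_list (map (%_. 0) []) ~= 0" using nz by simp
 hence "topspace (Bp n) ~= {}" using cup_length_classes[of "[]" "%_. 0" "Bp n" "%_. {}"] by(metis empty_iff empty_subsetI list.set(1))
 then obtain S where "S : topspace (Bp n)" by blast
 thus ?thesis using True by auto
next
 case r: False
 let ?X = "Tw n r" and ?B = "Bp n"
 have n: "0 < n"
 proof (rule ccontr)
  assume "~ 0 < n"
  hence "(\<Prod>i<r. wc n (N - n + 1 + 2 * i)) = 0" using r by(intro prod_zero bexI[of _ 0]) (simp_all add: wc(4))
  thus False using nz by simp
 qed
 show ?thesis
 proof (rule ccontr)
  assume neg: "~ ?thesis"
  define v where "v i = (vsel o snd) o (pr i :: (real^2) set \<times> (nat => nat \<times> nat => real) => _)" for i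
  define x where "x i = xc n r i" for i
  \<comment> \<open>Entries of the conditions in coefficient coordinates: \<open>m k\<close> for the
    pairing with \<open>e k\<close>, and below \<open>M\<close> for the inner product of two
    functions on the configuration.\<close>
  define m where "m k a z = (\<Sum>p\<in>fst z. e k (fst z) p * rec p a)" for k a and z :: "(real^2) set \<times> (nat => nat \<times> nat => real)"
  define M where "M a b z = (\<Sum>p\<in>fst z. rec p a * rec p b)" for a b and z :: "(real^2) set \<times> (nat => nat \<times> nat => real)"
  have lf: "line_field (2 * n) ?X (v i)" if "i < r" for i
   unfolding v_def by(rule line_field_compose[OF line_field_pbun cont_pr[OF that]])
  have xv: "x i = cls ?X (chi ?X (v i))" if "i < r" for i
   unfolding x_def v_def pull_cls[OF cont_pr[OF that] cyc_taut] pb_chi[OF cont_pr[OF that]] ..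
  have cs: "cmap ?X eur (%z. \<Sum>p\<in>fst z. h (fst z) p)"
   if "!!i. i < n ==> cmap (Y_plane n) eur (%x. h (x ` {..<n}) (x i))" for h
  proof -
   have "cmap (subt ?B (topspace ?B)) eur (%S. \<Sum>p\<in>S. h S p)"
    by(intro cont_config_sum openin_topspace cm_sub that)
   from cm_comp[OF cont_Tw(1)[of n r] this[unfolded subtopology_topspace]] show ?thesis by(simp add: o_def)
  qed
  have cm: "cmap ?X eur (m k a)" if "k < N" for k a
   unfolding m_def by(rule cs, rule cm_mult[OF e[OF that] cont_rec])
  have cM: "cmap ?X eur (M a b)" for a b
   unfolding M_def by(rule cs, rule cm_mult[OF cont_rec cont_rec])
  \<comment> \<open>Pairs \<open>(i, k)\<close>: for \<open>k < N\<close> the condition of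
    orthogonality to \<open>e k\<close>, from \<open>N\<close> on the one between the functions
    \<open>i\<close> and \<open>k - N\<close>.\<close>
  let ?I = "Sigma {..<r} (%i. {..<N + i})"
  define U where "U = (%(i, k). if k < N then {z : topspace ?X. (\<Sum>a<2*n. m k a z * v i z a) ~= 0}
   else {z : topspace ?X. (\<Sum>a<2*n. \<Sum>b<2*n. M a b z * v i z a * v (k - N) z b) ~= 0})"
  define A where "A = (%(i, k). if k < N then x i else x i + x (k - N))"
  obtain L where L: "set L = ?I" "distinct L" using finite_distinct_list[of ?I] by auto
  have UA: "A ik : cohs ?X & openin ?X (U ik) & restr ?X (U ik) (A ik) = 0" if ik: "ik : ?I" for ik
  proof -
   obtain i k where i: "ik = (i, k)" "i < r" "k < N + i" using ik by auto
   show ?thesis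
   proof (cases "k < N")
    case True
    thus ?thesis using open_nonzero_linear[OF lf[OF i(2)] cm[OF True]] i(2) xc_in[OF i(2), of n]
     by(simp add: A_def U_def i(1) xv[symmetric] x_def[symmetric])
   next
    case False
    hence "k - N < r" using i by simp
    thus ?thesis using False open_nonzero_bilinear[OF lf[OF i(2)] lf cM] i(2) xc_in[of _ r n]
     by(simp add: A_def U_def i(1) xv[symmetric] x_def[symmetric])
   qed
  qed
  have "one_at ?X * prod_list (map A L) = 0"
  proof (rule cup_length_classes[where U=U])
   show "topspace ?X <= (\<Union>ik\<in>set L. U ik)"
   proof
    fix z assume z: "z : topspace ?X"
    let ?g = "%i p. Re (fval n (v i z) p)"
    have SB: "fst z : topspace ?B" using z cont_Tw(1)[of n r] by(auto simp: cm_def Pi_iff)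
    have S: "finite (fst z)" "card (fst z) = n" using B_card[OF SB] by simp_all
    have "EX p:fst z. ?g i p ~= 0" if i: "i < r" for i
    proof -
     have "pr i z : topspace (Zn n)" using cont_pr[OF i, of n] z by(auto simp: cm_def Pi_iff)
     from Zn_point[OF this] have vE: "v i z : espace n (fst z)" and vS: "v i z : sph (2 * n)" by(simp_all add: v_def)
     obtain a where a: "v i z a ~= 0" using vS by(rule sph_nonzero)
     obtain p where p: "p : fst z" "fval n (v i z) p ~= 0"
      using fval_zero[OF S, of "v i z" a] a vS by(auto simp: sph_def)
     thus ?thesis using vE by(auto simp: espace_def complex_eq_iff)
    qed
    moreover have "~ ((ALL i<r. EX p:fst z. ?g i p ~= 0) & (ALL i<r. ALL j<i. (\<Sum>p\<in>fst z. ?g i p * ?g j p) = 0) &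
      (ALL i<r. ALL k<N. (\<Sum>p\<in>fst z. ?g i p * e k (fst z) p) = 0))"
     by(rule contrapos_nn[OF neg], rule bexI[OF _ SB], rule exI[of _ ?g])
    ultimately consider i j where "i < r" "j < i" "(\<Sum>p\<in>fst z. ?g i p * ?g j p) ~= 0"
     | i k where "i < r" "k < N" "(\<Sum>p\<in>fst z. ?g i p * e k (fst z) p) ~= 0"
     by blast
    thus "z : (\<Union>ik\<in>set L. U ik)"
    proof cases
     case (1 i j)
     have "(\<Sum>a<2*n. \<Sum>b<2*n. M a b z * v i z a * v j z b) = (\<Sum>p\<in>fst z. ?g i p * ?g j p)"
      unfolding re_fval[symmetric] sum_product unfolding M_def sdr
      by(simp only: sum.swap[of _ "fst z"] mult.assoc mult.commute mult.left_commute)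
     hence "z : U (i, N + j)" using z 1(3) by(simp add: U_def)
     thus ?thesis unfolding L(1) using 1 by(intro UN_I[of "(i, N + j)"]) simp_all
    next
     case (2 i k)
     have "(\<Sum>a<2*n. m k a z * v i z a) = (\<Sum>p\<in>fst z. ?g i p * e k (fst z) p)"
      unfolding re_fval[symmetric] m_def sdr
      by(simp only: sum.swap[of _ "fst z"] mult.assoc mult.commute mult.left_commute)
     hence "z : U (i, k)" using z 2 by(simp add: U_def)
     thus ?thesis unfolding L(1) using 2 by(intro UN_I[of "(i, k)"]) simp_all
    qed
   qed
  qed (use UA L(1) in blast)+
  also have "prod_list (map A L) = (\<Prod>i<r. \<Prod>k<N + i. A (i, k))"
   unfolding prod.distinct_set_conv_list[OF L(2), symmetric] L(1) by(subst prod.Sigma) simp_all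
  also have "... = (\<Prod>i<r. x i ^ N) * (\<Prod>i<r. \<Prod>j<i. x i + x j)"
   by(simp add: prod_lessThan_add A_def prod.distrib)
  finally have cover: "one_at ?X * ((\<Prod>i<r. x i ^ N) * (\<Prod>i<r. \<Prod>j<i. x i + x j)) = 0" .
  \<comment> \<open>The shift by \<open>N - n + 1\<close> makes the exponent
    \<open>n - 1 + k si i\<close> the sum of three: \<open>N\<close> from the power,
    \<open>i\<close> from the multiplier \<open>x i ^ i\<close>, and the inverse of
    \<open>si\<close> at \<open>i\<close> from Vandermonde's sum after reindexing.\<close>
  define k where "k si i = N - n + 1 + i + inv_into UNIV si i" for si and i :: nat
  let ?J = "{si. si permutes {..<r}}"
  have "(\<Sum>si\<in>?J. pull ?X fst ?B (one_at ?B) * (\<Prod>i<r. cpow ?X (x i) (n - 1 + k si i))) =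
    (\<Sum>si\<in>?J. one_at ?X * ((\<Prod>i<r. x i ^ N) * (\<Prod>i<r. x i ^ i)) * (\<Prod>i<r. x (si i) ^ i))"
  proof (rule sum.cong[OF refl])
   fix si assume "si : ?J"
   hence p: "si permutes {..<r}" by simp
   have ex: "n - 1 + k si i = N + i + inv_into UNIV si i" for i using n nN by(simp add: k_def)
   have "(\<Prod>i<r. x i ^ inv_into UNIV si i) = (\<Prod>i<r. x (si i) ^ i)"
    by(subst prod.permute[OF p]) (simp add: o_def permutes_inverses(2)[OF p])
   thus "pull ?X fst ?B (one_at ?B) * (\<Prod>i<r. cpow ?X (x i) (n - 1 + k si i)) =
     one_at ?X * ((\<Prod>i<r. x i ^ N) * (\<Prod>i<r. x i ^ i)) * (\<Prod>i<r. x (si i) ^ i)"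
    unfolding pull_one_at[OF cont_Tw(1)] one_at_cpows ex by(simp add: power_add prod.distrib mult.assoc)
  qed
  also have "... = one_at ?X * ((\<Prod>i<r. x i ^ N) * (\<Prod>i<r. \<Prod>j<i. x i + x j)) * (\<Prod>i<r. x i ^ i)"
   unfolding sdl[symmetric] vandermonde by(simp only: mult.assoc mult.commute mult.left_commute)
  also have "... = 0" unfolding cover by simp
  finally have "(\<Sum>si\<in>?J. one_at ?B * (\<Prod>i<r. wc n (k si i))) = 0"
   unfolding x_def by(intro top_coefficient[OF n]) (rule one_at_in)
  thus False using nz wc_hankel[of "N - n + 1" n r] unfolding sdl[symmetric] k_def by simp
 qed
qed

section \<open>Independent chords\<close>

definition cd :: "('i => real) => ('i => real) => 'i => (real => real) => real" where
 "cd a b i f = f (b i) - f (a i)"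

definition ind :: "('i => real) => ('i => real) => (real => real) set => 'i set => bool" where
 "ind a b V I \<longleftrightarrow> (ALL c. (ALL f:V. (\<Sum>i\<in>I. c i * cd a b i f) = 0) --> (ALL i:I. c i = 0))"

lemma cd_linear [simp]: "cd a b i (f + g) = cd a b i f + cd a b i g" "cd a b i (f - g) = cd a b i f - cd a b i g"
 "cd a b i (fscale c f) = c * cd a b i f"
 by(simp_all add: cd_def fscale_def plus_fun_def algebra_simps)

lemma cd_sum [simp]: "cd a b i (\<Sum>j\<in>J. h j) = (\<Sum>j\<in>J. cd a b i (h j))"
 by(induction J rule: infinite_finite_induct) (simp_all, simp_all add: cd_def zero_fun_def)

lemma ind_insert:
 assumes I: "finite I" "i ~: I" and "ind a b V (insert i I)" shows "ind a b V I"
 unfolding ind_def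
proof (intro allI impI)
 fix c assume c: "ALL f:V. (\<Sum>j\<in>I. c j * cd a b j f) = 0"
 have "(\<Sum>j\<in>I. (if j = i then 0 else c j) * cd a b j f) = (\<Sum>j\<in>I. c j * cd a b j f)" for f
  using I(2) by(intro sum.cong) auto
 hence *: "ALL f:V. (\<Sum>j\<in>insert i I. (if j = i then 0 else c j) * cd a b j f) = 0" using I c by simp
 note ** = assms(3)[unfolded ind_def, THEN spec, of "%j. if j = i then 0 else c j", THEN mp, OF *]
 show "ALL j:I. c j = 0"
 proof
  fix j assume "j : I"
  thus "c j = 0" using bspec[OF **, of j] I(2) by(cases "j = i") simp_all
 qed
qed

text \<open>\<open>pr\<close> projects onto the common kernel of the earlier functionals along their
  dual family. If the new functional vanished on its image, it would be a combination of the earlier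
  ones.\<close>

lemma dual_family:
 assumes V: "fun_space.subspace V" and "finite I" "ind a b V I"
 shows "EX F. (ALL i:I. F i : V) & (ALL i:I. ALL j:I. cd a b j (F i) = (if i = j then 1 else 0))"
 using assms(2,3)
proof (induction I rule: finite_induct)
 case (insert i I)
 obtain F where F: "!!j. j : I ==> F j : V" "!!j k. j : I ==> k : I ==> cd a b k (F j) = (if j = k then 1 else 0)"
  using insert.IH[OF ind_insert[OF insert.hyps insert.prems]] by blast
 define pr where "pr f = f - (\<Sum>j\<in>I. fscale (cd a b j f) (F j))" for f
 have prV: "pr f : V" if "f : V" for f
  unfolding pr_def by(intro fun_space.subspace_diff[OF V] fun_space.subspace_sum[OF V] fun_space.subspace_scale[OF V] that F(1))
 have prz: "cd a b k (pr f) = 0" if "k : I" for k f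
 proof -
  have "(\<Sum>j\<in>I. cd a b j f * cd a b k (F j)) = (\<Sum>j\<in>I. if j = k then cd a b j f else 0)" by(rule sum.cong) (auto simp: F(2) that)
  thus ?thesis using that insert.hyps(1) by(simp add: pr_def)
 qed
 have "EX f:V. cd a b i (pr f) ~= 0"
 proof (rule ccontr)
  assume "~ ?thesis"
  hence z: "cd a b i f = (\<Sum>j\<in>I. cd a b j f * cd a b i (F j))" if "f : V" for f using that by(simp add: pr_def)
  have e: "(\<Sum>j\<in>I. (if j = i then 1 else - cd a b i (F j)) * cd a b j f) = - (\<Sum>j\<in>I. cd a b j f * cd a b i (F j))" for f
   unfolding sum_negf[symmetric] using insert.hyps(2) by(intro sum.cong) auto
  have *: "ALL f:V. (\<Sum>j\<in>insert i I. (if j = i then 1 else - cd a b i (F j)) * cd a b j f) = 0"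
   using insert.hyps z by(simp add: e)
  from insert.prems[unfolded ind_def, THEN spec, of "%j. if j = i then 1 else - cd a b i (F j)", THEN mp, OF *] show False by auto
 qed
 then obtain f where f: "f : V" "cd a b i (pr f) ~= 0" by blast
 define G where "G = fscale (1 / cd a b i (pr f)) (pr f)"
 have G: "G : V" "cd a b i G = 1" "!!k. k : I ==> cd a b k G = 0"
  unfolding G_def using f prz by(simp_all add: fun_space.subspace_scale[OF V prV])
 let ?F = "%j. if j = i then G else F j - fscale (cd a b i (F j)) G"
 show ?case
 proof (intro exI[of _ ?F] conjI ballI)
  show "?F j : V" if "j : insert i I" for j
   using that G(1) F(1) by(auto intro!: fun_space.subspace_diff[OF V] fun_space.subspace_scale[OF V])
  show "cd a b k (?F j) = (if j = k then 1 else 0)" if "j : insert i I" "k : insert i I" for j k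
   using that G F(2) insert.hyps(2) by auto
 qed
qed simp

lemma codimension_ind:
 assumes V: "fun_space.subspace V" and I: "finite I" "ind a b V I"
 shows "has_codimension V {f : V. ALL i:I. cd a b i f = 0} (card I)"
proof -
 let ?U = "{f : V. ALL i:I. cd a b i f = 0}"
 obtain F where F: "!!j. j : I ==> F j : V" "!!j k. j : I ==> k : I ==> cd a b k (F j) = (if j = k then 1 else 0)"
  using dual_family[OF V I] by blast
 have inj: "inj_on F I" by(rule inj_onI) (metis F(2) zero_neq_one)
 have c0: "cd a b i 0 = 0" for i by(simp add: cd_def zero_fun_def)
 have U: "fun_space.subspace ?U"
  using V fun_space.subspace_0[OF V] by(auto simp: fun_space.subspace_def c0)
 have e: "cd a b k (\<Sum>j\<in>I. fscale (c j) (F j)) = c k" if "k : I" for c k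
 proof -
  have "(\<Sum>j\<in>I. c j * cd a b k (F j)) = (\<Sum>j\<in>I. if j = k then c j else 0)" by(rule sum.cong) (auto simp: F(2) that)
  thus ?thesis using that I(1) by simp
 qed
 have "fun_space.span (?U Un F ` I) = V"
 proof
  show "fun_space.span (?U Un F ` I) <= V" by(rule fun_space.span_minimal[OF _ V]) (use F(1) in auto)
  show "V <= fun_space.span (?U Un F ` I)"
  proof
   fix f assume f: "f : V"
   let ?s = "\<Sum>j\<in>I. fscale (cd a b j f) (F j)"
   have s: "?s : V" by(intro fun_space.subspace_sum[OF V] fun_space.subspace_scale[OF V] F(1))
   have "f - ?s : ?U" using fun_space.subspace_diff[OF V f s] e[of _ "%j. cd a b j f"] by simp
   hence 1: "f - ?s : fun_space.span (?U Un F ` I)" by(intro fun_space.span_base UnI1)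
   have "?s : fun_space.span (?U Un F ` I)"
    by(intro fun_space.span_sum fun_space.span_scale fun_space.span_base UnI2 imageI)
   from fun_space.span_add[OF 1 this] show "f : fun_space.span (?U Un F ` I)" by simp
  qed
 qed
 moreover have "ALL b:F ` I. c b = 0" if "(\<Sum>b\<in>F ` I. fscale (c b) b) : ?U" for c
  using that e[of _ "%j. c (F j)"] by(auto simp: sum.reindex[OF inj] o_def)
 ultimately show ?thesis unfolding has_codimension_def
  using V U F(1) I(1) card_image[OF inj] by(intro conjI exI[of _ "F ` I"]) auto
qed

lemma homogeneous_system:
 fixes M :: "'t => 's => real"
 assumes "finite S" "finite T" "card S < card T"
 shows "EX c. (EX t:T. c t ~= 0) & (ALL s:S. (\<Sum>t\<in>T. c t * M t s) = 0)"
 using assms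
proof (induction S arbitrary: T M rule: finite_induct)
 case empty
 then obtain t where "t : T" by fastforce
 thus ?case by(intro exI[of _ "%_. 1"]) auto
next
 case (insert s S)
 show ?case
 proof (cases "ALL t:T. M t s = 0")
  case True
  have "card S < card T" using insert by simp
  from insert.IH[OF insert.prems(1) this, of M] obtain c where "EX t:T. c t ~= 0" "ALL s:S. (\<Sum>t\<in>T. c t * M t s) = 0" by blast
  thus ?thesis using True by(intro exI[of _ c]) simp
 next
  case False
  then obtain u where u: "u : T" "M u s ~= 0" by blast
  have "card S < card (T - {u})" using insert u by simp
  from insert.IH[OF finite_Diff[OF insert.prems(1)] this, of "%t x. M t x - M t s / M u s * M u x"]
  obtain c where c: "EX t:T - {u}. c t ~= 0" "!!x. x : S ==> (\<Sum>t\<in>T - {u}. c t * (M t x - M t s / M u s * M u x)) = 0" by blast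
  define k where "k = - (\<Sum>t\<in>T - {u}. c t * M t s) / M u s"
  have sp: "(\<Sum>t\<in>T. (c(u := k)) t * M t x) = k * M u x + (\<Sum>t\<in>T - {u}. c t * M t x)" for x
   by(subst sum.remove[OF insert.prems(1) u(1)]) (auto intro!: arg_cong2[of _ _ _ _ plus] sum.cong)
  have "k * M u x + (\<Sum>t\<in>T - {u}. c t * M t x) = (\<Sum>t\<in>T - {u}. c t * (M t x - M t s / M u s * M u x))" for x
   by(simp add: k_def sum_subtractf right_diff_distrib sdr sum_divide_distrib mult.assoc)
  hence "(\<Sum>t\<in>T. (c(u := k)) t * M t x) = 0" if "x : S" for x using c(2)[OF that] sp by simp
  moreover have "(\<Sum>t\<in>T. (c(u := k)) t * M t s) = 0" unfolding sp using u(2) by(simp add: k_def)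
  ultimately show ?thesis using c(1) by(intro exI[of _ "c(u := k)"]) (auto intro!: bexI)
 qed
qed

text \<open>A maximal independent set \<open>I\<close> of chords cuts out the same subspace. The
  unit vectors of \<open>I\<close> together with the \<open>r\<close> relations \<open>g\<close> are
  independent: paired with \<open>V\<close> a dependence involves only chords of \<open>I\<close>,
  and the \<open>g\<close> are orthogonal. So \<open>card I + r\<close> is at most the dimension
  \<open>card S\<close>.\<close>

lemma codimension_le:
 fixes g :: "nat => 'i => real"
 assumes V: "fun_space.subspace V" and S: "finite S"
  and g0: "!!i. i < r ==> EX p:S. g i p ~= 0" and og: "!!i j. i < r ==> j < i ==> (\<Sum>p\<in>S. g i p * g j p) = 0"
  and rel: "!!i f. i < r ==> f : V ==> (\<Sum>p\<in>S. g i p * cd a b p f) = 0"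
 shows "EX k. has_codimension V {f : V. ALL p:S. cd a b p f = 0} k & k + r <= card S"
proof -
 have "{I : Pow S. ind a b V I} ~= {}" by(auto simp: ind_def intro!: exI[of _ "{}"])
 then obtain I where I: "I <= S" "ind a b V I" and max: "!!J. J <= S ==> ind a b V J ==> I <= J ==> I = J"
  using finite_has_maximal[of "{I : Pow S. ind a b V I}"] S by auto
 have fI: "finite I" using finite_subset[OF I(1) S] .
 have dep: "cd a b p f = 0" if p: "p : S" and f: "f : V" "ALL i:I. cd a b i f = 0" for p f
 proof (cases "p : I")
  case False
  hence "~ ind a b V (insert p I)" using max[of "insert p I"] I(1) p by auto
  then obtain c where c: "!!f. f : V ==> (\<Sum>j\<in>insert p I. c j * cd a b j f) = 0" "EX j:insert p I. c j ~= 0" unfolding ind_def by blast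
  have s: "c p * cd a b p f + (\<Sum>j\<in>I. c j * cd a b j f) = 0" if "f : V" for f using c(1)[OF that] False fI by simp
  have "c p ~= 0"
  proof
   assume "c p = 0"
   hence "ALL f:V. (\<Sum>j\<in>I. c j * cd a b j f) = 0" using s by simp
   hence "ALL j:I. c j = 0" using I(2) unfolding ind_def by blast
   thus False using c(2) \<open>c p = 0\<close> by auto
  qed
  thus ?thesis using s[OF f(1)] f(2) by simp
 qed (use f in simp)
 hence "{f : V. ALL p:S. cd a b p f = 0} = {f : V. ALL i:I. cd a b i f = 0}" using I(1) by blast
 hence "has_codimension V {f : V. ALL p:S. cd a b p f = 0} (card I)" using codimension_ind[OF V fI I(2)] by simp
 moreover have "card I + r <= card S"
 proof (rule ccontr)
  assume "~ ?thesis"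
  hence "card S < card (I <+> {..<r})" using fI by(simp add: card_Plus)
  then obtain c where c: "EX t:I <+> {..<r}. c t ~= 0"
   "ALL s:S. (\<Sum>t\<in>I <+> {..<r}. c t * (case t of Inl i => if i = s then 1 else 0 | Inr j => g j s)) = 0"
   using homogeneous_system[OF S, of "I <+> {..<r}" "%t s. case t of Inl i => if i = s then 1 else 0 | Inr j => g j s"] fI by auto
  have e: "(if s : I then c (Inl s) else 0) + (\<Sum>j<r. c (Inr j) * g j s) = 0" if "s : S" for s
  proof -
   have "(\<Sum>i\<in>I. c (Inl i) * (if i = s then 1 else 0)) = (\<Sum>i\<in>I. if i = s then c (Inl i) else 0)" by(rule sum.cong) auto
   thus ?thesis using c(2)[rule_format, OF that] fI by(simp add: sum.Plus)
  qed
  have "(\<Sum>i\<in>I. c (Inl i) * cd a b i f) = 0" if f: "f : V" for f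
  proof -
   have "(\<Sum>s\<in>S. (\<Sum>j<r. c (Inr j) * g j s) * cd a b s f) = (\<Sum>j<r. c (Inr j) * (\<Sum>s\<in>S. g j s * cd a b s f))"
    unfolding sdl sdr by(subst sum.swap) (simp add: mult.assoc)
   hence z: "(\<Sum>s\<in>S. (\<Sum>j<r. c (Inr j) * g j s) * cd a b s f) = 0" using rel f by simp
   have "(\<Sum>i\<in>I. c (Inl i) * cd a b i f) = (\<Sum>s\<in>S. (if s : I then c (Inl s) else 0) * cd a b s f)"
    using I(1) S by(intro sum.mono_neutral_cong_left) auto
   also have "... = (\<Sum>s\<in>S. - ((\<Sum>j<r. c (Inr j) * g j s) * cd a b s f))"
    using e by(intro sum.cong refl) (metis add_eq_0_iff2 mult_minus_left)
   finally show ?thesis using z by(simp add: sum_negf)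
  qed
  hence cI: "ALL i:I. c (Inl i) = 0" using I(2)[unfolded ind_def, rule_format, of "%i. c (Inl i)"] by blast
  hence g: "(\<Sum>j<r. c (Inr j) * g j s) = 0" if "s : S" for s using e[OF that] cI by(cases "s : I") simp_all
  have "c (Inr i) = 0" if i: "i < r" for i
  proof -
   have "0 = (\<Sum>s\<in>S. g i s * (\<Sum>j<r. c (Inr j) * g j s))" using g by simp
   also have "... = (\<Sum>j<r. c (Inr j) * (\<Sum>s\<in>S. g i s * g j s))"
    unfolding sdl by(subst sum.swap) (simp add: ac_simps)
   also have "... = (\<Sum>j<r. if j = i then c (Inr i) * (\<Sum>s\<in>S. g i s * g i s) else 0)"
   proof (rule sum.cong[OF refl])
    fix j assume "j : {..<r}"
    hence "j ~= i ==> (\<Sum>s\<in>S. g i s * g j s) = 0"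
     using og[of i j] og[of j i] i by(cases "j < i") (simp_all add: mult.commute)
    thus "c (Inr j) * (\<Sum>s\<in>S. g i s * g j s) = (if j = i then c (Inr i) * (\<Sum>s\<in>S. g i s * g i s) else 0)" by simp
   qed
   finally have "c (Inr i) * (\<Sum>s\<in>S. g i s * g i s) = 0" using i by simp
   moreover obtain p where "p : S" "g i p ~= 0" using g0[OF i] by blast
   hence "0 < (\<Sum>s\<in>S. g i s * g i s)" using S by(intro sum_pos2[of S p]) (auto simp: zero_less_mult_iff linorder_neq_iff)
   ultimately show ?thesis by simp
  qed
  thus False using c(1) cI by auto
 qed
 ultimately show ?thesis by blast
qed

text \<open>A continuous substitute for the inverse of the minimal distance: \<open>1 / RS S\<close>
  is at most half the distance of any two points. The summands with \<open>z = w\<close> are 0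
  because division by 0 gives 0.\<close>

definition RS :: "(real^2) set => real" where
 "RS S = 1 + (\<Sum>z\<in>S. \<Sum>w\<in>S. 2 / dist z w)"

text \<open>A continuous substitute for the number of points below \<open>z\<close>; points lower by
  at least \<open>1 / RS S\<close> count fully.\<close>

definition lv :: "(real^2) set => real^2 => real" where
 "lv S z = (\<Sum>w\<in>S. max 0 (min 1 ((z $ 2 - w $ 2) * RS S)))"

text \<open>Each level makes the interval longer by the factor \<open>2 * n\<close>, enough for
  \<open>uncovered_point\<close>. The exponent is at most 0, so that no length exceeds
  \<open>1 / RS S\<close>.\<close>

definition hh :: "nat => (real^2) set => real^2 => real" where
 "hh n S z = (2 * real n) powr (lv S z - real n) / RS S"

definition lo :: "real^2 => real" where "lo z = - exp (z $ 1)"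

definition hi :: "nat => (real^2) set => real^2 => real" where "hi n S z = exp (z $ 1 + hh n S z)"

lemma RS_ge: "1 <= RS S"
 unfolding RS_def by(simp add: sum_nonneg)

lemma RS_dist: assumes "finite S" "z : S" "w : S" shows "2 / dist z w <= RS S"
proof -
 have "2 / dist z w <= (\<Sum>w\<in>S. 2 / dist z w)" using assms by(intro member_le_sum) auto
 also have "... <= (\<Sum>z\<in>S. \<Sum>w\<in>S. 2 / dist z w)"
  using assms by(intro member_le_sum[of z S "%z. \<Sum>w\<in>S. 2 / dist z w"]) (auto intro: sum_nonneg)
 finally show ?thesis by(simp add: RS_def)
qed

lemma hh_bounds:
 assumes "card S = n" "0 < n"
 shows "0 < hh n S z" "hh n S z <= 1 / RS S"
proof -
 have R: "0 < RS S" using RS_ge[of S] by simp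
 thus "0 < hh n S z" using assms by(simp add: hh_def)
 have "lv S z <= real (card S) * 1" unfolding lv_def by(rule sum_bounded_above) simp
 hence "(2 * real n) powr (lv S z - real n) <= (2 * real n) powr 0" using assms by(intro powr_mono) auto
 thus "hh n S z <= 1 / RS S" using R assms by(simp add: hh_def divide_right_mono)
qed

text \<open>Since \<open>RS S\<close> times the distance is at least 2 and the abscissae are closer
  than \<open>1 / RS S\<close>, the ordinates differ by at least \<open>1 / RS S\<close>. So
  \<open>w\<close> counts fully in the level of \<open>z\<close> and not in its own, while no other
  point counts less; the level rises by at least 1.\<close>

lemma hh_scales:
 assumes S: "finite S" "card S = n" "z : S" "w : S" "z ~= w" and near: "\<bar>z $ 1 - w $ 1\<bar> < 1 / RS S" and le: "w $ 2 <= z $ 2"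
 shows "2 * real n * hh n S w <= hh n S z"
proof -
 have n: "0 < n" using S card_gt_0_iff by blast
 have R: "0 < RS S" using RS_ge[of S] by simp
 have "norm (z - w) <= (\<Sum>i\<in>UNIV. \<bar>(z - w) $ i\<bar>)" by(rule norm_le_l1_cart)
 hence d: "dist z w <= \<bar>z $ 1 - w $ 1\<bar> + (z $ 2 - w $ 2)" using le by(simp add: dist_norm UNIV_2)
 have "2 <= RS S * dist z w" using RS_dist[OF S(1,3,4)] S(5) by(simp add: divide_le_eq mult.commute)
 also have "... <= RS S * (\<bar>z $ 1 - w $ 1\<bar> + (z $ 2 - w $ 2))" using d R by(intro mult_left_mono) auto
 also have "... = \<bar>z $ 1 - w $ 1\<bar> * RS S + (z $ 2 - w $ 2) * RS S" by(simp add: algebra_simps)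
 finally have big: "1 <= (z $ 2 - w $ 2) * RS S" using near R by(simp add: pos_less_divide_eq)
 let ?c = "%z u. max 0 (min 1 ((z $ 2 - u $ 2) * RS S))"
 have "(\<Sum>u\<in>S - {w}. ?c w u) <= (\<Sum>u\<in>S - {w}. ?c z u)"
  using le R by(intro sum_mono max.mono min.mono mult_right_mono) auto
 moreover have "lv S w = (\<Sum>u\<in>S - {w}. ?c w u)" unfolding lv_def using S by(subst sum.remove[of _ w]) auto
 moreover have "lv S z = 1 + (\<Sum>u\<in>S - {w}. ?c z u)" unfolding lv_def using S big by(subst sum.remove[of _ w]) auto
 ultimately have l: "1 + (lv S w - n) <= lv S z - n" by simp
 have "2 * real n * (2 * real n) powr (lv S w - n) = (2 * real n) powr (1 + (lv S w - n))" using n by(simp add: powr_add)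
 also have "... <= (2 * real n) powr (lv S z - n)" using n l by(intro powr_mono) auto
 finally show ?thesis using R by(simp add: hh_def divide_right_mono)
qed

text \<open>Intervals meeting the longest one are so short that together they cannot cover it.\<close>

lemma uncovered_point:
 assumes S: "finite S" "card S = n" and T: "T <= S" "T ~= {}"
 obtains z t where "z : T" "z $ 1 <= t" "t < z $ 1 + hh n S z" "ALL w:T. w ~= z --> ~ (w $ 1 <= t & t < w $ 1 + hh n S w)"
proof -
 have fT: "finite T" using T S(1) finite_subset by blast
 have n: "0 < n" using S T card_gt_0_iff by blast
 note hb = hh_bounds[OF S(2) n]
 have "Max (hh n S ` T) : hh n S ` T" using fT T(2) by simp
 then obtain z where z: "z : T" "hh n S z = Max (hh n S ` T)" by auto
 have mx: "hh n S w <= hh n S z" if "w : T" for w unfolding z(2) using fT that by simp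
 \<comment> \<open>\<open>n\<close> equally spaced candidates in the longest interval. Every other
   interval that meets one is shorter than the spacing, so it contains at most one, and at most
   \<open>n - 1\<close> intervals compete.\<close>
 define t where "t k = z $ 1 + hh n S z * (real k / real n)" for k
 have tb: "z $ 1 <= t k" "t k < z $ 1 + hh n S z" if "k < n" for k
  using hb(1)[of z] that n mult_strict_left_mono[of "real k / real n" 1 "hh n S z"] by(simp_all add: t_def)
 have short: "2 * real n * hh n S w <= hh n S z" if w: "w : T" "w ~= z" "w $ 1 <= t k" "t k < w $ 1 + hh n S w" "k < n" for w k
 proof -
  have near: "\<bar>z $ 1 - w $ 1\<bar> < 1 / RS S" using tb[OF w(5)] w(3,4) hb(2)[of z] hb(2)[of w] by linarith
  show ?thesis
  proof (cases "w $ 2 <= z $ 2")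
   case True thus ?thesis using hh_scales[OF S, of z w] near T(1) z(1) w by auto
  next
   case False
   hence "2 * real n * hh n S z <= hh n S w" using hh_scales[OF S, of w z] near T(1) z(1) w by(auto simp: abs_minus_commute)
   moreover have "2 * hh n S z <= 2 * real n * hh n S z" using n hb(1)[of z] by(intro mult_right_mono) auto
   ultimately show ?thesis using mx[OF w(1)] hb(1)[of z] by linarith
  qed
 qed
 have "EX k<n. ALL w:T - {z}. ~ (w $ 1 <= t k & t k < w $ 1 + hh n S w)"
 proof (rule ccontr)
  assume "~ ?thesis"
  hence "ALL k:{..<n}. EX w. w : T - {z} & w $ 1 <= t k & t k < w $ 1 + hh n S w" by auto
  from bchoice[OF this] obtain f where f: "!!k. k < n ==> f k : T - {z} & f k $ 1 <= t k & t k < f k $ 1 + hh n S (f k)" by auto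
  have ne: "f j ~= f k" if jk: "j < k" "k < n" for j k
  proof
   assume e: "f j = f k"
   have "j < n" using jk by simp
   have "t k - t j < hh n S (f k)" using f[OF jk(2)] f[OF \<open>j < n\<close>] e by auto
   moreover have "t k - t j = hh n S z * (real k - real j) / real n" by(simp add: t_def algebra_simps diff_divide_distrib)
   moreover have "hh n S z * 1 / real n <= hh n S z * (real k - real j) / real n"
    using hb(1)[of z] jk by(intro divide_right_mono mult_left_mono) auto
   moreover have "2 * hh n S (f k) <= hh n S z / real n" using short[of "f k" k] f[OF jk(2)] jk(2) n by(auto simp: pos_le_divide_eq ac_simps)
   ultimately show False using hb(1)[of "f k"] by simp
  qed
  have "inj_on f {..<n}" by(rule inj_onI) (metis lessThan_iff linorder_neqE_nat ne)
  moreover have "f ` {..<n} <= T - {z}" using f by auto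
  ultimately have "card {..<n} <= card (T - {z})" using fT by(intro card_inj_on_le) auto
  moreover have "card (T - {z}) < n" using card_mono[OF S(1) T(1)] S(2) z(1) fT n by simp
  ultimately show False by simp
 qed
 thus thesis using that[of z] z(1) tb by blast
qed

section \<open>Independence and continuity of the chords\<close>

lemma right_gap: "finite P ==> EX ep>0. ALL p:P. p <= s \<or> s + ep <= p" for s :: real
proof (induction P rule: finite_induct)
 case (insert p P)
 then obtain ep where "ep > 0" "ALL p:P. p <= s \<or> s + ep <= p" by blast
 thus ?case by(intro exI[of _ "if p <= s then ep else min ep (p - s)"]) (auto simp: min_def)
qed (auto intro: exI[of _ 1])

lemma ind_chords:
 assumes S: "finite S" "card S = n"
 shows "ind lo (hi n S) C0 S"
 unfolding ind_def
proof (intro allI impI, rule ccontr)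
 fix c assume c: "ALL f:C0. (\<Sum>z\<in>S. c z * cd lo (hi n S) z f) = 0" and "~ (ALL z:S. c z = 0)"
 hence T: "{z : S. c z ~= 0} <= S" "{z : S. c z ~= 0} ~= {}" by auto
 obtain z0 t where z: "z0 : {z : S. c z ~= 0}" "z0 $ 1 <= t" "t < z0 $ 1 + hh n S z0"
   "ALL w:{z : S. c z ~= 0}. w ~= z0 --> ~ (w $ 1 <= t & t < w $ 1 + hh n S w)"
  by(rule uncovered_point[OF S T]) (rule that)
 have n: "0 < n" using S z(1) card_gt_0_iff by blast
 obtain ep where e: "ep > 0" "!!p. p : (%z. exp (z $ 1)) ` S Un hi n S ` S ==> p <= exp t \<or> exp t + ep <= p"
  using right_gap[of "(%z. exp (z $ 1)) ` S Un hi n S ` S" "exp t"] S(1) by blast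
 \<comment> \<open>An even function that is 0 up to \<open>exp t\<close> in absolute value and 1
   from the next end point on; it measures whether the interval of a chord contains
   \<open>t\<close>.\<close>
 define f where "f s = max 0 (min 1 ((\<bar>s\<bar> - exp t) / ep))" for s
 have fC: "f : C0" unfolding C0_def f_def using e(1) by(auto intro!: continuous_intros)
 have fv: "max 0 (min 1 ((p - exp t) / ep)) = (if p <= exp t then 0 else 1)"
  if "p : (%z. exp (z $ 1)) ` S Un hi n S ` S" for p
  using e(2)[OF that] e(1) by(auto simp: divide_le_0_iff le_divide_eq max_def min_def)
 have cdf: "cd lo (hi n S) z f = (if z $ 1 <= t & t < z $ 1 + hh n S z then 1 else 0)" if "z : S" for z
  using fv[of "exp (z $ 1)"] fv[of "hi n S z"] that hh_bounds(1)[OF S(2) n, of z]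
  by(auto simp: cd_def f_def lo_def hi_def)
 have "(\<Sum>z\<in>S. c z * cd lo (hi n S) z f) = (\<Sum>z\<in>S. if z = z0 then c z0 else 0)"
  using z by(intro sum.cong refl) (auto simp: cdf)
 thus False using c fC z(1) S(1) by simp
qed

lemma cont_chord:
 assumes i: "i < n" and f: "f : C0"
 shows "cmap (Y_plane n) eur (%x. cd lo (hi n (x ` {..<n})) (x i) f)"
proof (rule cm_eq)
 \<comment> \<open>\<open>RS\<close> on ordered configurations; the summands on the diagonal are
   written as 0 to be visibly continuous.\<close>
 define R where "R x = 1 + (\<Sum>a<n. \<Sum>b<n. if a = b then 0 else 2 / dist (x a) (x b))" for x :: "nat => real^2"
 define H where "H x = (2 * real n) powr ((\<Sum>j<n. max 0 (min 1 ((x i $ 2 - x j $ 2) * R x))) - real n) / R x" for x :: "nat => real^2"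
 have fc: "isCont f y" for y using f by(simp add: C0_def continuous_on_eq_continuous_at)
 show "cmap (Y_plane n) eur (%x. f (exp (x i $ 1 + H x)) - f (- exp (x i $ 1)))"
  unfolding continuous_map_atin limitin_canonical_iff
 proof
  fix x assume x: "x : topspace (Y_plane n)"
  let ?l = "atin (Y_plane n) x"
  have p: "((%x. x k) \<longlongrightarrow> x k) ?l" if "k < n" for k
   using continuous_map_point[OF that] x unfolding continuous_map_atin limitin_canonical_iff by blast
  have "((%x. if a = b then 0 else 2 / dist (x a) (x b)) \<longlongrightarrow> (if a = b then 0 else 2 / dist (x a) (x b))) ?l" if "a < n" "b < n" for a b
   using inj_onD[OF Y_point[OF x], of a b] that by(cases "a = b") (auto intro!: tendsto_intros p)
  hence R: "(R \<longlongrightarrow> R x) ?l" unfolding R_def by(intro tendsto_intros) auto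
  have "0 <= (\<Sum>a<n. \<Sum>b<n. if a = b then 0 else 2 / dist (x a) (x b))" by(intro sum_nonneg) auto
  hence R0: "R x ~= 0" by(simp add: R_def)
  have H: "(H \<longlongrightarrow> H x) ?l" unfolding H_def using i R0 by(intro tendsto_intros R p) auto
  show "((%x. f (exp (x i $ 1 + H x)) - f (- exp (x i $ 1))) \<longlongrightarrow> f (exp (x i $ 1 + H x)) - f (- exp (x i $ 1))) ?l"
   by(intro tendsto_diff isCont_tendsto_compose[OF fc] tendsto_intros H p i)
 qed
 fix x assume "x : topspace (Y_plane n)"
 hence inj: "inj_on x {..<n}" by(rule Y_point)
 have "RS (x ` {..<n}) = R x"
  unfolding RS_def R_def sum.reindex[OF inj] o_def by(intro arg_cong2[of _ _ _ _ plus] sum.cong refl) auto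
 hence "hh n (x ` {..<n}) (x i) = H x" by(simp add: hh_def lv_def H_def sum.reindex[OF inj])
 thus "f (exp (x i $ 1 + H x)) - f (- exp (x i $ 1)) = cd lo (hi n (x ` {..<n})) (x i) f" by(simp add: cd_def lo_def hi_def)
qed

theorem theorem2:
  fixes N n r :: nat
    and F :: "(real \<Rightarrow> real) set"
  assumes "n \<le> N"
    and "foldr (\<otimes>\<^bsub>cohomology_ring (B_plane n)\<^esub>)
           (map (\<lambda>i. sw_class n (\<xi>_plane n) (N - n + 2 * i - 1)) [1..<r + 1])
           \<one>\<^bsub>cohomology_ring (B_plane n)\<^esub> \<noteq> \<zero>\<^bsub>cohomology_ring (B_plane n)\<^esub>"
    and "F \<subseteq> C0" and "has_dimension F N"
  shows "\<exists>D k. independent_diagram n D \<and>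
           has_codimension F (F \<inter> chord_conditions D) k \<and> k + r \<le> n"
proof -
 obtain B where B: "finite B" "card B = N" "fun_space.span B = F" using assms(4) by(auto simp: has_dimension_def)
 obtain ph where ph: "bij_betw ph {0..<N} B" using ex_bij_betw_nat_finite[OF B(1)] B(2) by blast
 have BF: "B <= F" using fun_space.span_superset[of B] B(3) by simp
 \<comment> \<open>An index shift: the hypothesis counts from 1, the products here from 0.\<close>
 have "prod_list (map (%i. wc n (N - n + 2 * i - 1)) [1..<r + 1]) = (\<Prod>i<r. wc n (N - n + 1 + 2 * i))"
  by(induction r) simp_all
 hence nz: "one_at (Bp n) * (\<Prod>i<r. wc n (N - n + 1 + 2 * i)) ~= 0" using wc_product[OF assms(2)] by simp
 have cont: "cmap (Y_plane n) eur (%x. cd lo (hi n (x ` {..<n})) (x i) (ph k))" if "k < N" "i < n" for k i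
  using subsetD[OF assms(3) subsetD[OF BF bspec[OF bij_betwE[OF ph], of k]]] that by(intro cont_chord) auto
 have "EX S:topspace (Bp n). EX g. (ALL i<r. EX p:S. g i p ~= 0) & (ALL i<r. ALL j<i. (\<Sum>p\<in>S. g i p * g j p) = 0) &
   (ALL i<r. ALL k<N. (\<Sum>p\<in>S. g i p * cd lo (hi n S) p (ph k)) = 0)"
  by(rule orthogonal_relations[OF assms(1) nz]) (rule cont)
 then obtain S g where S: "S : topspace (Bp n)" and g: "ALL i<r. EX p:S. g i p ~= 0"
   "ALL i<r. ALL j<i. (\<Sum>p\<in>S. g i p * g j p) = 0" "ALL i<r. ALL k<N. (\<Sum>p\<in>S. g i p * cd lo (hi n S) p (ph k)) = 0"
  by(elim bexE exE conjE) (rule that)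
 have fS: "finite S" "card S = n" using B_card[OF S] by simp_all
 let ?a = lo and ?b = "hi n S"
 define D where "D = (%z. {?a z, ?b z}) ` S"
 \<comment> \<open>Left ends are negative and right ends positive, so equal chords have equal
   corresponding ends.\<close>
 have ab: "?a z < ?b w" for z w using exp_gt_zero[of "z $ 1"] exp_gt_zero[of "w $ 1 + hh n S w"] by(simp add: lo_def hi_def del: exp_gt_zero)
 have C: "V Int chord_conditions D = {f : V. ALL z:S. cd ?a ?b z f = 0}" for V
  by(auto simp: chord_conditions_def D_def cd_def doubleton_eq_iff)
 have C0: "fun_space.subspace C0"
  by(auto simp: fun_space.subspace_def C0_def zero_fun_def plus_fun_def fscale_def intro!: continuous_intros)
 have "inj_on (%z. {?a z, ?b z}) S"
 proof (rule inj_onI, rule ccontr)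
  fix z w assume zw: "z : S" "w : S" "{?a z, ?b z} = {?a w, ?b w}" "z ~= w"
  hence e: "?a z = ?a w" "?b z = ?b w" using ab[of z w] ab[of w z] by(auto simp: doubleton_eq_iff)
  \<comment> \<open>Equal chords of two points would give a linear relation between their
    functionals.\<close>
  let ?c = "%u. if u = z then 1 else if u = w then - 1 else (0::real)"
  have "(\<Sum>u\<in>S. ?c u * cd ?a ?b u f) = (\<Sum>u\<in>S. (if u = z then cd ?a ?b z f else 0) + (if u = w then - cd ?a ?b w f else 0))" for f
   using zw(4) by(intro sum.cong) auto
  hence "ALL f:C0. (\<Sum>u\<in>S. ?c u * cd ?a ?b u f) = 0" using zw fS(1) e by(simp add: sum.distrib cd_def)
  from ind_chords[OF fS, unfolded ind_def, THEN spec, of ?c, THEN mp, OF this] show False using zw(1) by auto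
 qed
 hence "card D = n" unfolding D_def using card_image fS(2) by metis
 moreover have "EX a b. a ~= b & C = {a, b}" if "C : D" for C
 proof -
  obtain z where "C = {?a z, ?b z}" using \<open>C : D\<close> unfolding D_def by blast
  thus ?thesis using less_imp_neq[OF ab[of z z]] by(intro exI[of _ "?a z"] exI[of _ "?b z"] conjI)
 qed
 moreover have "finite D" unfolding D_def using fS(1) by(rule finite_imageI)
 ultimately have "independent_diagram n D"
  unfolding independent_diagram_def chord_diagram_def C
  using codimension_ind[OF C0 fS(1) ind_chords[OF fS]] unfolding fS(2) by simp
 moreover have "(\<Sum>p\<in>S. g i p * cd ?a ?b p f) = 0" if i: "i < r" and f: "f : F" for i f
 proof -
  \<comment> \<open>The relations, known on a basis of \<open>F\<close>, define a subspace and so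
    extend to its span.\<close>
  have "fun_space.subspace {f. (\<Sum>p\<in>S. g i p * cd ?a ?b p f) = 0}"
   by(auto simp: fun_space.subspace_def sum.distrib distrib_left mult.left_commute sdl[symmetric]) (simp add: cd_def zero_fun_def)
  moreover have "B <= {f. (\<Sum>p\<in>S. g i p * cd ?a ?b p f) = 0}" using g(3) i ph by(auto simp: bij_betw_def)
  ultimately show ?thesis using fun_space.span_minimal f B(3) by blast
 qed
 hence "EX k. has_codimension F {f : F. ALL p:S. cd ?a ?b p f = 0} k & k + r <= card S"
  using B(3) fun_space.subspace_span[of B] by(intro codimension_le[where g=g] fS(1)) (use g(1,2) in simp_all)
 ultimately show ?thesis unfolding C[symmetric] fS(2) by blast
qed

end
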